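(* Assume the density $\rho=\rho(N)$ follows one of the regimes (Super1), (Super2), (Hyper2), (Super3). Then, as $N\to\infty$, $\frac1N(L_1,L_2,\dots)$ converges in distribution (in the sense of finite-dimensional distributions) to $(X_1,X_2,\dots)$, where: $Y_1,Y_2,\dots$ are i.i.d. $\mathrm{Beta}(1,\theta)$, $U_1,U_2,\dots$ are i.i.d. uniform on $[0,1]$ independent of the $Y$'s, $S_0=0$, and for $k\ge0$, $A_{k+1}=\{U_{k+1}<1-\frac{\tau}{1-S_k}\}$, $X_{k+1}=(1-S_k-\tau)Y_{k+1}\mathbf 1_{A_{k+1}}$, $S_{k+1}=\sum_{i=1}^{k+1}X_i$.
   Context: Fix an integer $d\ge1$ and a real $\theta>0$. $X$ is a random vector in $\mathbb R^d$ with density $\varphi$, a Schwartz function, with $\mathbb E X=0$ and covariance $\operatorname{Cov}(X)$; $\varphi^{*j}$ is the $j$-fold convolution. For $L>0$ let $\Lambda=[0,L)^d$, $\varphi_\Lambda(x)=\sum_{k\in\mathbb Z^d}\varphi(x+Lk)$. The spatial random permutation model on $N$ particles is the random pair $(\mathbf x,\pi)\in\Lambda^N\times\mathcal S_N$ with density proportional to $\theta^{C(\pi)}\prod_{i=1}^N\varphi_\Lambda(x_{\pi(i)}-x_i)$, $C(\pi)$ the number of cycles; $\rho=N/L^d$ and $L=(N/\rho)^{1/d}$. Cycles are ordered by minimal element and $L_j$ is the length of the $j$-th cycle ($0$ if absent). $\alpha_c:=\frac{\theta}{2\pi\sqrt{\det\operatorname{Cov}(X)}}$, $\rho_c:=\theta\sum_{j\ge1}\varphi^{*j}(0)$.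 Regimes: (Super1) $d=1$, $\rho/\sqrt N\to\infty$, $\rho\le N$; (Super2) $d=2$, $\rho/\log N\to\alpha\in(\alpha_c,\infty)$; (Hyper2) $d=2$, $\rho/\log N\to\infty$, $\rho\le N$; (Super3) $d\ge3$, $\rho>\rho_c$ fixed. $\tau$ is $0$ in (Super1),(Hyper2), $\alpha_c/\alpha$ in (Super2), $\rho_c/\rho$ in (Super3). $\mathrm{Beta}(1,\theta)$ has density $\theta(1-x)^{\theta-1}$ on $[0,1]$. *)

theory Defs
  imports "HOL-Probability.Probability" "HOL-Combinatorics.Orbits" "HOL-Combinatorics.Permutations"
begin

section \<open>Schwartz functions on R^d (d = CARD('n))\<close>

text \<open>Iterated partial derivatives along a list of coordinate directions.\<close>
fun iter_pderiv :: "'n list \<Rightarrow> (real^'n \<Rightarrow> real) \<Rightarrow> real^'n \<Rightarrow> real" where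
  "iter_pderiv [] f = f"
| "iter_pderiv (i # is) f =
     (\<lambda>x. frechet_derivative (iter_pderiv is f) (at x) (axis i 1))"

text \<open>Schwartz: smooth (all iterated partials Frechet differentiable everywhere)
  and every derivative decays faster than any polynomial.\<close>
definition schwartz :: "(real^'n \<Rightarrow> real) \<Rightarrow> bool" where
  "schwartz f \<longleftrightarrow>
     (\<forall>is x. iter_pderiv is f differentiable (at x)) \<and>
     (\<forall>is (k::nat). \<exists>C. \<forall>x. (1 + norm x) ^ k * \<bar>iter_pderiv is f x\<bar> \<le> C)"

section \<open>Moments, covariance, convolution powers\<close>

definition mean_vec :: "(real^'n \<Rightarrow> real) \<Rightarrow> real^'n" where
  "mean_vec f = (\<integral>x. f x *\<^sub>R x \<partial>lborel)"

definition cov_mat :: "(real^'n \<Rightarrow> real) \<Rightarrow> real^'n^'n" where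
  "cov_mat f = (\<chi> i j. \<integral>x. (x$i - mean_vec f $ i) * (x$j - mean_vec f $ j) * f x \<partial>lborel)"

text \<open>conv_pow f j is the (j+1)-fold convolution power of f.\<close>
primrec conv_pow :: "(real^'n \<Rightarrow> real) \<Rightarrow> nat \<Rightarrow> real^'n \<Rightarrow> real" where
  "conv_pow f 0 = f"
| "conv_pow f (Suc j) = (\<lambda>x. \<integral>y. f (x - y) * conv_pow f j y \<partial>lborel)"

definition alpha_c :: "real \<Rightarrow> (real^'n \<Rightarrow> real) \<Rightarrow> real" where
  "alpha_c \<theta> f = \<theta> / (2 * pi * sqrt (det (cov_mat f)))"

text \<open>rho_c = theta * sum_{j>=1} f^{*j}(0)\<close>
definition rho_c :: "real \<Rightarrow> (real^'n \<Rightarrow> real) \<Rightarrow> real" where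
  "rho_c \<theta> f = \<theta> * (\<Sum>j. conv_pow f j 0)"

section \<open>The spatial random permutation model\<close>

definition box_L :: "real \<Rightarrow> (real^'n) set" where
  "box_L L = {x. \<forall>i. 0 \<le> x$i \<and> x$i < L}"

text \<open>Periodisation phi_Lambda(x) = sum_{k in Z^d} phi(x + L k).\<close>
definition periodize :: "(real^'n \<Rightarrow> real) \<Rightarrow> real \<Rightarrow> real^'n \<Rightarrow> real" where
  "periodize f L x = (\<Sum>\<^sub>\<infinity>k::int^'n. f (x + L *\<^sub>R (\<chi> i. real_of_int (k$i))))"

text \<open>Number of cycles of a permutation of {0..<N}.\<close>
definition num_cycles :: "(nat \<Rightarrow> nat) \<Rightarrow> nat \<Rightarrow> nat" where
  "num_cycles \<pi> N = card (orbit \<pi> ` {..<N})"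

text \<open>Length of the j-th cycle (0-indexed j, so cyc_len \<pi> N j = L_{j+1}),
  cycles ordered by their minimal element; 0 if there is no such cycle.\<close>
definition cyc_len :: "(nat \<Rightarrow> nat) \<Rightarrow> nat \<Rightarrow> nat \<Rightarrow> nat" where
  "cyc_len \<pi> N j =
     (let ms = sorted_list_of_set (Min ` orbit \<pi> ` {..<N})
      in if j < length ms then card (orbit \<pi> (ms ! j)) else 0)"

definition spm_weight ::
  "(real^'n \<Rightarrow> real) \<Rightarrow> real \<Rightarrow> real \<Rightarrow> nat \<Rightarrow> (nat \<Rightarrow> real^'n) \<times> (nat \<Rightarrow> nat) \<Rightarrow> real" where
  "spm_weight f \<theta> L N z =
     \<theta> ^ num_cycles (snd z) N * (\<Prod>i<N. periodize f L (fst z (snd z i) - fst z i))"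

definition spm_ref :: "real \<Rightarrow> nat \<Rightarrow> ((nat \<Rightarrow> real^'n) \<times> (nat \<Rightarrow> nat)) measure" where
  "spm_ref L N =
     (\<Pi>\<^sub>M i\<in>{..<N}. restrict_space lborel (box_L L))
       \<Otimes>\<^sub>M count_space {\<pi>. \<pi> permutes {..<N}}"

text \<open>Law of the pair (x, \<pi>): density proportional to spm_weight w.r.t. spm_ref.\<close>
definition spm_measure ::
  "(real^'n \<Rightarrow> real) \<Rightarrow> real \<Rightarrow> real \<Rightarrow> nat \<Rightarrow> ((nat \<Rightarrow> real^'n) \<times> (nat \<Rightarrow> nat)) measure" where
  "spm_measure f \<theta> L N =
     density (spm_ref L N)
       (\<lambda>z. ennreal (spm_weight f \<theta> L N z) /
             (\<integral>\<^sup>+w. ennreal (spm_weight f \<theta> L N w) \<partial>spm_ref L N))"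

section \<open>The limit process\<close>

definition beta_1_measure :: "real \<Rightarrow> real measure" where
  "beta_1_measure \<theta> =
     density lborel (\<lambda>x. ennreal (indicator {0..1} x * \<theta> * (1 - x) powr (\<theta> - 1)))"

definition unif01 :: "real measure" where
  "unif01 = uniform_measure lborel {0..1}"

text \<open>Joint law of (Y_1,Y_2,...) i.i.d. Beta(1,theta) and independent (U_1,U_2,...) i.i.d. U[0,1]
  (0-indexed: y k = Y_{k+1}, u k = U_{k+1}).\<close>
definition YU_measure :: "real \<Rightarrow> ((nat \<Rightarrow> real) \<times> (nat \<Rightarrow> real)) measure" where
  "YU_measure \<theta> = (\<Pi>\<^sub>M k\<in>(UNIV::nat set). beta_1_measure \<theta>) \<Otimes>\<^sub>M (\<Pi>\<^sub>M k\<in>(UNIV::nat set). unif01)"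

definition lim_step :: "real \<Rightarrow> real \<Rightarrow> real \<Rightarrow> real \<Rightarrow> real" where
  "lim_step \<tau> s yk uk = (1 - s - \<tau>) * yk * (if uk < 1 - \<tau> / (1 - s) then 1 else 0)"

text \<open>S_k\<close>
primrec lim_S :: "real \<Rightarrow> (nat \<Rightarrow> real) \<Rightarrow> (nat \<Rightarrow> real) \<Rightarrow> nat \<Rightarrow> real" where
  "lim_S \<tau> y u 0 = 0"
| "lim_S \<tau> y u (Suc k) = lim_S \<tau> y u k + lim_step \<tau> (lim_S \<tau> y u k) (y k) (u k)"

text \<open>lim_X \<tau> y u k = X_{k+1}\<close>
definition lim_X :: "real \<Rightarrow> (nat \<Rightarrow> real) \<Rightarrow> (nat \<Rightarrow> real) \<Rightarrow> nat \<Rightarrow> real" where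
  "lim_X \<tau> y u k = lim_step \<tau> (lim_S \<tau> y u k) (y k) (u k)"

end

theory Submission
 imports Defs "HOL-Probability.Probability"
begin

text \<open>Integrating out the points, a cycle of length \<open>l\<close> receives the weight \<open>\<theta> (1 + v N l)\<close>, where
 \<open>1 + v N l\<close> is the trace of the \<open>l\<close>-th power of the convolution operator on the torus; by Poisson
 summation it is the sum of the \<open>l\<close>-th powers of the Fourier transform of \<open>\<phi>\<close> over the lattice
 \<open>k / L\<close>. Hence the cycle lengths form a Markov chain: with \<open>n\<close> points left, the next length is \<open>l\<close>
 with probability \<open>a l * h (n - l) / (n * h n)\<close>, where \<open>n * h n\<close> is the sum of all \<open>a l * h (n - l)\<close>.
 Fourier decay gives \<open>\<bar>v N l\<bar> \<le> e N (N / l)^d\<close> with \<open>e N \<longlonglongrightarrow> 0\<close>, and \<open>\<theta>\<close> times the average of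
 \<open>v N\<close> tends to \<open>\<tau>\<close>: the excess weight sits on lengths \<open>o(N)\<close> and acts like a shift of the total mass
 by \<open>\<tau>\<close>. So \<open>h\<close> has the scaling profile \<open>(x - \<tau>) powr (\<theta> - 1)\<close>: the cumulative sums converge because
 their limit points solve an integral equation with a unique solution, and the recursion upgrades
 this to \<open>h\<close> itself. The tail of the first cycle length is then
 \<open>(1 - \<tau> / x) (1 - t / (x - \<tau>)) powr \<theta>\<close>, one step of the limit process.\<close>

text \<open>The weights form a triangular array: \<open>v\<close> changes with N, so the argument
  works with limit points along N instead of the singularities of one generating function. Only the
  cumulative sums of \<open>h\<close> are monotone; Helly selection applies to them and not to
  \<open>h\<close> itself, and mass escaping to an atom at the right end 1 has to be excluded
  separately. In the passage to \<open>h\<close> the recursion acts on errors with multiplier \<tau>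
  / x, a contraction just when x > \<tau>. Errors are therefore carried with a weight that explodes
  near \<tau>, a power -d of a distance that matches the bound on \<open>v\<close>; this lets a
  strong induction start without an initial case. The strict inequality x > \<tau> survives the
  removal of a cycle because Beta(1,\<theta>) puts no mass at 1, so the induction over cycles stays
  where asymptotics are known. The Fourier bound is kept as a product over coordinates with
  numerator 1: the product makes lattice sums factorise, the numerator lets l-th powers be taken by
  Bernoulli's inequality. It serves all dimensions; the regimes then differ in how L / sqrt N and
  the mean weight are evaluated.\<close>

text \<open>The coefficients of exp (\<Sum> a l z^l / l), in the form that z H' = A H gives. They
  are also the total weights of the permutations of n points divided by n!, see
  \<open>perm_sum_const\<close>.\<close>

fun hh :: "(nat \<Rightarrow> real) \<Rightarrow> nat \<Rightarrow> real" where
 "hh a n = (if n = 0 then 1 else (\<Sum>l\<in>{1..n}. a l * hh a (n - l)) / real n)"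

declare hh.simps [simp del]

lemma hh_0 [simp]: "hh a 0 = 1" by (simp add: hh.simps)

lemma hh_rec: "real n * hh a n = (\<Sum>l\<in>{1..n}. a l * hh a (n - l))" if "n \<ge> 1"
 using that by (subst hh.simps) simp

lemma hh_nonneg: "hh a n \<ge> 0" if "\<And>l. a l \<ge> 0"
proof (induction n rule: less_induct)
 case (less n)
 thus ?case
  by (subst hh.simps) (auto intro!: sum_nonneg divide_nonneg_nonneg mult_nonneg_nonneg simp: that)
qed

section \<open>Uniqueness of the limiting profile\<close>

text \<open>The equation reads (x - \<tau>) F x = (1 + \<theta>) I x with I an integral of F. Left
  of \<tau> the two sides have opposite signs, so both vanish; right of \<tau> it is the linear
  equation (x - \<tau>) I' = (1 + \<theta>) I, which leaves one free constant. Values inside (0,1)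
  alone would allow mass to be lost to an atom at 1; \<open>I1\<close> forbids this and fixes the
  constant.\<close>

lemma limit_profile_unique:
 fixes F I :: "real \<Rightarrow> real" and \<theta> \<tau> :: real
 assumes th: "\<theta> > 0" and tau: "0 \<le> \<tau>" "\<tau> < 1"
  and mono: "mono F" and F_bnd: "\<And>x. 0 \<le> F x" "\<And>x. F x \<le> 1"
  and eq: "\<And>x. 0 < x \<Longrightarrow> x < 1 \<Longrightarrow> isCont F x \<Longrightarrow> x * F x = (1 + \<theta>) * I x + \<tau> * F x"
  and I_le: "\<And>x y. 0 < x \<Longrightarrow> x \<le> y \<Longrightarrow> y < 1 \<Longrightarrow> isCont F x \<Longrightarrow> isCont F y \<Longrightarrow>
      (y - x) * F x \<le> I y - I x \<and> I y - I x \<le> (y - x) * F y"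
  and I_lip: "\<And>x y. 0 \<le> x \<Longrightarrow> x \<le> y \<Longrightarrow> y \<le> 1 \<Longrightarrow> 0 \<le> I y - I x \<and> I y - I x \<le> y - x"
  and I0: "I 0 = 0" and I1: "1 \<le> (1 + \<theta>) * I 1 + \<tau>"
  and x: "0 < x" "x < 1"
 shows "F x = (max 0 (x - \<tau>) / (1 - \<tau>)) powr \<theta>"
proof -
 have dense: "\<exists>z. a < z \<and> z < b \<and> isCont F z" if "a < b" for a b :: real
  using real_interval_avoid_countable_set[OF that mono_ctble_discont[OF mono]] by auto
 have I_nonneg: "I y \<ge> 0" if "0 \<le> y" "y \<le> 1" for y
  using I_lip[of 0 y] I0 that by auto
 have low0: "I z = 0 \<and> F z = 0" if "0 < z" "z < \<tau>" "isCont F z" for z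
 proof -
  have "(z - \<tau>) * F z = (1 + \<theta>) * I z" using eq[of z] that tau by (simp add: algebra_simps)
  moreover have "(z - \<tau>) * F z \<le> 0" using that F_bnd(1)[of z] by (simp add: mult_le_0_iff)
  moreover have "(1 + \<theta>) * I z \<ge> 0" using I_nonneg[of z] that tau th by simp
  ultimately have "(z - \<tau>) * F z = 0" "(1 + \<theta>) * I z = 0" by linarith+
  thus ?thesis using th that by simp
 qed
 have F_low: "F y = 0" if y: "y < \<tau>" "0 < y" for y
 proof -
  obtain z where z: "y < z" "z < \<tau>" "isCont F z" using dense[OF y(1)] by blast
  hence "F y \<le> F z" using mono by (auto simp: mono_def)
  thus ?thesis using low0[of z] z y F_bnd(1)[of y] by auto
 qed
 have I_cont: "continuous_on {0..1} I"
 proof (rule continuous_onI)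
  fix y \<epsilon> :: real assume "y \<in> {0..1}" "\<epsilon> > 0"
  have "dist (I y') (I y) \<le> \<epsilon>" if "y' \<in> {0..1}" "dist y' y < \<epsilon>" for y'
  proof (cases "y \<le> y'")
   case True
   thus ?thesis using I_lip[of y y'] that \<open>y \<in> {0..1}\<close> by (auto simp: dist_real_def)
  next
   case False
   thus ?thesis using I_lip[of y' y] that \<open>y \<in> {0..1}\<close> by (auto simp: dist_real_def)
  qed
  thus "\<exists>d>0. \<forall>x'\<in>{0..1}. dist x' y < d \<longrightarrow> dist (I x') (I y) \<le> \<epsilon>"
   using \<open>\<epsilon> > 0\<close> by blast
 qed
 define G where "G y = (1 + \<theta>) * I y / (y - \<tau>)" for y
 have G_cont: "continuous_on {\<tau><..<1} G"
  unfolding G_def by (intro continuous_intros continuous_on_subset[OF I_cont]) (use tau in auto)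
 have G_isCont: "isCont G y" if "\<tau> < y" "y < 1" for y
  using G_cont that by (simp add: continuous_on_eq_continuous_at)
 have FG0: "F z = G z" if "\<tau> < z" "z < 1" "isCont F z" for z
  using eq[of z] that tau by (simp add: G_def field_simps)
 \<comment> \<open>The equation is known at continuity points of F only. G is continuous and F
   monotone, so a gap at y would contradict it at a continuity point just right of y (F above G) or
   just left of y (F below G).\<close>
 have FG: "F y = G y" if y: "\<tau> < y" "y < 1" for y
 proof (rule ccontr)
  assume ne: "F y \<noteq> G y"
  have tend: "G \<midarrow>y\<rightarrow> G y" using G_isCont[OF y] by (simp add: isCont_def)
  show False
  proof (cases "F y > G y")
   case True
   have "eventually (\<lambda>z. G z < F y) (at_right y)"
    using order_tendstoD(2)[OF tend True] by (simp add: eventually_at_split)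
   then obtain b where b: "b > y" "\<And>z. y < z \<Longrightarrow> z < b \<Longrightarrow> G z < F y"
    unfolding eventually_at_right_field by blast
   obtain z where z: "y < z" "z < min b 1" "isCont F z" using dense[of y "min b 1"] b y by auto
   hence "F y \<le> F z" using mono by (auto simp: mono_def)
   thus False using b(2)[of z] FG0[of z] z y by auto
  next
   case False
   hence lt: "F y < G y" using ne by auto
   have "eventually (\<lambda>z. G z > F y) (at_left y)"
    using order_tendstoD(1)[OF tend lt] by (simp add: eventually_at_split)
   then obtain b where b: "b < y" "\<And>z. b < z \<Longrightarrow> z < y \<Longrightarrow> G z > F y"
    unfolding eventually_at_left_field by blast
   obtain z where z: "max b \<tau> < z" "z < y" "isCont F z" using dense[of "max b \<tau>" y] b y by auto
   hence "F z \<le> F y" using mono by (auto simp: mono_def)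
   thus False using b(2)[of z] FG0[of z] z y by auto
  qed
 qed
 have F_isCont: "isCont F y" if y: "\<tau> < y" "y < 1" for y
 proof -
  have "eventually (\<lambda>z. z \<in> {\<tau><..<1}) (nhds y)" using y by (intro eventually_nhds_in_open) auto
  hence "eventually (\<lambda>z. F z = G z) (nhds y)" by eventually_elim (auto simp: FG)
  hence "isCont F y \<longleftrightarrow> isCont G y" by (rule isCont_cong)
  thus ?thesis using G_isCont[OF y] by simp
 qed
 have I_deriv: "(I has_real_derivative F y) (at y)" if y: "\<tau> < y" "y < 1" for y
 proof -
  \<comment> \<open>The difference quotient of I lies between the values of F at its two ends, so it
    differs from F z by at most |F z - F y|.\<close>
  have "((\<lambda>z. (I z - I y) / (z - y)) \<longlongrightarrow> F y) (at y)"
  proof (rule Lim_transform)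
   show "(F \<longlongrightarrow> F y) (at y)" using F_isCont[OF y] by (simp add: isCont_def)
   have lim0: "((\<lambda>z. \<bar>F z - F y\<bar>) \<longlongrightarrow> 0) (at y)"
    using F_isCont[OF y] by (simp add: isCont_def LIM_zero_iff tendsto_rabs_zero_iff)
   have "eventually (\<lambda>z. z \<in> {\<tau><..<1}) (at y)" using y by (intro eventually_at_in_open') auto
   moreover have "eventually (\<lambda>z. z \<noteq> y) (at y)" by (simp add: eventually_at_filter)
   ultimately have "eventually (\<lambda>z. norm ((I z - I y) / (z - y) - F z) \<le> \<bar>F z - F y\<bar>) (at y)"
   proof eventually_elim
    case (elim z)
    show ?case
    proof (cases "y < z")
     case True
     have "(z - y) * F y \<le> I z - I y \<and> I z - I y \<le> (z - y) * F z"
      using True elim y tau F_isCont by (intro I_le) auto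
     hence "F y \<le> (I z - I y) / (z - y)" "(I z - I y) / (z - y) \<le> F z" using True by (auto simp: field_simps)
     thus ?thesis by (simp only: real_norm_def)
    next
     case False
     hence lt: "z < y" using elim by auto
     have "(y - z) * F z \<le> I y - I z \<and> I y - I z \<le> (y - z) * F y"
      using lt elim y tau F_isCont by (intro I_le) auto
     moreover have "(I z - I y) / (z - y) = (I y - I z) / (y - z)"
      using lt by (simp add: divide_simps) (simp add: algebra_simps)
     ultimately have "F z \<le> (I z - I y) / (z - y)" "(I z - I y) / (z - y) \<le> F y"
      using lt by (auto simp: field_simps)
     thus ?thesis by (simp only: real_norm_def)
    qed
   qed
   thus "((\<lambda>z. (I z - I y) / (z - y) - F z) \<longlongrightarrow> 0) (at y)"
    by (rule Lim_null_comparison[OF _ lim0])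
  qed
  thus ?thesis by (simp add: has_field_derivative_iff)
 qed
 \<comment> \<open>The power -(1 + \<theta>) of y - \<tau> is the integrating factor of the linear
   equation.\<close>
 have "\<exists>c. \<forall>y\<in>{\<tau><..<1}. I y * (y - \<tau>) powr (-(1 + \<theta>)) = c"
 proof (rule has_field_derivative_zero_constant)
  fix y assume y: "y \<in> {\<tau><..<1}"
  have p: "((\<lambda>y. (y - \<tau>) powr p) has_real_derivative p * (y - \<tau>) powr (p - 1)) (at y)" for p
   using DERIV_fun_powr[of "\<lambda>y. y - \<tau>" 1 y p] y by (auto intro!: derivative_eq_intros)
  have "((\<lambda>y. I y * (y - \<tau>) powr (-(1 + \<theta>))) has_real_derivative
    F y * (y - \<tau>) powr (-(1 + \<theta>)) + (-(1 + \<theta>)) * (y - \<tau>) powr (-(1 + \<theta>) - 1) * I y) (at y)"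
   using y by (intro DERIV_mult I_deriv p) auto
  also have "F y * (y - \<tau>) powr (-(1 + \<theta>)) + (-(1 + \<theta>)) * (y - \<tau>) powr (-(1 + \<theta>) - 1) * I y = 0"
  proof -
   have "(y - \<tau>) powr (-(1 + \<theta>) - 1) = (y - \<tau>) powr (-(1 + \<theta>)) / (y - \<tau>)"
    using y by (subst powr_diff) simp
   thus ?thesis using FG[of y] y by (simp add: G_def divide_inverse algebra_simps)
  qed
  finally show "((\<lambda>y. I y * (y - \<tau>) powr (-(1 + \<theta>))) has_real_derivative 0) (at y within {\<tau><..<1})"
   by (rule has_field_derivative_at_within)
 qed auto
 then obtain c where c: "\<And>y. y \<in> {\<tau><..<1} \<Longrightarrow> I y * (y - \<tau>) powr (-(1 + \<theta>)) = c" by blast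
 have I_eq: "I y = c * (y - \<tau>) powr (1 + \<theta>)" if "\<tau> < y" "y < 1" for y
 proof -
  have "c * (y - \<tau>) powr (1 + \<theta>) = I y * ((y - \<tau>) powr (-(1 + \<theta>)) * (y - \<tau>) powr (1 + \<theta>))"
   using c[of y] that by simp
  also have "(y - \<tau>) powr (-(1 + \<theta>)) * (y - \<tau>) powr (1 + \<theta>) = 1"
   using that by (simp add: powr_add[symmetric])
  finally show ?thesis by simp
 qed
 have F_eq: "F y = (1 + \<theta>) * c * (y - \<tau>) powr \<theta>" if "\<tau> < y" "y < 1" for y
  using FG[of y] I_eq[of y] that by (simp add: G_def powr_add)
 have left1: "eventually (\<lambda>y. \<tau> < y \<and> y < 1) (at_left 1)"
  using tau(2) unfolding eventually_at_left_field by auto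
 have "((\<lambda>y. (1 + \<theta>) * c * (y - \<tau>) powr \<theta>) \<longlongrightarrow> (1 + \<theta>) * c * (1 - \<tau>) powr \<theta>) (at_left 1)"
  using tau(2) by (intro tendsto_intros) auto
 hence c1: "(1 + \<theta>) * c * (1 - \<tau>) powr \<theta> \<le> 1"
 proof (rule tendsto_upperbound)
  show "eventually (\<lambda>y. (1 + \<theta>) * c * (y - \<tau>) powr \<theta> \<le> 1) (at_left 1)"
   using left1
  proof eventually_elim
   case (elim y)
   thus ?case using F_eq[of y] F_bnd(2)[of y] by simp
  qed
 qed (simp add: trivial_limit_at_left_real)
 have "(I \<longlongrightarrow> I 1) (at_left 1)"
 proof -
  have "(I \<longlongrightarrow> I 1) (at 1 within {0..1})" using I_cont by (auto simp: continuous_on_def)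
  thus ?thesis by (simp add: at_within_Icc_at_left)
 qed
 moreover have "((\<lambda>y. c * (y - \<tau>) powr (1 + \<theta>)) \<longlongrightarrow> c * (1 - \<tau>) powr (1 + \<theta>)) (at_left 1)"
  using tau(2) by (intro tendsto_intros) auto
 hence "(I \<longlongrightarrow> c * (1 - \<tau>) powr (1 + \<theta>)) (at_left 1)"
 proof (rule Lim_transform_eventually)
  show "eventually (\<lambda>y. c * (y - \<tau>) powr (1 + \<theta>) = I y) (at_left 1)"
   using left1
  proof eventually_elim
   case (elim y)
   thus ?case using I_eq[of y] by simp
  qed
 qed
 ultimately have I1_eq: "I 1 = c * (1 - \<tau>) powr (1 + \<theta>)"
  using tendsto_unique trivial_limit_at_left_real by blast
 \<comment> \<open>\<open>I1\<close> bounds the constant from below, F \<le> 1 has bounded it from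
   above; together they determine it.\<close>
 have "(1 - \<tau>) * 1 \<le> (1 - \<tau>) * ((1 + \<theta>) * c * (1 - \<tau>) powr \<theta>)"
  using I1 I1_eq tau by (simp add: powr_add algebra_simps)
 hence "1 \<le> (1 + \<theta>) * c * (1 - \<tau>) powr \<theta>" using tau by (simp only: mult_le_cancel_left_pos)
 with c1 have cc: "(1 + \<theta>) * c * (1 - \<tau>) powr \<theta> = 1" by linarith
 have hi: "F y = ((y - \<tau>) / (1 - \<tau>)) powr \<theta>" if "\<tau> < y" "y < 1" for y
 proof -
  have "((y - \<tau>) / (1 - \<tau>)) powr \<theta> = (y - \<tau>) powr \<theta> / (1 - \<tau>) powr \<theta>"
   using that by (simp add: powr_divide)
  also have "\<dots> = (y - \<tau>) powr \<theta> * ((1 + \<theta>) * c * (1 - \<tau>) powr \<theta>) / (1 - \<tau>) powr \<theta>"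
   by (simp add: cc)
  also have "\<dots> = F y" using F_eq[OF that] tau by simp
  finally show ?thesis ..
 qed
 consider "x < \<tau>" | "x = \<tau>" | "x > \<tau>" by linarith
 thus ?thesis
 proof cases
  case 1
  thus ?thesis using F_low[of x] x by simp
 next
  case 2
  \<comment> \<open>At \<tau> the factor x - \<tau> vanishes and the equation says nothing about F;
    monotonicity bounds F there by the values to the right, which tend to 0.\<close>
  have "((\<lambda>y. ((y - \<tau>) / (1 - \<tau>)) powr \<theta>) \<longlongrightarrow> ((\<tau> - \<tau>) / (1 - \<tau>)) powr \<theta>) (at_right \<tau>)"
  proof (rule tendsto_powr')
   show "((\<lambda>y. (y - \<tau>) / (1 - \<tau>)) \<longlongrightarrow> (\<tau> - \<tau>) / (1 - \<tau>)) (at_right \<tau>)"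
    using tau by (intro tendsto_intros) auto
  qed (use tau th in \<open>auto intro!: eventually_at_rightI[of _ 1]\<close>)
  moreover have "eventually (\<lambda>y. F x \<le> ((y - \<tau>) / (1 - \<tau>)) powr \<theta>) (at_right \<tau>)"
  proof (rule eventually_at_rightI[of _ 1])
   fix y assume "y \<in> {\<tau><..<1}"
   thus "F x \<le> ((y - \<tau>) / (1 - \<tau>)) powr \<theta>" using hi[of y] monoD[OF mono, of x y] 2 by auto
  qed (use tau in auto)
  ultimately have "F x \<le> ((\<tau> - \<tau>) / (1 - \<tau>)) powr \<theta>"
   by (intro tendsto_lowerbound[of _ _ "at_right \<tau>"]) (auto simp: trivial_limit_at_right_real)
  thus ?thesis using F_bnd(1)[of x] 2 by simp
 next
  case 3
  thus ?thesis using hi[of x] x by simp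
 qed
qed

section \<open>Cycle weights as a triangular array\<close>

text \<open>What the asymptotic part takes from the spatial model: \<open>v\<close> is the excess of
  a cycle weight over its ideal value 1. \<open>v_le\<close> makes the excess negligible at lengths
  of order N; what happens at lengths o(N) enters through the total in
  \<open>v_mean\<close>.\<close>

locale cycle_weights =
 fixes \<theta> \<tau> :: real and d :: nat and v :: "nat \<Rightarrow> nat \<Rightarrow> real" and e :: "nat \<Rightarrow> real"
 assumes theta_pos: "\<theta> > 0" and tau_nonneg: "0 \<le> \<tau>" and tau_less: "\<tau> < 1"
  and v_ge: "\<And>N l. v N l \<ge> -1"
  and v_le: "\<And>N l. 1 \<le> l \<Longrightarrow> l \<le> N \<Longrightarrow> \<bar>v N l\<bar> \<le> e N * (real N / real l) ^ d"
  and e_nonneg: "\<And>N. e N \<ge> 0"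
  and e_lim: "e \<longlonglongrightarrow> 0"
  and v_mean: "(\<lambda>N. \<theta> / real N * (\<Sum>l=1..N. v N l)) \<longlonglongrightarrow> \<tau>"
begin

definition a :: "nat \<Rightarrow> nat \<Rightarrow> real" where "a N l = \<theta> * (1 + v N l)"
definition h :: "nat \<Rightarrow> nat \<Rightarrow> real" where "h N n = hh (a N) n"
definition T :: "nat \<Rightarrow> nat \<Rightarrow> real" where "T N m = (\<Sum>j\<le>m. h N j)"

lemma a_nonneg: "a N l \<ge> 0" unfolding a_def using v_ge[of N l] theta_pos by simp

lemma h_nonneg: "h N n \<ge> 0" unfolding h_def by (intro hh_nonneg a_nonneg)

lemma h_0 [simp]: "h N 0 = 1" by (simp add: h_def)

lemma T_mono: "m \<le> n \<Longrightarrow> T N m \<le> T N n"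
 unfolding T_def by (intro sum_mono2) (auto simp: h_nonneg)

lemma T_pos: "T N m > 0" using T_mono[of 0 m N] by (simp add: T_def)

lemma h_rec: "real n * h N n = \<theta> * (\<Sum>j<n. h N j) + \<theta> * (\<Sum>l=1..n. v N l * h N (n - l))" if "n \<ge> 1"
proof -
 have "real n * h N n = (\<Sum>l\<in>{1..n}. a N l * h N (n - l))" unfolding h_def by (rule hh_rec[OF that])
 also have "\<dots> = \<theta> * (\<Sum>l=1..n. h N (n - l)) + \<theta> * (\<Sum>l=1..n. v N l * h N (n - l))"
  by (simp add: a_def algebra_simps sum.distrib sum_distrib_left)
 also have "(\<Sum>l=1..n. h N (n - l)) = (\<Sum>j<n. h N j)"
  by (rule sum.reindex_bij_witness[of _ "\<lambda>j. n - j" "\<lambda>l. n - l"]) auto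
 finally show ?thesis .
qed

text \<open>The generating function of T is that of h divided by 1 - z, so it belongs to weights
  raised by 1. Since 1 + a = (1 + \<theta>) + \<theta> v, this is the recursion for the raised
  weights, and the origin of the factor 1 + \<theta>. The induction adds up
  \<open>h_rec\<close>.\<close>

lemma T_rec: "real M * T N M = (1 + \<theta>) * (\<Sum>n<M. T N n) + \<theta> * (\<Sum>l=1..M. v N l * T N (M - l))"
proof (induction M)
 case 0
 show ?case by simp
next
 case (Suc M)
 have "real (Suc M) * T N (Suc M) = real M * T N M + T N M + real (Suc M) * h N (Suc M)"
  by (simp add: T_def algebra_simps)
 also have "real (Suc M) * h N (Suc M) = \<theta> * T N M + \<theta> * (\<Sum>l=1..Suc M. v N l * h N (Suc M - l))"
  by (subst h_rec) (auto simp: T_def lessThan_Suc_atMost)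
 finally have *: "real (Suc M) * T N (Suc M) = real M * T N M + T N M + \<theta> * T N M + \<theta> * (\<Sum>l=1..Suc M. v N l * h N (Suc M - l))"
  by simp
 have "(\<Sum>l=1..Suc M. v N l * T N (Suc M - l)) = (\<Sum>l=1..M. v N l * T N (Suc M - l)) + v N (Suc M) * h N 0"
  by (simp add: T_def)
 also have "(\<Sum>l=1..M. v N l * T N (Suc M - l)) = (\<Sum>l=1..M. v N l * T N (M - l) + v N l * h N (Suc M - l))"
  by (rule sum.cong) (auto simp: T_def Suc_diff_le algebra_simps)
 finally have "(\<Sum>l=1..Suc M. v N l * T N (Suc M - l)) = (\<Sum>l=1..M. v N l * T N (M - l)) + (\<Sum>l=1..Suc M. v N l * h N (Suc M - l))"
  by (simp add: sum.distrib)
 thus ?case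
  unfolding * Suc.IH by (simp add: algebra_simps)
qed

lemma v_tail:
 assumes "\<epsilon> > 0" "\<eta> > 0"
 shows "eventually (\<lambda>N. \<forall>l\<in>{1..N}. real l > \<epsilon> * real N \<longrightarrow> \<bar>v N l\<bar> \<le> \<eta>) sequentially"
proof -
 have "(\<lambda>N. e N * (1 / \<epsilon>) ^ d) \<longlonglongrightarrow> 0 * (1 / \<epsilon>) ^ d"
  by (intro tendsto_intros e_lim)
 hence "eventually (\<lambda>N. e N * (1 / \<epsilon>) ^ d < \<eta>) sequentially"
  using assms by (intro order_tendstoD(2)[of _ 0]) auto
 thus ?thesis
 proof eventually_elim
  case (elim N)
  show ?case
  proof (intro ballI impI)
   fix l assume l: "l \<in> {1..N}" "real l > \<epsilon> * real N"
   have "real N / real l \<le> 1 / \<epsilon>" using l assms by (simp add: field_simps)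
   hence "(real N / real l) ^ d \<le> (1 / \<epsilon>) ^ d" by (intro power_mono) auto
   hence "e N * (real N / real l) ^ d \<le> e N * (1 / \<epsilon>) ^ d" by (intro mult_left_mono e_nonneg)
   thus "\<bar>v N l\<bar> \<le> \<eta>" using v_le[of l N] l elim by auto
  qed
 qed
qed

lemma v_tail_sum:
 assumes "\<epsilon> > 0" "\<eta> > 0"
 shows "eventually (\<lambda>N. \<theta> / real N * (\<Sum>l\<in>{l\<in>{1..N}. real l > \<epsilon> * real N}. \<bar>v N l\<bar>) \<le> \<eta>) sequentially"
proof -
 have "eventually (\<lambda>N::nat. N > 0) sequentially" by (rule eventually_gt_at_top)
 moreover have "eventually (\<lambda>N. \<forall>l\<in>{1..N}. real l > \<epsilon> * real N \<longrightarrow> \<bar>v N l\<bar> \<le> \<eta> / \<theta>) sequentially"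
  using assms theta_pos by (intro v_tail) auto
 ultimately show ?thesis
 proof eventually_elim
  case (elim N)
  have "(\<Sum>l\<in>{l\<in>{1..N}. real l > \<epsilon> * real N}. \<bar>v N l\<bar>) \<le> real (card {l\<in>{1..N}. real l > \<epsilon> * real N}) * (\<eta> / \<theta>)"
   using elim by (intro sum_bounded_above) auto
  also have "card {l\<in>{1..N}. real l > \<epsilon> * real N} \<le> card {1..N}" by (intro card_mono) auto
  hence "real (card {l\<in>{1..N}. real l > \<epsilon> * real N}) * (\<eta> / \<theta>) \<le> real N * (\<eta> / \<theta>)"
   using assms theta_pos by (intro mult_right_mono) auto
  finally have "\<theta> / real N * (\<Sum>l\<in>{l\<in>{1..N}. real l > \<epsilon> * real N}. \<bar>v N l\<bar>) \<le> \<theta> / real N * (real N * (\<eta> / \<theta>))"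
   using theta_pos by (intro mult_left_mono) auto
  thus ?case using elim theta_pos by simp
 qed
qed

text \<open>Because v \<ge> -1, the negative part is bounded: on lengths up to \<epsilon> N it costs
  a multiple of \<epsilon>, and longer lengths are covered by \<open>v_tail_sum\<close>. The error
  estimates below need the absolute values.\<close>

lemma v_abs_mean: "(\<lambda>N. \<theta> / real N * (\<Sum>l=1..N. \<bar>v N l\<bar>)) \<longlonglongrightarrow> \<tau>"
proof -
 have "(\<lambda>N. \<theta> / real N * (\<Sum>l=1..N. \<bar>v N l\<bar> - v N l)) \<longlonglongrightarrow> 0"
 proof (rule tendstoI)
  fix r :: real assume r: "r > 0"
  \<comment> \<open>The short lengths then contribute 2 \<theta> \<epsilon> = r / 2 and the long
    ones at most r / 4.\<close>
  define \<epsilon> where "\<epsilon> = r / (4 * \<theta>)"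
  have eps: "\<epsilon> > 0" using r theta_pos by (simp add: \<epsilon>_def)
  have "eventually (\<lambda>N::nat. N > 0) sequentially" by (rule eventually_gt_at_top)
  moreover have "eventually (\<lambda>N. \<theta> / real N * (\<Sum>l\<in>{l\<in>{1..N}. real l > \<epsilon> * real N}. \<bar>v N l\<bar>) \<le> r / 8) sequentially"
   using eps r by (intro v_tail_sum) auto
  ultimately show "eventually (\<lambda>N. dist (\<theta> / real N * (\<Sum>l=1..N. \<bar>v N l\<bar> - v N l)) 0 < r) sequentially"
  proof eventually_elim
   case (elim N)
   let ?A = "{l\<in>{1..N}. real l > \<epsilon> * real N}" and ?B = "{l\<in>{1..N}. real l \<le> \<epsilon> * real N}"
   have split: "{1..N} = ?A \<union> ?B" "?A \<inter> ?B = {}" by auto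
   have "(\<Sum>l=1..N. \<bar>v N l\<bar> - v N l) = (\<Sum>l\<in>?A. \<bar>v N l\<bar> - v N l) + (\<Sum>l\<in>?B. \<bar>v N l\<bar> - v N l)"
    by (subst split(1), rule sum.union_disjoint) auto
   also have "(\<Sum>l\<in>?A. \<bar>v N l\<bar> - v N l) \<le> (\<Sum>l\<in>?A. 2 * \<bar>v N l\<bar>)"
    by (intro sum_mono) auto
   also have "(\<Sum>l\<in>?B. \<bar>v N l\<bar> - v N l) \<le> real (card ?B) * 2"
   proof (rule sum_bounded_above)
    show "\<bar>v N l\<bar> - v N l \<le> 2" if "l \<in> ?B" for l using v_ge[of N l] by linarith
   qed
   also have "real (card ?B) \<le> \<epsilon> * real N"
   proof -
    have "?B \<subseteq> {1..nat \<lfloor>\<epsilon> * real N\<rfloor>}" by (auto simp: le_nat_floor)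
    hence "card ?B \<le> nat \<lfloor>\<epsilon> * real N\<rfloor>"
     using card_mono[of "{1..nat \<lfloor>\<epsilon> * real N\<rfloor>}" ?B] by simp
    thus ?thesis using eps
     by (smt (verit) mult_nonneg_nonneg of_nat_0_le_iff of_nat_floor of_nat_mono)
   qed
   finally have "(\<Sum>l=1..N. \<bar>v N l\<bar> - v N l) \<le> 2 * (\<Sum>l\<in>?A. \<bar>v N l\<bar>) + 2 * \<epsilon> * real N"
    by (simp add: sum_distrib_left mult_ac)
   hence "\<theta> / real N * (\<Sum>l=1..N. \<bar>v N l\<bar> - v N l) \<le> \<theta> / real N * (2 * (\<Sum>l\<in>?A. \<bar>v N l\<bar>) + 2 * \<epsilon> * real N)"
    using theta_pos by (intro mult_left_mono) auto
   also have "\<dots> = 2 * (\<theta> / real N * (\<Sum>l\<in>?A. \<bar>v N l\<bar>)) + 2 * \<theta> * \<epsilon>"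
    using elim by (simp add: field_simps)
   also have "\<dots> \<le> 2 * (r / 8) + r / 2"
   proof -
    have "2 * (\<theta> / real N * (\<Sum>l\<in>?A. \<bar>v N l\<bar>)) \<le> 2 * (r / 8)"
     using elim(2) by (intro mult_left_mono) auto
    moreover have "2 * \<theta> * \<epsilon> = r / 2" using theta_pos by (simp add: \<epsilon>_def)
    ultimately show ?thesis by linarith
   qed
   also have "\<dots> < r" using r by simp
   finally have "\<theta> / real N * (\<Sum>l=1..N. \<bar>v N l\<bar> - v N l) < r" .
   moreover have "\<theta> / real N * (\<Sum>l=1..N. \<bar>v N l\<bar> - v N l) \<ge> 0"
    using theta_pos by (intro mult_nonneg_nonneg sum_nonneg) auto
   ultimately show ?case by (simp only: dist_real_def)
  qed
 qed
 from tendsto_add[OF this v_mean] show ?thesis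
  by (simp add: sum_subtractf algebra_simps)
qed

text \<open>The signed measures with mass \<theta> v / N at l / N have total variation tending to
  \<tau> and concentrate at 0, so they act like \<tau> times the point mass at 0. The test functions
  vary with n and run along a subsequence since they will be cumulative sums along a Helly
  subsequence.\<close>

lemma v_average:
 assumes bnd: "\<And>N l. \<bar>\<phi> N l\<bar> \<le> B"
  and near: "\<And>\<delta>. \<delta> > 0 \<Longrightarrow> \<exists>\<epsilon>>0. eventually (\<lambda>n. \<forall>l\<in>{1..r n}. real l \<le> \<epsilon> * real (r n) \<longrightarrow> \<bar>\<phi> n l - c\<bar> \<le> \<delta>) sequentially"
  and r: "strict_mono r"
 shows "(\<lambda>n. \<theta> / real (r n) * (\<Sum>l=1..r n. v (r n) l * \<phi> n l)) \<longlonglongrightarrow> \<tau> * c"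
proof -
 have ev: "eventually (\<lambda>n. P (r n)) sequentially" if "eventually P sequentially" for P
  using that filterlim_subseq[OF r] by (auto simp: filterlim_iff)
 have B: "B \<ge> 0" using bnd[of 0 0] by linarith
 have "(\<lambda>n. \<theta> / real (r n) * (\<Sum>l=1..r n. v (r n) l * (\<phi> n l - c))) \<longlonglongrightarrow> 0"
 proof (rule tendstoI)
  fix q :: real assume q: "q > 0"
  \<comment> \<open>The total variation is eventually below \<tau> + 1, so lengths where \<phi> is
    within \<delta> of c give at most q / 3; the remaining lengths give another q / 3.\<close>
  define \<delta> where "\<delta> = q / (3 * (\<tau> + 1))"
  have delta: "\<delta> > 0" using q tau_nonneg by (simp add: \<delta>_def)
  obtain \<epsilon> where eps: "\<epsilon> > 0" and *: "eventually (\<lambda>n. \<forall>l\<in>{1..r n}. real l \<le> \<epsilon> * real (r n) \<longrightarrow> \<bar>\<phi> n l - c\<bar> \<le> \<delta>) sequentially"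
   using near[OF delta] by blast
  have "eventually (\<lambda>n::nat. r n > 0) sequentially" by (rule ev, rule eventually_gt_at_top)
  moreover have "eventually (\<lambda>n. \<theta> / real (r n) * (\<Sum>l=1..r n. \<bar>v (r n) l\<bar>) < \<tau> + 1) sequentially"
   by (rule ev, rule order_tendstoD(2)[OF v_abs_mean]) simp
  moreover have "eventually (\<lambda>n. \<theta> / real (r n) * (\<Sum>l\<in>{l\<in>{1..r n}. real l > \<epsilon> * real (r n)}. \<bar>v (r n) l\<bar>) \<le> q / (3 * (B + \<bar>c\<bar> + 1))) sequentially"
   using eps q B by (intro ev v_tail_sum) auto
  ultimately show "eventually (\<lambda>n. dist (\<theta> / real (r n) * (\<Sum>l=1..r n. v (r n) l * (\<phi> n l - c))) 0 < q) sequentially"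
   using *
  proof eventually_elim
   case (elim n)
   let ?A = "{l\<in>{1..r n}. real l > \<epsilon> * real (r n)}"
   have "\<bar>\<Sum>l=1..r n. v (r n) l * (\<phi> n l - c)\<bar> \<le> (\<Sum>l=1..r n. \<bar>v (r n) l\<bar> * \<bar>\<phi> n l - c\<bar>)"
    by (rule order_trans[OF sum_abs]) (simp add: abs_mult)
   also have "\<dots> \<le> (\<Sum>l=1..r n. \<delta> * \<bar>v (r n) l\<bar> + (if l \<in> ?A then (B + \<bar>c\<bar> + 1) * \<bar>v (r n) l\<bar> else 0))"
   proof (rule sum_mono)
    fix l assume l: "l \<in> {1..r n}"
    show "\<bar>v (r n) l\<bar> * \<bar>\<phi> n l - c\<bar> \<le> \<delta> * \<bar>v (r n) l\<bar> + (if l \<in> ?A then (B + \<bar>c\<bar> + 1) * \<bar>v (r n) l\<bar> else 0)"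
    proof (cases "l \<in> ?A")
     case True
     have "\<bar>\<phi> n l - c\<bar> \<le> B + \<bar>c\<bar> + 1" using bnd[of n l] by linarith
     hence "\<bar>v (r n) l\<bar> * \<bar>\<phi> n l - c\<bar> \<le> \<bar>v (r n) l\<bar> * (B + \<bar>c\<bar> + 1)"
      by (intro mult_left_mono) auto
     moreover have "\<delta> * \<bar>v (r n) l\<bar> \<ge> 0" using delta by simp
     ultimately show ?thesis using True by (simp add: mult.commute)
    next
     case False
     hence "\<bar>\<phi> n l - c\<bar> \<le> \<delta>" using elim(4) l by auto
     hence "\<bar>v (r n) l\<bar> * \<bar>\<phi> n l - c\<bar> \<le> \<bar>v (r n) l\<bar> * \<delta>"
      by (intro mult_left_mono) auto
     thus ?thesis unfolding if_not_P[OF False] by (simp add: mult.commute)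
    qed
   qed
   also have "\<dots> = \<delta> * (\<Sum>l=1..r n. \<bar>v (r n) l\<bar>) + (B + \<bar>c\<bar> + 1) * (\<Sum>l\<in>?A. \<bar>v (r n) l\<bar>)"
   proof -
    have "(\<Sum>l=1..r n. (if l \<in> ?A then (B + \<bar>c\<bar> + 1) * \<bar>v (r n) l\<bar> else 0)) = (\<Sum>l\<in>{1..r n} \<inter> ?A. (B + \<bar>c\<bar> + 1) * \<bar>v (r n) l\<bar>)"
     by (rule sum.inter_restrict[symmetric]) simp
    also have "{1..r n} \<inter> ?A = ?A" by auto
    finally show ?thesis by (simp add: sum.distrib sum_distrib_left)
   qed
   finally have "\<theta> / real (r n) * \<bar>\<Sum>l=1..r n. v (r n) l * (\<phi> n l - c)\<bar> \<le> \<theta> / real (r n) * (\<delta> * (\<Sum>l=1..r n. \<bar>v (r n) l\<bar>) + (B + \<bar>c\<bar> + 1) * (\<Sum>l\<in>?A. \<bar>v (r n) l\<bar>))"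
    using theta_pos by (intro mult_left_mono) auto
   also have "\<dots> = \<delta> * (\<theta> / real (r n) * (\<Sum>l=1..r n. \<bar>v (r n) l\<bar>)) + (B + \<bar>c\<bar> + 1) * (\<theta> / real (r n) * (\<Sum>l\<in>?A. \<bar>v (r n) l\<bar>))"
    by (simp only: distrib_left mult.left_commute)
   also have "\<dots> \<le> \<delta> * (\<tau> + 1) + (B + \<bar>c\<bar> + 1) * (q / (3 * (B + \<bar>c\<bar> + 1)))"
    using elim delta B by (intro add_mono mult_left_mono) auto
   also have "\<delta> * (\<tau> + 1) = q / 3" using tau_nonneg by (simp add: \<delta>_def field_simps)
   also have "(B + \<bar>c\<bar> + 1) * (q / (3 * (B + \<bar>c\<bar> + 1))) = q / 3"
    using B by (simp add: divide_simps)
   finally have "\<theta> / real (r n) * \<bar>\<Sum>l=1..r n. v (r n) l * (\<phi> n l - c)\<bar> < q" using q by linarith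
   thus ?case using theta_pos by (simp add: abs_mult)
  qed
 qed
 moreover have "(\<lambda>n. \<theta> / real (r n) * (\<Sum>l=1..r n. v (r n) l) * c) \<longlonglongrightarrow> \<tau> * c"
  using LIMSEQ_subseq_LIMSEQ[OF v_mean r] by (intro tendsto_mult_right) (simp add: o_def)
 ultimately have "(\<lambda>n. \<theta> / real (r n) * (\<Sum>l=1..r n. v (r n) l * (\<phi> n l - c)) + \<theta> / real (r n) * (\<Sum>l=1..r n. v (r n) l) * c) \<longlonglongrightarrow> 0 + \<tau> * c"
  by (rule tendsto_add)
 moreover have "\<theta> / real (r n) * (\<Sum>l=1..r n. v (r n) l * (\<phi> n l - c)) + \<theta> / real (r n) * (\<Sum>l=1..r n. v (r n) l) * c
   = \<theta> / real (r n) * (\<Sum>l=1..r n. v (r n) l * \<phi> n l)" for n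
 proof -
  have e: "(\<Sum>l=1..r n. v (r n) l * (\<phi> n l - c)) = (\<Sum>l=1..r n. v (r n) l * \<phi> n l) - (\<Sum>l=1..r n. v (r n) l) * c"
   by (simp add: right_diff_distrib sum_subtractf sum_distrib_right)
  show ?thesis unfolding e by (simp add: algebra_simps)
 qed
 ultimately show ?thesis by simp
qed

end

section \<open>Limit points of the cumulative sums\<close>

context cycle_weights begin

definition f :: "nat \<Rightarrow> real \<Rightarrow> real" where
 "f N x = (\<Sum>j\<le>N. h N j * (if real j / real N \<le> x then 1 else 0)) / T N N"

text \<open>The integral of \<open>f N\<close> over [0, x] in closed form, see
  \<open>J_integral\<close>.\<close>

definition J :: "nat \<Rightarrow> real \<Rightarrow> real" where
 "J N x = (\<Sum>j\<le>N. h N j * max 0 (x - real j / real N)) / T N N"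

definition Ft :: "real \<Rightarrow> real" where
 "Ft x = (max 0 (x - \<tau>) / (1 - \<tau>)) powr \<theta>"

lemma f_mono: "mono (f N)"
 unfolding f_def using T_pos[of N N]
 by (intro monoI divide_right_mono sum_mono mult_left_mono) (auto simp: h_nonneg)

lemma f_nonneg: "f N x \<ge> 0"
 unfolding f_def using T_pos[of N N] by (intro divide_nonneg_pos sum_nonneg) (auto simp: h_nonneg)

lemma f_le_1: "f N x \<le> 1"
proof -
 have "(\<Sum>j\<le>N. h N j * (if real j / real N \<le> x then 1 else 0)) \<le> (\<Sum>j\<le>N. h N j)"
  by (intro sum_mono) (auto simp: h_nonneg)
 thus ?thesis using T_pos[of N N] by (simp add: f_def T_def)
qed

lemma f_rcont: "continuous (at_right x) (f N)"
proof -
 have "continuous (at_right x) (\<lambda>x. if c \<le> x then 1 else 0 :: real)" for c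
 proof (cases "c \<le> x")
  case True
  hence "eventually (\<lambda>y. (if c \<le> y then 1 else 0 :: real) = 1) (at_right x)"
   by (intro eventually_at_rightI[of _ "x + 1"]) auto
  thus ?thesis using True by (auto simp: continuous_within intro: tendsto_eventually)
 next
  case False
  hence "eventually (\<lambda>y. (if c \<le> y then 1 else 0 :: real) = 0) (at_right x)"
   by (intro eventually_at_rightI[of _ c]) auto
  thus ?thesis using False by (auto simp: continuous_within intro: tendsto_eventually)
 qed
 thus ?thesis unfolding f_def by (intro continuous_intros) (use T_pos[of N N] in auto)
qed

lemma f_at:
 assumes "N > 0" "M \<le> N" "real M \<le> x * real N" "x * real N < real M + 1"
 shows "f N x = T N M / T N N"
proof -
 have eq: "real j / real N \<le> x \<longleftrightarrow> j \<le> M" for j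
 proof
  assume "real j / real N \<le> x"
  hence "real j \<le> x * real N" using assms by (simp add: field_simps)
  thus "j \<le> M" using assms by linarith
 next
  assume "j \<le> M"
  hence "real j \<le> x * real N" using assms by linarith
  thus "real j / real N \<le> x" using assms by (simp add: field_simps)
 qed
 have "(\<Sum>j\<le>N. h N j * (if real j / real N \<le> x then 1 else 0)) = (\<Sum>j\<le>N. if j \<in> {..M} then h N j else 0)"
  by (intro sum.cong) (auto simp: eq)
 also have "\<dots> = (\<Sum>j\<in>{..N} \<inter> {..M}. h N j)" by (rule sum.inter_restrict[symmetric]) simp
 also have "{..N} \<inter> {..M} = {..M}" using assms by auto
 finally show ?thesis by (simp add: f_def T_def)
qed

lemma f_ge_1: "N > 0 \<Longrightarrow> x \<ge> 1 \<Longrightarrow> f N x = 1"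
proof -
 assume "N > 0" "x \<ge> 1"
 hence "f N 1 = 1" using T_pos[of N N] by (subst f_at[of N N]) auto
 thus "f N x = 1" using f_le_1[of N x] monoD[OF f_mono[of N], of 1 x] \<open>x \<ge> 1\<close> by simp
qed

lemma f_neg: "x < 0 \<Longrightarrow> f N x = 0"
proof -
 assume x: "x < 0"
 have "\<not> real j / real N \<le> x" for j
  using x by (smt (verit) divide_nonneg_nonneg of_nat_0_le_iff)
 thus ?thesis by (simp add: f_def)
qed

lemma J_le:
 assumes "x \<le> y"
 shows "(y - x) * f N x \<le> J N y - J N x" "J N y - J N x \<le> (y - x) * f N y"
proof -
 have *: "J N y - J N x = (\<Sum>j\<le>N. h N j * (max 0 (y - real j / real N) - max 0 (x - real j / real N))) / T N N"
  by (simp add: J_def diff_divide_distrib[symmetric] sum_subtractf[symmetric] algebra_simps)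
 have "(y - x) * f N x = (\<Sum>j\<le>N. h N j * ((y - x) * (if real j / real N \<le> x then 1 else 0))) / T N N"
  by (simp add: f_def sum_distrib_left mult_ac)
 also have "\<dots> \<le> J N y - J N x" unfolding *
  using assms T_pos[of N N] by (intro divide_right_mono sum_mono mult_left_mono) (auto simp: h_nonneg)
 finally show "(y - x) * f N x \<le> J N y - J N x" .
 have "J N y - J N x \<le> (\<Sum>j\<le>N. h N j * ((y - x) * (if real j / real N \<le> y then 1 else 0))) / T N N"
  unfolding *
  using assms T_pos[of N N] by (intro divide_right_mono sum_mono mult_left_mono) (auto simp: h_nonneg)
 also have "\<dots> = (y - x) * f N y" by (simp add: f_def sum_distrib_left mult_ac)
 finally show "J N y - J N x \<le> (y - x) * f N y" .
qed

lemma J_lip: "x \<le> y \<Longrightarrow> 0 \<le> J N y - J N x \<and> J N y - J N x \<le> y - x"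
 using J_le[of x y N] f_nonneg[of N x] mult_left_le[OF f_le_1[of N y], of "y - x"]
 by (smt (verit) mult_nonneg_nonneg)

lemma J_0: "J N 0 = 0"
proof -
 have "max 0 (0 - real j / real N) = 0" for j by (intro max_absorb1) simp
 thus ?thesis by (simp add: J_def)
qed

text \<open>The term h j is counted once for each n with j \<le> n < M, that is, max 0 (M - j)
  times.\<close>

lemma J_sum:
 assumes "N > 0" "M \<le> N"
 shows "J N (real M / real N) = (\<Sum>n<M. T N n) / (real N * T N N)"
proof -
 have "(\<Sum>n<M. T N n) = (\<Sum>j\<le>N. h N j * max 0 (real M - real j))" using assms(2)
 proof (induction M)
  case (Suc M)
  have "(\<Sum>j\<le>N. h N j * max 0 (real (Suc M) - real j)) = (\<Sum>j\<le>N. h N j * max 0 (real M - real j) + (if j \<in> {..M} then h N j else 0))"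
   by (intro sum.cong refl) (auto simp: max_def algebra_simps)
  also have "\<dots> = (\<Sum>j\<le>N. h N j * max 0 (real M - real j)) + (\<Sum>j\<in>{..N} \<inter> {..M}. h N j)"
   by (simp only: sum.distrib sum.inter_restrict finite_atMost)
  also have "{..N} \<inter> {..M} = {..M}" using Suc by auto
  finally show ?case using Suc by (simp add: T_def)
 next
  case 0
  have "max 0 (real 0 - real j) = 0" for j by (intro max_absorb1) simp
  thus ?case by simp
 qed
 moreover have "J N (real M / real N) = (\<Sum>j\<le>N. h N j * max 0 (real M - real j)) / (real N * T N N)"
 proof -
  have "max 0 (real M / real N - real j / real N) = max 0 (real M - real j) / real N" for j
   using assms by (auto simp: max_def field_simps)
  hence "(\<Sum>j\<le>N. h N j * max 0 (real M / real N - real j / real N)) = (\<Sum>j\<le>N. h N j * max 0 (real M - real j)) / real N"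
   by (simp add: sum_divide_distrib)
  thus ?thesis by (simp add: J_def)
 qed
 ultimately show ?thesis by simp
qed

lemma J_integral: "(LINT t|lborel. indicator {0..x} t * f N t) = J N x" if "0 \<le> x"
proof -
 have *: "has_bochner_integral lborel (\<lambda>t. indicator {0..x} t * (if c \<le> t then 1 else 0)) (max 0 (x - c))" if "c \<ge> 0" for c :: real
 proof -
  have "measure lborel {c..x} = max 0 (x - c)" by (cases "c \<le> x") auto
  hence "has_bochner_integral lborel (indicator {c..x}) (max 0 (x - c))"
   using has_bochner_integral_real_indicator[of "{c..x}" lborel] by (simp add: emeasure_lborel_Icc_eq)
  moreover have "indicator {c..x} = (\<lambda>t. indicator {0..x} t * (if c \<le> t then 1 else 0 :: real))"
   using that by (auto simp: indicator_def fun_eq_iff)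
  ultimately show ?thesis by simp
 qed
 have "has_bochner_integral lborel (\<lambda>t. (\<Sum>j\<le>N. h N j * (indicator {0..x} t * (if real j / real N \<le> t then 1 else 0))) / T N N)
   ((\<Sum>j\<le>N. h N j * max 0 (x - real j / real N)) / T N N)"
  by (intro has_bochner_integral_divide has_bochner_integral_sum has_bochner_integral_mult_right *) auto
 moreover have "(\<lambda>t. (\<Sum>j\<le>N. h N j * (indicator {0..x} t * (if real j / real N \<le> t then 1 else 0))) / T N N) = (\<lambda>t. indicator {0..x} t * f N t)"
  by (simp add: f_def fun_eq_iff sum_distrib_left mult_ac)
 ultimately show ?thesis
  by (simp add: has_bochner_integral_integral_eq J_def)
qed

text \<open>This is \<open>T_rec\<close> at M = floor (x N), divided by N T N N. In its last sum T
  at M - l must be replaced by T at M for short l, which is possible where the limit F is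
  continuous; hence the restriction on x.\<close>

lemma limit_equation:
 assumes r: "strict_mono r" and mono: "mono F"
  and conv: "\<And>x. isCont F x \<Longrightarrow> (\<lambda>n. f (r n) x) \<longlonglongrightarrow> F x"
  and convJ: "\<And>x. 0 \<le> x \<Longrightarrow> (\<lambda>n. J (r n) x) \<longlonglongrightarrow> I x"
  and x: "0 < x" "x < 1" "isCont F x"
 shows "x * F x = (1 + \<theta>) * I x + \<tau> * F x"
proof -
 have ev: "eventually (\<lambda>n. P (r n)) sequentially" if "eventually P sequentially" for P
  using that filterlim_subseq[OF r] by (auto simp: filterlim_iff)
 define M where "M n = nat \<lfloor>x * real (r n)\<rfloor>" for n
 have M: "real (M n) \<le> x * real (r n)" "x * real (r n) < real (M n) + 1" for n
  using x unfolding M_def by (auto simp: of_nat_nat)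
 have M_le: "M n \<le> r n" for n
  using M(1)[of n] x mult_right_mono[of x 1 "real (r n)"] by simp
 have inv0: "(\<lambda>n. 1 / real (r n)) \<longlonglongrightarrow> 0"
  using LIMSEQ_subseq_LIMSEQ[OF lim_inverse_n r] by (simp add: o_def inverse_eq_divide)
 have Mlow: "x - 1 / real (r n) \<le> real (M n) / real (r n)" "real (M n) / real (r n) \<le> x" if "r n > 0" for n
 proof -
  have "x \<le> (real (M n) + 1) / real (r n)" using M(2)[of n] that by (simp add: field_simps)
  thus "x - 1 / real (r n) \<le> real (M n) / real (r n)" by (simp add: add_divide_distrib)
  show "real (M n) / real (r n) \<le> x" using M(1)[of n] that by (simp add: field_simps)
 qed
 have r_pos: "eventually (\<lambda>n. r n > 0) sequentially" by (rule ev, rule eventually_gt_at_top)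
 have Mx: "(\<lambda>n. real (M n) / real (r n)) \<longlonglongrightarrow> x"
 proof (rule tendsto_sandwich)
  show "(\<lambda>n. x - 1 / real (r n)) \<longlonglongrightarrow> x" using tendsto_diff[OF tendsto_const inv0] by simp
  show "(\<lambda>n. x) \<longlonglongrightarrow> x" by simp
 qed (use Mlow in \<open>auto intro: eventually_mono[OF r_pos]\<close>)
 have JM: "(\<lambda>n. J (r n) (real (M n) / real (r n))) \<longlonglongrightarrow> I x"
 proof (rule tendsto_sandwich)
  show "(\<lambda>n. J (r n) x - 1 / real (r n)) \<longlonglongrightarrow> I x" using tendsto_diff[OF convJ inv0] x by simp
  show "(\<lambda>n. J (r n) x) \<longlonglongrightarrow> I x" using convJ x by simp
  show "eventually (\<lambda>n. J (r n) x - 1 / real (r n) \<le> J (r n) (real (M n) / real (r n))) sequentially"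
   using r_pos by eventually_elim (use Mlow J_lip in \<open>smt (verit)\<close>)
  show "eventually (\<lambda>n. J (r n) (real (M n) / real (r n)) \<le> J (r n) x) sequentially"
   using r_pos by eventually_elim (use Mlow J_lip in \<open>smt (verit)\<close>)
 qed
 \<comment> \<open>Extended by 0 beyond M n, so that the sum runs up to N as in
   \<open>v_average\<close>.\<close>
 define \<phi> where "\<phi> n l = (if l \<le> M n then T (r n) (M n - l) / T (r n) (r n) else 0)" for n l
 have phi_f: "\<phi> n l = f (r n) (real (M n - l) / real (r n))" if "l \<le> M n" "r n > 0" for n l
  using that M_le[of n] by (simp add: \<phi>_def) (subst f_at[of _ "M n - l"], auto)
 have vlim: "(\<lambda>n. \<theta> / real (r n) * (\<Sum>l=1..r n. v (r n) l * \<phi> n l)) \<longlonglongrightarrow> \<tau> * F x"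
 proof (rule v_average[where B = 1])
  fix n l
  have "0 \<le> \<phi> n l" using T_pos by (auto simp: \<phi>_def less_imp_le)
  moreover have "\<phi> n l \<le> 1" using T_mono[of "M n - l" "r n" "r n"] M_le[of n] T_pos by (auto simp: \<phi>_def)
  ultimately show "\<bar>\<phi> n l\<bar> \<le> 1" by simp
 next
  fix \<delta> :: real assume \<delta>: "\<delta> > 0"
  have "eventually (\<lambda>z. dist (F z) (F x) < \<delta> / 2) (at_left x)"
   using x(3) \<delta> tendstoD[of F "F x" "at x" "\<delta> / 2"] by (auto simp: isCont_def eventually_at_split)
  then obtain b where b: "b < x" "\<And>z. b < z \<Longrightarrow> z < x \<Longrightarrow> dist (F z) (F x) < \<delta> / 2"
   unfolding eventually_at_left_field by blast
  \<comment> \<open>A continuity point y slightly left of x: for l \<le> \<epsilon> N the argument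
    (M - l) / N lies between y and x, and monotonicity traps \<phi> between two convergent
    sequences. With \<epsilon> = (x - y) / 2, one half of the gap absorbs l / N and the other the
    rounding in M.\<close>
  obtain y where y: "y \<in> {max b 0<..<x}" "isCont F y"
   using real_interval_avoid_countable_set[of "max b 0" x "{x. \<not> isCont F x}"] mono_ctble_discont[OF mono] b x by auto
  have Fy: "\<bar>F y - F x\<bar> < \<delta> / 2" using b(2)[of y] y by (simp add: dist_real_def)
  define \<epsilon> where "\<epsilon> = (x - y) / 2"
  have eps: "\<epsilon> > 0" using y by (simp add: \<epsilon>_def)
  have e1: "eventually (\<lambda>n. 1 / real (r n) < \<epsilon>) sequentially"
   using order_tendstoD(2)[OF inv0 eps] .
  have e2: "eventually (\<lambda>n. \<bar>f (r n) x - F x\<bar> < \<delta>) sequentially"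
   using tendstoD[OF conv[OF x(3)] \<delta>] by (simp add: dist_real_def)
  have e3: "eventually (\<lambda>n. \<bar>f (r n) y - F y\<bar> < \<delta> / 2) sequentially"
   using tendstoD[OF conv[OF y(2)], of "\<delta> / 2"] \<delta> by (simp add: dist_real_def)
  have "eventually (\<lambda>n. \<forall>l\<in>{1..r n}. real l \<le> \<epsilon> * real (r n) \<longrightarrow> \<bar>\<phi> n l - F x\<bar> \<le> \<delta>) sequentially"
   using r_pos e1 e2 e3
  proof eventually_elim
   case (elim n)
   show ?case
   proof (intro ballI impI)
    fix l assume l: "l \<in> {1..r n}" "real l \<le> \<epsilon> * real (r n)"
    have rn: "real (r n) > 0" using elim by simp
    have le: "real l / real (r n) \<le> \<epsilon>" using l rn by (simp add: field_simps)
    have "real (M n) / real (r n) \<ge> x - \<epsilon>" using Mlow(1)[of n] elim by linarith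
    hence ge: "real (M n) / real (r n) - real l / real (r n) \<ge> y"
    proof -
     have "x - 2 * \<epsilon> = y" by (simp add: \<epsilon>_def field_simps)
     thus ?thesis using le \<open>real (M n) / real (r n) \<ge> x - \<epsilon>\<close> by linarith
    qed
    hence "real (M n) / real (r n) \<ge> real l / real (r n)" using y by auto
    hence lM: "l \<le> M n" using rn by (simp add: field_simps)
    have eq: "real (M n - l) / real (r n) = real (M n) / real (r n) - real l / real (r n)"
     using lM by (simp add: of_nat_diff diff_divide_distrib)
    have "f (r n) y \<le> \<phi> n l" using phi_f[OF lM] elim ge monoD[OF f_mono] unfolding eq by auto
    moreover have "\<phi> n l \<le> f (r n) x"
     using phi_f[OF lM] elim Mlow(2)[of n] monoD[OF f_mono[of "r n"], of "real (M n - l) / real (r n)" x] unfolding eq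
     by (smt (verit) divide_nonneg_nonneg of_nat_0_le_iff)
    ultimately show "\<bar>\<phi> n l - F x\<bar> \<le> \<delta>" using elim Fy by linarith
   qed
  qed
  with eps show "\<exists>\<epsilon>>0. eventually (\<lambda>n. \<forall>l\<in>{1..r n}. real l \<le> \<epsilon> * real (r n) \<longrightarrow> \<bar>\<phi> n l - F x\<bar> \<le> \<delta>) sequentially"
   by blast
 qed (rule r)
 have "(\<lambda>n. (1 + \<theta>) * J (r n) (real (M n) / real (r n)) + \<theta> / real (r n) * (\<Sum>l=1..r n. v (r n) l * \<phi> n l)) \<longlonglongrightarrow> (1 + \<theta>) * I x + \<tau> * F x"
  by (intro tendsto_intros JM vlim)
 moreover have "(\<lambda>n. (real (M n) / real (r n)) * f (r n) x) \<longlonglongrightarrow> x * F x"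
  by (intro tendsto_intros Mx conv x)
 moreover have "eventually (\<lambda>n. (1 + \<theta>) * J (r n) (real (M n) / real (r n)) + \<theta> / real (r n) * (\<Sum>l=1..r n. v (r n) l * \<phi> n l) = (real (M n) / real (r n)) * f (r n) x) sequentially"
  using r_pos
 proof eventually_elim
  case (elim n)
  let ?N = "r n"
  have "(\<Sum>l=1..?N. v ?N l * \<phi> n l) = (\<Sum>l\<in>{1..M n}. v ?N l * \<phi> n l)"
   using M_le[of n] by (intro sum.mono_neutral_right) (auto simp: \<phi>_def)
  also have "\<dots> = (\<Sum>l=1..M n. v ?N l * T ?N (M n - l)) / T ?N ?N"
   unfolding sum_divide_distrib by (intro sum.cong) (auto simp: \<phi>_def)
  finally have s: "(\<Sum>l=1..?N. v ?N l * \<phi> n l) = (\<Sum>l=1..M n. v ?N l * T ?N (M n - l)) / T ?N ?N" .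
  have fx: "f ?N x = T ?N (M n) / T ?N ?N" using elim M_le[of n] M[of n] by (intro f_at) auto
  have JM': "J ?N (real (M n) / real ?N) = (\<Sum>k<M n. T ?N k) / (real ?N * T ?N ?N)"
   using elim M_le by (intro J_sum) auto
  have "(real (M n) / real ?N) * f ?N x = (real (M n) * T ?N (M n)) / (real ?N * T ?N ?N)" by (simp add: fx)
  also have "\<dots> = (1 + \<theta>) * J ?N (real (M n) / real ?N) + \<theta> / real ?N * (\<Sum>l=1..?N. v ?N l * \<phi> n l)"
   unfolding T_rec[where N = "r n" and M = "M n"] s JM' by (simp add: add_divide_distrib)
  finally show ?case ..
 qed
 ultimately show ?thesis
  using LIMSEQ_unique[OF _ Lim_transform_eventually] by blast
qed

text \<open>Continuity of the limit at 1 is not known at this stage, so \<open>T_rec\<close> is only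
  estimated, by T (N - l) \<le> T N and v \<le> |v|. The inequality is enough to exclude lost
  mass.\<close>

lemma profile_at_1:
 assumes r: "strict_mono r" and convJ: "(\<lambda>n. J (r n) 1) \<longlonglongrightarrow> I"
 shows "1 \<le> (1 + \<theta>) * I + \<tau>"
proof (rule tendsto_lowerbound)
 show "(\<lambda>n. (1 + \<theta>) * J (r n) 1 + \<theta> / real (r n) * (\<Sum>l=1..r n. \<bar>v (r n) l\<bar>)) \<longlonglongrightarrow> (1 + \<theta>) * I + \<tau>"
  using LIMSEQ_subseq_LIMSEQ[OF v_abs_mean r] by (intro tendsto_intros convJ) (simp add: o_def)
 have "eventually (\<lambda>n. r n > 0) sequentially"
  using filterlim_subseq[OF r] eventually_gt_at_top[of "0::nat"] by (auto simp: filterlim_iff)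
 thus "eventually (\<lambda>n. 1 \<le> (1 + \<theta>) * J (r n) 1 + \<theta> / real (r n) * (\<Sum>l=1..r n. \<bar>v (r n) l\<bar>)) sequentially"
 proof eventually_elim
  case (elim n)
  let ?N = "r n"
  have J1: "J ?N 1 = (\<Sum>n<?N. T ?N n) / (real ?N * T ?N ?N)" using J_sum[of ?N ?N] elim by simp
  have "(\<Sum>l=1..?N. v ?N l * T ?N (?N - l)) \<le> (\<Sum>l=1..?N. \<bar>v ?N l\<bar> * T ?N ?N)"
   using T_pos T_mono by (intro sum_mono mult_mono) (auto simp: less_imp_le)
  hence "real ?N * T ?N ?N \<le> (1 + \<theta>) * (\<Sum>n<?N. T ?N n) + \<theta> * ((\<Sum>l=1..?N. \<bar>v ?N l\<bar>) * T ?N ?N)"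
   unfolding T_rec[of ?N ?N] using theta_pos by (simp add: sum_distrib_right mult_left_mono)
  hence "(real ?N * T ?N ?N) / (real ?N * T ?N ?N) \<le> ((1 + \<theta>) * (\<Sum>n<?N. T ?N n) + \<theta> * ((\<Sum>l=1..?N. \<bar>v ?N l\<bar>) * T ?N ?N)) / (real ?N * T ?N ?N)"
   using T_pos[of ?N ?N] by (intro divide_right_mono) auto
  also have "\<dots> = (1 + \<theta>) * J ?N 1 + \<theta> / real ?N * (\<Sum>l=1..?N. \<bar>v ?N l\<bar>)"
   using T_pos[of ?N ?N] by (simp add: J1 add_divide_distrib)
  finally show ?case using T_pos[of ?N ?N] elim by simp
 qed
qed simp

end

context cycle_weights begin

lemma Ft_nonneg: "Ft x \<ge> 0" by (simp add: Ft_def)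

lemma Ft_le_tau: "x \<le> \<tau> \<Longrightarrow> Ft x = 0" by (simp add: Ft_def)

lemma Ft_1: "Ft 1 = 1" using tau_less by (simp add: Ft_def)

lemma Ft_cont: "continuous_on A Ft"
 unfolding Ft_def using tau_less theta_pos
 by (intro continuous_on_powr' continuous_intros) auto

text \<open>A subsequence staying away from \<open>Ft\<close> would have, by Helly selection, a
  further subsequence with a monotone limit; that limit solves the profile equation and so equals
  \<open>Ft\<close> inside (0,1).\<close>

lemma f_lim:
 assumes x: "0 \<le> x" "x \<le> 1"
 shows "(\<lambda>N. f N x) \<longlonglongrightarrow> Ft x"
proof (rule ccontr)
 assume "\<not> (\<lambda>N. f N x) \<longlonglongrightarrow> Ft x"
 then obtain \<epsilon> where eps: "\<epsilon> > 0" and "\<not> eventually (\<lambda>N. dist (f N x) (Ft x) < \<epsilon>) sequentially"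
  by (auto simp: tendsto_iff)
 hence "\<forall>m. \<exists>N>m. \<not> dist (f N x) (Ft x) < \<epsilon>"
  by (auto simp: eventually_sequentially) (meson Suc_le_lessD)
 hence inf: "infinite {N. \<not> dist (f N x) (Ft x) < \<epsilon>}" by (auto simp: infinite_nat_iff_unbounded)
 define r0 where "r0 = enumerate {N. \<not> dist (f N x) (Ft x) < \<epsilon>}"
 have r0: "strict_mono r0" "\<And>n. \<not> dist (f (r0 n) x) (Ft x) < \<epsilon>"
  using enumerate_in_set[OF inf] strict_mono_enumerate[OF inf] by (auto simp: r0_def)
 obtain s F where s: "strict_mono (s :: nat \<Rightarrow> nat)" and F: "mono F" "\<And>x. isCont F x \<Longrightarrow> (\<lambda>n. f (r0 (s n)) x) \<longlonglongrightarrow> F x"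
  using Helly_selection[of "\<lambda>n. f (r0 n)" 1] f_rcont f_mono f_nonneg f_le_1
  by (smt (verit, best))
 define r where "r = r0 \<circ> s"
 have r: "strict_mono r" using r0 s by (simp add: r_def strict_mono_o)
 have conv: "(\<lambda>n. f (r n) x) \<longlonglongrightarrow> F x" if "isCont F x" for x
  using F(2)[OF that] by (simp add: r_def)
 have dense: "\<exists>z. a < z \<and> z < b \<and> isCont F z" if "a < b" for a b :: real
  using real_interval_avoid_countable_set[OF that mono_ctble_discont[OF F(1)]] by auto
 have Fb_cont: "0 \<le> F y \<and> F y \<le> 1" if "isCont F y" for y
  using LIMSEQ_le_const[OF conv[OF that], of 0] LIMSEQ_le_const2[OF conv[OF that], of 1] f_nonneg f_le_1 by auto
 have Fb: "0 \<le> F y" "F y \<le> 1" for y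
 proof -
  obtain z z' where z: "y - 1 < z" "z < y" "isCont F z" "y < z'" "isCont F z'"
   using dense[of "y - 1" y] dense[of y "y + 1"] by auto
  hence "F z \<le> F y" "F y \<le> F z'" using F(1) by (auto simp: mono_def)
  thus "0 \<le> F y" "F y \<le> 1" using Fb_cont z by fastforce+
 qed
 define I where "I x = (LINT t|lborel. indicator {0..x} t * F t)" for x
 have AE_cont: "AE t in lborel. isCont F t"
  by (rule AE_I'[OF countable_imp_null_set_lborel[OF mono_ctble_discont[OF F(1)]]]) auto
 have meas: "f N \<in> borel_measurable borel" for N by (rule borel_measurable_mono[OF f_mono])
 have measF: "F \<in> borel_measurable borel" by (rule borel_measurable_mono[OF F(1)])
 \<comment> \<open>A monotone F is continuous almost everywhere, so dominated convergence carries J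
   to the integral of F.\<close>
 have convJ: "(\<lambda>n. J (r n) x) \<longlonglongrightarrow> I x" if "0 \<le> x" for x
 proof -
  have "(\<lambda>n. LINT t|lborel. indicator {0..x} t * f (r n) t) \<longlonglongrightarrow> (LINT t|lborel. indicator {0..x} t * F t)"
  proof (rule integral_dominated_convergence[where w = "indicator {0..x}"])
   show "AE t in lborel. (\<lambda>n. indicator {0..x} t * f (r n) t) \<longlonglongrightarrow> indicator {0..x} t * F t"
    using AE_cont by eventually_elim (intro tendsto_intros conv)
   show "AE t in lborel. norm (indicator {0..x} t * f (r n) t) \<le> indicator {0..x} t" for n
    using f_nonneg f_le_1 by (intro AE_I2) (auto simp: indicator_def)
   show "integrable lborel (indicator {0..x} :: real \<Rightarrow> real)"
    by (simp add: integrable_real_indicator emeasure_lborel_Icc_eq)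
  qed (use meas measF in measurable)
  thus ?thesis using J_integral[OF that] by (simp add: I_def)
 qed
 have Feq: "F y = Ft y" if y: "0 < y" "y < 1" for y
  unfolding Ft_def
 proof (rule limit_profile_unique[where I = I, OF theta_pos tau_nonneg tau_less F(1) Fb])
  show "z * F z = (1 + \<theta>) * I z + \<tau> * F z" if "0 < z" "z < 1" "isCont F z" for z
   by (rule limit_equation[OF r F(1) conv convJ]) (use that in auto)
  show "(z' - z) * F z \<le> I z' - I z \<and> I z' - I z \<le> (z' - z) * F z'"
   if z: "0 < z" "z \<le> z'" "z' < 1" "isCont F z" "isCont F z'" for z z'
  proof
   show "(z' - z) * F z \<le> I z' - I z"
    by (rule LIMSEQ_le[of "\<lambda>n. (z' - z) * f (r n) z" _ "\<lambda>n. J (r n) z' - J (r n) z"])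
      (use z J_le(1) in \<open>auto intro!: tendsto_intros conv convJ\<close>)
   show "I z' - I z \<le> (z' - z) * F z'"
    by (rule LIMSEQ_le[of "\<lambda>n. J (r n) z' - J (r n) z" _ "\<lambda>n. (z' - z) * f (r n) z'"])
      (use z J_le(2) in \<open>auto intro!: tendsto_intros conv convJ\<close>)
  qed
  show "0 \<le> I z' - I z \<and> I z' - I z \<le> z' - z" if z: "0 \<le> z" "z \<le> z'" "z' \<le> 1" for z z'
  proof
   have lim: "(\<lambda>n. J (r n) z' - J (r n) z) \<longlonglongrightarrow> I z' - I z" using z by (intro tendsto_intros convJ) auto
   show "0 \<le> I z' - I z" by (rule LIMSEQ_le_const[OF lim]) (use J_lip[OF z(2)] in auto)
   show "I z' - I z \<le> z' - z" by (rule LIMSEQ_le_const2[OF lim]) (use J_lip[OF z(2)] in auto)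
  qed
  have "(\<lambda>n. J (r n) 0) \<longlonglongrightarrow> I 0" by (rule convJ) simp
  thus "I 0 = 0" by (simp add: J_0 LIMSEQ_const_iff)
  show "1 \<le> (1 + \<theta>) * I 1 + \<tau>" by (rule profile_at_1[OF r convJ]) simp
 qed (use y in auto)
 have r_pos: "eventually (\<lambda>n. r n > 0) sequentially"
  using filterlim_subseq[OF r] eventually_gt_at_top[of "0::nat"] by (auto simp: filterlim_iff)
 have "(\<lambda>n. f (r n) x) \<longlonglongrightarrow> Ft x"
 proof -
  consider "x = 0" | "0 < x" "x < 1" | "x = 1" using x by linarith
  thus ?thesis
  proof cases
   case 3
   have "(\<lambda>n. f (r n) x) \<longlonglongrightarrow> 1"
    by (rule tendsto_eventually) (use r_pos f_ge_1 3 in \<open>auto elim!: eventually_mono\<close>)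
   thus ?thesis using 3 by (simp add: Ft_1)
  next
   case 2
   have "eventually (\<lambda>z. z \<in> {0<..<1}) (nhds x)" using 2 by (intro eventually_nhds_in_open) auto
   hence "eventually (\<lambda>z. F z = Ft z) (nhds x)" by eventually_elim (auto simp: Feq)
   hence "isCont F x \<longleftrightarrow> isCont Ft x" by (rule isCont_cong)
   moreover have "isCont Ft x" using Ft_cont[of UNIV] by (simp add: continuous_on_eq_continuous_at)
   ultimately have "isCont F x" by simp
   from conv[OF this] show ?thesis using Feq[of x] 2 by simp
  next
   case 1
   \<comment> \<open>The identification F = Ft holds inside (0,1) only. At 0 the value of f is
     bounded by f at a small continuity point z, where the limit Ft z is below q.\<close>
   have Ft0: "Ft 0 = 0" using tau_nonneg by (intro Ft_le_tau) simp
   show ?thesis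
   proof (rule tendstoI)
    fix q :: real assume q: "q > 0"
    have "eventually (\<lambda>z. Ft z < q) (at_right 0)"
    proof -
     have "isCont Ft 0" using Ft_cont[of UNIV] by (simp add: continuous_on_eq_continuous_at)
     hence "(Ft \<longlongrightarrow> 0) (at_right 0)" using Ft0 by (simp add: isCont_def filterlim_at_split)
     thus ?thesis using q by (rule order_tendstoD)
    qed
    then obtain b where b: "b > 0" "\<And>z. 0 < z \<Longrightarrow> z < b \<Longrightarrow> Ft z < q"
     unfolding eventually_at_right_field by blast
    obtain z where z: "0 < z" "z < min b 1" "isCont F z" using dense[of 0 "min b 1"] b by auto
    have "eventually (\<lambda>n. f (r n) z < q) sequentially"
     using order_tendstoD(2)[OF conv[OF z(3)], of q] Feq[of z] b(2)[of z] z by auto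
    thus "eventually (\<lambda>n. dist (f (r n) x) (Ft x) < q) sequentially"
    proof eventually_elim
     case (elim n)
     have "f (r n) 0 \<le> f (r n) z" using f_mono z by (auto simp: mono_def)
     thus ?case using elim f_nonneg[of "r n" 0] by (simp add: 1 Ft0 dist_real_def)
    qed
   qed
  qed
 qed
 hence "eventually (\<lambda>n. dist (f (r n) x) (Ft x) < \<epsilon>) sequentially" using eps by (rule tendstoD)
 thus False using r0(2) by (auto simp: r_def)
qed

text \<open>Polya's argument: f is monotone and the limit uniformly continuous, so convergence on a
  finite grid suffices, the values in between being trapped by the neighbouring grid points.\<close>

lemma f_uniform:
 assumes \<epsilon>: "\<epsilon> > 0"
 shows "eventually (\<lambda>N. \<forall>x\<le>1. \<bar>f N x - Ft x\<bar> \<le> \<epsilon>) sequentially"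
proof -
 have "uniformly_continuous_on {0..1} Ft" by (intro compact_uniformly_continuous Ft_cont) auto
 then obtain d where d: "d > 0" "\<And>x y. x \<in> {0..1} \<Longrightarrow> y \<in> {0..1} \<Longrightarrow> dist y x < d \<Longrightarrow> dist (Ft y) (Ft x) < \<epsilon> / 2"
  using \<epsilon> unfolding uniformly_continuous_on_def by (metis half_gt_zero)
 obtain K :: nat where K: "K > 0" "1 / real K < d"
  using reals_Archimedean[OF d(1)] by (metis inverse_eq_divide zero_less_Suc)
 have "eventually (\<lambda>N. \<forall>i\<in>{0..K}. \<bar>f N (real i / real K) - Ft (real i / real K)\<bar> < \<epsilon> / 2) sequentially"
 proof (rule eventually_ball_finite)
  show "\<forall>i\<in>{0..K}. eventually (\<lambda>N. \<bar>f N (real i / real K) - Ft (real i / real K)\<bar> < \<epsilon> / 2) sequentially"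
   using tendstoD[OF f_lim, of _ "\<epsilon> / 2"] \<epsilon> K by (auto simp: dist_real_def)
 qed simp
 thus ?thesis
 proof eventually_elim
  case (elim N)
  show ?case
  proof (intro allI impI)
   fix x :: real assume x1: "x \<le> 1"
   show "\<bar>f N x - Ft x\<bar> \<le> \<epsilon>"
   proof (cases "0 \<le> x \<and> x < 1")
    case False
    then consider "x < 0" | "x = 1" using x1 by linarith
    thus ?thesis
    proof cases
     case 1
     thus ?thesis using f_neg[of x N] Ft_le_tau[of x] tau_nonneg \<epsilon> by simp
    next
     case 2
     thus ?thesis using elim[rule_format, of K] K \<epsilon> by simp
    qed
   next
    case True
    define i where "i = nat \<lfloor>x * real K\<rfloor>"
    have i: "real i \<le> x * real K" "x * real K < real i + 1" using True by (auto simp: i_def of_nat_nat)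
    have "x * real K < 1 * real K" using True K by (intro mult_strict_right_mono) auto
    hence "real i < real K" using i(1) by linarith
    hence iK: "Suc i \<le> K" by simp
    let ?a = "real i / real K" and ?b = "real (Suc i) / real K"
    have ab: "?a \<le> x" "x \<le> ?b" "?b - ?a = 1 / real K" using i K by (auto simp: field_simps)
    have in01: "?a \<in> {0..1}" "?b \<in> {0..1}" using iK K by (auto simp: field_simps)
    have "dist (Ft x) (Ft ?a) < \<epsilon> / 2" "dist (Ft x) (Ft ?b) < \<epsilon> / 2"
     using ab K in01 True by (intro d(2); force simp: dist_real_def)+
    moreover have "\<bar>f N ?a - Ft ?a\<bar> < \<epsilon> / 2" "\<bar>f N ?b - Ft ?b\<bar> < \<epsilon> / 2"
     using elim[rule_format, of i] elim[rule_format, of "Suc i"] iK by simp_all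
    moreover have "f N ?a \<le> f N x" "f N x \<le> f N ?b" using ab f_mono by (auto simp: mono_def)
    ultimately show ?thesis unfolding dist_real_def by linarith
   qed
  qed
 qed
qed

lemma f_lim_seq:
 assumes "\<And>N. y N \<le> 1" "y \<longlonglongrightarrow> z"
 shows "(\<lambda>N. f N (y N)) \<longlonglongrightarrow> Ft z"
proof -
 have "(\<lambda>N. Ft (y N)) \<longlonglongrightarrow> Ft z"
  by (rule isCont_tendsto_compose[OF _ assms(2)]) (use Ft_cont[of UNIV] in \<open>simp add: continuous_on_eq_continuous_at\<close>)
 moreover have "(\<lambda>N. f N (y N) - Ft (y N)) \<longlonglongrightarrow> 0"
 proof (rule tendstoI)
  fix q :: real assume "q > 0"
  hence "eventually (\<lambda>N. \<forall>x\<le>1. \<bar>f N x - Ft x\<bar> \<le> q / 2) sequentially" by (intro f_uniform) auto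
  thus "eventually (\<lambda>N. dist (f N (y N) - Ft (y N)) 0 < q) sequentially"
  proof eventually_elim
   case (elim N)
   hence "\<bar>f N (y N) - Ft (y N)\<bar> \<le> q / 2" using assms(1)[of N] by blast
   thus ?case using \<open>q > 0\<close> by (simp add: dist_real_def)
  qed
 qed
 ultimately show ?thesis using tendsto_add by fastforce
qed

text \<open>The derivative of \<open>Ft\<close> right of \<tau>, hence the expected limit of the
  rescaled \<open>h\<close>.\<close>

definition g :: "real \<Rightarrow> real" where
 "g x = \<theta> * (x - \<tau>) powr (\<theta> - 1) / (1 - \<tau>) powr \<theta>"

lemma g_Ft: "x > \<tau> \<Longrightarrow> x * g x = \<theta> * Ft x + \<tau> * g x"
proof -
 assume x: "x > \<tau>"
 have "(x - \<tau>) * (x - \<tau>) powr (\<theta> - 1) = (x - \<tau>) powr \<theta>" using x by (simp add: powr_diff)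
 hence "(x - \<tau>) * g x = \<theta> * ((x - \<tau>) powr \<theta> / (1 - \<tau>) powr \<theta>)"
  by (simp add: g_def mult.left_commute)
 also have "\<dots> = \<theta> * Ft x" using x tau_less by (simp add: Ft_def powr_divide)
 finally show ?thesis by (simp add: algebra_simps)
qed

lemma g_pos: "x > \<tau> \<Longrightarrow> g x > 0" unfolding g_def using theta_pos tau_less by simp

text \<open>Scaled to be the density of the mass behind \<open>f\<close> with respect to cells of
  length 1 / N.\<close>

definition H :: "nat \<Rightarrow> nat \<Rightarrow> real" where "H N n = h N n * real N / T N N"

lemma H_nonneg: "H N n \<ge> 0" unfolding H_def using h_nonneg T_pos[of N N] by (simp add: divide_nonneg_pos)

lemma H_sum_le: "(\<Sum>j\<le>N. H N j) = real N"
 unfolding H_def using T_pos[of N N] by (simp add: sum_divide_distrib[symmetric] sum_distrib_right[symmetric] T_def)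

lemma H_rec:
 assumes "1 \<le> n" "n \<le> N"
 shows "real n / real N * H N n = \<theta> * f N (real (n - 1) / real N) + \<theta> / real N * (\<Sum>l=1..n. v N l * H N (n - l))"
proof -
 have "f N (real (n - 1) / real N) = T N (n - 1) / T N N" using assms by (intro f_at) auto
 also have "T N (n - 1) = (\<Sum>j<n. h N j)" using assms by (auto simp: T_def lessThan_Suc_atMost[symmetric])
 finally have ff: "f N (real (n - 1) / real N) = (\<Sum>j<n. h N j) / T N N" .
 have "real n / real N * H N n = real n * h N n / T N N" using assms by (simp add: H_def)
 also have "\<dots> = \<theta> * ((\<Sum>j<n. h N j) / T N N) + \<theta> * (\<Sum>l=1..n. v N l * h N (n - l)) / T N N"
  using h_rec[OF assms(1), of N] by (simp add: add_divide_distrib)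
 also have "\<theta> * (\<Sum>l=1..n. v N l * h N (n - l)) / T N N = \<theta> / real N * (\<Sum>l=1..n. v N l * H N (n - l))"
  using assms by (simp add: H_def sum_distrib_left sum_divide_distrib mult_ac)
 finally show ?thesis by (simp only: ff)
qed

end

section \<open>From cumulative sums to single terms\<close>

context cycle_weights begin

text \<open>Comparing \<open>H_rec\<close> with \<open>g_Ft\<close> expresses x times the error at n
  by small terms plus an average of earlier errors under v, of total mass about \<tau> < x. Errors
  are measured against y^(-d), where y is the distance of n / N from \<tau> + \<delta>. This weight
  matches long jumps, for which v is only bounded by a multiple of e N / y^d, and it dispenses with
  an initial case: close to the edge, where no short jump exists, the long-jump bound already
  suffices.\<close>

lemma H_lim_uniform:
 assumes \<delta>: "\<delta> > 0" and \<epsilon>: "\<epsilon> > 0"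
 shows "eventually (\<lambda>N. \<forall>n\<in>{1..N}. real n / real N \<ge> \<tau> + 2 * \<delta> \<longrightarrow> \<bar>H N n - g (real n / real N)\<bar> \<le> \<epsilon>) sequentially"
proof -
 have "continuous_on {\<tau> + \<delta>..1} g"
  unfolding g_def using \<delta> tau_less by (intro continuous_intros) auto
 hence gc: "uniformly_continuous_on {\<tau> + \<delta>..1} g" and "bounded (g ` {\<tau> + \<delta>..1})"
  by (auto intro!: compact_uniformly_continuous compact_imp_bounded compact_continuous_image)
 then obtain G where G: "G > 0" "\<And>x. x \<in> {\<tau> + \<delta>..1} \<Longrightarrow> \<bar>g x\<bar> \<le> G"
  by (auto simp: bounded_pos)
 \<comment> \<open>The induction hypothesis will be applied at distance at least (1 - \<eta>) y,
   which costs (1 - \<eta>)^(-d); \<eta> is so small that this raises \<tau> + \<delta> / 3 to less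
   than \<tau> + 2 \<delta> / 3.\<close>
 have "((\<lambda>\<eta>. (\<tau> + \<delta> / 3) / (1 - \<eta>) ^ d) \<longlongrightarrow> (\<tau> + \<delta> / 3) / (1 - 0) ^ d) (at_right 0)"
  by (intro tendsto_intros) auto
 hence "eventually (\<lambda>\<eta>. (\<tau> + \<delta> / 3) / (1 - \<eta>) ^ d < \<tau> + 2 * \<delta> / 3) (at_right 0)"
  using \<delta> by (intro order_tendstoD(2)) auto
 moreover have "eventually (\<lambda>\<eta>::real. 0 < \<eta> \<and> \<eta> < 1) (at_right 0)"
  by (rule eventually_at_rightI[of _ 1]) auto
 ultimately have "eventually (\<lambda>\<eta>. (0 < \<eta> \<and> \<eta> < 1) \<and> (\<tau> + \<delta> / 3) / (1 - \<eta>) ^ d < \<tau> + 2 * \<delta> / 3) (at_right 0)"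
  by eventually_elim simp
 then obtain \<eta> where eta: "0 < \<eta>" "\<eta> < 1" "(\<tau> + \<delta> / 3) / (1 - \<eta>) ^ d < \<tau> + 2 * \<delta> / 3"
  using eventually_happens'[OF trivial_limit_at_right_real] by blast
 \<comment> \<open>Since x \<ge> \<tau> + \<delta>, a slack of \<delta> / 3 is left for the other
   errors, which add up to (4 + 2 G) q / y^d; B balances the two. The choice of q turns the bound at
   y \<ge> \<delta> into \<epsilon>.\<close>
 define B where "B = 3 * (4 + 2 * G) / \<delta>"
 have B: "B > 0" "B * (\<delta> / 3) = 4 + 2 * G" using \<delta> G by (auto simp: B_def)
 define q where "q = \<epsilon> * \<delta> ^ d / B"
 have q: "q > 0" using \<epsilon> \<delta> B by (simp add: q_def)
 obtain w where w: "w > 0" "\<And>x y. x \<in> {\<tau> + \<delta>..1} \<Longrightarrow> y \<in> {\<tau> + \<delta>..1} \<Longrightarrow> dist y x < w \<Longrightarrow> dist (g y) (g x) < q / (\<tau> + \<delta>)"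
  using gc q \<delta> tau_nonneg unfolding uniformly_continuous_on_def
  by (metis add_nonneg_pos divide_pos_pos)
 have "eventually (\<lambda>N. \<forall>x\<le>1. \<bar>f N x - Ft x\<bar> \<le> q / (2 * \<theta>)) sequentially"
  using q theta_pos by (intro f_uniform) auto
 moreover have "eventually (\<lambda>N. \<forall>n\<in>{1..N}. \<bar>Ft (real (n - 1) / real N) - Ft (real n / real N)\<bar> \<le> q / (2 * \<theta>)) sequentially"
 proof -
  have "uniformly_continuous_on {0..1} Ft" by (intro compact_uniformly_continuous Ft_cont) auto
  then obtain w' where w': "w' > 0" "\<And>x y. x \<in> {0..1} \<Longrightarrow> y \<in> {0..1} \<Longrightarrow> dist y x < w' \<Longrightarrow> dist (Ft y) (Ft x) < q / (2 * \<theta>)"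
   using q theta_pos unfolding uniformly_continuous_on_def
   by (metis divide_pos_pos mult_pos_pos zero_less_numeral)
  have "eventually (\<lambda>N. 1 / real N < w') sequentially"
   using order_tendstoD(2)[OF lim_inverse_n' w'(1)] .
  thus ?thesis
  proof eventually_elim
   case (elim N)
   show ?case
   proof
    fix n assume n: "n \<in> {1..N}"
    have "real n / real N - real (n - 1) / real N = 1 / real N"
     using n by (simp add: diff_divide_distrib[symmetric] of_nat_diff)
    hence "dist (real (n - 1) / real N) (real n / real N) < w'"
     using elim unfolding dist_real_def by (subst abs_minus_commute) simp
    hence "dist (Ft (real (n - 1) / real N)) (Ft (real n / real N)) < q / (2 * \<theta>)"
     using n by (intro w'(2)) (auto simp: field_simps)
    thus "\<bar>Ft (real (n - 1) / real N) - Ft (real n / real N)\<bar> \<le> q / (2 * \<theta>)"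
     by (simp add: dist_real_def)
   qed
  qed
 qed
 moreover have "eventually (\<lambda>N. \<theta> * e N / \<eta> ^ d < q) sequentially"
 proof -
  have "(\<lambda>N. \<theta> * e N / \<eta> ^ d) \<longlonglongrightarrow> \<theta> * 0 / \<eta> ^ d"
   using eta by (intro tendsto_intros e_lim) auto
  thus ?thesis using q by (intro order_tendstoD(2)) auto
 qed
 moreover have "eventually (\<lambda>N. \<bar>\<theta> / real N * (\<Sum>l=1..N. v N l) - \<tau>\<bar> < q) sequentially"
  using tendstoD[OF v_mean q] by (simp add: dist_real_def)
 moreover have "eventually (\<lambda>N. \<theta> / real N * (\<Sum>l=1..N. \<bar>v N l\<bar>) < \<tau> + \<delta> / 3) sequentially"
  using \<delta> by (intro order_tendstoD(2)[OF v_abs_mean]) auto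
 moreover have "eventually (\<lambda>N. \<theta> / real N * (\<Sum>l\<in>{l\<in>{1..N}. real l > (w / 2) * real N}. \<bar>v N l\<bar>) \<le> q / (2 * G)) sequentially"
  using w q G by (intro v_tail_sum) auto
 moreover have "eventually (\<lambda>N::nat. N > 0) sequentially" by (rule eventually_gt_at_top)
 ultimately show ?thesis
 proof eventually_elim
  case (elim N)
  note fF = elim(1) and FF = elim(2) and e_small = elim(3) and mean = elim(4) and absm = elim(5) and tailm = elim(6)
  have N: "N > 0" by fact
  define n0 where "n0 = (\<tau> + \<delta>) * real N"
  define y where "y n = (real n - n0) / real N" for n
  have key: "\<bar>H N n - g (real n / real N)\<bar> \<le> B * q / y n ^ d" if "n \<in> {1..N}" "real n > n0" for n
   using that
  proof (induction n rule: less_induct)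
   case (less n)
   define yn where "yn = y n"
   have yn: "0 < yn" "yn \<le> 1"
   proof -
    have "n0 \<ge> 0" using \<delta> tau_nonneg by (simp add: n0_def)
    thus "0 < yn" "yn \<le> 1" using less.prems N by (auto simp: yn_def y_def)
   qed
   have ynN: "yn * real N = real n - n0" using N by (simp add: yn_def y_def)
   \<comment> \<open>Jumps up to r stay above n0 and keep at least the fraction 1 - \<eta> of the
     distance; for longer ones v is at most e N / (\<eta> y)^d.\<close>
   define r where "r = \<eta> * (yn * real N)"
   have r: "r > 0" "r < yn * real N" using eta yn N by (auto simp: r_def)
   define x where "x = real n / real N"
   have x: "x \<in> {\<tau> + \<delta>..1}" "x > \<tau> + \<delta>"
    using less.prems N by (auto simp: x_def n0_def field_simps)
   define S where "S = {l\<in>{1..n}. real l \<le> r}"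
   define R where "R = {l\<in>{1..n}. real l > r}"
   have SR: "{1..n} = S \<union> R" "S \<inter> R = {}" "finite S" "finite R" by (auto simp: S_def R_def)
   have S_sub: "S \<subseteq> {1..N}" using less.prems by (auto simp: S_def)
   have tail_v: "\<bar>v N l\<bar> \<le> e N / \<eta> ^ d / yn ^ d" if l: "l \<in> {1..N}" "real l > r" for l
   proof -
    have "real N / real l \<le> 1 / (\<eta> * yn)"
    proof -
     have "real N * (\<eta> * yn) \<le> real l" using l by (simp add: r_def mult_ac)
     hence "real N \<le> real l / (\<eta> * yn)" using eta yn by (simp add: pos_le_divide_eq)
     hence "real N / real l \<le> (real l / (\<eta> * yn)) / real l" by (rule divide_right_mono) simp
     thus ?thesis using l by simp
    qed
    hence "(real N / real l) ^ d \<le> (1 / (\<eta> * yn)) ^ d" by (intro power_mono) auto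
    hence "e N * (real N / real l) ^ d \<le> e N * (1 / (\<eta> * yn)) ^ d" by (intro mult_left_mono e_nonneg)
    also have "\<dots> = e N / \<eta> ^ d / yn ^ d" by (simp add: power_divide power_mult_distrib)
    finally show ?thesis using v_le[of l N] l by auto
   qed
   have tail_small: "\<theta> * (e N / \<eta> ^ d / yn ^ d) \<le> q / yn ^ d"
   proof -
    have "\<theta> * e N / \<eta> ^ d / yn ^ d \<le> q / yn ^ d" using e_small yn by (intro divide_right_mono) auto
    thus ?thesis by simp
   qed
   have nl: "real (n - l) / real N \<in> {\<tau> + \<delta>..1} \<and> n - l \<in> {1..N} \<and> real (n - l) > n0 \<and> real (n - l) / real N = x - real l / real N"
    if l: "l \<in> S" for l
   proof -
    have l': "real l \<le> r" "l \<le> n" "1 \<le> l" using l by (auto simp: S_def)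
    have a: "real (n - l) > n0" using l' r ynN by (simp add: of_nat_diff)
    have "n0 \<ge> 0" using \<delta> tau_nonneg by (simp add: n0_def)
    hence b: "n - l \<in> {1..N}" using a less.prems by (cases "n - l") auto
    thus ?thesis using a b l' N less.prems
     by (auto simp: n0_def field_simps x_def of_nat_diff)
   qed
   have yn_inv: "1 \<le> 1 / yn ^ d" using yn by (simp add: power_le_one)
   have t1: "\<bar>\<theta> * f N (real (n - 1) / real N) - \<theta> * Ft x\<bar> \<le> q"
   proof -
    have "real (n - 1) / real N \<le> 1" using less.prems by (auto simp: field_simps)
    hence "\<bar>f N (real (n - 1) / real N) - Ft (real (n - 1) / real N)\<bar> \<le> q / (2 * \<theta>)" using fF by blast
    moreover have "\<bar>Ft (real (n - 1) / real N) - Ft x\<bar> \<le> q / (2 * \<theta>)" using FF less.prems by (auto simp: x_def)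
    ultimately have "\<bar>f N (real (n - 1) / real N) - Ft x\<bar> \<le> q / \<theta>" by (simp add: field_simps abs_if split: if_splits)
    hence "\<theta> * \<bar>f N (real (n - 1) / real N) - Ft x\<bar> \<le> \<theta> * (q / \<theta>)"
     using theta_pos by (intro mult_left_mono) auto
    moreover have "\<theta> * \<bar>f N (real (n - 1) / real N) - Ft x\<bar> = \<bar>\<theta> * f N (real (n - 1) / real N) - \<theta> * Ft x\<bar>"
     using theta_pos by (simp add: abs_mult right_diff_distrib[symmetric])
    ultimately show ?thesis using theta_pos by simp
   qed
   \<comment> \<open>Long jumps: v is uniformly small there, and the values of H enter only through
     their total mass N.\<close>
   have t3: "\<bar>\<theta> / real N * (\<Sum>l\<in>R. v N l * H N (n - l))\<bar> \<le> q / yn ^ d"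
   proof -
    have "\<bar>\<Sum>l\<in>R. v N l * H N (n - l)\<bar> \<le> (\<Sum>l\<in>R. \<bar>v N l\<bar> * H N (n - l))"
     by (rule order_trans[OF sum_abs]) (simp add: abs_mult H_nonneg)
    also have "\<dots> \<le> (\<Sum>l\<in>R. (e N / \<eta> ^ d / yn ^ d) * H N (n - l))"
     using less.prems by (intro sum_mono mult_right_mono tail_v H_nonneg) (auto simp: R_def)
    also have "\<dots> = (e N / \<eta> ^ d / yn ^ d) * (\<Sum>l\<in>R. H N (n - l))" by (simp add: sum_distrib_left)
    also have "\<dots> \<le> (e N / \<eta> ^ d / yn ^ d) * real N"
    proof (rule mult_left_mono)
     have "(\<Sum>l\<in>R. H N (n - l)) = (\<Sum>j\<in>(\<lambda>l. n - l) ` R. H N j)"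
      by (subst sum.reindex) (auto simp: R_def inj_on_def)
     also have "\<dots> \<le> (\<Sum>j\<le>N. H N j)" using less.prems by (intro sum_mono2) (auto simp: H_nonneg)
     also have "\<dots> = real N" by (rule H_sum_le)
     finally show "(\<Sum>l\<in>R. H N (n - l)) \<le> real N" .
    qed (use e_nonneg eta yn in auto)
    finally have "\<theta> / real N * \<bar>\<Sum>l\<in>R. v N l * H N (n - l)\<bar> \<le> \<theta> / real N * ((e N / \<eta> ^ d / yn ^ d) * real N)"
     using theta_pos by (intro mult_left_mono) auto
    also have "\<dots> = \<theta> * (e N / \<eta> ^ d / yn ^ d)" using N by simp
    finally show ?thesis using tail_small theta_pos by (simp add: abs_mult)
   qed
   \<comment> \<open>short jumps, replacing \<open>g (x - l / N)\<close> by \<open>g x\<close>\<close>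
   have t2a: "\<bar>\<theta> / real N * (\<Sum>l\<in>S. v N l * (g (real (n - l) / real N) - g x))\<bar> \<le> 2 * q"
   proof -
    let ?W = "{l\<in>{1..N}. real l > (w / 2) * real N}"
    have "\<bar>\<Sum>l\<in>S. v N l * (g (real (n - l) / real N) - g x)\<bar> \<le> (\<Sum>l\<in>S. \<bar>v N l\<bar> * \<bar>g (real (n - l) / real N) - g x\<bar>)"
     by (rule order_trans[OF sum_abs]) (simp add: abs_mult)
    also have "\<dots> \<le> (\<Sum>l\<in>S. q / (\<tau> + \<delta>) * \<bar>v N l\<bar> + (if l \<in> ?W then 2 * G * \<bar>v N l\<bar> else 0))"
    proof (rule sum_mono)
     fix l assume l: "l \<in> S"
     show "\<bar>v N l\<bar> * \<bar>g (real (n - l) / real N) - g x\<bar> \<le> q / (\<tau> + \<delta>) * \<bar>v N l\<bar> + (if l \<in> ?W then 2 * G * \<bar>v N l\<bar> else 0)"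
     proof (cases "l \<in> ?W")
      case True
      have "\<bar>g (real (n - l) / real N)\<bar> \<le> G" "\<bar>g x\<bar> \<le> G" using nl[OF l] x G by auto
      hence "\<bar>g (real (n - l) / real N) - g x\<bar> \<le> 2 * G" by linarith
      hence "\<bar>v N l\<bar> * \<bar>g (real (n - l) / real N) - g x\<bar> \<le> \<bar>v N l\<bar> * (2 * G)" by (intro mult_left_mono) auto
      moreover have "q / (\<tau> + \<delta>) * \<bar>v N l\<bar> \<ge> 0" using q \<delta> tau_nonneg by simp
      ultimately show ?thesis unfolding if_P[OF True] by (simp only: mult.commute)
     next
      case False
      have "real l / real N < w"
      proof -
       have "real l \<le> w / 2 * real N" using False l S_sub by auto
       hence "real l / real N \<le> w / 2" using N by (simp add: field_simps)
       thus ?thesis using w by linarith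
      qed
      hence "dist (g (real (n - l) / real N)) (g x) < q / (\<tau> + \<delta>)"
       using nl[OF l] x by (intro w(2)) (auto simp: dist_real_def)
      hence "\<bar>v N l\<bar> * \<bar>g (real (n - l) / real N) - g x\<bar> \<le> \<bar>v N l\<bar> * (q / (\<tau> + \<delta>))"
       by (intro mult_left_mono) (auto simp: dist_real_def)
      thus ?thesis unfolding if_not_P[OF False] by (simp add: mult.commute)
     qed
    qed
    also have "\<dots> = q / (\<tau> + \<delta>) * (\<Sum>l\<in>S. \<bar>v N l\<bar>) + (\<Sum>l\<in>S \<inter> ?W. 2 * G * \<bar>v N l\<bar>)"
     by (simp only: sum.distrib sum_distrib_left sum.inter_restrict[OF SR(3)])
    also have "\<dots> \<le> q / (\<tau> + \<delta>) * (\<Sum>l=1..N. \<bar>v N l\<bar>) + 2 * G * (\<Sum>l\<in>?W. \<bar>v N l\<bar>)"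
     unfolding sum_distrib_left
     using S_sub q \<delta> tau_nonneg G by (intro add_mono sum_mono2) auto
    finally have "\<theta> / real N * \<bar>\<Sum>l\<in>S. v N l * (g (real (n - l) / real N) - g x)\<bar>
      \<le> \<theta> / real N * (q / (\<tau> + \<delta>) * (\<Sum>l=1..N. \<bar>v N l\<bar>) + 2 * G * (\<Sum>l\<in>?W. \<bar>v N l\<bar>))"
     using theta_pos by (intro mult_left_mono) auto
    also have "\<dots> = q / (\<tau> + \<delta>) * (\<theta> / real N * (\<Sum>l=1..N. \<bar>v N l\<bar>)) + 2 * G * (\<theta> / real N * (\<Sum>l\<in>?W. \<bar>v N l\<bar>))"
     by (simp only: distrib_left mult.left_commute)
    also have "\<dots> \<le> q / (\<tau> + \<delta>) * (\<tau> + \<delta>) + 2 * G * (q / (2 * G))"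
     using q \<delta> tau_nonneg G absm tailm by (intro add_mono mult_left_mono) auto
    also have "\<dots> = 2 * q" using \<delta> tau_nonneg G by simp
    finally show ?thesis using theta_pos by (simp add: abs_mult)
   qed
   \<comment> \<open>The mean of v over all lengths is near \<tau>; the lengths above r missing from
     S are again a long-jump error.\<close>
   have t2b: "\<bar>g x * (\<theta> / real N * (\<Sum>l\<in>S. v N l)) - \<tau> * g x\<bar> \<le> 2 * G * (q / yn ^ d)"
   proof -
    define Q where "Q = {l\<in>{1..N}. real l > r}"
    have SQ: "(\<Sum>l=1..N. v N l) = (\<Sum>l\<in>S. v N l) + (\<Sum>l\<in>Q. v N l)"
    proof -
     have "S = {l\<in>{1..N}. real l \<le> r}"
     proof -
      have "n0 \<ge> 0" using \<delta> tau_nonneg by (simp add: n0_def)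
      hence "r \<le> real n" using r(2) ynN by linarith
      thus ?thesis using less.prems by (auto simp: S_def)
     qed
     hence u: "{1..N} = S \<union> Q" "S \<inter> Q = {}" by (auto simp: Q_def)
     have "finite Q" by (simp add: Q_def)
     thus ?thesis unfolding u(1) by (intro sum.union_disjoint SR(3) u(2))
    qed
    have "\<bar>\<Sum>l\<in>Q. v N l\<bar> \<le> (\<Sum>l\<in>Q. \<bar>v N l\<bar>)" by (rule sum_abs)
    also have "\<dots> \<le> real (card Q) * (e N / \<eta> ^ d / yn ^ d)"
    proof (rule sum_bounded_above)
     fix l assume "l \<in> Q"
     thus "\<bar>v N l\<bar> \<le> e N / \<eta> ^ d / yn ^ d" by (intro tail_v) (auto simp: Q_def)
    qed
    also have "\<dots> \<le> real N * (e N / \<eta> ^ d / yn ^ d)"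
    proof (rule mult_right_mono)
     have "card Q \<le> card {1..N}" by (rule card_mono) (auto simp: Q_def)
     thus "real (card Q) \<le> real N" by simp
    qed (use e_nonneg eta yn in auto)
    finally have "\<theta> / real N * \<bar>\<Sum>l\<in>Q. v N l\<bar> \<le> \<theta> / real N * (real N * (e N / \<eta> ^ d / yn ^ d))"
     using theta_pos by (intro mult_left_mono) auto
    also have "\<dots> = \<theta> * (e N / \<eta> ^ d / yn ^ d)" using N by simp
    also note tail_small
    finally have Qb: "\<bar>\<theta> / real N * (\<Sum>l\<in>Q. v N l)\<bar> \<le> q / yn ^ d" using theta_pos by (simp add: abs_mult)
    have "q \<le> q / yn ^ d" using mult_left_mono[OF yn_inv, of q] q by simp
    moreover have "\<theta> / real N * (\<Sum>l=1..N. v N l) = \<theta> / real N * (\<Sum>l\<in>S. v N l) + \<theta> / real N * (\<Sum>l\<in>Q. v N l)"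
     unfolding SQ by (rule distrib_left)
    ultimately have "\<bar>\<theta> / real N * (\<Sum>l\<in>S. v N l) - \<tau>\<bar> \<le> 2 * (q / yn ^ d)"
     using mean Qb by linarith
    hence "\<bar>g x\<bar> * \<bar>\<theta> / real N * (\<Sum>l\<in>S. v N l) - \<tau>\<bar> \<le> G * (2 * (q / yn ^ d))"
     using G(2)[OF x(1)] G(1) by (intro mult_mono) auto
    moreover have "g x * (\<theta> / real N * (\<Sum>l\<in>S. v N l)) - \<tau> * g x = g x * (\<theta> / real N * (\<Sum>l\<in>S. v N l) - \<tau>)"
     by (simp add: algebra_simps)
    ultimately show ?thesis by (simp only: abs_mult mult.left_commute[of 2 G] mult.assoc)
   qed
   \<comment> \<open>The earlier errors; the only place where the induction hypothesis
     enters.\<close>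
   have t4: "\<bar>\<theta> / real N * (\<Sum>l\<in>S. v N l * (H N (n - l) - g (real (n - l) / real N)))\<bar> \<le> (\<tau> + 2 * \<delta> / 3) * (B * q / yn ^ d)"
   proof -
    define b where "b = B * q / ((1 - \<eta>) ^ d * yn ^ d)"
    have b0: "b \<ge> 0" using B q eta yn by (simp add: b_def)
    have D: "\<bar>H N (n - l) - g (real (n - l) / real N)\<bar> \<le> b" if l: "l \<in> S" for l
    proof -
     have l': "1 \<le> l" "real l \<le> r" "l \<le> n" using l by (auto simp: S_def)
     have IH: "\<bar>H N (n - l) - g (real (n - l) / real N)\<bar> \<le> B * q / y (n - l) ^ d"
      using nl[OF l] l' by (intro less.IH) auto
     have "y (n - l) = yn - real l / real N" using l' by (simp add: y_def yn_def of_nat_diff diff_divide_distrib)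
     moreover have "real l / real N \<le> \<eta> * yn" using l' N by (simp add: r_def field_simps)
     ultimately have yl: "y (n - l) \<ge> (1 - \<eta>) * yn" by (simp add: algebra_simps)
     have pos: "(1 - \<eta>) * yn > 0" using eta yn by simp
     from yl have "((1 - \<eta>) * yn) ^ d \<le> y (n - l) ^ d" using eta yn by (intro power_mono) auto
     hence "B * q / y (n - l) ^ d \<le> B * q / ((1 - \<eta>) * yn) ^ d"
      using B q pos yl by (intro divide_left_mono) (auto intro: mult_pos_pos zero_less_power)
     thus ?thesis using IH by (simp add: b_def power_mult_distrib)
    qed
    have "\<bar>\<Sum>l\<in>S. v N l * (H N (n - l) - g (real (n - l) / real N))\<bar> \<le> (\<Sum>l\<in>S. \<bar>v N l\<bar> * \<bar>H N (n - l) - g (real (n - l) / real N)\<bar>)"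
     by (rule order_trans[OF sum_abs]) (simp add: abs_mult)
    also have "\<dots> \<le> (\<Sum>l\<in>S. \<bar>v N l\<bar> * b)" by (intro sum_mono mult_left_mono D) auto
    also have "\<dots> \<le> (\<Sum>l=1..N. \<bar>v N l\<bar> * b)" using S_sub b0 by (intro sum_mono2) auto
    finally have "\<theta> / real N * \<bar>\<Sum>l\<in>S. v N l * (H N (n - l) - g (real (n - l) / real N))\<bar> \<le> \<theta> / real N * (\<Sum>l=1..N. \<bar>v N l\<bar> * b)"
     using theta_pos by (intro mult_left_mono) auto
    also have "\<dots> = (\<theta> / real N * (\<Sum>l=1..N. \<bar>v N l\<bar>)) * b" by (simp add: sum_distrib_right mult.assoc)
    also have "\<dots> \<le> (\<tau> + \<delta> / 3) * b" using absm b0 by (intro mult_right_mono) auto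
    also have "\<dots> = ((\<tau> + \<delta> / 3) / (1 - \<eta>) ^ d) * (B * q / yn ^ d)" by (simp add: b_def)
    also have "\<dots> \<le> (\<tau> + 2 * \<delta> / 3) * (B * q / yn ^ d)"
     using eta B q yn by (intro mult_right_mono) auto
    finally show ?thesis using theta_pos by (simp add: abs_mult)
   qed
   have rec: "x * (H N n - g x) = (\<theta> * f N (real (n - 1) / real N) - \<theta> * Ft x)
     + \<theta> / real N * (\<Sum>l\<in>R. v N l * H N (n - l))
     + \<theta> / real N * (\<Sum>l\<in>S. v N l * (g (real (n - l) / real N) - g x))
     + (g x * (\<theta> / real N * (\<Sum>l\<in>S. v N l)) - \<tau> * g x)
     + \<theta> / real N * (\<Sum>l\<in>S. v N l * (H N (n - l) - g (real (n - l) / real N)))"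
   proof -
    have "x * H N n = \<theta> * f N (real (n - 1) / real N) + \<theta> / real N * (\<Sum>l=1..n. v N l * H N (n - l))"
     using H_rec[of n N] less.prems by (simp add: x_def)
    moreover have "x * g x = \<theta> * Ft x + \<tau> * g x" using x \<delta> by (intro g_Ft) auto
    moreover have "(\<Sum>l=1..n. v N l * H N (n - l)) = (\<Sum>l\<in>S. v N l * H N (n - l)) + (\<Sum>l\<in>R. v N l * H N (n - l))"
     unfolding SR(1) using SR by (intro sum.union_disjoint) auto
    moreover have "(\<Sum>l\<in>S. v N l * H N (n - l)) = (\<Sum>l\<in>S. v N l * (g (real (n - l) / real N) - g x)) + g x * (\<Sum>l\<in>S. v N l)
      + (\<Sum>l\<in>S. v N l * (H N (n - l) - g (real (n - l) / real N)))"
     unfolding sum_distrib_left sum.distrib[symmetric] by (intro sum.cong refl) (simp add: algebra_simps)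
    \<comment> \<open>An identity between arbitrary reals, so that the sums stay opaque during the
      rearrangement.\<close>
    moreover have "X = A1 + t * Y \<Longrightarrow> Z = A2 + A3 \<Longrightarrow> Y = Y1 + Y2 \<Longrightarrow> Y1 = B1 + g x * B2 + B3 \<Longrightarrow>
      X - Z = (A1 - A2) + t * Y2 + t * B1 + (g x * (t * B2) - A3) + t * B3" for X A1 t Y Z A2 A3 Y1 Y2 B1 B2 B3 :: real
     by (simp add: algebra_simps)
    ultimately show ?thesis unfolding right_diff_distrib[of x] by blast
   qed
   have x0: "x > 0" using x \<delta> tau_nonneg by linarith
   have "\<bar>x * (H N n - g x)\<bar> \<le> q + q / yn ^ d + 2 * q + 2 * G * (q / yn ^ d) + (\<tau> + 2 * \<delta> / 3) * (B * q / yn ^ d)"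
    unfolding rec using t1 t2a t2b t3 t4 by linarith
   also have "\<dots> \<le> q / yn ^ d + q / yn ^ d + 2 * (q / yn ^ d) + 2 * G * (q / yn ^ d) + (\<tau> + 2 * \<delta> / 3) * (B * q / yn ^ d)"
    using mult_left_mono[OF yn_inv, of q] q by simp
   also have "\<dots> = (4 + 2 * G + (\<tau> + 2 * \<delta> / 3) * B) * (q / yn ^ d)" by (simp add: algebra_simps)
   also have "\<dots> = ((\<tau> + \<delta>) * B) * (q / yn ^ d)" unfolding B(2)[symmetric] by (simp add: algebra_simps)
   also have "\<dots> \<le> (x * B) * (q / yn ^ d)" using x B q yn by (intro mult_right_mono) auto
   finally have "x * \<bar>H N n - g x\<bar> \<le> x * (B * q / yn ^ d)" using x0 by (simp add: abs_mult)
   hence "\<bar>H N n - g x\<bar> \<le> B * q / yn ^ d" using x0 by (simp only: mult_le_cancel_left_pos)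
   thus ?case by (simp add: yn_def x_def)
  qed
  show ?case
  proof (intro ballI impI)
   fix n assume n: "n \<in> {1..N}" "\<tau> + 2 * \<delta> \<le> real n / real N"
   have n': "(\<tau> + 2 * \<delta>) * real N \<le> real n" using n N by (simp add: field_simps)
   have "(\<tau> + \<delta>) * real N < (\<tau> + 2 * \<delta>) * real N" using N \<delta> by (intro mult_strict_right_mono) auto
   hence "real n > n0" using n' unfolding n0_def by linarith
   hence k: "\<bar>H N n - g (real n / real N)\<bar> \<le> B * q / y n ^ d" using n by (intro key) auto
   have "y n \<ge> \<delta>" using n' N by (simp add: y_def n0_def field_simps)
   hence "\<delta> ^ d \<le> y n ^ d" using \<delta> by (intro power_mono) auto
   hence "B * q / y n ^ d \<le> B * q / \<delta> ^ d"
    using B q \<delta> by (intro divide_left_mono) (auto intro!: mult_pos_pos elim: less_le_trans[rotated])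
   also have "\<dots> = \<epsilon>" using B \<delta> by (simp add: q_def)
   finally show "\<bar>H N n - g (real n / real N)\<bar> \<le> \<epsilon>" using k by linarith
  qed
 qed
qed

lemma H_lim:
 assumes n: "\<And>N. m N \<le> N" and x: "(\<lambda>N. real (m N) / real N) \<longlonglongrightarrow> x" "x > \<tau>"
 shows "(\<lambda>N. H N (m N)) \<longlonglongrightarrow> g x"
proof -
 have "(\<lambda>N. g (real (m N) / real N)) \<longlonglongrightarrow> g x"
  unfolding g_def using x tau_less by (intro tendsto_intros) auto
 moreover have "(\<lambda>N. H N (m N) - g (real (m N) / real N)) \<longlonglongrightarrow> 0"
 proof (rule tendstoI)
  fix q :: real assume q: "q > 0"
  define \<delta> where "\<delta> = (x - \<tau>) / 4"
  have d: "\<delta> > 0" using x by (simp add: \<delta>_def)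
  have "eventually (\<lambda>N. real (m N) / real N > \<tau> + 2 * \<delta>) sequentially"
   using x by (intro order_tendstoD(1)[OF x(1)]) (simp add: \<delta>_def field_simps)
  moreover have "eventually (\<lambda>N. \<forall>n\<in>{1..N}. real n / real N \<ge> \<tau> + 2 * \<delta> \<longrightarrow> \<bar>H N n - g (real n / real N)\<bar> \<le> q / 2) sequentially"
   using d q by (intro H_lim_uniform) auto
  ultimately show "eventually (\<lambda>N. dist (H N (m N) - g (real (m N) / real N)) 0 < q) sequentially"
  proof eventually_elim
   case (elim N)
   have "m N \<noteq> 0"
   proof
    assume "m N = 0"
    thus False using elim(1) d tau_nonneg by simp
   qed
   hence "m N \<in> {1..N}" using n by auto
   hence "\<bar>H N (m N) - g (real (m N) / real N)\<bar> \<le> q / 2" using elim by auto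
   thus ?case using q by (simp add: dist_real_def)
  qed
 qed
 ultimately show ?thesis using tendsto_add by fastforce
qed

text \<open>At lengths above t N the excess v is negligible, so the numerator is \<theta> times a
  cumulative sum and, on the common scale, tends to \<theta> Ft (x - t), while the denominator tends
  to x g x. The quotient is the survival function found in \<open>step_law_cdf\<close>. Positivity
  of h makes the chain well defined for large N.\<close>

theorem first_cycle_tail:
 assumes m: "\<And>N. m N \<le> N" and x: "(\<lambda>N. real (m N) / real N) \<longlonglongrightarrow> x" "x > \<tau>" and t: "t > 0"
 shows "(\<lambda>N. (\<Sum>l\<in>{l\<in>{1..m N}. real l > t * real N}. a N l * h N (m N - l)) / (real (m N) * h N (m N)))
   \<longlonglongrightarrow> (1 - \<tau> / x) * (max 0 (1 - t / (x - \<tau>))) powr \<theta>"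
  and "eventually (\<lambda>N. h N (m N) > 0) sequentially"
proof -
 have x0: "x > 0" using x tau_nonneg by linarith
 have N_pos: "eventually (\<lambda>N::nat. N > 0) sequentially" by (rule eventually_gt_at_top)
 have "eventually (\<lambda>N. H N (m N) > 0) sequentially"
  using order_tendstoD(1)[OF H_lim[OF m x] g_pos[OF x(2)]] .
 thus h_pos: "eventually (\<lambda>N. h N (m N) > 0) sequentially"
  by eventually_elim (auto simp: H_def zero_less_mult_iff zero_less_divide_iff dest: not_less_iff_gr_or_eq[THEN iffD1] intro: h_nonneg le_neq_trans)
 define A where "A N = {l\<in>{1..m N}. real l > t * real N}" for N
 define P where "P N = (\<Sum>l\<in>A N. h N (m N - l)) / T N N" for N
 have Ahalf: "(\<Sum>l\<in>A N. h N (m N - l)) = (\<Sum>j\<le>N. h N j * (if real j < real (m N) - t * real N then 1 else 0))" if "N > 0" for N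
 proof -
  have "(\<Sum>l\<in>A N. h N (m N - l)) = (\<Sum>j\<in>{j\<in>{..N}. real j < real (m N) - t * real N}. h N j)"
  proof (rule sum.reindex_bij_witness[of _ "\<lambda>j. m N - j" "\<lambda>l. m N - l"])
   have tN: "t * real N > 0" using t that by simp
   fix j assume j: "j \<in> {j \<in> {..N}. real j < real (m N) - t * real N}"
   hence "real j < real (m N)" using tN by auto
   hence "j < m N" by simp
   thus "m N - j \<in> A N" "m N - (m N - j) = j" using j by (auto simp: A_def of_nat_diff)
  next
   fix l assume "l \<in> A N"
   thus "m N - l \<in> {j \<in> {..N}. real j < real (m N) - t * real N}" "m N - (m N - l) = l"
    using m[of N] by (auto simp: A_def of_nat_diff)
  qed auto
  also have "\<dots> = (\<Sum>j\<le>N. if real j < real (m N) - t * real N then h N j else 0)"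
   by (intro sum.inter_filter) simp
  also have "\<dots> = (\<Sum>j\<le>N. h N j * (if real j < real (m N) - t * real N then 1 else 0))"
   by (intro sum.cong) auto
  finally show ?thesis .
 qed
 have P_lim: "P \<longlonglongrightarrow> Ft (x - t)"
 proof (rule tendsto_sandwich)
  have lim: "(\<lambda>N. real (m N) / real N - t) \<longlonglongrightarrow> x - t" by (intro tendsto_intros x)
  have le1: "real (m N) / real N \<le> 1" for N using m[of N] by (cases "N = 0") (auto simp: field_simps)
  \<comment> \<open>The strict inequality l > t N against the closed one in f costs at most one cell
    of length 1 / N.\<close>
  have "(\<lambda>N. real (m N) / real N - t - 1 / real N) \<longlonglongrightarrow> x - t - 0" by (intro tendsto_diff lim lim_inverse_n')
  thus "(\<lambda>N. f N (real (m N) / real N - t - 1 / real N)) \<longlonglongrightarrow> Ft (x - t)"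
   using le1 t by (intro f_lim_seq) (auto, smt (verit) divide_nonneg_nonneg of_nat_0_le_iff)
  show "(\<lambda>N. f N (real (m N) / real N - t)) \<longlonglongrightarrow> Ft (x - t)"
   using le1 t by (intro f_lim_seq lim) (smt (verit))
  show "eventually (\<lambda>N. f N (real (m N) / real N - t - 1 / real N) \<le> P N) sequentially"
   using N_pos
  proof eventually_elim
   case (elim N)
   show ?case unfolding f_def P_def Ahalf[OF elim]
   proof (intro divide_right_mono sum_mono mult_left_mono h_nonneg)
    fix j
    have "real j / real N \<le> real (m N) / real N - t - 1 / real N \<Longrightarrow> real j + 1 \<le> real (m N) - t * real N"
     using elim by (simp add: pos_divide_le_eq left_diff_distrib)
    thus "(if real j / real N \<le> real (m N) / real N - t - 1 / real N then 1 else 0) \<le> (if real j < real (m N) - t * real N then 1 else (0::real))"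
     by auto
   qed (use T_pos[of N N] in auto)
  qed
  show "eventually (\<lambda>N. P N \<le> f N (real (m N) / real N - t)) sequentially"
   using N_pos
  proof eventually_elim
   case (elim N)
   show ?case unfolding f_def P_def Ahalf[OF elim]
   proof (intro divide_right_mono sum_mono mult_left_mono h_nonneg)
    fix j
    have "real j < real (m N) - t * real N \<Longrightarrow> real j / real N \<le> real (m N) / real N - t"
     using elim by (simp add: field_simps)
    thus "(if real j < real (m N) - t * real N then 1 else 0) \<le> (if real j / real N \<le> real (m N) / real N - t then 1 else (0::real))"
     by auto
   qed (use T_pos[of N N] in auto)
  qed
 qed
 define V where "V N = (\<Sum>l\<in>A N. v N l * h N (m N - l)) / T N N" for N
 have V_lim: "V \<longlonglongrightarrow> 0"
 proof (rule tendstoI)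
  fix q :: real assume q: "q > 0"
  have "eventually (\<lambda>N. P N < Ft (x - t) + 1) sequentially" using order_tendstoD(2)[OF P_lim] by simp
  moreover have "eventually (\<lambda>N. \<forall>l\<in>{1..N}. real l > t * real N \<longrightarrow> \<bar>v N l\<bar> \<le> q / (2 * (Ft (x - t) + 1))) sequentially"
   using q t Ft_nonneg[of "x - t"] by (intro v_tail) auto
  ultimately show "eventually (\<lambda>N. dist (V N) 0 < q) sequentially"
  proof eventually_elim
   case (elim N)
   let ?c = "q / (2 * (Ft (x - t) + 1))"
   have c: "?c \<ge> 0" using q Ft_nonneg[of "x - t"] by simp
   have "\<bar>\<Sum>l\<in>A N. v N l * h N (m N - l)\<bar> \<le> (\<Sum>l\<in>A N. \<bar>v N l\<bar> * h N (m N - l))"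
    by (rule order_trans[OF sum_abs]) (simp add: abs_mult h_nonneg)
   also have "\<dots> \<le> (\<Sum>l\<in>A N. ?c * h N (m N - l))"
    using elim(2) m[of N] by (intro sum_mono mult_right_mono h_nonneg) (auto simp: A_def)
   also have "\<dots> = ?c * (\<Sum>l\<in>A N. h N (m N - l))" by (simp add: sum_distrib_left)
   finally have "\<bar>\<Sum>l\<in>A N. v N l * h N (m N - l)\<bar> / T N N \<le> ?c * (\<Sum>l\<in>A N. h N (m N - l)) / T N N"
    using T_pos[of N N] by (intro divide_right_mono) auto
   hence "\<bar>V N\<bar> \<le> ?c * P N" using T_pos[of N N] by (simp add: V_def P_def abs_divide)
   also have "\<dots> \<le> ?c * (Ft (x - t) + 1)" using elim(1) c by (intro mult_left_mono) auto
   also have "\<dots> = q / 2" using Ft_nonneg[of "x - t"] by (simp add: divide_simps) 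
   finally show ?case using q by (simp add: dist_real_def)
  qed
 qed
 have "(\<lambda>N. (\<theta> * P N + \<theta> * V N) / (real (m N) / real N * H N (m N))) \<longlonglongrightarrow> (\<theta> * Ft (x - t) + \<theta> * 0) / (x * g x)"
  using x0 g_pos[OF x(2)] by (intro tendsto_intros P_lim V_lim x H_lim[OF m x]) auto
 moreover have "eventually (\<lambda>N. (\<theta> * P N + \<theta> * V N) / (real (m N) / real N * H N (m N))
   = (\<Sum>l\<in>A N. a N l * h N (m N - l)) / (real (m N) * h N (m N))) sequentially"
  using N_pos
 proof eventually_elim
  case (elim N)
  have "(\<Sum>l\<in>A N. a N l * h N (m N - l)) = \<theta> * (\<Sum>l\<in>A N. h N (m N - l)) + \<theta> * (\<Sum>l\<in>A N. v N l * h N (m N - l))"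
   by (simp add: a_def sum_distrib_left sum.distrib[symmetric] algebra_simps)
  hence "\<theta> * P N + \<theta> * V N = (\<Sum>l\<in>A N. a N l * h N (m N - l)) / T N N"
   by (simp add: P_def V_def add_divide_distrib)
  moreover have "real (m N) / real N * H N (m N) = real (m N) * h N (m N) / T N N" using elim by (simp add: H_def)
  ultimately show ?case using T_pos[of N N] by simp
 qed
 moreover have "(\<theta> * Ft (x - t) + \<theta> * 0) / (x * g x) = (1 - \<tau> / x) * (max 0 (1 - t / (x - \<tau>))) powr \<theta>"
 proof -
  have "max 0 (x - t - \<tau>) = (x - \<tau>) * max 0 (1 - t / (x - \<tau>))"
  proof -
   have "(x - \<tau>) * (1 - t / (x - \<tau>)) = x - t - \<tau>" using x(2) by (simp add: right_diff_distrib)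
   thus ?thesis using x(2) by (metis diff_gt_0_iff_gt less_imp_le max_mult_distrib_left mult_zero_right)
  qed
  hence "Ft (x - t) = (x - \<tau>) powr \<theta> * (max 0 (1 - t / (x - \<tau>))) powr \<theta> / (1 - \<tau>) powr \<theta>"
   using x(2) tau_less by (simp add: Ft_def powr_divide powr_mult)
  moreover have "(x - \<tau>) powr \<theta> = (x - \<tau>) * (x - \<tau>) powr (\<theta> - 1)" using x(2) by (simp add: powr_diff)
  ultimately show ?thesis using x0 x(2) theta_pos tau_less by (simp add: g_def field_simps)
 qed
 ultimately show "(\<lambda>N. (\<Sum>l\<in>{l\<in>{1..m N}. real l > t * real N}. a N l * h N (m N - l)) / (real (m N) * h N (m N)))
   \<longlonglongrightarrow> (1 - \<tau> / x) * (max 0 (1 - t / (x - \<tau>))) powr \<theta>"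
  unfolding A_def[symmetric] using Lim_transform_eventually by fastforce
qed

end

subsection \<open>Splitting off the cycle of the smallest element\<close>

text \<open>\<open>cyc_len\<close> over an arbitrary set of points: once the first cycle is removed,
  the remaining points need not form an initial segment.\<close>

definition cyc_len_on :: "(nat \<Rightarrow> nat) \<Rightarrow> nat set \<Rightarrow> nat \<Rightarrow> nat" where
 "cyc_len_on \<pi> A j =
   (let ms = sorted_list_of_set (Min ` orbit \<pi> ` A)
   in if j < length ms then card (orbit \<pi> (ms ! j)) else 0)"

definition cyclic_perms :: "nat set \<Rightarrow> (nat \<Rightarrow> nat) set" where
 "cyclic_perms C = {c. c permutes C \<and> cyclic_on c C}"

lemma perm_restrict_orbit_permutes:
 assumes "\<pi> permutes A" "finite A" "x \<in> A"
 shows "perm_restrict \<pi> (orbit \<pi> x) permutes orbit \<pi> x"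
proof (rule bij_imp_permutes)
 have sub: "orbit \<pi> x \<subseteq> A" using permutes_orbit_subset assms by metis
 have "finite (orbit \<pi> x)" using sub assms finite_subset by blast
 moreover have "perm_restrict \<pi> (orbit \<pi> x) ` orbit \<pi> x \<subseteq> orbit \<pi> x"
  by (auto simp: perm_restrict_def intro: orbit.intros)
 moreover have "inj_on (perm_restrict \<pi> (orbit \<pi> x)) (orbit \<pi> x)"
  using permutes_inj[OF assms(1)] by (auto simp: inj_on_def perm_restrict_def)
 ultimately show "bij_betw (perm_restrict \<pi> (orbit \<pi> x)) (orbit \<pi> x) (orbit \<pi> x)"
  unfolding bij_betw_def by (intro conjI endo_inj_surj)
qed (simp add: perm_restrict_def)

lemma orbit_comp_in:
 assumes "c \<in> cyclic_perms C" "\<pi> permutes B" "B \<inter> C = {}" "x \<in> C"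
 shows "orbit (c \<circ> \<pi>) x = C"
proof -
 have c: "c permutes C" "cyclic_on c C" using assms by (auto simp: cyclic_perms_def)
 have "orbit c x = orbit (c \<circ> \<pi>) x"
 proof (rule orbit_cong0[OF assms(4)])
  show "c \<in> C \<rightarrow> C" using c by (auto simp: permutes_in_image)
  show "c y = (c \<circ> \<pi>) y" if "y \<in> C" for y
  proof -
   have "y \<notin> B" using that assms(3) by blast
   thus ?thesis using permutes_not_in[OF assms(2), of y] by simp
  qed
 qed
 thus ?thesis using orbit_cyclic_eq3[OF c(2) assms(4)] by simp
qed

lemma orbit_comp_out:
 assumes "c \<in> cyclic_perms C" "\<pi> permutes B" "B \<inter> C = {}" "x \<in> B"
 shows "orbit (c \<circ> \<pi>) x = orbit \<pi> x"
proof -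
 have c: "c permutes C" using assms by (auto simp: cyclic_perms_def)
 have "orbit \<pi> x = orbit (c \<circ> \<pi>) x"
 proof (rule orbit_cong0[OF assms(4)])
  show "\<pi> \<in> B \<rightarrow> B" using assms by (auto simp: permutes_in_image)
  show "\<pi> y = (c \<circ> \<pi>) y" if "y \<in> B" for y
  proof -
   have "\<pi> y \<in> B" using that assms by (auto simp: permutes_in_image)
   hence "\<pi> y \<notin> C" using assms by auto
   thus ?thesis using permutes_not_in[OF c] by auto
  qed
 qed
 thus ?thesis by simp
qed

text \<open>Restricting \<pi> to the orbit C of x and to its complement is a bijection onto pairs of
  a cyclic permutation of C and any permutation of A - C; composition is the inverse.\<close>

lemma sum_permutations_first_cycle:
 fixes \<Phi> :: "(nat \<Rightarrow> nat) \<Rightarrow> 'b :: comm_monoid_add"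
 assumes A: "finite A" "x \<in> A"
 shows "(\<Sum>\<pi> | \<pi> permutes A. \<Phi> \<pi>) =
  (\<Sum>C | C \<subseteq> A \<and> x \<in> C. \<Sum>c\<in>cyclic_perms C. \<Sum>\<pi> | \<pi> permutes A - C. \<Phi> (c \<circ> \<pi>))"
proof -
 have "(\<Sum>\<pi> | \<pi> permutes A. \<Phi> \<pi>) = (\<Sum>C | C \<subseteq> A \<and> x \<in> C. \<Sum>\<pi> | \<pi> \<in> {\<pi>. \<pi> permutes A} \<and> orbit \<pi> x = C. \<Phi> \<pi>)"
 proof (rule sum.group[symmetric])
  have "x \<in> orbit \<pi> x" if "\<pi> permutes A" for \<pi>
   using permutation_self_in_orbit permutation_permutes that A by metis
  thus "(\<lambda>\<pi>. orbit \<pi> x) ` {\<pi>. \<pi> permutes A} \<subseteq> {C. C \<subseteq> A \<and> x \<in> C}"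
   using permutes_orbit_subset A(2) by fastforce
 qed (use A finite_permutations in auto)
 also have "\<dots> = (\<Sum>C | C \<subseteq> A \<and> x \<in> C. \<Sum>c\<in>cyclic_perms C. \<Sum>\<pi> | \<pi> permutes A - C. \<Phi> (c \<circ> \<pi>))"
 proof (rule sum.cong[OF refl])
  fix C assume C: "C \<in> {C. C \<subseteq> A \<and> x \<in> C}"
  have "(\<Sum>\<pi> | \<pi> \<in> {\<pi>. \<pi> permutes A} \<and> orbit \<pi> x = C. \<Phi> \<pi>)
    = (\<Sum>(c, \<pi>)\<in>cyclic_perms C \<times> {\<pi>. \<pi> permutes A - C}. \<Phi> (c \<circ> \<pi>))"
  proof (rule sum.reindex_bij_witness[of _ "\<lambda>(c, \<pi>). c \<circ> \<pi>" "\<lambda>\<pi>. (perm_restrict \<pi> C, perm_restrict \<pi> (A - C))"])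
   fix \<pi> assume "\<pi> \<in> {\<pi> \<in> {\<pi>. \<pi> permutes A}. orbit \<pi> x = C}"
   hence p: "\<pi> permutes A" "orbit \<pi> x = C" by auto
   have cyc: "cyclic_on \<pi> C" using cyclic_on_orbit[OF p(1) A(1), of x] p(2) by simp
   have c: "perm_restrict \<pi> C permutes C" using perm_restrict_orbit_permutes[OF p(1) A] p(2) by simp
   have d: "perm_restrict \<pi> (A - C) permutes A - C" by (rule perm_restrict_diff_cyclic[OF p(1) cyc])
   show "(perm_restrict \<pi> C, perm_restrict \<pi> (A - C)) \<in> cyclic_perms C \<times> {\<pi>. \<pi> permutes A - C}"
    using c d cyc by (auto simp: cyclic_perms_def cyclic_on_perm_restrict)
   have "perm_restrict \<pi> C \<circ> perm_restrict \<pi> (A - C) = perm_restrict \<pi> (C \<union> (A - C))"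
    by (rule perm_restrict_union[OF c d]) auto
   also have "C \<union> (A - C) = A" using C by auto
   also have "perm_restrict \<pi> A = \<pi>" using p by simp
   finally have eq: "perm_restrict \<pi> C \<circ> perm_restrict \<pi> (A - C) = \<pi>" .
   show "(case (perm_restrict \<pi> C, perm_restrict \<pi> (A - C)) of (c, \<pi>) \<Rightarrow> c \<circ> \<pi>) = \<pi>"
    using eq by simp
   show "(case (perm_restrict \<pi> C, perm_restrict \<pi> (A - C)) of (c, \<pi>) \<Rightarrow> \<Phi> (c \<circ> \<pi>)) = \<Phi> \<pi>"
    using eq by simp
  next
   fix z assume "z \<in> cyclic_perms C \<times> {\<pi>. \<pi> permutes A - C}"
   then obtain c \<pi> where z: "z = (c, \<pi>)" "c \<in> cyclic_perms C" "\<pi> permutes A - C" by auto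
   have cp: "c permutes C" using z by (auto simp: cyclic_perms_def)
   have eq1: "(c \<circ> \<pi>) y = c y" if "y \<in> C" for y
    using that permutes_not_in[OF z(3), of y] by auto
   have eq2: "(c \<circ> \<pi>) y = \<pi> y" if "y \<in> A - C" for y
   proof -
    have "\<pi> y \<in> A - C" using that permutes_in_image[OF z(3), of y] by blast
    thus ?thesis using permutes_not_in[OF cp] by auto
   qed
   have r1: "perm_restrict (c \<circ> \<pi>) C = c"
    using eq1 permutes_not_in[OF cp] by (auto simp: perm_restrict_def fun_eq_iff)
   have r2: "perm_restrict (c \<circ> \<pi>) (A - C) = \<pi>"
    using eq2 permutes_not_in[OF z(3)] by (auto simp: perm_restrict_def fun_eq_iff)
   show "(perm_restrict (case z of (c, \<pi>) \<Rightarrow> c \<circ> \<pi>) C, perm_restrict (case z of (c, \<pi>) \<Rightarrow> c \<circ> \<pi>) (A - C)) = z"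
    using r1 r2 z by simp
   have "c \<circ> \<pi> permutes A"
    using permutes_compose[OF permutes_subset[OF z(3)] permutes_subset[OF cp], of A] C by auto
   moreover have "orbit (c \<circ> \<pi>) x = C" by (rule orbit_comp_in[OF z(2,3)]) (use C in auto)
   ultimately show "(case z of (c, \<pi>) \<Rightarrow> c \<circ> \<pi>) \<in> {\<pi> \<in> {\<pi>. \<pi> permutes A}. orbit \<pi> x = C}"
    using z by simp
  qed
  thus "(\<Sum>\<pi> | \<pi> \<in> {\<pi>. \<pi> permutes A} \<and> orbit \<pi> x = C. \<Phi> \<pi>) = (\<Sum>c\<in>cyclic_perms C. \<Sum>\<pi> | \<pi> permutes A - C. \<Phi> (c \<circ> \<pi>))"
   by (simp add: sum.cartesian_product)
 qed
 finally show ?thesis .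
qed

lemma orbits_comp:
 assumes "c \<in> cyclic_perms C" "\<pi> permutes A - C" "C \<subseteq> A"
 shows "orbit (c \<circ> \<pi>) ` A = insert C (orbit \<pi> ` (A - C))" "C \<notin> orbit \<pi> ` (A - C)"
proof -
 have ne: "C \<noteq> {}" using assms(1) by (auto simp: cyclic_perms_def cyclic_on_alldef)
 have *: "(A - C) \<inter> C = {}" by auto
 have "orbit (c \<circ> \<pi>) ` A = orbit (c \<circ> \<pi>) ` C \<union> orbit (c \<circ> \<pi>) ` (A - C)" using assms(3) by auto
 also have "orbit (c \<circ> \<pi>) ` C = {C}" using orbit_comp_in[OF assms(1,2) *] ne by auto
 also have "orbit (c \<circ> \<pi>) ` (A - C) = orbit \<pi> ` (A - C)" using orbit_comp_out[OF assms(1,2) *] by auto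
 finally show "orbit (c \<circ> \<pi>) ` A = insert C (orbit \<pi> ` (A - C))"
  unfolding insert_is_Un[of C "orbit \<pi> ` (A - C)"] .
 show "C \<notin> orbit \<pi> ` (A - C)" using permutes_orbit_subset[OF assms(2)] ne by blast
qed

text \<open>The cycle through Min A comes first in the order by minimal elements, and removing it
  does not disturb the order of the others.\<close>

lemma cyc_len_on_comp:
 assumes A: "finite A" and C: "C \<subseteq> A" "Min A \<in> C" and c: "c \<in> cyclic_perms C" and p: "\<pi> permutes A - C"
 shows "cyc_len_on (c \<circ> \<pi>) A = case_nat (card C) (cyc_len_on \<pi> (A - C))"
proof
 fix j
 have fin: "finite (A - C)" "finite C" using A C finite_subset by auto
 have *: "(A - C) \<inter> C = {}" by auto
 have "Min A \<in> A" using C by auto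
 have MinC: "Min C = Min A" by (rule Min_eqI) (use A C fin in \<open>auto intro: Min_le\<close>)
 define ms where "ms = sorted_list_of_set (Min ` orbit \<pi> ` (A - C))"
 have orb_fin: "orbit \<pi> x \<subseteq> A - C \<and> orbit \<pi> x \<noteq> {} \<and> finite (orbit \<pi> x)" if "x \<in> A - C" for x
  using permutes_orbit_subset[OF p that] orbit_nonempty fin finite_subset by metis
 have ms_sub: "Min ` orbit \<pi> ` (A - C) \<subseteq> A - C" using orb_fin Min_in by fastforce
 have set_ms: "set ms = Min ` orbit \<pi> ` (A - C)" using fin by (simp add: ms_def)
 have "Min ` orbit (c \<circ> \<pi>) ` A = insert (Min A) (Min ` orbit \<pi> ` (A - C))"
  unfolding orbits_comp(1)[OF c p C(1)] by (simp add: MinC)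
 moreover have "Min A \<notin> Min ` orbit \<pi> ` (A - C)" using ms_sub C by auto
 moreover have "Min (insert (Min A) (Min ` orbit \<pi> ` (A - C))) = Min A"
  by (rule Min_eqI) (use fin ms_sub A in \<open>auto simp: image_iff intro: Min_le\<close>)
 ultimately have list: "sorted_list_of_set (Min ` orbit (c \<circ> \<pi>) ` A) = Min A # ms"
  using fin by (subst sorted_list_of_set_nonempty) (auto simp: ms_def)
 show "cyc_len_on (c \<circ> \<pi>) A j = case_nat (card C) (cyc_len_on \<pi> (A - C)) j"
 proof (cases j)
  case 0
  thus ?thesis using orbit_comp_in[OF c p * C(2)] by (simp add: cyc_len_on_def list)
 next
  case (Suc i)
  have "orbit (c \<circ> \<pi>) (ms ! i) = orbit \<pi> (ms ! i)" if "i < length ms"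
  proof (rule orbit_comp_out[OF c p *])
   have "ms ! i \<in> set ms" using that by simp
   thus "ms ! i \<in> A - C" using set_ms ms_sub by blast
  qed
  thus ?thesis using Suc by (simp add: cyc_len_on_def list ms_def[symmetric])
 qed
qed

lemma sum_subsets_containing:
 fixes F :: "nat \<Rightarrow> real"
 assumes "finite A" "x \<in> A"
 shows "(\<Sum>C | C \<subseteq> A \<and> x \<in> C. F (card C)) = (\<Sum>l=1..card A. real ((card A - 1) choose (l - 1)) * F l)"
proof -
 have "(\<Sum>C | C \<subseteq> A \<and> x \<in> C. F (card C)) = (\<Sum>D\<in>Pow (A - {x}). F (Suc (card D)))"
 proof (rule sum.reindex_bij_witness[of _ "insert x" "\<lambda>C. C - {x}"])
  fix C assume C: "C \<in> {C. C \<subseteq> A \<and> x \<in> C}"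
  thus "F (Suc (card (C - {x}))) = F (card C)" using finite_subset[OF _ assms(1)] card.remove[of C x] by auto
 qed (use assms in auto)
 also have "\<dots> = (\<Sum>k\<le>card (A - {x}). \<Sum>D | D \<in> Pow (A - {x}) \<and> card D = k. F (Suc (card D)))"
 proof (rule sum.group[symmetric])
  have "finite (A - {x})" using assms by simp
  thus "card ` Pow (A - {x}) \<subseteq> {..card (A - {x})}"
   using card_mono[of "A - {x}"] by (intro image_subsetI) (simp only: atMost_iff Pow_iff)
 qed (use assms in auto)
 also have "\<dots> = (\<Sum>k\<le>card (A - {x}). real (card (A - {x}) choose k) * F (Suc k))"
 proof (rule sum.cong[OF refl])
  fix k
  have "(\<Sum>D | D \<in> Pow (A - {x}) \<and> card D = k. F (Suc (card D))) = (\<Sum>D | D \<subseteq> A - {x} \<and> card D = k. F (Suc k))"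
   by (rule sum.cong) auto
  thus "(\<Sum>D | D \<in> Pow (A - {x}) \<and> card D = k. F (Suc (card D))) = real (card (A - {x}) choose k) * F (Suc k)"
   using n_subsets[of "A - {x}" k] assms by simp
 qed
 also have "\<dots> = (\<Sum>l=1..card A. real ((card A - 1) choose (l - 1)) * F l)"
 proof -
  have pos: "card A > 0" using assms card_gt_0_iff by blast
  have card: "card (A - {x}) = card A - 1" using assms by simp
  show ?thesis unfolding card
   by (rule sum.reindex_bij_witness[of _ "\<lambda>l. l - 1" Suc]) (use pos in auto)
 qed
 finally show ?thesis .
qed

text \<open>The n! permutations are counted by the size l of the cycle through x. Each l < n
  contributes binomial(n-1, l-1) (l-1)! (n-l)! = (n-1)!, so n! - (n-1) (n-1)! = (n-1)! of them are
  left for the full cycle.\<close>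

lemma card_cyclic_perms: "finite C \<Longrightarrow> C \<noteq> {} \<Longrightarrow> card (cyclic_perms C) = fact (card C - 1)"
proof (induction "card C" arbitrary: C rule: less_induct)
 case less
 then obtain x where x: "x \<in> C" by auto
 define n where "n = card C"
 have n: "n > 0" using less by (simp add: n_def card_gt_0_iff)
 \<comment> \<open>The unknown count is the entry l = n; the others come from the induction
   hypothesis.\<close>
 define F where "F l = (if l = n then real (card (cyclic_perms C)) else fact (l - 1) * fact (n - l))" for l
 have "fact n = (\<Sum>\<pi> | \<pi> permutes C. 1 :: real)"
  using card_permutations[OF refl less.prems(1)] by (simp add: n_def)
 also have "\<dots> = (\<Sum>D | D \<subseteq> C \<and> x \<in> D. \<Sum>c\<in>cyclic_perms D. \<Sum>\<pi> | \<pi> permutes C - D. 1)"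
  by (rule sum_permutations_first_cycle[OF less.prems(1) x])
 also have "\<dots> = (\<Sum>D | D \<subseteq> C \<and> x \<in> D. F (card D))"
 proof (rule sum.cong[OF refl])
  fix D assume D: "D \<in> {D. D \<subseteq> C \<and> x \<in> D}"
  have finD: "finite D" using D less.prems finite_subset by auto
  have "card (C - D) = n - card D" using D finD by (simp add: card_Diff_subset n_def)
  hence eq: "(\<Sum>c\<in>cyclic_perms D. \<Sum>\<pi> | \<pi> permutes C - D. 1 :: real) = real (card (cyclic_perms D)) * fact (n - card D)"
   using card_permutations[OF refl, of "C - D"] less.prems by simp
  show "(\<Sum>c\<in>cyclic_perms D. \<Sum>\<pi> | \<pi> permutes C - D. 1 :: real) = F (card D)"
  proof (cases "D = C")
   case True
   thus ?thesis unfolding eq by (simp add: F_def n_def)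
  next
   case False
   have ne: "D \<noteq> {}" using D by blast
   from False have "card D < card C" using D less.prems by (intro psubset_card_mono) auto
   thus ?thesis unfolding eq using less.hyps[of D] ne finD by (simp add: F_def n_def)
  qed
 qed
 also have "\<dots> = (\<Sum>l=1..n. real ((n - 1) choose (l - 1)) * F l)"
  unfolding n_def by (rule sum_subsets_containing[OF less.prems(1) x])
 also have "{1..n} = insert n {1..n - 1}" using n by auto
 also have "(\<Sum>l\<in>insert n {1..n - 1}. real ((n - 1) choose (l - 1)) * F l) = real (card (cyclic_perms C)) + (\<Sum>l=1..n-1. real ((n - 1) choose (l - 1)) * F l)"
  using n by (subst sum.insert) (auto simp: F_def)
 also have "(\<Sum>l=1..n-1. real ((n - 1) choose (l - 1)) * F l) = (\<Sum>l=1..n-1. fact (n - 1))"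
 proof (rule sum.cong[OF refl])
  fix l assume l: "l \<in> {1..n - 1}"
  hence "real ((n - 1) choose (l - 1)) = fact (n - 1) / (fact (l - 1) * fact (n - 1 - (l - 1)))"
   by (intro binomial_fact) auto
  moreover have "n - 1 - (l - 1) = n - l" using l by auto
  ultimately show "real ((n - 1) choose (l - 1)) * F l = fact (n - 1)" using l by (auto simp: F_def)
 qed
 finally have "real (card (cyclic_perms C)) = fact n - real (n - 1) * fact (n - 1)" by simp
 also have "fact n = real n * fact (n - 1)" using n by (simp add: fact_reduce)
 also have "real n * fact (n - 1) - real (n - 1) * fact (n - 1) = fact (n - 1)"
  using n by (simp add: algebra_simps of_nat_diff)
 finally show ?case by (metis n_def of_nat_eq_iff of_nat_fact)
qed

definition perm_sum :: "(nat \<Rightarrow> real) \<Rightarrow> nat set \<Rightarrow> ((nat \<Rightarrow> nat) \<Rightarrow> real) \<Rightarrow> real" where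
 "perm_sum a A G = (\<Sum>\<pi> | \<pi> permutes A. (\<Prod>C\<in>orbit \<pi> ` A. a (card C)) * G (cyc_len_on \<pi> A))"

lemma perm_sum_rec:
 assumes A: "finite A" "A \<noteq> {}"
 shows "perm_sum a A G = (\<Sum>C | C \<subseteq> A \<and> Min A \<in> C.
   fact (card C - 1) * a (card C) * perm_sum a (A - C) (\<lambda>s. G (case_nat (card C) s)))"
proof -
 have "perm_sum a A G = (\<Sum>C | C \<subseteq> A \<and> Min A \<in> C. \<Sum>c\<in>cyclic_perms C. \<Sum>\<pi> | \<pi> permutes A - C.
   (\<Prod>D\<in>orbit (c \<circ> \<pi>) ` A. a (card D)) * G (cyc_len_on (c \<circ> \<pi>) A))"
  unfolding perm_sum_def by (rule sum_permutations_first_cycle) (use A in auto)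
 also have "\<dots> = (\<Sum>C | C \<subseteq> A \<and> Min A \<in> C. \<Sum>c\<in>cyclic_perms C. a (card C) * perm_sum a (A - C) (\<lambda>s. G (case_nat (card C) s)))"
 proof (intro sum.cong refl)
  fix C c assume C: "C \<in> {C. C \<subseteq> A \<and> Min A \<in> C}" and c: "c \<in> cyclic_perms C"
  have "finite (A - C)" using A by auto
  thus "(\<Sum>\<pi> | \<pi> permutes A - C. (\<Prod>D\<in>orbit (c \<circ> \<pi>) ` A. a (card D)) * G (cyc_len_on (c \<circ> \<pi>) A))
    = a (card C) * perm_sum a (A - C) (\<lambda>s. G (case_nat (card C) s))"
   unfolding perm_sum_def sum_distrib_left
   using C by (intro sum.cong refl) (simp add: orbits_comp[OF c] cyc_len_on_comp[OF A(1) _ _ c])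
 qed
 also have "\<dots> = (\<Sum>C | C \<subseteq> A \<and> Min A \<in> C. fact (card C - 1) * a (card C) * perm_sum a (A - C) (\<lambda>s. G (case_nat (card C) s)))"
 proof (intro sum.cong refl)
  fix C assume C: "C \<in> {C. C \<subseteq> A \<and> Min A \<in> C}"
  hence "card (cyclic_perms C) = fact (card C - 1)" using A finite_subset by (intro card_cyclic_perms) auto
  thus "(\<Sum>c\<in>cyclic_perms C. a (card C) * perm_sum a (A - C) (\<lambda>s. G (case_nat (card C) s)))
    = fact (card C - 1) * a (card C) * perm_sum a (A - C) (\<lambda>s. G (case_nat (card C) s))"
   by simp
 qed
 finally show ?thesis .
qed

lemma perm_sum_empty: "perm_sum a {} G = G (\<lambda>_. 0)"
proof -
 have "cyc_len_on id {} = (\<lambda>_. 0)" by (rule ext) (simp add: cyc_len_on_def)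
 thus ?thesis by (simp add: perm_sum_def)
qed

text \<open>The number of subsets of size l through the minimum, times (l-1)! (n-l)!, is (n-1)! for
  every l. With values normalised by the factorial of the cardinality, the sum over subsets
  collapses to the sum over lengths that defines \<open>hh\<close>.\<close>

lemma perm_sum_rec_card:
 assumes A: "finite A" "A \<noteq> {}"
  and val: "\<And>B l. finite B \<Longrightarrow> card B < card A \<Longrightarrow> l = card A - card B \<Longrightarrow> perm_sum a B (\<lambda>s. G (case_nat l s)) = fact (card B) * P l (card B)"
 shows "perm_sum a A G = fact (card A - 1) * (\<Sum>l=1..card A. a l * P l (card A - l))"
proof -
 have "perm_sum a A G = (\<Sum>C | C \<subseteq> A \<and> Min A \<in> C. fact (card C - 1) * a (card C) * (fact (card A - card C) * P (card C) (card A - card C)))"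
  unfolding perm_sum_rec[OF A]
 proof (intro sum.cong refl)
  fix C assume C: "C \<in> {C. C \<subseteq> A \<and> Min A \<in> C}"
  have finC: "finite C" using C A finite_subset by auto
  have "card (A - C) = card A - card C" using C finC by (simp add: card_Diff_subset)
  have pos: "card C > 0" using C finC by (auto simp: card_gt_0_iff)
  have le: "card C \<le> card A" using C A by (auto intro: card_mono)
  have "perm_sum a (A - C) (\<lambda>s. G (case_nat (card C) s)) = fact (card (A - C)) * P (card C) (card (A - C))"
  proof (rule val)
   show "finite (A - C)" using A by simp
  qed (use \<open>card (A - C) = card A - card C\<close> pos le in linarith)+
  thus "fact (card C - 1) * a (card C) * perm_sum a (A - C) (\<lambda>s. G (case_nat (card C) s))
   = fact (card C - 1) * a (card C) * (fact (card A - card C) * P (card C) (card A - card C))"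
   by (simp only: \<open>card (A - C) = card A - card C\<close>)
 qed
 also have "\<dots> = (\<Sum>l=1..card A. real ((card A - 1) choose (l - 1)) * (fact (l - 1) * a l * (fact (card A - l) * P l (card A - l))))"
  by (rule sum_subsets_containing) (use A in auto)
 also have "\<dots> = (\<Sum>l=1..card A. fact (card A - 1) * (a l * P l (card A - l)))"
 proof (rule sum.cong[OF refl])
  fix l assume l: "l \<in> {1..card A}"
  hence "real ((card A - 1) choose (l - 1)) = fact (card A - 1) / (fact (l - 1) * fact (card A - 1 - (l - 1)))"
   by (intro binomial_fact) auto
  moreover have "card A - 1 - (l - 1) = card A - l" using l by auto
  ultimately show "real ((card A - 1) choose (l - 1)) * (fact (l - 1) * a l * (fact (card A - l) * P l (card A - l))) = fact (card A - 1) * (a l * P l (card A - l))"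
   by simp
 qed
 finally show ?thesis by (simp add: sum_distrib_left)
qed

text \<open>Identifies \<open>hh a n\<close> as the partition function divided by n!.\<close>

lemma perm_sum_const: "finite A \<Longrightarrow> perm_sum a A (\<lambda>_. c) = fact (card A) * (hh a (card A) * c)"
proof (induction "card A" arbitrary: A rule: less_induct)
 case less
 show ?case
 proof (cases "A = {}")
  case True
  thus ?thesis by (simp add: perm_sum_empty)
 next
  case False
  hence n: "card A > 0" using less by (simp add: card_gt_0_iff)
  have "perm_sum a A (\<lambda>_. c) = fact (card A - 1) * (\<Sum>l=1..card A. a l * (hh a (card A - l) * c))"
   using less.hyps by (intro perm_sum_rec_card[OF less.prems False]) auto
  also have "(\<Sum>l=1..card A. a l * (hh a (card A - l) * c)) = real (card A) * hh a (card A) * c"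
   using n by (simp add: hh_rec sum_distrib_right mult.assoc)
  finally show ?thesis using n by (simp add: fact_reduce[of "card A"])
 qed
qed

text \<open>Expectation of a function of the first \<open>k\<close> cycle lengths, written as a Markov chain: with
 \<open>n\<close> points left, the next cycle has length \<open>l\<close> with probability \<open>a l * hh a (n - l) / (n * hh a n)\<close>.\<close>
primrec cyc_exp :: "(nat \<Rightarrow> real) \<Rightarrow> nat \<Rightarrow> ((nat \<Rightarrow> nat) \<Rightarrow> real) \<Rightarrow> nat \<Rightarrow> real" where
 "cyc_exp a 0 G n = G (\<lambda>_. 0)"
| "cyc_exp a (Suc k) G n = (if n = 0 then G (\<lambda>_. 0) else
   (\<Sum>l=1..n. a l * hh a (n - l) * cyc_exp a k (\<lambda>s. G (case_nat l s)) (n - l)) / (real n * hh a n))"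

lemma perm_sum_eq_cyc_exp:
 assumes a: "\<And>l. a l \<ge> 0" and "finite A"
  and "\<And>s t. (\<And>i. i < k \<Longrightarrow> s i = t i) \<Longrightarrow> G s = G t"
 shows "perm_sum a A G = fact (card A) * (hh a (card A) * cyc_exp a k G (card A))"
 using assms(2,3)
proof (induction k arbitrary: A G)
 case 0
 have "G = (\<lambda>_. G (\<lambda>_. 0))" using 0 by blast
 hence "perm_sum a A G = perm_sum a A (\<lambda>_. G (\<lambda>_. 0))" by simp
 thus ?case using perm_sum_const[OF 0(1)] by simp
next
 case (Suc k)
 show ?case
 proof (cases "A = {}")
  case True
  thus ?thesis by (simp add: perm_sum_empty)
 next
  case False
  hence n: "card A > 0" using Suc.prems by (simp add: card_gt_0_iff)
  let ?n = "card A"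
  let ?E = "\<lambda>l. cyc_exp a k (\<lambda>s. G (case_nat l s))"
  have "perm_sum a A G = fact (?n - 1) * (\<Sum>l=1..?n. a l * (hh a (?n - l) * ?E l (?n - l)))"
  proof (rule perm_sum_rec_card[OF Suc.prems(1) False, where P = "\<lambda>l m. hh a m * ?E l m"])
   fix B l assume B: "finite (B :: nat set)"
   show "perm_sum a B (\<lambda>s. G (case_nat l s)) = fact (card B) * (hh a (card B) * ?E l (card B))"
   proof (rule Suc.IH[OF B])
    fix s t :: "nat \<Rightarrow> nat" assume "\<And>i. i < k \<Longrightarrow> s i = t i"
    thus "G (case_nat l s) = G (case_nat l t)" by (intro Suc.prems(2)) (auto split: nat.split)
   qed
  qed
  also have "(\<Sum>l=1..?n. a l * (hh a (?n - l) * ?E l (?n - l))) = real ?n * (hh a ?n * cyc_exp a (Suc k) G ?n)"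
  proof (cases "hh a ?n = 0")
   case True
   \<comment> \<open>With hh = 0 the right side is 0 whatever the quotient in \<open>cyc_exp\<close>
     evaluates to; on the left the nonnegative summands add up to n hh = 0, so each of them
     vanishes.\<close>
   have "(\<Sum>l=1..?n. a l * hh a (?n - l)) = 0" using hh_rec[of ?n a] n True by simp
   hence "\<forall>l\<in>{1..?n}. a l * hh a (?n - l) = 0"
    using a hh_nonneg[OF a] by (subst (asm) sum_nonneg_eq_0_iff) auto
   hence "(\<Sum>l=1..?n. a l * (hh a (?n - l) * ?E l (?n - l))) = 0" by (intro sum.neutral) auto
   thus ?thesis using True by simp
  next
   case False
   thus ?thesis using n by (simp add: mult.assoc)
  qed
  finally show ?thesis using n by (simp add: fact_reduce[of ?n])
 qed
qed

section \<open>Integrating out the points\<close>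

locale kernel_on = sigma_finite_measure M for M :: "'x measure" +
 fixes K :: "'x \<Rightarrow> 'x \<Rightarrow> ennreal"
 assumes K_measurable [measurable]: "(\<lambda>(x, y). K x y) \<in> borel_measurable (M \<Otimes>\<^sub>M M)"
begin

sublocale product_sigma_finite "\<lambda>_. M"
 by standard

text \<open>The index is shifted: \<open>kernel_pow m\<close> is the (m+1)-fold iterate, so
  \<open>kernel_trace m\<close> belongs to cycles of length m + 1. Values in ennreal spare
  integrability conditions in the Fubini steps.\<close>

primrec kernel_pow :: "nat \<Rightarrow> 'x \<Rightarrow> 'x \<Rightarrow> ennreal" where
 "kernel_pow 0 y z = K y z"
| "kernel_pow (Suc m) y z = (\<integral>\<^sup>+x. K y x * kernel_pow m x z \<partial>M)"

definition kernel_trace :: "nat \<Rightarrow> ennreal" where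
 "kernel_trace m = (\<integral>\<^sup>+y. kernel_pow m y y \<partial>M)"

text \<open>The product of K along the path from y through the points labelled by the list to z. A
  cycle opened up into such a path can be integrated one point at a time.\<close>

fun chain :: "'x \<Rightarrow> nat list \<Rightarrow> 'x \<Rightarrow> (nat \<Rightarrow> 'x) \<Rightarrow> ennreal" where
 "chain y [] z f = K y z"
| "chain y (b # bs) z f = K y (f b) * chain (f b) bs z f"

lemma chain_measurable:
 assumes "u \<in> measurable (Pi\<^sub>M I (\<lambda>_. M)) M" "v \<in> measurable (Pi\<^sub>M I (\<lambda>_. M)) M" "set bs \<subseteq> I"
 shows "(\<lambda>f. chain (u f) bs (v f) f) \<in> borel_measurable (Pi\<^sub>M I (\<lambda>_. M))"
 using assms
proof (induction bs arbitrary: u)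
 case Nil
 have "(\<lambda>f. case (u f, v f) of (x, y) \<Rightarrow> K x y) \<in> borel_measurable (Pi\<^sub>M I (\<lambda>_. M))"
  by (rule measurable_compose[OF measurable_Pair K_measurable]) (use Nil in auto)
 thus ?case by simp
next
 case (Cons b bs)
 have b: "(\<lambda>f. f b) \<in> measurable (Pi\<^sub>M I (\<lambda>_. M)) M"
  using Cons by (intro measurable_component_singleton) auto
 have "(\<lambda>f. case (u f, f b) of (x, y) \<Rightarrow> K x y) \<in> borel_measurable (Pi\<^sub>M I (\<lambda>_. M))"
  by (rule measurable_compose[OF measurable_Pair K_measurable]) (use Cons b in auto)
 moreover have "(\<lambda>f. chain (f b) bs (v f) f) \<in> borel_measurable (Pi\<^sub>M I (\<lambda>_. M))"
  using Cons b by (intro Cons.IH) auto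
 ultimately show ?case by (auto intro!: borel_measurable_times_ennreal)
qed

lemma chain_upd: "b \<notin> set bs \<Longrightarrow> chain y bs z (f(b := u)) = chain y bs z f"
 by (induction bs arbitrary: y) auto

lemma nn_integral_chain:
 assumes "distinct bs" "y \<in> space M" "z \<in> space M"
 shows "(\<integral>\<^sup>+f. chain y bs z f \<partial>Pi\<^sub>M (set bs) (\<lambda>_. M)) = kernel_pow (length bs) y z"
 using assms
proof (induction bs arbitrary: y)
 case Nil
 thus ?case by (simp add: PiM_empty nn_integral_count_space_finite)
next
 case (Cons b bs)
 have meas: "(\<lambda>f. chain y' (b # bs) z f) \<in> borel_measurable (Pi\<^sub>M (insert b (set bs)) (\<lambda>_. M))" if "y' \<in> space M" for y'
  by (rule chain_measurable) (use Cons that in auto)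
 have "(\<integral>\<^sup>+f. chain y (b # bs) z f \<partial>Pi\<^sub>M (set (b # bs)) (\<lambda>_. M))
   = (\<integral>\<^sup>+u. \<integral>\<^sup>+f. chain y (b # bs) z (f(b := u)) \<partial>Pi\<^sub>M (set bs) (\<lambda>_. M) \<partial>M)"
  using Cons meas[of y] by (simp only: list.set(2)) (intro product_nn_integral_insert_rev, auto)
 also have "\<dots> = (\<integral>\<^sup>+u. K y u * kernel_pow (length bs) u z \<partial>M)"
 proof (rule nn_integral_cong)
  fix u assume u: "u \<in> space M"
  have m: "(\<lambda>f. chain u bs z f) \<in> borel_measurable (Pi\<^sub>M (set bs) (\<lambda>_. M))"
   by (rule chain_measurable) (use Cons u in auto)
  have "(\<integral>\<^sup>+f. chain y (b # bs) z (f(b := u)) \<partial>Pi\<^sub>M (set bs) (\<lambda>_. M)) = (\<integral>\<^sup>+f. K y u * chain u bs z f \<partial>Pi\<^sub>M (set bs) (\<lambda>_. M))"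
   using Cons by (simp add: chain_upd)
  also have "\<dots> = K y u * kernel_pow (length bs) u z" using Cons u m by (simp add: nn_integral_cmult)
  finally show "(\<integral>\<^sup>+f. chain y (b # bs) z (f(b := u)) \<partial>Pi\<^sub>M (set bs) (\<lambda>_. M)) = K y u * kernel_pow (length bs) u z" .
 qed
 finally show ?case by simp
qed

lemma chain_orbit:
 "i < n \<Longrightarrow> chain (f ((c ^^ i) a)) (map (\<lambda>j. (c ^^ j) a) [Suc i..<n]) (f ((c ^^ n) a)) f
   = (\<Prod>j\<in>{i..<n}. K (f ((c ^^ j) a)) (f (c ((c ^^ j) a))))"
proof (induction "n - i" arbitrary: i)
 case (Suc m)
 show ?case
 proof (cases "Suc i < n")
  case True
  hence "[Suc i..<n] = Suc i # [Suc (Suc i)..<n]" by (simp add: upt_conv_Cons)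
  moreover have "{i..<n} = insert i {Suc i..<n}" using Suc by auto
  ultimately show ?thesis using Suc.hyps(1)[of "Suc i"] Suc True by simp
 next
  case False
  hence "n = Suc i" using Suc by simp
  thus ?thesis by simp
 qed
qed simp

definition perm_weight :: "(nat \<Rightarrow> nat) \<Rightarrow> nat set \<Rightarrow> ennreal" where
 "perm_weight \<pi> A = (\<integral>\<^sup>+f. (\<Prod>i\<in>A. K (f i) (f (\<pi> i))) \<partial>Pi\<^sub>M A (\<lambda>_. M))"

lemma K_component_measurable:
 assumes "i \<in> A" "j \<in> A"
 shows "(\<lambda>f. K (f i) (f j)) \<in> borel_measurable (Pi\<^sub>M A (\<lambda>_. M))"
proof -
 have "(\<lambda>f. case (f i, f j) of (x, y) \<Rightarrow> K x y) \<in> borel_measurable (Pi\<^sub>M A (\<lambda>_. M))"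
  by (rule measurable_compose[OF measurable_Pair K_measurable]) (use assms in \<open>auto intro!: measurable_component_singleton\<close>)
 thus ?thesis by simp
qed

text \<open>Starting from a point a of the cycle and listing the others in the order of c turns the
  product of kernels into a closed chain. Integrating out the others gives a kernel power on the
  diagonal, and the last integral is its trace.\<close>

lemma perm_weight_cyclic:
 assumes c: "c \<in> cyclic_perms C" "finite C"
 shows "perm_weight c C = kernel_trace (card C - 1)"
proof -
 have cyc: "c permutes C" "cyclic_on c C" using c by (auto simp: cyclic_perms_def)
 then obtain a where a: "a \<in> C" "orbit c a = C" by (auto simp: cyclic_on_def)
 have self: "a \<in> orbit c a" using a by simp
 define n where "n = funpow_dist1 c a a"
 have img: "C = (\<lambda>j. (c ^^ j) a) ` {0..<n}" using orbit_conv_funpow_dist1[OF self] a by (simp add: n_def)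
 have inj: "inj_on (\<lambda>j. (c ^^ j) a) {0..<n}" using inj_on_funpow_dist1[OF self] by (simp add: n_def)
 have per: "(c ^^ n) a = a" unfolding n_def by (rule funpow_dist1_prop[OF self])
 have n0: "n > 0" by (simp add: n_def)
 have card: "card C = n" by (subst img) (simp add: card_image[OF inj])
 define bs where "bs = map (\<lambda>j. (c ^^ j) a) [1..<n]"
 have dist: "distinct bs" unfolding bs_def
  by (auto simp: distinct_map intro: inj_on_subset[OF inj])
 have "{0..<n} = insert 0 {1..<n}" using n0 by auto
 hence Cset: "C = insert a (set bs)" by (subst img) (auto simp: bs_def)
 have a_notin: "a \<notin> set bs"
 proof
  assume "a \<in> set bs"
  then obtain j where j: "j \<in> {1..<n}" "(c ^^ j) a = (c ^^ 0) a" by (auto simp: bs_def)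
  hence "j = 0" using inj_onD[OF inj j(2)] by auto
  thus False using j by simp
 qed
 have prod: "(\<Prod>i\<in>C. K (f i) (f (c i))) = chain (f a) bs (f a) f" for f
 proof -
  have "(\<Prod>i\<in>C. K (f i) (f (c i))) = (\<Prod>j\<in>{0..<n}. K (f ((c ^^ j) a)) (f (c ((c ^^ j) a))))"
   by (subst img) (simp add: prod.reindex[OF inj])
  also have "\<dots> = chain (f ((c ^^ 0) a)) bs (f ((c ^^ n) a)) f"
   unfolding bs_def One_nat_def using n0 by (intro chain_orbit[symmetric])
  finally show ?thesis by (simp add: per)
 qed
 have "perm_weight c C = (\<integral>\<^sup>+f. chain (f a) bs (f a) f \<partial>Pi\<^sub>M (insert a (set bs)) (\<lambda>_. M))"
  unfolding perm_weight_def prod Cset[symmetric] ..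
 also have "\<dots> = (\<integral>\<^sup>+u. \<integral>\<^sup>+f. chain ((f(a := u)) a) bs ((f(a := u)) a) (f(a := u)) \<partial>Pi\<^sub>M (set bs) (\<lambda>_. M) \<partial>M)"
  using a_notin by (intro product_nn_integral_insert_rev) (auto intro!: chain_measurable)
 also have "\<dots> = (\<integral>\<^sup>+u. kernel_pow (length bs) u u \<partial>M)"
  using a_notin dist by (intro nn_integral_cong) (simp add: chain_upd nn_integral_chain)
 finally show ?thesis by (simp add: kernel_trace_def card bs_def)
qed

text \<open>c maps C into itself and \<pi> maps A - C into itself, so the two products involve
  disjoint sets of coordinates and Fubini separates them.\<close>

lemma perm_weight_comp:
 assumes A: "finite A" and C: "C \<subseteq> A" and c: "c permutes C" and p: "\<pi> permutes A - C"
 shows "perm_weight (c \<circ> \<pi>) A = perm_weight c C * perm_weight \<pi> (A - C)"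
proof -
 have eq1: "(c \<circ> \<pi>) y = c y" if "y \<in> C" for y
  using that permutes_not_in[OF p, of y] by auto
 have eq2: "(c \<circ> \<pi>) y = \<pi> y" if "y \<in> A - C" for y
 proof -
  have "\<pi> y \<in> A - C" using that permutes_in_image[OF p, of y] by blast
  thus ?thesis using permutes_not_in[OF c] by auto
 qed
 have cin: "c y \<in> C" if "y \<in> C" for y using that c by (simp add: permutes_in_image)
 have pin: "\<pi> y \<in> A - C" if "y \<in> A - C" for y using that permutes_in_image[OF p, of y] by blast
 have AC: "A = C \<union> (A - C)" "C \<inter> (A - C) = {}" using C by auto
 have fin: "finite C" "finite (A - C)" using A C finite_subset by auto
 have split: "(\<Prod>i\<in>A. K (f i) (f ((c \<circ> \<pi>) i))) = (\<Prod>i\<in>C. K (f i) (f (c i))) * (\<Prod>i\<in>A - C. K (f i) (f (\<pi> i)))" for f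
 proof -
  have "(\<Prod>i\<in>A. K (f i) (f ((c \<circ> \<pi>) i))) = (\<Prod>i\<in>C. K (f i) (f ((c \<circ> \<pi>) i))) * (\<Prod>i\<in>A - C. K (f i) (f ((c \<circ> \<pi>) i)))"
   by (subst AC(1), rule prod.union_disjoint) (use fin in auto)
  also have "(\<Prod>i\<in>C. K (f i) (f ((c \<circ> \<pi>) i))) = (\<Prod>i\<in>C. K (f i) (f (c i)))"
   by (rule prod.cong[OF refl]) (simp only: eq1)
  also have "(\<Prod>i\<in>A - C. K (f i) (f ((c \<circ> \<pi>) i))) = (\<Prod>i\<in>A - C. K (f i) (f (\<pi> i)))"
   by (rule prod.cong[OF refl]) (simp only: eq2)
  finally show ?thesis .
 qed
 have measC: "(\<lambda>f. \<Prod>i\<in>C. K (f i) (f (c i))) \<in> borel_measurable (Pi\<^sub>M I (\<lambda>_. M))" if "C \<subseteq> I" for I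
  using that cin by (intro borel_measurable_prod_ennreal K_component_measurable) auto
 have measD: "(\<lambda>f. \<Prod>i\<in>A - C. K (f i) (f (\<pi> i))) \<in> borel_measurable (Pi\<^sub>M I (\<lambda>_. M))" if "A - C \<subseteq> I" for I
  using that pin by (intro borel_measurable_prod_ennreal K_component_measurable) auto
 have "perm_weight (c \<circ> \<pi>) A = (\<integral>\<^sup>+f. (\<Prod>i\<in>C. K (f i) (f (c i))) * (\<Prod>i\<in>A - C. K (f i) (f (\<pi> i))) \<partial>Pi\<^sub>M (C \<union> (A - C)) (\<lambda>_. M))"
  unfolding perm_weight_def split AC(1)[symmetric] ..
 also have "\<dots> = (\<integral>\<^sup>+f. \<integral>\<^sup>+f'. (\<Prod>i\<in>C. K (merge C (A - C) (f, f') i) (merge C (A - C) (f, f') (c i)))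
    * (\<Prod>i\<in>A - C. K (merge C (A - C) (f, f') i) (merge C (A - C) (f, f') (\<pi> i))) \<partial>Pi\<^sub>M (A - C) (\<lambda>_. M) \<partial>Pi\<^sub>M C (\<lambda>_. M))"
  using AC(2) fin by (intro product_nn_integral_fold borel_measurable_times_ennreal measC measD) auto
 also have "\<dots> = (\<integral>\<^sup>+f. \<integral>\<^sup>+f'. (\<Prod>i\<in>C. K (f i) (f (c i))) * (\<Prod>i\<in>A - C. K (f' i) (f' (\<pi> i))) \<partial>Pi\<^sub>M (A - C) (\<lambda>_. M) \<partial>Pi\<^sub>M C (\<lambda>_. M))"
 proof (intro nn_integral_cong arg_cong2[where f = "(*)"] prod.cong refl)
  fix f f' :: "nat \<Rightarrow> 'x" and i assume i: "i \<in> C"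
  show "K (merge C (A - C) (f, f') i) (merge C (A - C) (f, f') (c i)) = K (f i) (f (c i))"
   using i cin[OF i] by (simp add: merge_def)
 next
  fix f f' :: "nat \<Rightarrow> 'x" and i assume i: "i \<in> A - C"
  show "K (merge C (A - C) (f, f') i) (merge C (A - C) (f, f') (\<pi> i)) = K (f' i) (f' (\<pi> i))"
   using i pin[OF i] by (simp add: merge_def)
 qed
 also have "\<dots> = perm_weight c C * perm_weight \<pi> (A - C)"
  unfolding perm_weight_def by (simp add: nn_integral_cmult nn_integral_multc measC measD)
 finally show ?thesis .
qed

lemma perm_weight_eq:
 assumes w: "\<And>m. kernel_trace m = ennreal (w (Suc m))" "\<And>m. w m \<ge> 0"
  and "finite A" "\<pi> permutes A"
 shows "perm_weight \<pi> A = ennreal (\<Prod>C\<in>orbit \<pi> ` A. w (card C))"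
 using assms(3,4)
proof (induction "card A" arbitrary: A \<pi> rule: less_induct)
 case less
 show ?case
 proof (cases "A = {}")
  case True
  thus ?thesis by (simp add: perm_weight_def PiM_empty nn_integral_count_space_finite)
 next
  case False
  then obtain x where x: "x \<in> A" by auto
  define C where "C = orbit \<pi> x"
  have CA: "C \<subseteq> A" unfolding C_def using permutes_orbit_subset less x by metis
  have finC: "finite C" using CA less finite_subset by auto
  have cyc: "cyclic_on \<pi> C" unfolding C_def by (rule cyclic_on_orbit) (use less in auto)
  have Cne: "C \<noteq> {}" unfolding C_def by (rule orbit_nonempty)
  have c: "perm_restrict \<pi> C permutes C" unfolding C_def by (rule perm_restrict_orbit_permutes) (use less x in auto)
  have d: "perm_restrict \<pi> (A - C) permutes A - C" by (rule perm_restrict_diff_cyclic[OF less.prems(2) cyc])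
  have "perm_restrict \<pi> C \<circ> perm_restrict \<pi> (A - C) = perm_restrict \<pi> (C \<union> (A - C))"
   by (rule perm_restrict_union[OF c d]) auto
  also have "C \<union> (A - C) = A" using CA by auto
  also have "perm_restrict \<pi> A = \<pi>" using less by simp
  finally have eq: "perm_restrict \<pi> C \<circ> perm_restrict \<pi> (A - C) = \<pi>" .
  have cc: "perm_restrict \<pi> C \<in> cyclic_perms C" using c cyc by (simp add: cyclic_perms_def cyclic_on_perm_restrict)
  have "card (A - C) < card A" using CA Cne less by (intro psubset_card_mono) auto
  hence IH: "perm_weight (perm_restrict \<pi> (A - C)) (A - C) = ennreal (\<Prod>C\<in>orbit (perm_restrict \<pi> (A - C)) ` (A - C). w (card C))"
   using less d by (intro less.hyps) auto
  have "perm_weight \<pi> A = perm_weight (perm_restrict \<pi> C) C * perm_weight (perm_restrict \<pi> (A - C)) (A - C)"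
   using perm_weight_comp[OF less.prems(1) CA c d] eq by simp
  also have "perm_weight (perm_restrict \<pi> C) C = ennreal (w (card C))"
   using perm_weight_cyclic[OF cc finC] w Cne finC by (simp add: card_gt_0_iff)
  also have "ennreal (w (card C)) * perm_weight (perm_restrict \<pi> (A - C)) (A - C) = ennreal (\<Prod>C\<in>orbit \<pi> ` A. w (card C))"
  proof -
   have "orbit \<pi> ` A = insert C (orbit (perm_restrict \<pi> (A - C)) ` (A - C))" "C \<notin> orbit (perm_restrict \<pi> (A - C)) ` (A - C)"
    using orbits_comp[OF cc d CA] eq by auto
   thus ?thesis unfolding IH using less w by (simp add: ennreal_mult prod_nonneg)
  qed
  finally show ?thesis .
 qed
qed

end

lemma cyc_len_eq: "cyc_len \<pi> N = cyc_len_on \<pi> {..<N}" by (simp add: fun_eq_iff cyc_len_def cyc_len_on_def)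

text \<open>The cycle lengths depend on \<pi> only. Integrating over the points first leaves a
  factor \<theta> w l for each cycle of length l, and the normalising constant becomes N! times
  \<open>hh\<close> at N.\<close>

theorem spm_expectation:
 fixes \<phi> :: "real^'n \<Rightarrow> real" and G :: "(nat \<Rightarrow> nat) \<Rightarrow> real"
 assumes th: "\<theta> > 0"
  and per: "periodize \<phi> L \<in> borel_measurable borel" "\<And>x. periodize \<phi> L x \<ge> 0"
  and tr: "\<And>m. kernel_on.kernel_trace (restrict_space lborel (box_L L)) (\<lambda>y z. ennreal (periodize \<phi> L (z - y))) m = ennreal (w (Suc m))"
  and w: "\<And>m. w m \<ge> 0"
  and pos: "hh (\<lambda>l. \<theta> * w l) N > 0"
  and dep: "\<And>s t. (\<And>i. i < k \<Longrightarrow> s i = t i) \<Longrightarrow> G s = G t"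
 shows "(\<integral>z. G (cyc_len (snd z) N) \<partial>spm_measure \<phi> \<theta> L N) = cyc_exp (\<lambda>l. \<theta> * w l) k G N"
proof -
 define M where "M = restrict_space lborel (box_L L :: (real^'n) set)"
 define K where "K = (\<lambda>y z :: real^'n. ennreal (periodize \<phi> L (z - y)))"
 define a where "a = (\<lambda>l. \<theta> * w l)"
 have a: "a l \<ge> 0" for l using th w by (simp add: a_def)
 have sf: "sigma_finite_measure M" unfolding M_def
  by (rule sigma_finite_measure_restrict_space) (auto simp: box_L_def sigma_finite_lborel)
 have idM: "(\<lambda>x. x) \<in> measurable M borel" unfolding M_def by (intro measurable_restrict_space1) simp
 have "(\<lambda>p. snd p - fst p) \<in> borel_measurable (M \<Otimes>\<^sub>M M)"
  by (intro borel_measurable_diff measurable_compose[OF measurable_snd idM] measurable_compose[OF measurable_fst idM])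
 hence "(\<lambda>p. ennreal (periodize \<phi> L (snd p - fst p))) \<in> borel_measurable (M \<Otimes>\<^sub>M M)"
  by (intro measurable_compose[OF _ measurable_ennreal] measurable_compose[OF _ per(1)])
 then interpret kernel_on M K
  using sf by (auto simp: kernel_on_def kernel_on_axioms_def K_def case_prod_beta)
 define Pm where "Pm = {\<pi>. \<pi> permutes {..<N}}"
 have finP: "finite Pm" unfolding Pm_def by (rule finite_permutations) simp
 have Pm_in: "\<pi> i \<in> {..<N}" if "\<pi> \<in> Pm" "i \<in> {..<N}" for \<pi> i
  using that permutes_in_image[of \<pi> "{..<N}" i] by (simp add: Pm_def)
 let ?P = "Pi\<^sub>M {..<N} (\<lambda>_. M)"
 have ref: "spm_ref L N = ?P \<Otimes>\<^sub>M count_space Pm" by (simp add: spm_ref_def M_def Pm_def)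
 interpret cs: sigma_finite_measure "count_space Pm"
  by (rule sigma_finite_measure_count_space_finite[OF finP])
 have wt_eq: "ennreal (spm_weight \<phi> \<theta> L N (f, \<pi>)) = ennreal (\<theta> ^ num_cycles \<pi> N) * (\<Prod>i<N. K (f i) (f (\<pi> i)))" for f \<pi>
  using per th by (simp add: spm_weight_def K_def ennreal_mult prod_nonneg prod_ennreal)
 have wt_meas: "(\<lambda>f. ennreal (spm_weight \<phi> \<theta> L N (f, \<pi>))) \<in> borel_measurable ?P" if "\<pi> \<in> Pm" for \<pi>
  unfolding wt_eq using Pm_in[OF that]
  by (intro borel_measurable_times_ennreal borel_measurable_prod_ennreal K_component_measurable borel_measurable_const) auto
 have W_meas: "(\<lambda>z. ennreal (spm_weight \<phi> \<theta> L N z)) \<in> borel_measurable (?P \<Otimes>\<^sub>M count_space Pm)"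
 proof -
  \<comment> \<open>The second component ranges over a finite set, so measurability is checked for
    each fixed \<pi>.\<close>
  have "(\<lambda>z. (\<lambda>\<pi> z. ennreal (spm_weight \<phi> \<theta> L N (fst z, \<pi>))) (snd z) z) \<in> borel_measurable (?P \<Otimes>\<^sub>M count_space Pm)"
  proof (rule measurable_compose_countable'[where I = Pm and g = snd
     and f = "\<lambda>\<pi> z. ennreal (spm_weight \<phi> \<theta> L N (fst z, \<pi>))"])
   show "(\<lambda>z. ennreal (spm_weight \<phi> \<theta> L N (fst z, \<pi>))) \<in> borel_measurable (?P \<Otimes>\<^sub>M count_space Pm)" if "\<pi> \<in> Pm" for \<pi>
    by (rule measurable_compose[OF measurable_fst wt_meas[OF that]])
  qed (use finP countable_finite in auto)
  thus ?thesis by simp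
 qed
 define c where "c \<pi> = (\<Prod>C\<in>orbit \<pi> ` {..<N}. a (card C))" for \<pi>
 have c0: "c \<pi> \<ge> 0" for \<pi> unfolding c_def by (intro prod_nonneg) (simp add: a)
 have wt_int: "(\<integral>\<^sup>+f. ennreal (spm_weight \<phi> \<theta> L N (f, \<pi>)) \<partial>?P) = ennreal (c \<pi>)" if "\<pi> \<in> Pm" for \<pi>
 proof -
  have m: "(\<lambda>f. \<Prod>i<N. K (f i) (f (\<pi> i))) \<in> borel_measurable ?P"
   using Pm_in[OF that] by (intro borel_measurable_prod_ennreal K_component_measurable) auto
  have "(\<integral>\<^sup>+f. ennreal (spm_weight \<phi> \<theta> L N (f, \<pi>)) \<partial>?P) = ennreal (\<theta> ^ num_cycles \<pi> N) * perm_weight \<pi> {..<N}"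
   unfolding wt_eq perm_weight_def by (rule nn_integral_cmult[OF m])
  also have "perm_weight \<pi> {..<N} = ennreal (\<Prod>C\<in>orbit \<pi> ` {..<N}. w (card C))"
   using that tr w by (intro perm_weight_eq) (auto simp: Pm_def M_def K_def)
  also have "ennreal (\<theta> ^ num_cycles \<pi> N) * \<dots> = ennreal (c \<pi>)"
   using th w by (simp add: c_def a_def num_cycles_def prod.distrib ennreal_mult prod_nonneg)
  finally show ?thesis .
 qed
 have int_pair: "(\<integral>\<^sup>+z. ennreal (spm_weight \<phi> \<theta> L N z) * u (snd z) \<partial>spm_ref L N) = (\<Sum>\<pi>\<in>Pm. ennreal (c \<pi>) * u \<pi>)"
  for u :: "(nat \<Rightarrow> nat) \<Rightarrow> ennreal"
 proof -
  have um: "(\<lambda>z. u (snd z)) \<in> borel_measurable (?P \<Otimes>\<^sub>M count_space Pm)"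
   by (rule measurable_compose[OF measurable_snd]) simp
  have "(\<integral>\<^sup>+z. ennreal (spm_weight \<phi> \<theta> L N z) * u (snd z) \<partial>spm_ref L N)
    = (\<integral>\<^sup>+f. \<integral>\<^sup>+\<pi>. ennreal (spm_weight \<phi> \<theta> L N (f, \<pi>)) * u \<pi> \<partial>count_space Pm \<partial>?P)"
   unfolding ref using borel_measurable_times_ennreal[OF W_meas um] by (subst cs.nn_integral_fst[symmetric]) auto
  also have "\<dots> = (\<integral>\<^sup>+f. (\<Sum>\<pi>\<in>Pm. ennreal (spm_weight \<phi> \<theta> L N (f, \<pi>)) * u \<pi>) \<partial>?P)"
   by (simp add: nn_integral_count_space_finite finP)
  also have "\<dots> = (\<Sum>\<pi>\<in>Pm. \<integral>\<^sup>+f. ennreal (spm_weight \<phi> \<theta> L N (f, \<pi>)) * u \<pi> \<partial>?P)"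
   by (rule nn_integral_sum) (use wt_meas in \<open>auto intro!: borel_measurable_times_ennreal\<close>)
  also have "\<dots> = (\<Sum>\<pi>\<in>Pm. ennreal (c \<pi>) * u \<pi>)"
   by (intro sum.cong refl) (simp add: nn_integral_multc wt_meas wt_int)
  finally show ?thesis .
 qed
 define Z where "Z = fact N * hh a N"
 have Z0: "Z > 0" using pos by (simp add: Z_def a_def)
 have Zsum: "(\<Sum>\<pi>\<in>Pm. c \<pi>) = Z"
  using perm_sum_const[of "{..<N}" a 1] by (simp add: perm_sum_def Z_def c_def Pm_def)
 have Zint: "(\<integral>\<^sup>+z. ennreal (spm_weight \<phi> \<theta> L N z) \<partial>spm_ref L N) = ennreal Z"
  using int_pair[of "\<lambda>_. 1"] c0 by (simp add: sum_ennreal Zsum)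
 have spm: "spm_measure \<phi> \<theta> L N = density (spm_ref L N) (\<lambda>z. ennreal (spm_weight \<phi> \<theta> L N z) / ennreal Z)"
  by (simp add: spm_measure_def Zint)
 let ?S = "spm_measure \<phi> \<theta> L N"
 have space_S: "space ?S = space ?P \<times> Pm" by (simp add: spm ref space_pair_measure)
 have em: "emeasure ?S (space ?P \<times> {\<pi>}) = ennreal (c \<pi> / Z)" if p: "\<pi> \<in> Pm" for \<pi>
 proof -
  have sets: "space ?P \<times> {\<pi>} \<in> sets (spm_ref L N)" unfolding ref using p by (intro pair_measureI) auto
  have "emeasure ?S (space ?P \<times> {\<pi>}) = (\<integral>\<^sup>+z. ennreal (spm_weight \<phi> \<theta> L N z) / ennreal Z * indicator (space ?P \<times> {\<pi>}) z \<partial>spm_ref L N)"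
   unfolding spm using sets W_meas by (intro emeasure_density) (auto simp: ref)
  also have "\<dots> = (\<integral>\<^sup>+z. ennreal (spm_weight \<phi> \<theta> L N z) * (indicator {\<pi>} (snd z) / ennreal Z) \<partial>spm_ref L N)"
   by (intro nn_integral_cong) (auto simp: ref space_pair_measure indicator_def divide_ennreal_def mult_ac)
  also have "\<dots> = (\<Sum>\<pi>'\<in>Pm. ennreal (c \<pi>') * (indicator {\<pi>} \<pi>' / ennreal Z))" by (rule int_pair)
  also have "\<dots> = (\<Sum>\<pi>'\<in>{\<pi>}. ennreal (c \<pi>') * (indicator {\<pi>} \<pi>' / ennreal Z))"
   using p finP by (intro sum.mono_neutral_right) (auto simp: indicator_def)
  also have "\<dots> = ennreal (c \<pi> / Z)"
   using Z0 c0[of \<pi>] by (simp add: divide_ennreal[symmetric] divide_ennreal_def)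
  finally show ?thesis .
 qed
 have setsS: "space ?P \<times> {\<pi>} \<in> sets ?S" if "\<pi> \<in> Pm" for \<pi>
  unfolding spm ref sets_density using that by (intro pair_measureI) auto
 \<comment> \<open>A finite combination of the indicators of the events on which \<pi> is fixed,
   whose probabilities have just been computed.\<close>
 have "(\<integral>z. G (cyc_len (snd z) N) \<partial>?S) = (\<integral>z. (\<Sum>\<pi>\<in>Pm. G (cyc_len \<pi> N) * indicator (space ?P \<times> {\<pi>}) z) \<partial>?S)"
 proof (rule Bochner_Integration.integral_cong[OF refl])
  fix z assume "z \<in> space ?S"
  hence z: "fst z \<in> space ?P" "snd z \<in> Pm" unfolding space_S by auto
  have "(\<Sum>\<pi>\<in>Pm. G (cyc_len \<pi> N) * indicator (space ?P \<times> {\<pi>}) z) = (\<Sum>\<pi>\<in>{snd z}. G (cyc_len \<pi> N) * indicator (space ?P \<times> {\<pi>}) z)"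
   using z finP by (intro sum.mono_neutral_right) (auto simp: indicator_def)
  also have "\<dots> = G (cyc_len (snd z) N)" using z by (cases z) (auto simp: indicator_def)
  finally show "G (cyc_len (snd z) N) = (\<Sum>\<pi>\<in>Pm. G (cyc_len \<pi> N) * indicator (space ?P \<times> {\<pi>}) z)" ..
 qed
 also have "\<dots> = (\<Sum>\<pi>\<in>Pm. \<integral>z. G (cyc_len \<pi> N) * indicator (space ?P \<times> {\<pi>}) z \<partial>?S)"
  using em setsS by (intro Bochner_Integration.integral_sum integrable_mult_right integrable_real_indicator) auto
 also have "\<dots> = (\<Sum>\<pi>\<in>Pm. G (cyc_len \<pi> N) * (c \<pi> / Z))"
 proof (rule sum.cong[OF refl])
  fix \<pi> assume p: "\<pi> \<in> Pm"
  have "measure ?S (space ?P \<times> {\<pi>}) = c \<pi> / Z" using em[OF p] c0 Z0 by (simp add: measure_def)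
  moreover have "space ?P \<times> {\<pi>} \<inter> space ?S = space ?P \<times> {\<pi>}" using p by (auto simp: space_S)
  ultimately show "(\<integral>z. G (cyc_len \<pi> N) * indicator (space ?P \<times> {\<pi>}) z \<partial>?S) = G (cyc_len \<pi> N) * (c \<pi> / Z)"
   by simp
 qed
 also have "\<dots> = perm_sum a {..<N} G / Z"
  by (simp add: perm_sum_def c_def Pm_def cyc_len_eq sum_divide_distrib mult.commute)
 also have "\<dots> = cyc_exp a k G N"
 proof -
  have "perm_sum a {..<N} G = fact (card {..<N}) * (hh a (card {..<N}) * cyc_exp a k G (card {..<N}))"
   by (rule perm_sum_eq_cyc_exp[OF a _ dep]) auto
  moreover have "hh a N \<noteq> 0" using pos by (simp add: a_def)
  ultimately show ?thesis by (simp add: Z_def)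
 qed
 finally show ?thesis by (simp add: a_def)
qed

subsection \<open>The limit process\<close>

lemma Beta_1_tail:
 assumes th: "\<theta> > 0" and c: "0 \<le> c" "c \<le> 1"
 shows "emeasure (beta_1_measure \<theta>) {c<..} = ennreal ((1 - c) powr \<theta>)"
proof -
 \<comment> \<open>For \<theta> < 1 the density is unbounded at 1; the antiderivative is therefore
   differentiated in the open interval only, and is merely continuous at the ends.\<close>
 have D: "((\<lambda>y. \<theta> * (1 - y) powr (\<theta> - 1)) has_integral (- ((1 - 1) powr \<theta>) - (- ((1 - c) powr \<theta>)))) {c..1}"
 proof (rule fundamental_theorem_of_calculus_interior)
  show "continuous_on {c..1} (\<lambda>y. - ((1 - y) powr \<theta>))"
   using th by (intro continuous_intros continuous_on_powr') auto
  show "((\<lambda>y. - ((1 - y) powr \<theta>)) has_vector_derivative \<theta> * (1 - y) powr (\<theta> - 1)) (at y)" if "y \<in> {c<..<1}" for y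
  proof -
   have "((\<lambda>y. (1 - y) powr \<theta>) has_real_derivative \<theta> * (1 - y) powr (\<theta> - of_nat 1) * (-1)) (at y)"
    using that by (intro DERIV_fun_powr) (auto intro!: derivative_eq_intros)
   hence "((\<lambda>y. - ((1 - y) powr \<theta>)) has_real_derivative \<theta> * (1 - y) powr (\<theta> - 1)) (at y)"
    by (auto dest: DERIV_minus)
   thus ?thesis by (simp add: has_real_derivative_iff_has_vector_derivative)
  qed
 qed (use c in auto)
 have eq: "(\<lambda>y. if y \<in> {c..1} then \<theta> * (1 - y) powr (\<theta> - 1) else 0) = (\<lambda>y. indicator {c..1} y * \<theta> * (1 - y) powr (\<theta> - 1))"
  by (auto simp: indicator_def fun_eq_iff)
 have "((\<lambda>y. indicator {c..1} y * \<theta> * (1 - y) powr (\<theta> - 1)) has_integral (1 - c) powr \<theta>) UNIV"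
  using D unfolding has_integral_restrict_UNIV[of "{c..1}", symmetric] eq by simp
 hence I: "(\<integral>\<^sup>+y. ennreal (indicator {c..1} y * \<theta> * (1 - y) powr (\<theta> - 1)) \<partial>lborel) = ennreal ((1 - c) powr \<theta>)"
  using th by (intro nn_integral_has_integral_lborel) (auto simp: indicator_def)
 have "emeasure (beta_1_measure \<theta>) {c<..} = (\<integral>\<^sup>+y. ennreal (indicator {0..1} y * \<theta> * (1 - y) powr (\<theta> - 1)) * indicator {c<..} y \<partial>lborel)"
  unfolding beta_1_measure_def by (subst emeasure_density) auto
 also have "\<dots> = (\<integral>\<^sup>+y. ennreal (indicator {c..1} y * \<theta> * (1 - y) powr (\<theta> - 1)) \<partial>lborel)"
 proof (rule nn_integral_cong_AE)
  show "AE y in lborel. ennreal (indicator {0..1} y * \<theta> * (1 - y) powr (\<theta> - 1)) * indicator {c<..} y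
    = ennreal (indicator {c..1} y * \<theta> * (1 - y) powr (\<theta> - 1))"
   using AE_lborel_singleton[of c] by eventually_elim (use c in \<open>auto simp: indicator_def\<close>)
 qed
 finally show ?thesis using I by simp
qed

lemma sets_Beta_1 [measurable_cong, simp]: "sets (beta_1_measure \<theta>) = sets borel"
 by (simp add: beta_1_measure_def)

text \<open>Excluding y = 1 keeps the remaining mass strictly above \<tau> after a step, see
  \<open>step_law_AE\<close>.\<close>

lemma Beta_1_AE: "AE y in beta_1_measure \<theta>. 0 \<le> y \<and> y < 1"
proof -
 have "AE y in lborel. ennreal (indicator {0..1} y * \<theta> * (1 - y) powr (\<theta> - 1)) > 0 \<longrightarrow> 0 \<le> y \<and> y < 1"
  using AE_lborel_singleton[of 1] by eventually_elim (auto simp: indicator_def split: if_splits)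
 thus ?thesis unfolding beta_1_measure_def by (subst AE_density) auto
qed

lemma prob_space_Beta_1: "\<theta> > 0 \<Longrightarrow> prob_space (beta_1_measure \<theta>)"
proof (rule prob_spaceI)
 assume th: "\<theta> > 0"
 have sp: "space (beta_1_measure \<theta>) = UNIV" by (simp add: beta_1_measure_def)
 have "emeasure (beta_1_measure \<theta>) UNIV = (\<integral>\<^sup>+y. ennreal (indicator {0..1} y * \<theta> * (1 - y) powr (\<theta> - 1)) \<partial>lborel)"
  unfolding beta_1_measure_def by (subst emeasure_density) auto
 also have "\<dots> = (\<integral>\<^sup>+y. ennreal (indicator {0..1} y * \<theta> * (1 - y) powr (\<theta> - 1)) * indicator {0<..} y \<partial>lborel)"
 proof (rule nn_integral_cong_AE)
  show "AE y in lborel. ennreal (indicator {0..1} y * \<theta> * (1 - y) powr (\<theta> - 1))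
    = ennreal (indicator {0..1} y * \<theta> * (1 - y) powr (\<theta> - 1)) * indicator {0<..} y"
   using AE_lborel_singleton[of 0] by eventually_elim (auto simp: indicator_def)
 qed
 also have "\<dots> = emeasure (beta_1_measure \<theta>) {0<..}"
  unfolding beta_1_measure_def by (subst emeasure_density) auto
 also have "\<dots> = 1" using Beta_1_tail[OF th, of 0] by simp
 finally show "emeasure (beta_1_measure \<theta>) (space (beta_1_measure \<theta>)) = 1" by (simp add: sp)
qed

lemma sets_unif01 [measurable_cong, simp]: "sets unif01 = sets borel" by (simp add: unif01_def)

lemma prob_space_unif01: "prob_space unif01" unfolding unif01_def by (rule prob_space_uniform_measure) auto

lemma unif01_less: "0 \<le> p \<Longrightarrow> p \<le> 1 \<Longrightarrow> emeasure unif01 {..<p} = ennreal p"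
proof -
 assume p: "0 \<le> p" "p \<le> 1"
 have "{0..1} \<inter> {..<p} = {0..<p}" using p by auto
 moreover have "emeasure unif01 {..<p} = emeasure lborel ({0..1} \<inter> {..<p}) / emeasure lborel {0..1::real}"
  unfolding unif01_def by (rule emeasure_uniform_measure) auto
 moreover have "emeasure lborel {0..<p} = ennreal p" "emeasure lborel {0..1::real} = 1"
  using p emeasure_lborel_Ico[of 0 p] emeasure_lborel_Icc[of 0 "1::real"] by simp_all
 ultimately show ?thesis by (simp add: divide_ennreal_def)
qed

text \<open>The conditional law of the next X given the partial sum s. Below, x = 1 - s is the
  remaining mass.\<close>

definition step_law :: "real \<Rightarrow> real \<Rightarrow> real \<Rightarrow> real measure" where
 "step_law \<theta> \<tau> s = distr (beta_1_measure \<theta> \<Otimes>\<^sub>M unif01) borel (\<lambda>(y, u). lim_step \<tau> s y u)"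

lemma lim_step_measurable:
 assumes [measurable]: "f \<in> borel_measurable M" "g \<in> borel_measurable M" "h \<in> borel_measurable M"
 shows "(\<lambda>x. lim_step \<tau> (f x) (g x) (h x)) \<in> borel_measurable M"
 unfolding lim_step_def by measurable

context
 fixes \<theta> \<tau> s x :: real
 assumes th: "\<theta> > 0" and x: "\<tau> < x" "0 \<le> \<tau>" and s: "s = 1 - x"
begin

interpretation pair_prob_space "beta_1_measure \<theta>" unif01
 unfolding pair_prob_space_def pair_sigma_finite_def
 using prob_space_Beta_1[OF th] prob_space_unif01 by (simp add: prob_space_imp_sigma_finite)

lemma step_measurable: "(\<lambda>(y, u). lim_step \<tau> s y u) \<in> borel_measurable (beta_1_measure \<theta> \<Otimes>\<^sub>M unif01)"
 unfolding split_beta' by (intro lim_step_measurable) measurable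

lemma real_distribution_step_law: "real_distribution (step_law \<theta> \<tau> s)"
 unfolding step_law_def using step_measurable by (intro real_distribution_distr) auto

lemma step_law_AE: "AE t in step_law \<theta> \<tau> s. 0 \<le> t \<and> t < x - \<tau>"
proof -
 have "AE z in beta_1_measure \<theta> \<Otimes>\<^sub>M unif01. 0 \<le> fst z \<and> fst z < 1"
 proof (rule AE_pair_measure)
  show "{z \<in> space (beta_1_measure \<theta> \<Otimes>\<^sub>M unif01). 0 \<le> fst z \<and> fst z < 1} \<in> sets (beta_1_measure \<theta> \<Otimes>\<^sub>M unif01)"
   by measurable
  show "AE y in beta_1_measure \<theta>. AE u in unif01. 0 \<le> fst (y, u) \<and> fst (y, u) < 1"
   using Beta_1_AE[of \<theta>] by simp
 qed
 hence "AE z in beta_1_measure \<theta> \<Otimes>\<^sub>M unif01. 0 \<le> (case z of (y, u) \<Rightarrow> lim_step \<tau> s y u) \<and> (case z of (y, u) \<Rightarrow> lim_step \<tau> s y u) < x - \<tau>"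
  by eventually_elim (use x in \<open>auto simp: lim_step_def s split_beta'\<close>)
 thus ?thesis unfolding step_law_def
  by (subst AE_distr_iff[OF step_measurable]) auto
qed

text \<open>For t > 0 the event that the step exceeds t is a rectangle in (y, u): the indicator must
  be on and y must exceed t / (x - \<tau>). Independence multiplies the two probabilities.\<close>

lemma step_law_cdf:
 assumes t: "t > 0"
 shows "1 - cdf (step_law \<theta> \<tau> s) t = (1 - \<tau> / x) * (max 0 (1 - t / (x - \<tau>))) powr \<theta>"
proof -
 interpret S: real_distribution "step_law \<theta> \<tau> s" by (rule real_distribution_step_law)
 have p: "0 \<le> 1 - \<tau> / x" "1 - \<tau> / x \<le> 1" using x by (auto simp: field_simps)
 have comp: "measure (step_law \<theta> \<tau> s) {t<..} = 1 - cdf (step_law \<theta> \<tau> s) t"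
 proof -
  have "{t<..} = UNIV - {..t}" by auto
  thus ?thesis using S.prob_compl[of "{..t}"] by (simp add: cdf_def)
 qed
 have "emeasure (step_law \<theta> \<tau> s) {t<..} = emeasure (beta_1_measure \<theta> \<Otimes>\<^sub>M unif01) ((\<lambda>(y, u). lim_step \<tau> s y u) -` {t<..} \<inter> space (beta_1_measure \<theta> \<Otimes>\<^sub>M unif01))"
  unfolding step_law_def by (rule emeasure_distr[OF step_measurable]) auto
 also have "(\<lambda>(y, u). lim_step \<tau> s y u) -` {t<..} \<inter> space (beta_1_measure \<theta> \<Otimes>\<^sub>M unif01) = {t / (x - \<tau>)<..} \<times> {..<1 - \<tau> / x}"
  using x t by (auto simp: lim_step_def s space_pair_measure beta_1_measure_def unif01_def field_simps split: if_splits)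
 also have "emeasure (beta_1_measure \<theta> \<Otimes>\<^sub>M unif01) \<dots> = emeasure (beta_1_measure \<theta>) {t / (x - \<tau>)<..} * emeasure unif01 {..<1 - \<tau> / x}"
  by (rule M2.emeasure_pair_measure_Times) auto
 also have "emeasure (beta_1_measure \<theta>) {t / (x - \<tau>)<..} = ennreal ((max 0 (1 - t / (x - \<tau>))) powr \<theta>)"
 proof (cases "t / (x - \<tau>) \<le> 1")
  case True
  thus ?thesis using Beta_1_tail[OF th, of "t / (x - \<tau>)"] t x by (simp add: max_def)
 next
  case False
  have "emeasure (beta_1_measure \<theta>) {t / (x - \<tau>)<..} \<le> emeasure (beta_1_measure \<theta>) {1<..}"
   using False by (intro emeasure_mono) auto
  also have "\<dots> = 0" using Beta_1_tail[OF th, of 1] by simp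
  finally show ?thesis using False by simp
 qed
 also have "emeasure unif01 {..<1 - \<tau> / x} = ennreal (1 - \<tau> / x)" by (rule unif01_less[OF p])
 finally have "emeasure (step_law \<theta> \<tau> s) {t<..} = ennreal ((1 - \<tau> / x) * (max 0 (1 - t / (x - \<tau>))) powr \<theta>)"
  using p by (simp add: ennreal_mult mult.commute)
 hence "measure (step_law \<theta> \<tau> s) {t<..} = (1 - \<tau> / x) * (max 0 (1 - t / (x - \<tau>))) powr \<theta>"
  using p by (simp add: measure_def)
 thus ?thesis using comp by simp
qed

end

section \<open>One step of the chain in the limit\<close>

text \<open>The functions G N vary with N and converge only along sequences with l N / N convergent.
  Skorokhod's theorem turns convergence in law into pointwise convergence on one probability space,
  where this hypothesis can be applied; the bound B then gives convergence of the integrals.\<close>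

lemma pmf_expectation_limit:
 fixes q :: "nat \<Rightarrow> nat pmf" and G :: "nat \<Rightarrow> nat \<Rightarrow> real"
 assumes \<mu>: "real_distribution \<mu>" and supp: "AE y in \<mu>. 0 \<le> y \<and> y < s"
  and tail: "\<And>t. t > 0 \<Longrightarrow> (\<lambda>N. measure_pmf.prob (q N) {l. real l > t * real N}) \<longlonglongrightarrow> 1 - cdf \<mu> t"
  and pos: "eventually (\<lambda>N. 0 \<notin> set_pmf (q N)) sequentially"
  and bnd: "\<And>N l. \<bar>G N l\<bar> \<le> B"
  and meas: "H \<in> borel_measurable borel"
  and conv: "\<And>l y. (\<lambda>N. real (l N) / real N) \<longlonglongrightarrow> y \<Longrightarrow> 0 \<le> y \<Longrightarrow> y < s \<Longrightarrow> (\<lambda>N. G N (l N)) \<longlonglongrightarrow> H y"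
 shows "(\<lambda>N. measure_pmf.expectation (q N) (G N)) \<longlonglongrightarrow> (\<integral>y. H y \<partial>\<mu>)"
proof -
 interpret mu: real_distribution \<mu> by fact
 define Q where "Q N = distr (measure_pmf (q N)) borel (\<lambda>l. real l / real N)" for N
 have Q: "real_distribution (Q N)" for N
  unfolding Q_def by (intro prob_space.real_distribution_distr[OF measure_pmf.prob_space_axioms]) auto
 have cdfQ: "cdf (Q N) t = measure_pmf.prob (q N) {l. real l / real N \<le> t}" for N t
  unfolding Q_def cdf_def by (subst measure_distr) (auto simp: vimage_def)
 have N_pos: "eventually (\<lambda>N::nat. N > 0) sequentially" by (rule eventually_gt_at_top)
 have neg: "cdf \<mu> t = 0" if "t < 0" for t
 proof -
  have "AE y in \<mu>. y \<notin> {..t}" using supp by eventually_elim (use that in auto)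
  thus ?thesis unfolding cdf_def by (subst (asm) AE_iff_measurable[OF _ refl]) (auto simp: measure_def vimage_def atMost_def)
 qed
 have "weak_conv_m Q \<mu>"
  unfolding weak_conv_m_def weak_conv_def
 proof (intro allI impI)
  fix t assume c: "isCont (cdf \<mu>) t"
  consider "t < 0" | "t = 0" | "t > 0" by linarith
  thus "(\<lambda>N. cdf (Q N) t) \<longlonglongrightarrow> cdf \<mu> t"
  proof cases
   case 1
   have "cdf (Q N) t = 0" for N
   proof -
    have "{l. real l / real N \<le> t} = {}" using 1
     by (auto simp: not_le) (smt (verit) divide_nonneg_nonneg of_nat_0_le_iff)
    thus ?thesis by (simp add: cdfQ)
   qed
   thus ?thesis using neg[OF 1] by simp
  next
   case 2
   \<comment> \<open>The limit law may have an atom at 0, the case of a first cycle of length o(N).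
     Weak convergence tests the point 0 only if there is no atom, and then both distribution
     functions vanish there because q N eventually does not charge 0.\<close>
   have "(cdf \<mu> \<longlongrightarrow> cdf \<mu> 0) (at_left 0)" using c 2 by (simp add: isCont_def filterlim_at_split)
   moreover have "eventually (\<lambda>t. cdf \<mu> t = 0) (at_left 0)"
    by (rule eventually_at_leftI[of "-1"]) (auto simp: neg)
   hence "(cdf \<mu> \<longlongrightarrow> 0) (at_left 0)" by (rule tendsto_eventually)
   ultimately have z: "cdf \<mu> 0 = 0" using tendsto_unique trivial_limit_at_left_real by blast
   have "eventually (\<lambda>N. cdf (Q N) t = 0) sequentially"
    using pos N_pos
   proof eventually_elim
    case (elim N)
    have "{l. real l / real N \<le> t} = {0}" using 2 elim by (auto simp: divide_le_0_iff)
    thus ?case using elim by (simp add: cdfQ pmf_eq_0_set_pmf measure_pmf_single)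
   qed
   thus ?thesis using z 2 by (simp add: tendsto_eventually)
  next
   case 3
   have "(\<lambda>N. 1 - measure_pmf.prob (q N) {l. real l > t * real N}) \<longlonglongrightarrow> 1 - (1 - cdf \<mu> t)"
    by (intro tendsto_intros tail 3)
   moreover have "eventually (\<lambda>N. 1 - measure_pmf.prob (q N) {l. real l > t * real N} = cdf (Q N) t) sequentially"
    using N_pos
   proof eventually_elim
    case (elim N)
    have "{l. real l / real N \<le> t} = UNIV - {l. real l > t * real N}" using elim by (auto simp: field_simps)
    thus ?case using measure_pmf.prob_compl[of "{l. real l > t * real N}" "q N"] by (simp add: cdfQ)
   qed
   ultimately show ?thesis using Lim_transform_eventually by fastforce
  qed
 qed
 from Skorohod[of Q \<mu>, OF Q \<mu> this]
 obtain \<Omega> :: "real measure" and Y :: "nat \<Rightarrow> real \<Rightarrow> real" and Z :: "real \<Rightarrow> real" where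
  \<Omega>: "prob_space \<Omega>" and Y: "\<And>n. Y n \<in> measurable \<Omega> borel" "\<And>n. distr \<Omega> borel (Y n) = Q n"
  and Z: "Z \<in> measurable \<Omega> lborel" "distr \<Omega> borel Z = \<mu>" and lim: "\<And>x. x \<in> space \<Omega> \<Longrightarrow> (\<lambda>n. Y n x) \<longlonglongrightarrow> Z x"
  by blast
 interpret O: prob_space \<Omega> by fact
 have Zb[measurable]: "Z \<in> borel_measurable \<Omega>" using Z(1) by simp
 have [measurable]: "Y n \<in> borel_measurable \<Omega>" for n by (rule Y)
 \<comment> \<open>Y is only known to have the law of l / N. Rounding recovers a length measurably,
   exactly on multiples of 1 / N, and everywhere else within 1 / N of the positive part of
   Y.\<close>
 define lN where "lN N y = nat (round (y * real N))" for N :: nat and y :: real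
 have lN_meas [measurable]: "lN N \<in> measurable borel (count_space UNIV)" for N
  unfolding lN_def round_def by measurable
 have GlN [measurable]: "(\<lambda>y. G N (lN N y)) \<in> borel_measurable borel" for N
  by (rule measurable_compose[OF lN_meas]) simp
 have AE_Z: "AE \<omega> in \<Omega>. 0 \<le> Z \<omega> \<and> Z \<omega> < s"
  using supp unfolding Z(2)[symmetric] by (subst (asm) AE_distr_iff) auto
 have l_lim: "(\<lambda>N. real (lN N (Y N \<omega>)) / real N) \<longlonglongrightarrow> Z \<omega>" if w: "\<omega> \<in> space \<Omega>" "0 \<le> Z \<omega>" for \<omega>
 proof -
  have "(\<lambda>N. max 0 (Y N \<omega>)) \<longlonglongrightarrow> max 0 (Z \<omega>)" by (intro tendsto_intros lim w)
  hence "(\<lambda>N. max 0 (Y N \<omega>)) \<longlonglongrightarrow> Z \<omega>" using w by simp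
  moreover have "(\<lambda>N. real (lN N (Y N \<omega>)) / real N - max 0 (Y N \<omega>)) \<longlonglongrightarrow> 0"
  proof (rule Lim_null_comparison[OF _ lim_inverse_n'])
   show "eventually (\<lambda>N. norm (real (lN N (Y N \<omega>)) / real N - max 0 (Y N \<omega>)) \<le> 1 / real N) sequentially"
    using N_pos
   proof eventually_elim
    case (elim N)
    have r: "\<bar>real_of_int (round (Y N \<omega> * real N)) - Y N \<omega> * real N\<bar> \<le> 1 / 2"
     by (rule of_int_round_abs_le)
    have m: "max 0 (Y N \<omega>) * real N = max 0 (Y N \<omega> * real N)" by (auto simp: max_def mult_le_0_iff zero_le_mult_iff)
    have "\<bar>real (lN N (Y N \<omega>)) - max 0 (Y N \<omega> * real N)\<bar> \<le> 1"
    proof (cases "round (Y N \<omega> * real N) \<ge> 0")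
     case True
     hence e: "real (lN N (Y N \<omega>)) = real_of_int (round (Y N \<omega> * real N))" by (simp add: lN_def)
     have "real_of_int (round (Y N \<omega> * real N)) \<ge> 0" using True by simp
     thus ?thesis unfolding e using r by (auto simp: max_def)
    next
     case False
     hence e: "real (lN N (Y N \<omega>)) = 0" by (simp add: lN_def)
     have "real_of_int (round (Y N \<omega> * real N)) \<le> -1" using False by linarith
     thus ?thesis unfolding e using r by (auto simp: max_def)
    qed
    hence "\<bar>real (lN N (Y N \<omega>)) - max 0 (Y N \<omega>) * real N\<bar> / real N \<le> 1 / real N"
     unfolding m by (intro divide_right_mono) auto
    moreover have "real (lN N (Y N \<omega>)) / real N - max 0 (Y N \<omega>) = (real (lN N (Y N \<omega>)) - max 0 (Y N \<omega>) * real N) / real N"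
     using elim by (simp add: field_simps)
    ultimately show ?case by (simp add: abs_divide)
   qed
  qed
  ultimately show ?thesis using tendsto_add by fastforce
 qed
 have "(\<lambda>N. \<integral>\<omega>. G N (lN N (Y N \<omega>)) \<partial>\<Omega>) \<longlonglongrightarrow> (\<integral>\<omega>. H (Z \<omega>) \<partial>\<Omega>)"
 proof (rule integral_dominated_convergence[where w = "\<lambda>_. B"])
  show "AE \<omega> in \<Omega>. (\<lambda>N. G N (lN N (Y N \<omega>))) \<longlonglongrightarrow> H (Z \<omega>)"
   using AE_Z AE_space by eventually_elim (auto intro!: conv l_lim)
  show "AE \<omega> in \<Omega>. norm (G N (lN N (Y N \<omega>))) \<le> B" for N using bnd by simp
 qed (use meas in measurable)
 also have "(\<integral>\<omega>. H (Z \<omega>) \<partial>\<Omega>) = (\<integral>y. H y \<partial>\<mu>)"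
  unfolding Z(2)[symmetric] using meas by (subst integral_distr) auto
 finally have lim1: "(\<lambda>N. \<integral>\<omega>. G N (lN N (Y N \<omega>)) \<partial>\<Omega>) \<longlonglongrightarrow> (\<integral>y. H y \<partial>\<mu>)" .
 have "eventually (\<lambda>N. (\<integral>\<omega>. G N (lN N (Y N \<omega>)) \<partial>\<Omega>) = measure_pmf.expectation (q N) (G N)) sequentially"
  using N_pos
 proof eventually_elim
  case (elim N)
  have "(\<integral>\<omega>. G N (lN N (Y N \<omega>)) \<partial>\<Omega>) = (\<integral>y. G N (lN N y) \<partial>Q N)"
   unfolding Y(2)[symmetric] by (subst integral_distr) auto
  also have "\<dots> = (\<integral>l. G N (lN N (real l / real N)) \<partial>measure_pmf (q N))"
   unfolding Q_def by (subst integral_distr) auto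
  also have "\<dots> = measure_pmf.expectation (q N) (G N)" using elim by (simp add: lN_def)
  finally show ?case .
 qed
 thus ?thesis by (rule Lim_transform_eventually[OF lim1])
qed

text \<open>The recursion started at an arbitrary partial sum s, as required once a first step has
  been split off.\<close>

primrec lim_S_from :: "real \<Rightarrow> real \<Rightarrow> (nat \<Rightarrow> real) \<Rightarrow> (nat \<Rightarrow> real) \<Rightarrow> nat \<Rightarrow> real" where
 "lim_S_from \<tau> s y u 0 = s"
| "lim_S_from \<tau> s y u (Suc k) = lim_S_from \<tau> s y u k + lim_step \<tau> (lim_S_from \<tau> s y u k) (y k) (u k)"

definition lim_X_from :: "real \<Rightarrow> real \<Rightarrow> (nat \<Rightarrow> real) \<Rightarrow> (nat \<Rightarrow> real) \<Rightarrow> nat \<Rightarrow> real" where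
 "lim_X_from \<tau> s y u k = lim_step \<tau> (lim_S_from \<tau> s y u k) (y k) (u k)"

lemma lim_S_from_0: "lim_S_from \<tau> 0 y u k = lim_S \<tau> y u k" by (induction k) auto

lemma lim_X_from_0: "lim_X_from \<tau> 0 y u = lim_X \<tau> y u"
 by (simp add: fun_eq_iff lim_X_from_def lim_X_def lim_S_from_0)

lemma lim_S_from_shift:
 "lim_S_from \<tau> s (case_nat y0 y) (case_nat u0 u) (Suc k) = lim_S_from \<tau> (s + lim_step \<tau> s y0 u0) y u k"
 by (induction k) auto

lemma lim_X_from_shift:
 "lim_X_from \<tau> s (case_nat y0 y) (case_nat u0 u) =
   case_nat (lim_step \<tau> s y0 u0) (lim_X_from \<tau> (s + lim_step \<tau> s y0 u0) y u)"
proof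
 fix j show "lim_X_from \<tau> s (case_nat y0 y) (case_nat u0 u) j =
   case_nat (lim_step \<tau> s y0 u0) (lim_X_from \<tau> (s + lim_step \<tau> s y0 u0) y u) j"
  by (cases j) (simp_all add: lim_X_from_def lim_S_from_shift del: lim_S_from.simps(2))
qed

lemma lim_S_from_measurable:
 assumes "s \<in> borel_measurable M" "\<And>i. (\<lambda>z. y z i) \<in> borel_measurable M" "\<And>i. (\<lambda>z. u z i) \<in> borel_measurable M"
 shows "(\<lambda>z. lim_S_from \<tau> (s z) (y z) (u z) k) \<in> borel_measurable M"
 using assms by (induction k) (auto intro!: borel_measurable_add lim_step_measurable)

lemma lim_X_from_measurable:
 assumes "s \<in> borel_measurable M" "\<And>i. (\<lambda>z. y z i) \<in> borel_measurable M" "\<And>i. (\<lambda>z. u z i) \<in> borel_measurable M"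
 shows "(\<lambda>z. lim_X_from \<tau> (s z) (y z) (u z)) \<in> borel_measurable M"
 unfolding lim_X_from_def
 by (intro measurable_coordinatewise_then_product lim_step_measurable lim_S_from_measurable assms)

definition lim_exp :: "real \<Rightarrow> real \<Rightarrow> ((nat \<Rightarrow> real) \<Rightarrow> real) \<Rightarrow> real \<Rightarrow> real" where
 "lim_exp \<theta> \<tau> g s = (\<integral>w. g (lim_X_from \<tau> s (fst w) (snd w)) \<partial>YU_measure \<theta>)"

context
 fixes \<theta> :: real
 assumes th: "\<theta> > 0"
begin

interpretation B: prob_space "beta_1_measure \<theta>" by (rule prob_space_Beta_1[OF th])
interpretation U: prob_space unif01 by (rule prob_space_unif01)
interpretation SB: sequence_space "beta_1_measure \<theta>"
 by (simp add: sequence_space_def product_prob_space_def product_prob_space_axioms_def product_sigma_finite_def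
   B.sigma_finite_measure_axioms B.prob_space_axioms)
interpretation SU: sequence_space unif01
 by (simp add: sequence_space_def product_prob_space_def product_prob_space_axioms_def product_sigma_finite_def
   U.sigma_finite_measure_axioms U.prob_space_axioms)
interpretation BU: pair_prob_space "beta_1_measure \<theta>" unif01 ..
interpretation YU: pair_prob_space "\<Pi>\<^sub>M k\<in>(UNIV::nat set). beta_1_measure \<theta>" "\<Pi>\<^sub>M k\<in>(UNIV::nat set). unif01" ..
interpretation BUYU: pair_prob_space "beta_1_measure \<theta> \<Otimes>\<^sub>M unif01"
 "(\<Pi>\<^sub>M k\<in>(UNIV::nat set). beta_1_measure \<theta>) \<Otimes>\<^sub>M (\<Pi>\<^sub>M k\<in>(UNIV::nat set). unif01)" ..

lemma prob_space_YU: "prob_space (YU_measure \<theta>)" unfolding YU_measure_def by (rule YU.prob_space_axioms)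

lemma YU_fst_measurable: "(\<lambda>w. fst w i) \<in> borel_measurable (YU_measure \<theta>)"
proof -
 have "(\<lambda>y. y i) \<in> measurable (\<Pi>\<^sub>M k\<in>(UNIV::nat set). beta_1_measure \<theta>) (beta_1_measure \<theta>)"
  by (rule measurable_component_singleton) simp
 hence "(\<lambda>y. y i) \<in> borel_measurable (\<Pi>\<^sub>M k\<in>(UNIV::nat set). beta_1_measure \<theta>)"
  by (simp cong: measurable_cong_sets)
 thus ?thesis unfolding YU_measure_def by (rule measurable_compose[OF measurable_fst])
qed

lemma YU_snd_measurable: "(\<lambda>w. snd w i) \<in> borel_measurable (YU_measure \<theta>)"
proof -
 have "(\<lambda>y. y i) \<in> measurable (\<Pi>\<^sub>M k\<in>(UNIV::nat set). unif01) unif01"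
  by (rule measurable_component_singleton) simp
 hence "(\<lambda>y. y i) \<in> borel_measurable (\<Pi>\<^sub>M k\<in>(UNIV::nat set). unif01)"
  by (simp cong: measurable_cong_sets)
 thus ?thesis unfolding YU_measure_def by (rule measurable_compose[OF measurable_snd])
qed

text \<open>For one sequence this is \<open>PiM_iter\<close>; on rectangles the integral factorises,
  so the two sequences combine. It is the shift invariance behind
  \<open>lim_exp_step\<close>.\<close>

lemma YU_iter:
 "distr ((beta_1_measure \<theta> \<Otimes>\<^sub>M unif01) \<Otimes>\<^sub>M YU_measure \<theta>) (YU_measure \<theta>)
   (\<lambda>z. (case_nat (fst (fst z)) (fst (snd z)), case_nat (snd (fst z)) (snd (snd z)))) = YU_measure \<theta>"
 (is "distr ?P ?YU ?f = _")
proof -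
 let ?B = "beta_1_measure \<theta>" and ?S = "\<Pi>\<^sub>M k\<in>(UNIV::nat set). beta_1_measure \<theta>" and ?T = "\<Pi>\<^sub>M k\<in>(UNIV::nat set). unif01"
 have mB: "(\<lambda>z. case_nat (fst z) (snd z)) \<in> measurable (?B \<Otimes>\<^sub>M ?S) ?S"
  by (auto intro!: measurable_case_nat')
 have mU: "(\<lambda>z. case_nat (fst z) (snd z)) \<in> measurable (unif01 \<Otimes>\<^sub>M ?T) ?T"
  by (auto intro!: measurable_case_nat')
 have f: "?f \<in> measurable ?P ?YU"
  unfolding YU_measure_def
  by (intro measurable_Pair measurable_case_nat') measurable
 have iterB: "distr (?B \<Otimes>\<^sub>M ?S) ?S (\<lambda>z. case_nat (fst z) (snd z)) = ?S"
  using SB.PiM_iter by (simp add: split_beta')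
 have iterU: "distr (unif01 \<Otimes>\<^sub>M ?T) ?T (\<lambda>z. case_nat (fst z) (snd z)) = ?T"
  using SU.PiM_iter by (simp add: split_beta')
 have "?S \<Otimes>\<^sub>M ?T = distr ?P ?YU ?f"
 proof (rule pair_measure_eqI)
  fix A C assume A: "A \<in> sets ?S" and C: "C \<in> sets ?T"
  have eA: "emeasure ?S A = (\<integral>\<^sup>+y0. \<integral>\<^sup>+y. indicator A (case_nat y0 y) \<partial>?S \<partial>?B)"
  proof -
   have "emeasure ?S A = (\<integral>\<^sup>+y. indicator A y \<partial>?S)" using A by simp
   also have "\<dots> = (\<integral>\<^sup>+z. indicator A (case_nat (fst z) (snd z)) \<partial>(?B \<Otimes>\<^sub>M ?S))"
    by (subst (1) iterB[symmetric], subst nn_integral_distr[OF mB]) (use A in auto)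
   also have "\<dots> = (\<integral>\<^sup>+y0. \<integral>\<^sup>+y. indicator A (case_nat y0 y) \<partial>?S \<partial>?B)"
    by (subst SB.P.nn_integral_fst[symmetric]) (use A measurable_compose[OF mB borel_measurable_indicator[OF A]] in auto)
   finally show ?thesis .
  qed
  have eC: "emeasure ?T C = (\<integral>\<^sup>+y0. \<integral>\<^sup>+y. indicator C (case_nat y0 y) \<partial>?T \<partial>unif01)"
  proof -
   have "emeasure ?T C = (\<integral>\<^sup>+y. indicator C y \<partial>?T)" using C by simp
   also have "\<dots> = (\<integral>\<^sup>+z. indicator C (case_nat (fst z) (snd z)) \<partial>(unif01 \<Otimes>\<^sub>M ?T))"
    by (subst (1) iterU[symmetric], subst nn_integral_distr[OF mU]) (use C in auto)
   also have "\<dots> = (\<integral>\<^sup>+y0. \<integral>\<^sup>+y. indicator C (case_nat y0 y) \<partial>?T \<partial>unif01)"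
    by (subst SU.P.nn_integral_fst[symmetric]) (use C measurable_compose[OF mU borel_measurable_indicator[OF C]] in auto)
   finally show ?thesis .
  qed
  have mA: "(\<lambda>z. indicator A (case_nat (fst z) (snd z)) :: ennreal) \<in> borel_measurable (?B \<Otimes>\<^sub>M ?S)"
   by (rule measurable_compose[OF mB borel_measurable_indicator[OF A]])
  have mC: "(\<lambda>z. indicator C (case_nat (fst z) (snd z)) :: ennreal) \<in> borel_measurable (unif01 \<Otimes>\<^sub>M ?T)"
   by (rule measurable_compose[OF mU borel_measurable_indicator[OF C]])
  have mA': "(\<lambda>y. indicator A (case_nat y0 y) :: ennreal) \<in> borel_measurable ?S" if "y0 \<in> space ?B" for y0
   using measurable_compose[OF measurable_Pair1'[OF that] mA] by simp
  have mC': "(\<lambda>y. indicator C (case_nat y0 y) :: ennreal) \<in> borel_measurable ?T" if "y0 \<in> space unif01" for y0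
   using measurable_compose[OF measurable_Pair1'[OF that] mC] by simp
  have AC: "A \<times> C \<in> sets ?YU" unfolding YU_measure_def using A C by auto
  have mAC: "(\<lambda>z. indicator (A \<times> C) (?f z) :: ennreal) \<in> borel_measurable ?P"
   by (rule measurable_compose[OF f borel_measurable_indicator[OF AC]])
  have "emeasure (distr ?P ?YU ?f) (A \<times> C) = (\<integral>\<^sup>+z. indicator (A \<times> C) z \<partial>distr ?P ?YU ?f)" using AC by simp
  also have "\<dots> = (\<integral>\<^sup>+z. indicator (A \<times> C) (?f z) \<partial>?P)"
   using AC by (subst nn_integral_distr[OF f]) auto
  also have "\<dots> = (\<integral>\<^sup>+p. \<integral>\<^sup>+w. indicator (A \<times> C) (?f (p, w)) \<partial>(?S \<Otimes>\<^sub>M ?T) \<partial>(?B \<Otimes>\<^sub>M unif01))"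
   using mAC unfolding YU_measure_def by (subst YU.P.nn_integral_fst[symmetric]) auto
  also have "\<dots> = (\<integral>\<^sup>+p. (\<integral>\<^sup>+y. indicator A (case_nat (fst p) y) \<partial>?S) * (\<integral>\<^sup>+u. indicator C (case_nat (snd p) u) \<partial>?T) \<partial>(?B \<Otimes>\<^sub>M unif01))"
  proof (rule nn_integral_cong)
   fix p assume "p \<in> space (?B \<Otimes>\<^sub>M unif01)"
   hence p: "fst p \<in> space ?B" "snd p \<in> space unif01" by (auto simp: space_pair_measure)
   have "(\<integral>\<^sup>+w. indicator (A \<times> C) (?f (p, w)) \<partial>(?S \<Otimes>\<^sub>M ?T))
     = (\<integral>\<^sup>+w. indicator A (case_nat (fst p) (fst w)) * indicator C (case_nat (snd p) (snd w)) \<partial>(?S \<Otimes>\<^sub>M ?T))"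
    by (intro nn_integral_cong) (auto simp: indicator_def)
   also have "\<dots> = (\<integral>\<^sup>+y. \<integral>\<^sup>+u. indicator A (case_nat (fst p) y) * indicator C (case_nat (snd p) u) \<partial>?T \<partial>?S)"
    using measurable_compose[OF measurable_fst mA'[OF p(1)]] measurable_compose[OF measurable_snd mC'[OF p(2)]]
    by (subst SU.P.nn_integral_fst[symmetric]) (auto intro!: borel_measurable_times_ennreal)
   also have "\<dots> = (\<integral>\<^sup>+y. indicator A (case_nat (fst p) y) \<partial>?S) * (\<integral>\<^sup>+u. indicator C (case_nat (snd p) u) \<partial>?T)"
    using mA'[OF p(1)] mC'[OF p(2)] by (simp add: nn_integral_cmult nn_integral_multc)
   finally show "(\<integral>\<^sup>+w. indicator (A \<times> C) (?f (p, w)) \<partial>(?S \<Otimes>\<^sub>M ?T))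
    = (\<integral>\<^sup>+y. indicator A (case_nat (fst p) y) \<partial>?S) * (\<integral>\<^sup>+u. indicator C (case_nat (snd p) u) \<partial>?T)" .
  qed
  also have "\<dots> = (\<integral>\<^sup>+y0. \<integral>\<^sup>+u0. (\<integral>\<^sup>+y. indicator A (case_nat y0 y) \<partial>?S) * (\<integral>\<^sup>+u. indicator C (case_nat u0 u) \<partial>?T) \<partial>unif01 \<partial>?B)"
  proof -
   have i1: "(\<lambda>y0. \<integral>\<^sup>+y. indicator A (case_nat y0 y) \<partial>?S) \<in> borel_measurable ?B"
    using SB.P.borel_measurable_nn_integral_fst[OF mA] by simp
   have i2: "(\<lambda>u0. \<integral>\<^sup>+u. indicator C (case_nat u0 u) \<partial>?T) \<in> borel_measurable unif01"
    using SU.P.borel_measurable_nn_integral_fst[OF mC] by simp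
   show ?thesis
    using measurable_compose[OF measurable_fst i1] measurable_compose[OF measurable_snd i2]
    by (subst U.nn_integral_fst[symmetric]) (auto intro!: borel_measurable_times_ennreal)
  qed
  also have "\<dots> = emeasure ?S A * emeasure ?T C"
  proof -
   have i1: "(\<lambda>y0. \<integral>\<^sup>+y. indicator A (case_nat y0 y) \<partial>?S) \<in> borel_measurable ?B"
    using SB.P.borel_measurable_nn_integral_fst[OF mA] by simp
   have i2: "(\<lambda>u0. \<integral>\<^sup>+u. indicator C (case_nat u0 u) \<partial>?T) \<in> borel_measurable unif01"
    using SU.P.borel_measurable_nn_integral_fst[OF mC] by simp
   show ?thesis unfolding eA eC by (simp add: nn_integral_cmult nn_integral_multc i1 i2)
  qed
  finally show "emeasure ?S A * emeasure ?T C = emeasure (distr ?P ?YU ?f) (A \<times> C)" ..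
 qed (auto simp: YU_measure_def SB.sigma_finite_measure_axioms SU.sigma_finite_measure_axioms)
 thus ?thesis by (simp add: YU_measure_def)
qed

lemma lim_exp_measurable:
 assumes g: "continuous_on UNIV g"
 shows "(\<lambda>t. lim_exp \<theta> \<tau> (\<lambda>x. g (case_nat t x)) (s + t)) \<in> borel_measurable borel"
proof -
 have gm: "g \<in> borel_measurable borel" using g by (rule borel_measurable_continuous_onI)
 have "(\<lambda>z. case_nat (fst z) (lim_X_from \<tau> (s + fst z) (fst (snd z)) (snd (snd z)))) \<in> borel_measurable (borel \<Otimes>\<^sub>M YU_measure \<theta>)"
 proof (rule measurable_coordinatewise_then_product)
  fix i
  have "(\<lambda>z. lim_X_from \<tau> (s + fst z) (fst (snd z)) (snd (snd z)) j) \<in> borel_measurable (borel \<Otimes>\<^sub>M YU_measure \<theta>)" for j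
   unfolding lim_X_from_def
   by (intro lim_step_measurable lim_S_from_measurable borel_measurable_add
      measurable_compose[OF measurable_snd YU_fst_measurable] measurable_compose[OF measurable_snd YU_snd_measurable]) auto
  thus "(\<lambda>z. case_nat (fst z) (lim_X_from \<tau> (s + fst z) (fst (snd z)) (snd (snd z))) i) \<in> borel_measurable (borel \<Otimes>\<^sub>M YU_measure \<theta>)"
   by (cases i) auto
 qed
 hence m: "(\<lambda>(t, w). g (case_nat t (lim_X_from \<tau> (s + t) (fst w) (snd w)))) \<in> borel_measurable (borel \<Otimes>\<^sub>M YU_measure \<theta>)"
  using measurable_compose[OF _ gm] by (simp add: split_beta')
 interpret Y: prob_space "YU_measure \<theta>" by (rule prob_space_YU)
 show ?thesis unfolding lim_exp_def by (rule Y.borel_measurable_lebesgue_integral[OF m])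
qed

text \<open>The Markov property of the limit process: split off the first pair (Y, U) by
  \<open>YU_iter\<close>, rewrite by \<open>lim_X_from_shift\<close>, and integrate over that pair
  last. It mirrors the recursion of \<open>cyc_exp\<close>.\<close>

lemma lim_exp_step:
 assumes g: "continuous_on UNIV g" and bnd: "\<And>x. \<bar>g x\<bar> \<le> B"
 shows "lim_exp \<theta> \<tau> g s = (\<integral>t. lim_exp \<theta> \<tau> (\<lambda>x. g (case_nat t x)) (s + t) \<partial>step_law \<theta> \<tau> s)"
proof -
 let ?BU = "beta_1_measure \<theta> \<Otimes>\<^sub>M unif01"
 let ?f = "\<lambda>z :: (real \<times> real) \<times> (nat \<Rightarrow> real) \<times> (nat \<Rightarrow> real). (case_nat (fst (fst z)) (fst (snd z)), case_nat (snd (fst z)) (snd (snd z)))"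
 have gm: "g \<in> borel_measurable borel" using g by (rule borel_measurable_continuous_onI)
 have F: "(\<lambda>w. g (lim_X_from \<tau> s (fst w) (snd w))) \<in> borel_measurable (YU_measure \<theta>)"
  by (rule measurable_compose[OF _ gm]) (intro lim_X_from_measurable YU_fst_measurable YU_snd_measurable, auto)
 have f: "?f \<in> measurable (?BU \<Otimes>\<^sub>M YU_measure \<theta>) (YU_measure \<theta>)"
  unfolding YU_measure_def by (intro measurable_Pair measurable_case_nat') measurable
 have Fm: "(\<lambda>z. g (lim_X_from \<tau> s (fst (?f z)) (snd (?f z)))) \<in> borel_measurable (?BU \<Otimes>\<^sub>M YU_measure \<theta>)"
  by (rule measurable_compose[OF f F])
 have "lim_exp \<theta> \<tau> g s = (\<integral>w. g (lim_X_from \<tau> s (fst w) (snd w)) \<partial>distr (?BU \<Otimes>\<^sub>M YU_measure \<theta>) (YU_measure \<theta>) ?f)"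
  unfolding YU_iter lim_exp_def ..
 also have "\<dots> = (\<integral>z. g (lim_X_from \<tau> s (fst (?f z)) (snd (?f z))) \<partial>(?BU \<Otimes>\<^sub>M YU_measure \<theta>))"
  by (rule integral_distr[OF f F])
 also have "\<dots> = (\<integral>p. \<integral>w. g (lim_X_from \<tau> s (fst (?f (p, w))) (snd (?f (p, w)))) \<partial>YU_measure \<theta> \<partial>?BU)"
 proof -
  have "integrable (?BU \<Otimes>\<^sub>M YU_measure \<theta>) (\<lambda>z. g (lim_X_from \<tau> s (fst (?f z)) (snd (?f z))))"
   using Fm bnd unfolding YU_measure_def by (intro BUYU.integrable_const_bound[where B = B]) auto
  thus ?thesis
   unfolding YU_measure_def by (subst BUYU.integral_fst'[symmetric]) auto
 qed
 also have "\<dots> = (\<integral>p. lim_exp \<theta> \<tau> (\<lambda>x. g (case_nat (lim_step \<tau> s (fst p) (snd p)) x)) (s + lim_step \<tau> s (fst p) (snd p)) \<partial>?BU)"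
  by (simp add: lim_X_from_shift lim_exp_def)
 also have "\<dots> = (\<integral>t. lim_exp \<theta> \<tau> (\<lambda>x. g (case_nat t x)) (s + t) \<partial>step_law \<theta> \<tau> s)"
 proof -
  have "(\<lambda>p. lim_step \<tau> s (fst p) (snd p)) \<in> borel_measurable ?BU"
   by (intro lim_step_measurable) measurable
  thus ?thesis unfolding step_law_def split_beta'
   by (subst integral_distr) (auto intro!: lim_exp_measurable g)
 qed
 finally show ?thesis .
qed

end

lemma cyc_exp_bound:
 assumes a: "\<And>l. a l \<ge> 0" and bnd: "\<And>s. \<bar>G s\<bar> \<le> B"
 shows "\<bar>cyc_exp a k G n\<bar> \<le> B"
 using bnd
proof (induction k arbitrary: G n)
 case (Suc k)
 have B: "B \<ge> 0" using Suc.prems[of undefined] by linarith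
 show ?case
 proof (cases "n = 0 \<or> hh a n = 0")
  case True
  thus ?thesis using Suc.prems B by auto
 next
  case False
  have "hh a n \<ge> 0" by (rule hh_nonneg) (rule a)
  hence pos: "real n * hh a n > 0" using False by (intro mult_pos_pos) auto
  have "\<bar>\<Sum>l=1..n. a l * hh a (n - l) * cyc_exp a k (\<lambda>s. G (case_nat l s)) (n - l)\<bar>
    \<le> (\<Sum>l=1..n. a l * hh a (n - l) * B)"
  proof (rule order_trans[OF sum_abs], rule sum_mono)
   fix l assume "l \<in> {1..n}"
   have "\<bar>cyc_exp a k (\<lambda>s. G (case_nat l s)) (n - l)\<bar> \<le> B" by (rule Suc.IH) (rule Suc.prems)
   thus "\<bar>a l * hh a (n - l) * cyc_exp a k (\<lambda>s. G (case_nat l s)) (n - l)\<bar> \<le> a l * hh a (n - l) * B"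
   proof -
    have nn: "0 \<le> a l * hh a (n - l)" by (intro mult_nonneg_nonneg a hh_nonneg)
    have "\<bar>a l * hh a (n - l) * cyc_exp a k (\<lambda>s. G (case_nat l s)) (n - l)\<bar> = a l * hh a (n - l) * \<bar>cyc_exp a k (\<lambda>s. G (case_nat l s)) (n - l)\<bar>"
     unfolding abs_mult[of "a l * hh a (n - l)"] abs_of_nonneg[OF nn] ..
    thus ?thesis using mult_left_mono[OF \<open>\<bar>cyc_exp a k (\<lambda>s. G (case_nat l s)) (n - l)\<bar> \<le> B\<close> nn] by simp
   qed
  qed
  also have "\<dots> = real n * hh a n * B" using False by (simp add: hh_rec sum_distrib_right)
  finally have "\<bar>\<Sum>l=1..n. a l * hh a (n - l) * cyc_exp a k (\<lambda>s. G (case_nat l s)) (n - l)\<bar> / (real n * hh a n) \<le> B"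
   using pos by (simp add: pos_divide_le_eq mult.commute)
  thus ?thesis using False pos by (simp add: abs_divide)
 qed
qed simp

context cycle_weights begin

theorem cyc_exp_limit:
 fixes G :: "nat \<Rightarrow> (nat \<Rightarrow> real) \<Rightarrow> real"
 assumes "\<And>N x. \<bar>G N x\<bar> \<le> B" "\<And>x. \<bar>u x\<bar> \<le> B"
  and "\<And>N x y. (\<And>i. i < k \<Longrightarrow> x i = y i) \<Longrightarrow> G N x = G N y"
  and "\<And>X x. (\<And>i. (\<lambda>N. X N i) \<longlonglongrightarrow> x i) \<Longrightarrow> (\<lambda>N. G N (X N)) \<longlonglongrightarrow> u x"
  and "continuous_on UNIV u"
  and "\<And>N. m N \<le> N" and "(\<lambda>N. real (m N) / real N) \<longlonglongrightarrow> x" and "x > \<tau>"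
 shows "(\<lambda>N. cyc_exp (a N) k (\<lambda>s. G N (\<lambda>j. real (s j) / real N)) (m N)) \<longlonglongrightarrow> lim_exp \<theta> \<tau> u (1 - x)"
 using assms
proof (induction k arbitrary: G u m x)
 case 0
 have "u y = u (\<lambda>_. 0)" for y
 proof -
  have "(\<lambda>N. G N y) \<longlonglongrightarrow> u y" "(\<lambda>N. G N (\<lambda>_. 0)) \<longlonglongrightarrow> u (\<lambda>_. 0)" by (rule 0(4), simp)+
  moreover have "(\<lambda>N. G N y) = (\<lambda>N. G N (\<lambda>_. 0))" by (intro ext 0(3)) simp
  ultimately show ?thesis using LIMSEQ_unique by metis
 qed
 hence "u = (\<lambda>_. u (\<lambda>_. 0))" by blast
 hence "lim_exp \<theta> \<tau> u (1 - x) = (\<integral>w. u (\<lambda>_. 0) \<partial>YU_measure \<theta>)" unfolding lim_exp_def by metis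
 also have "\<dots> = u (\<lambda>_. 0)" using prob_space_YU[OF theta_pos] by (simp add: prob_space.prob_space)
 finally show ?case using 0(4)[of "\<lambda>_ _. 0" "\<lambda>_. 0"] by simp
next
 case (Suc k)
 note bndG = Suc.prems(1) and bndg = Suc.prems(2) and dep = Suc.prems(3) and conv = Suc.prems(4)
  and cont = Suc.prems(5) and m = Suc.prems(6) and mx = Suc.prems(7) and x = Suc.prems(8)
 define valid where "valid N \<longleftrightarrow> m N \<ge> 1 \<and> h N (m N) > 0" for N
 define p where "p N l = (if l \<in> {1..m N} then a N l * h N (m N - l) / (real (m N) * h N (m N)) else 0)" for N l
 \<comment> \<open>The law of the next cycle length; the point mass at 0 is a placeholder for the
   finitely many N at which the normalisation may fail.\<close>
 define q where "q N = (if valid N then embed_pmf (p N) else return_pmf 0)" for N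
 define F where "F N l = cyc_exp (a N) k (\<lambda>s. G N (\<lambda>j. real (case_nat l s j) / real N)) (m N - l)" for N l
 define HH where "HH t = lim_exp \<theta> \<tau> (\<lambda>y. u (case_nat t y)) (1 - x + t)" for t
 have x0: "x > 0" using x tau_nonneg by linarith
 have valid_ev: "eventually valid sequentially"
 proof -
  have "eventually (\<lambda>N. real (m N) / real N > 0) sequentially" using order_tendstoD(1)[OF mx x0] .
  thus ?thesis using first_cycle_tail(2)[OF m mx x zero_less_one]
   by eventually_elim (auto simp: valid_def zero_less_divide_iff)
 qed
 have pmf_q: "pmf (q N) l = p N l" if v: "valid N" for N l
 proof -
  have nn: "p N l \<ge> 0" for l using v a_nonneg h_nonneg by (simp add: p_def valid_def)
  have "(\<integral>\<^sup>+l. ennreal (p N l) \<partial>count_space UNIV) = (\<Sum>l\<in>{1..m N}. ennreal (p N l))"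
   by (rule nn_integral_count_space') (auto simp: p_def)
  also have "\<dots> = ennreal (\<Sum>l\<in>{1..m N}. p N l)" by (rule sum_ennreal) (rule nn)
  also have "(\<Sum>l\<in>{1..m N}. p N l) = (\<Sum>l\<in>{1..m N}. a N l * h N (m N - l)) / (real (m N) * h N (m N))"
   unfolding sum_divide_distrib by (rule sum.cong) (auto simp: p_def)
  also have "(\<Sum>l\<in>{1..m N}. a N l * h N (m N - l)) = real (m N) * h N (m N)"
   unfolding h_def by (rule hh_rec[symmetric]) (use v in \<open>simp add: valid_def\<close>)
  also have "real (m N) * h N (m N) / (real (m N) * h N (m N)) = 1" using v by (simp add: valid_def)
  finally show ?thesis unfolding q_def using v nn by (simp add: pmf_embed_pmf)
 qed
 have expq: "measure_pmf.expectation (q N) f = (\<Sum>l\<in>{1..m N}. f l * p N l)" if v: "valid N" for N and f :: "nat \<Rightarrow> real"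
 proof -
  have "measure_pmf.expectation (q N) f = (\<Sum>l\<in>{1..m N}. f l * pmf (q N) l)"
  proof (rule integral_measure_pmf_real)
   fix l assume "l \<in> set_pmf (q N)" thus "l \<in> {1..m N}"
    using pmf_q[OF v, of l] by (auto simp: set_pmf_iff p_def split: if_splits)
  qed simp
  thus ?thesis by (simp add: pmf_q[OF v])
 qed
 have lim: "(\<lambda>N. measure_pmf.expectation (q N) (F N)) \<longlonglongrightarrow> (\<integral>t. HH t \<partial>step_law \<theta> \<tau> (1 - x))"
 proof (rule pmf_expectation_limit)
  show "real_distribution (step_law \<theta> \<tau> (1 - x))"
   by (rule real_distribution_step_law[OF theta_pos x tau_nonneg refl])
  show "AE t in step_law \<theta> \<tau> (1 - x). 0 \<le> t \<and> t < x - \<tau>"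
   by (rule step_law_AE[OF theta_pos x tau_nonneg refl])
  show "\<bar>F N l\<bar> \<le> B" for N l unfolding F_def by (rule cyc_exp_bound) (auto simp: a_nonneg bndG)
  show "HH \<in> borel_measurable borel" unfolding HH_def by (rule lim_exp_measurable[OF theta_pos cont])
  show "eventually (\<lambda>N. 0 \<notin> set_pmf (q N)) sequentially"
   using valid_ev by eventually_elim (simp add: set_pmf_iff pmf_q p_def)
  fix t :: real assume t: "t > 0"
  have "eventually (\<lambda>N. (\<Sum>l\<in>{l\<in>{1..m N}. real l > t * real N}. a N l * h N (m N - l)) / (real (m N) * h N (m N))
    = measure_pmf.prob (q N) {l. real l > t * real N}) sequentially"
   using valid_ev
  proof eventually_elim
   case (elim N)
   have "measure_pmf.prob (q N) {l. real l > t * real N} = measure_pmf.expectation (q N) (indicator {l. real l > t * real N})"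
    by simp
   also have "\<dots> = (\<Sum>l\<in>{1..m N}. indicator {l. real l > t * real N} l * p N l)" by (rule expq[OF elim])
   also have "\<dots> = (\<Sum>l\<in>{1..m N}. if real l > t * real N then a N l * h N (m N - l) / (real (m N) * h N (m N)) else 0)"
    by (rule sum.cong) (auto simp: p_def indicator_def)
   also have "\<dots> = (\<Sum>l\<in>{l\<in>{1..m N}. real l > t * real N}. a N l * h N (m N - l) / (real (m N) * h N (m N)))"
    by (rule sum.inter_filter[symmetric]) simp
   finally show ?case by (simp add: sum_divide_distrib)
  qed
  from Lim_transform_eventually[OF first_cycle_tail(1)[OF m mx x t] this]
  show "(\<lambda>N. measure_pmf.prob (q N) {l. real l > t * real N}) \<longlonglongrightarrow> 1 - cdf (step_law \<theta> \<tau> (1 - x)) t"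
   unfolding step_law_cdf[OF theta_pos x tau_nonneg refl t] .
 next
  fix l :: "nat \<Rightarrow> nat" and y assume l: "(\<lambda>N. real (l N) / real N) \<longlonglongrightarrow> y" and y: "0 \<le> y" "y < x - \<tau>"
  have "(\<lambda>N. cyc_exp (a N) k (\<lambda>s. (\<lambda>z. G N (case_nat (real (l N) / real N) z)) (\<lambda>j. real (s j) / real N)) (m N - l N))
    \<longlonglongrightarrow> lim_exp \<theta> \<tau> (\<lambda>z. u (case_nat y z)) (1 - (x - y))"
  proof (rule Suc.IH)
   show "\<bar>G N (case_nat (real (l N) / real N) z)\<bar> \<le> B" for N z by (rule bndG)
   show "\<bar>u (case_nat y z)\<bar> \<le> B" for z by (rule bndg)
   show "G N (case_nat (real (l N) / real N) z) = G N (case_nat (real (l N) / real N) z')"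
    if "\<And>i. i < k \<Longrightarrow> z i = z' i" for N z z'
    by (rule dep) (use that in \<open>auto split: nat.split\<close>)
   show "(\<lambda>N. G N (case_nat (real (l N) / real N) (X N))) \<longlonglongrightarrow> u (case_nat y z)"
    if X: "\<And>i. (\<lambda>N. X N i) \<longlonglongrightarrow> z i" for X z
   proof (rule conv)
    fix i show "(\<lambda>N. case_nat (real (l N) / real N) (X N) i) \<longlonglongrightarrow> case_nat y z i"
     by (cases i) (use l X in auto)
   qed
   show "continuous_on UNIV (\<lambda>z. u (case_nat y z))"
   proof (rule continuous_on_compose2[OF cont])
    show "continuous_on UNIV (\<lambda>z. case_nat y z)"
    proof (rule continuous_on_coordinatewise_then_product)
     fix i show "continuous_on UNIV (\<lambda>z. case_nat y z i)"
      by (cases i) (auto intro: continuous_on_product_coordinates)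
    qed
   qed auto
   show "m N - l N \<le> N" for N using m[of N] by simp
   show "x - y > \<tau>" using y by simp
   have "(\<lambda>N. real (m N) / real N - real (l N) / real N) \<longlonglongrightarrow> x - y" by (intro tendsto_intros mx l)
   moreover have "eventually (\<lambda>N. real (m N) / real N - real (l N) / real N > 0) sequentially"
    using calculation y tau_nonneg by (intro order_tendstoD(1)) auto
   hence "eventually (\<lambda>N. real (m N) / real N - real (l N) / real N = real (m N - l N) / real N) sequentially"
   proof eventually_elim
    case (elim N)
    hence "real (m N) - real (l N) > 0" by (simp add: diff_divide_distrib[symmetric] zero_less_divide_iff)
    thus ?case by (simp add: of_nat_diff diff_divide_distrib)
   qed
   ultimately show "(\<lambda>N. real (m N - l N) / real N) \<longlonglongrightarrow> x - y"
    by (rule Lim_transform_eventually)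
  qed
  moreover have "(\<lambda>j. real (case_nat (l N) s j) / real N) = case_nat (real (l N) / real N) (\<lambda>j. real (s j) / real N)" for N s
   by (rule ext) (simp split: nat.split)
  ultimately show "(\<lambda>N. F N (l N)) \<longlonglongrightarrow> HH y" by (simp add: F_def HH_def algebra_simps)
 qed
 have "eventually (\<lambda>N. measure_pmf.expectation (q N) (F N) = cyc_exp (a N) (Suc k) (\<lambda>s. G N (\<lambda>j. real (s j) / real N)) (m N)) sequentially"
  using valid_ev
 proof eventually_elim
  case (elim N)
  have "measure_pmf.expectation (q N) (F N) = (\<Sum>l\<in>{1..m N}. a N l * h N (m N - l) * F N l / (real (m N) * h N (m N)))"
   unfolding expq[OF elim] by (rule sum.cong) (auto simp: p_def)
  thus ?case using elim by (simp add: valid_def F_def h_def sum_divide_distrib)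
 qed
 from Lim_transform_eventually[OF lim this]
 show ?case unfolding HH_def using lim_exp_step[OF theta_pos cont bndg, of \<tau> "1 - x"] by simp
qed

end

subsection \<open>Sums over the integer lattice\<close>

text \<open>Makes the integration theorems for the counting measure available for
  \<open>infsum\<close>.\<close>

lemma count_space_infsum:
 fixes f :: "'k \<Rightarrow> 'b :: {banach, second_countable_topology}"
 assumes "(\<lambda>k. norm (f k)) summable_on UNIV"
 shows "integrable (count_space UNIV) f" "integral\<^sup>L (count_space UNIV) f = infsum f UNIV"
proof -
 have a: "Infinite_Set_Sum.abs_summable_on f UNIV" using assms by (simp add: abs_summable_equivalent)
 thus "integrable (count_space UNIV) f" by (simp add: Infinite_Set_Sum.abs_summable_on_def)
 show "integral\<^sup>L (count_space UNIV) f = infsum f UNIV"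
  using infsetsum_infsum[OF a] by (simp add: infsetsum_def)
qed

lemma infsum_dominated_convergence:
 fixes a :: "nat \<Rightarrow> 'k \<Rightarrow> 'b :: {banach, second_countable_topology}"
 assumes "\<And>k. (\<lambda>n. a n k) \<longlonglongrightarrow> b k" "\<And>n k. norm (a n k) \<le> c k" "c summable_on UNIV"
 shows "(\<lambda>n. \<Sum>\<^sub>\<infinity>k. a n k) \<longlonglongrightarrow> (\<Sum>\<^sub>\<infinity>k. b k)"
proof -
 have c0: "c k \<ge> 0" for k using assms(2)[of 0 k] norm_ge_zero order_trans by blast
 have ci: "integrable (count_space UNIV) c" using assms(3) c0 by (intro count_space_infsum) simp
 have sa: "(\<lambda>k. norm (a n k)) summable_on UNIV" for n
  by (rule summable_on_comparison_test[OF assms(3)]) (use assms(2) in auto)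
 have nb: "norm (b k) \<le> c k" for k
  by (rule LIMSEQ_le_const2[OF tendsto_norm[OF assms(1)]]) (use assms(2) in auto)
 have sb: "(\<lambda>k. norm (b k)) summable_on UNIV"
  by (rule summable_on_comparison_test[OF assms(3)]) (use nb in auto)
 have "(\<lambda>n. integral\<^sup>L (count_space UNIV) (a n)) \<longlonglongrightarrow> integral\<^sup>L (count_space UNIV) b"
  by (rule integral_dominated_convergence[where w = c]) (use assms ci in auto)
 thus ?thesis by (simp add: count_space_infsum sa sb)
qed

text \<open>Comparison with the integral of 1 / (1 + b t^2), by the mean value theorem for arctan on
  each unit interval.\<close>

lemma sum_inverse_square_le:
 fixes b :: real
 assumes b: "b > 0"
 shows "(\<Sum>j=1..n. 1 / (1 + b * (real j)\<^sup>2)) \<le> arctan (sqrt b * real n) / sqrt b"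
proof (induction n)
 case (Suc n)
 have "\<exists>z. sqrt b * real n < z \<and> z < sqrt b * real (Suc n) \<and>
   arctan (sqrt b * real (Suc n)) - arctan (sqrt b * real n) = (sqrt b * real (Suc n) - sqrt b * real n) * (inverse (1 + z\<^sup>2))"
  using b by (intro MVT2) (auto intro: DERIV_arctan)
 then obtain z where z: "sqrt b * real n < z" "z < sqrt b * real (Suc n)"
   and eq: "arctan (sqrt b * real (Suc n)) - arctan (sqrt b * real n) = sqrt b * inverse (1 + z\<^sup>2)"
  by (auto simp: algebra_simps)
 have "z\<^sup>2 \<le> (sqrt b * real (Suc n))\<^sup>2"
  using z b by (intro power_mono) (auto intro: order_trans[of 0 "sqrt b * real n"])
 also have "\<dots> = b * (real (Suc n))\<^sup>2" using b by (simp add: power_mult_distrib)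
 finally have "1 / (1 + b * (real (Suc n))\<^sup>2) \<le> inverse (1 + z\<^sup>2)"
  by (simp add: inverse_eq_divide frac_le add_pos_nonneg)
 also have "\<dots> = (arctan (sqrt b * real (Suc n)) - arctan (sqrt b * real n)) / sqrt b"
  unfolding eq using b by simp
 finally show ?case using Suc.IH by (simp add: diff_divide_distrib)
qed simp

text \<open>The explicit bound matters: with b proportional to l / L^2 it becomes the factor 1 +
  const L / sqrt l in \<open>cweight_bound\<close>.\<close>

lemma int_inverse_square:
 fixes b :: real
 assumes b: "b > 0"
 shows "(\<lambda>k::int. 1 / (1 + b * (real_of_int k)\<^sup>2)) summable_on UNIV"
  and "(\<Sum>\<^sub>\<infinity>k::int. 1 / (1 + b * (real_of_int k)\<^sup>2)) \<le> 1 + pi / sqrt b"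
proof -
 let ?u = "\<lambda>k::int. 1 / (1 + b * (real_of_int k)\<^sup>2)"
 have u0: "?u k \<ge> 0" for k using b by (simp add: add_nonneg_nonneg)
 have fin: "sum ?u F \<le> 1 + pi / sqrt b" if F: "finite F" for F
 proof -
  define n where "n = nat (Max (insert 0 (abs ` F)))"
  have "F \<subseteq> {- int n..int n}"
  proof
   fix k assume "k \<in> F"
   hence "\<bar>k\<bar> \<le> Max (insert 0 (abs ` F))" using F by (intro Max_ge) auto
   thus "k \<in> {- int n..int n}" by (auto simp: n_def)
  qed
  hence "sum ?u F \<le> sum ?u {- int n..int n}" by (intro sum_mono2) (use u0 in auto)
  also have "{- int n..int n} = insert 0 ((\<lambda>j. int j) ` {1..n} \<union> (\<lambda>j. - int j) ` {1..n})" (is "_ = ?R")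
  proof
   show "{- int n..int n} \<subseteq> ?R"
   proof
    fix k assume k: "k \<in> {- int n..int n}"
    consider "k = 0" | "k > 0" | "k < 0" by linarith
    thus "k \<in> ?R"
    proof cases
     case 2
     hence "k = int (nat k)" "nat k \<in> {1..n}" using k by auto
     thus ?thesis by blast
    next
     case 3
     hence "k = - int (nat (- k))" "nat (- k) \<in> {1..n}" using k by auto
     thus ?thesis by blast
    qed simp
   qed
  qed auto
  also have "sum ?u \<dots> = 1 + (\<Sum>j=1..n. ?u (int j)) + (\<Sum>j=1..n. ?u (- int j))"
  proof -
   have "sum ?u ((\<lambda>j. int j) ` {1..n} \<union> (\<lambda>j. - int j) ` {1..n}) = sum ?u ((\<lambda>j. int j) ` {1..n}) + sum ?u ((\<lambda>j. - int j) ` {1..n})"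
    by (rule sum.union_disjoint) auto
   thus ?thesis by (subst sum.insert) (auto simp: sum.reindex inj_on_def)
  qed
  also have "\<dots> = 1 + 2 * (\<Sum>j=1..n. 1 / (1 + b * (real j)\<^sup>2))" by simp
  also have "\<dots> \<le> 1 + 2 * (arctan (sqrt b * real n) / sqrt b)"
   using sum_inverse_square_le[OF b, of n] by simp
  also have "\<dots> \<le> 1 + 2 * ((pi / 2) / sqrt b)"
   using b arctan_ubound[of "sqrt b * real n"] by (intro add_left_mono mult_left_mono divide_right_mono) auto
  finally show ?thesis by simp
 qed
 show s: "?u summable_on UNIV"
  by (rule nonneg_bdd_above_summable_on) (use u0 fin in \<open>auto intro!: bdd_aboveI\<close>)
 show "infsum ?u UNIV \<le> 1 + pi / sqrt b" by (rule infsum_le_finite_sums[OF s]) (use fin in auto)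
qed

lemma lattice_prod_summable:
 fixes u :: "int \<Rightarrow> real"
 assumes u: "u summable_on UNIV" "\<And>k. u k \<ge> 0"
 shows "(\<lambda>k::int^'n. \<Prod>i\<in>UNIV. u (k $ i)) summable_on UNIV"
  and "(\<Sum>\<^sub>\<infinity>k::int^'n. \<Prod>i\<in>UNIV. u (k $ i)) = (\<Sum>\<^sub>\<infinity>k. u k) ^ CARD('n)"
proof -
 have PiE_UNIV: "Pi\<^sub>E UNIV (\<lambda>_::'n. UNIV :: int set) = UNIV" by (auto simp: PiE_def extensional_def)
 have bij: "bij_betw vec_lambda (UNIV :: ('n \<Rightarrow> int) set) UNIV" by (rule bij_betwI[where g = vec_nth]) auto
 have ua: "Infinite_Set_Sum.abs_summable_on u UNIV" using u by (simp add: abs_summable_equivalent[symmetric])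
 have "Infinite_Set_Sum.abs_summable_on (\<lambda>g. \<Prod>i\<in>UNIV. u (g i)) (Pi\<^sub>E UNIV (\<lambda>_::'n. UNIV :: int set))"
  by (rule abs_summable_on_prod_PiE) (use ua in auto)
 hence s: "(\<lambda>g. \<Prod>i\<in>UNIV. u (g i)) summable_on (UNIV :: ('n \<Rightarrow> int) set)"
  using u by (simp add: PiE_UNIV abs_summable_equivalent[symmetric] abs_prod)
 show "(\<lambda>k::int^'n. \<Prod>i\<in>UNIV. u (k $ i)) summable_on UNIV"
  using s summable_on_reindex_bij_betw[OF bij, of "\<lambda>k. \<Prod>i\<in>UNIV. u (k $ i)"] by simp
 have "(\<Sum>\<^sub>\<infinity>k::int^'n. \<Prod>i\<in>UNIV. u (k $ i)) = (\<Sum>\<^sub>\<infinity>g::'n \<Rightarrow> int. \<Prod>i\<in>UNIV. u (g i))"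
  using infsum_reindex_bij_betw[OF bij, of "\<lambda>k. \<Prod>i\<in>UNIV. u (k $ i)"] by simp
 also have "\<dots> = (\<Prod>i\<in>(UNIV::'n set). infsum u UNIV)"
  using infsum_prod_PiE_abs[of "UNIV :: 'n set" "\<lambda>_. u" "\<lambda>_. UNIV"] u by (simp add: PiE_UNIV)
 finally show "(\<Sum>\<^sub>\<infinity>k::int^'n. \<Prod>i\<in>UNIV. u (k $ i)) = (\<Sum>\<^sub>\<infinity>k. u k) ^ CARD('n)" by simp
qed

subsection \<open>Periodisation\<close>

abbreviation rvec :: "int^'n \<Rightarrow> real^'n" where "rvec k \<equiv> (\<chi> i. real_of_int (k $ i))"

text \<open>A majorant that is integrable and factorises over the coordinates, so that lattice sums
  reduce to dimension one.\<close>

definition maj :: "real^'n \<Rightarrow> real" where "maj x = (\<Prod>i\<in>UNIV. 1 / (1 + (x $ i)\<^sup>2))"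

definition tame :: "(real^'n \<Rightarrow> real) \<Rightarrow> bool" where
 "tame f \<longleftrightarrow> continuous_on UNIV f \<and> (\<exists>C. \<forall>x. \<bar>f x\<bar> \<le> C * maj x)"

lemma maj_pos: "maj x > 0" unfolding maj_def by (intro prod_pos ballI divide_pos_pos add_pos_nonneg) auto

lemma maj_measurable [measurable]: "maj \<in> borel_measurable borel"
 unfolding maj_def
 by (intro borel_measurable_prod borel_measurable_divide borel_measurable_add borel_measurable_power borel_measurable_const
   borel_measurable_continuous_onI continuous_intros)

lemma maj_le_norm: "1 \<le> (1 + norm x) ^ (2 * CARD('n)) * maj (x :: real^'n)"
proof -
 have "(\<Prod>i\<in>(UNIV::'n set). 1 + (x $ i)\<^sup>2) \<le> (\<Prod>i\<in>(UNIV::'n set). (1 + norm x)\<^sup>2)"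
 proof (rule prod_mono, rule conjI)
  fix i
  have "(x $ i)\<^sup>2 \<le> (norm x)\<^sup>2" using component_le_norm_cart[of x i] by (intro abs_le_square_iff[THEN iffD1]) auto
  also have "1 + (norm x)\<^sup>2 \<le> (1 + norm x)\<^sup>2" by (simp add: power2_sum)
  finally show "1 + (x $ i)\<^sup>2 \<le> (1 + norm x)\<^sup>2" by simp
 qed auto
 also have "\<dots> = (1 + norm x) ^ (2 * CARD('n))" by (simp add: power_mult)
 finally have "(\<Prod>i\<in>(UNIV::'n set). 1 + (x $ i)\<^sup>2) * maj x \<le> (1 + norm x) ^ (2 * CARD('n)) * maj x"
  using maj_pos[of x] by (intro mult_right_mono) auto
 moreover have "1 + (x $ i)\<^sup>2 \<noteq> 0" for i by (smt (verit) zero_le_power2)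
 hence "(\<Prod>i\<in>(UNIV::'n set). 1 + (x $ i)\<^sup>2) * maj x = 1"
  unfolding maj_def by (simp add: prod.distrib[symmetric])
 ultimately show ?thesis by simp
qed

lemma maj_integrable: "integrable lborel (maj :: real^'n \<Rightarrow> real)"
proof (rule integrableI_nonneg)
 have inv: "integrable lborel (\<lambda>t::real. 1 / (1 + t\<^sup>2))"
  using integrable_inverse_1_plus_square by (simp add: set_integrable_def inverse_eq_divide)
 have eq: "maj x = (\<Prod>b\<in>Basis. 1 / (1 + (x \<bullet> b)\<^sup>2))" for x :: "real^'n"
 proof -
  have B: "(Basis :: (real^'n) set) = range (\<lambda>i. axis i 1)" by (auto simp: Basis_vec_def)
  have "inj (\<lambda>i::'n. axis i (1::real))" by (auto simp: inj_on_def axis_eq_axis)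
  thus ?thesis unfolding B by (simp add: prod.reindex maj_def inner_axis)
 qed
 have "(\<integral>\<^sup>+x. ennreal (maj (x :: real^'n)) \<partial>lborel) = (\<integral>\<^sup>+x. (\<Prod>b\<in>Basis. ennreal (1 / (1 + (x \<bullet> b)\<^sup>2))) \<partial>(lborel :: (real^'n) measure))"
  unfolding eq by (intro nn_integral_cong prod_ennreal[symmetric]) (simp add: add_nonneg_nonneg)
 also have "\<dots> = (\<Prod>b\<in>(Basis::(real^'n) set). \<integral>\<^sup>+t. ennreal (1 / (1 + t\<^sup>2)) \<partial>lborel)"
  by (rule nn_integral_lborel_prod) auto
 also have "\<dots> < \<infinity>"
 proof -
  have "(\<integral>\<^sup>+t. ennreal (1 / (1 + t\<^sup>2)) \<partial>lborel) < \<infinity>"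
   using inv unfolding integrable_iff_bounded by (simp add: abs_of_nonneg add_nonneg_nonneg)
  thus ?thesis by (simp add: prod_constant power_less_top_ennreal)
 qed
 finally show "(\<integral>\<^sup>+x. ennreal (maj (x :: real^'n)) \<partial>lborel) < \<infinity>" .
qed (auto intro: AE_I2 less_imp_le[OF maj_pos])

text \<open>From L k = t - x follows L^2 k^2 \<le> 2 t^2 + 2 R^2. The bound is uniform over bounded
  x, as the domination of periodised series requires.\<close>

lemma maj_lattice:
 fixes x :: "real^'n"
 assumes L: "L > 0" and x: "\<And>i. \<bar>x $ i\<bar> \<le> R"
 shows "maj (x + L *\<^sub>R rvec k) \<le> (\<Prod>i\<in>UNIV. (1 + (2 * R\<^sup>2 + 2) / L\<^sup>2) * (1 / (1 + 1 * (real_of_int (k $ i))\<^sup>2)))"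
 unfolding maj_def
proof (rule prod_mono, rule conjI)
 fix i
 let ?t = "(x + L *\<^sub>R rvec k) $ i" and ?k = "real_of_int (k $ i)" and ?K = "1 + (2 * R\<^sup>2 + 2) / L\<^sup>2"
 have kt: "L * ?k = ?t - x $ i" by simp
 have "(L * ?k)\<^sup>2 \<le> 2 * ?t\<^sup>2 + 2 * (x $ i)\<^sup>2"
  unfolding kt using zero_le_power2[of "?t + x $ i"] by (simp add: power2_diff power2_sum)
 also have "(x $ i)\<^sup>2 \<le> R\<^sup>2" using x[of i] by (simp add: abs_le_square_iff[symmetric])
 finally have "L\<^sup>2 * ?k\<^sup>2 \<le> 2 * ?t\<^sup>2 + 2 * R\<^sup>2" by (simp add: power_mult_distrib)
 hence "?k\<^sup>2 \<le> (2 * ?t\<^sup>2 + 2 * R\<^sup>2) / L\<^sup>2" using L by (simp add: field_simps)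
 also have "\<dots> \<le> ?K * (1 + ?t\<^sup>2) - 1"
 proof -
  have "0 \<le> ?t\<^sup>2 + (2 * R\<^sup>2 * ?t\<^sup>2 + 2) / L\<^sup>2" by (intro add_nonneg_nonneg divide_nonneg_nonneg) auto
  thus ?thesis by (simp add: algebra_simps add_divide_distrib)
 qed
 finally have "1 + ?k\<^sup>2 \<le> ?K * (1 + ?t\<^sup>2)" by simp
 moreover have "1 + ?k\<^sup>2 > 0" "1 + ?t\<^sup>2 > 0" by (simp_all add: add_pos_nonneg del: vector_add_component)
 ultimately show "1 / (1 + ?t\<^sup>2) \<le> ?K * (1 / (1 + 1 * ?k\<^sup>2))"
  by (simp add: divide_simps mult.commute del: vector_add_component)
qed (simp add: add_nonneg_nonneg)

lemma tame_integrable: "tame f \<Longrightarrow> integrable lborel f"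
proof -
 assume "tame f"
 then obtain C where C: "continuous_on UNIV f" "\<And>x. \<bar>f x\<bar> \<le> C * maj x" by (auto simp: tame_def)
 show ?thesis
 proof (rule Bochner_Integration.integrable_bound)
  show "integrable lborel (\<lambda>x. C * maj x)" by (intro integrable_mult_right maj_integrable)
  show "f \<in> borel_measurable lborel" using C(1) by (simp add: borel_measurable_continuous_onI)
  show "AE x in lborel. norm (f x) \<le> norm (C * maj x)"
   by (intro AE_I2) (simp, rule order_trans[OF C(2) abs_ge_self])
 qed
qed

lemma tame_lattice_bound:
 fixes f :: "real^'n \<Rightarrow> real"
 assumes "tame f" "L > 0"
 obtains c where "c summable_on UNIV" "\<And>x k. (\<And>i. \<bar>x $ i\<bar> \<le> R) \<Longrightarrow> \<bar>f (x + L *\<^sub>R rvec k)\<bar> \<le> c k"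
proof -
 obtain C where C: "\<And>x. \<bar>f x\<bar> \<le> C * maj x" using assms by (auto simp: tame_def)
 have C0: "C \<ge> 0"
 proof -
  have "0 \<le> C * maj (0 :: real^'n)" by (rule order_trans[OF abs_ge_zero C])
  thus ?thesis using maj_pos[of "0 :: real^'n"] by (simp add: zero_le_mult_iff)
 qed
 let ?u = "\<lambda>k::int. (1 + (2 * R\<^sup>2 + 2) / L\<^sup>2) * (1 / (1 + 1 * (real_of_int k)\<^sup>2))"
 have u: "?u summable_on UNIV" by (intro summable_on_cmult_right int_inverse_square) simp
 have "(\<lambda>k::int^'n. C * (\<Prod>i\<in>UNIV. ?u (k $ i))) summable_on UNIV"
  by (intro summable_on_cmult_right lattice_prod_summable u) (simp add: add_nonneg_nonneg)
 moreover have "\<bar>f (x + L *\<^sub>R rvec k)\<bar> \<le> C * (\<Prod>i\<in>UNIV. ?u (k $ i))" if "\<And>i. \<bar>x $ i\<bar> \<le> R" for x k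
  using order_trans[OF C mult_left_mono[OF maj_lattice[OF assms(2) that] C0]] .
 ultimately show ?thesis by (rule that)
qed

lemma tame_lattice_summable:
 assumes "tame f" "L > 0"
 shows "(\<lambda>k. \<bar>f (x + L *\<^sub>R rvec k)\<bar>) summable_on UNIV"
proof -
 obtain c where c: "c summable_on UNIV" "\<And>y k. (\<And>i. \<bar>y $ i\<bar> \<le> norm x) \<Longrightarrow> \<bar>f (y + L *\<^sub>R rvec k)\<bar> \<le> c k"
  using tame_lattice_bound[OF assms] by blast
 show ?thesis by (rule summable_on_comparison_test[OF c(1)]) (use c(2)[of x] component_le_norm_cart in auto)
qed

lemma periodize_continuous:
 assumes "tame f" "L > 0"
 shows "continuous_on UNIV (periodize f L)"
proof (rule continuous_at_imp_continuous_on, rule ballI)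
 fix x
 show "isCont (periodize f L) x"
  unfolding continuous_at_sequentially
 proof (intro allI impI)
  fix X assume X: "X \<longlonglongrightarrow> x"
  then obtain B where B: "\<And>n. norm (X n) \<le> B" using convergent_imp_Bseq Bseq_def convergentI by (metis BseqE)
  obtain c where c: "c summable_on UNIV" "\<And>y k. (\<And>i. \<bar>y $ i\<bar> \<le> B) \<Longrightarrow> \<bar>f (y + L *\<^sub>R rvec k)\<bar> \<le> c k"
   using tame_lattice_bound[OF assms] by blast
  show "((periodize f L) \<circ> X) \<longlonglongrightarrow> periodize f L x"
   unfolding periodize_def o_def
  proof (rule infsum_dominated_convergence[OF _ _ c(1)])
   fix k
   have "isCont f y" for y using assms by (simp add: tame_def continuous_on_eq_continuous_at)
   thus "(\<lambda>n. f (X n + L *\<^sub>R rvec k)) \<longlonglongrightarrow> f (x + L *\<^sub>R rvec k)"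
    by (rule isCont_tendsto_compose) (intro tendsto_intros X)
  next
   fix n k
   show "norm (f (X n + L *\<^sub>R rvec k)) \<le> c k"
    using c(2)[of "X n" k] B[of n] component_le_norm_cart[of "X n"] order_trans by auto
  qed
 qed
qed

lemma periodize_nonneg: "(\<And>x. f x \<ge> 0) \<Longrightarrow> periodize f L x \<ge> 0"
 unfolding periodize_def by (rule infsum_nonneg) simp

lemma box_L_measurable [measurable]: "(box_L L :: (real^'n) set) \<in> sets borel"
proof -
 have "(box_L L :: (real^'n) set) = (\<Inter>i. {x. 0 \<le> x $ i} \<inter> {x. x $ i < L})" by (auto simp: box_L_def)
 moreover have "{x :: real^'n. 0 \<le> x $ i} \<in> sets borel" "{x :: real^'n. x $ i < L} \<in> sets borel" for i
  by (auto intro!: borel_closed closed_halfspace_component_ge_cart borel_open open_halfspace_component_lt_cart)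
 ultimately show ?thesis by (simp only:) (intro sets.finite_INT sets.Int, auto)
qed

lemma box_L_unique: 
 assumes "L > 0"
 shows "x - L *\<^sub>R rvec k \<in> box_L L \<longleftrightarrow> k = (\<chi> i. \<lfloor>x $ i / L\<rfloor>)"
proof -
 have "0 \<le> x $ i - L * real_of_int (k $ i) \<and> x $ i - L * real_of_int (k $ i) < L \<longleftrightarrow> k $ i = \<lfloor>x $ i / L\<rfloor>" for i
 proof -
  have "k $ i = \<lfloor>x $ i / L\<rfloor> \<longleftrightarrow> real_of_int (k $ i) \<le> x $ i / L \<and> x $ i / L < real_of_int (k $ i) + 1"
   using floor_eq_iff[of "x $ i / L" "k $ i"] by auto
  also have "\<dots> \<longleftrightarrow> 0 \<le> x $ i - L * real_of_int (k $ i) \<and> x $ i - L * real_of_int (k $ i) < L"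
   using assms by (auto simp: field_simps)
  finally show ?thesis ..
 qed
 thus ?thesis by (simp add: box_L_def vec_eq_iff)
qed

lemma lborel_integral_shift:
 fixes F :: "real^'n \<Rightarrow> 'b :: {banach, second_countable_topology}"
 assumes "F \<in> borel_measurable borel"
 shows "(LBINT x. F (x + c)) = (LBINT x. F x)"
proof -
 have "(LBINT x. F x) = (\<integral>x. F x \<partial>distr lborel borel ((+) c))" by (simp add: lborel_distr_plus)
 also have "\<dots> = (LBINT x. F (c + x))" by (rule integral_distr) (use assms in auto)
 finally show ?thesis by (simp add: add.commute)
qed

lemma lborel_nn_integral_shift:
 fixes F :: "real^'n \<Rightarrow> ennreal"
 assumes "F \<in> borel_measurable borel"
 shows "(\<integral>\<^sup>+x. F (x + c) \<partial>lborel) = (\<integral>\<^sup>+x. F x \<partial>lborel)"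
proof -
 have "(\<integral>\<^sup>+x. F x \<partial>lborel) = (\<integral>\<^sup>+x. F x \<partial>distr lborel borel ((+) c))" by (simp add: lborel_distr_plus)
 also have "\<dots> = (\<integral>\<^sup>+x. F (c + x) \<partial>lborel)" by (rule nn_integral_distr) (use assms in auto)
 finally show ?thesis by (simp add: add.commute)
qed

text \<open>Every x lies in exactly one lattice translate of the box. The indicator of that
  translate is inserted, sum and integral are exchanged, and each term is shifted back to the
  box.\<close>

lemma unfold_integral:
 fixes F :: "real^'n \<Rightarrow> 'b :: {banach, second_countable_topology}"
 assumes F: "integrable lborel F" and L: "L > 0"
 shows "(LBINT x. F x) = (LBINT x. indicator (box_L L) x *\<^sub>R (\<integral>k. F (x + L *\<^sub>R rvec k) \<partial>count_space UNIV))"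
proof -
 let ?N = "count_space (UNIV :: (int^'n) set)"
 interpret N: sigma_finite_measure ?N by (rule sigma_finite_measure_count_space_countable) simp
 interpret P: pair_sigma_finite "lborel :: (real^'n) measure" ?N by standard
 have Fm [measurable]: "F \<in> borel_measurable borel" using F by (simp add: borel_measurable_integrable)
 \<comment> \<open>\<open>?h'\<close> is \<open>?h\<close> shifted by L k. Summed over k the norm of
   \<open>?h\<close> is that of F, which gives integrability of both on the product space.\<close>
 let ?h = "\<lambda>x k. indicator (box_L L) (x - L *\<^sub>R rvec k) *\<^sub>R F x"
 let ?h' = "\<lambda>x k. indicator (box_L L) x *\<^sub>R F (x + L *\<^sub>R rvec k)"
 have meas: "(\<lambda>(x, k). u k x) \<in> borel_measurable (lborel \<Otimes>\<^sub>M ?N)"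
  if "\<And>k. u k \<in> borel_measurable borel" for u :: "int^'n \<Rightarrow> real^'n \<Rightarrow> 'b"
 proof -
  have "(\<lambda>z. u (snd z) (fst z)) \<in> borel_measurable (lborel \<Otimes>\<^sub>M ?N)"
  proof (rule measurable_compose_countable[where f = "\<lambda>k z. u k (fst z)" and g = snd])
   show "(\<lambda>z. u k (fst z)) \<in> borel_measurable (lborel \<Otimes>\<^sub>M ?N)" for k
    by (rule measurable_compose[OF measurable_fst]) (use that in simp)
  qed simp
  thus ?thesis by (simp add: split_beta')
 qed
 have hm: "(\<lambda>(x, k). ?h x k) \<in> borel_measurable (lborel \<Otimes>\<^sub>M ?N)"
  and hm': "(\<lambda>(x, k). ?h' x k) \<in> borel_measurable (lborel \<Otimes>\<^sub>M ?N)"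
  by (rule meas; measurable)+
 have ind: "indicator (box_L L) (x - L *\<^sub>R rvec k) = (indicator {\<chi> i. \<lfloor>x $ i / L\<rfloor>} k :: real)" for x :: "real^'n" and k
  using box_L_unique[OF L, of x k] by (auto simp: indicator_def)
 have nnF: "(\<integral>\<^sup>+x. norm (F x) \<partial>lborel) < \<infinity>" using F by (simp add: integrable_iff_bounded)
 have n1: "(\<integral>\<^sup>+k. norm (?h x k) \<partial>?N) = norm (F x)" for x
 proof -
  have "(\<integral>\<^sup>+k. norm (?h x k) \<partial>?N) = (\<integral>\<^sup>+k. ennreal (norm (F x)) * indicator {\<chi> i. \<lfloor>x $ i / L\<rfloor>} k \<partial>?N)"
   unfolding ind by (rule nn_integral_cong) (auto simp: indicator_def)
  also have "\<dots> = norm (F x)" by (subst nn_integral_cmult_indicator) auto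
  finally show ?thesis .
 qed
 have "(\<integral>\<^sup>+z. norm (case z of (x, k) \<Rightarrow> ?h x k) \<partial>(lborel \<Otimes>\<^sub>M ?N)) = (\<integral>\<^sup>+x. \<integral>\<^sup>+k. norm (?h x k) \<partial>?N \<partial>lborel)"
  using hm by (subst N.nn_integral_fst[symmetric]) auto
 also have "\<dots> = (\<integral>\<^sup>+x. norm (F x) \<partial>lborel)" by (simp only: n1)
 finally have h_int: "integrable (lborel \<Otimes>\<^sub>M ?N) (\<lambda>(x, k). ?h x k)"
  using hm nnF by (simp only: integrable_iff_bounded)
 have "(\<integral>\<^sup>+z. norm (case z of (x, k) \<Rightarrow> ?h' x k) \<partial>(lborel \<Otimes>\<^sub>M ?N)) = (\<integral>\<^sup>+k. \<integral>\<^sup>+x. norm (?h' x k) \<partial>lborel \<partial>?N)"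
  using hm' by (subst P.nn_integral_snd[symmetric]) (auto simp: split_beta')
 also have "\<dots> = (\<integral>\<^sup>+k. \<integral>\<^sup>+x. norm (?h x k) \<partial>lborel \<partial>?N)"
 proof (rule nn_integral_cong)
  fix k
  show "(\<integral>\<^sup>+x. norm (?h' x k) \<partial>lborel) = (\<integral>\<^sup>+x. norm (?h x k) \<partial>lborel)"
   using lborel_nn_integral_shift[of "\<lambda>x. norm (?h x k)" "L *\<^sub>R rvec k"] by simp
 qed
 also have "\<dots> = (\<integral>\<^sup>+x. \<integral>\<^sup>+k. norm (?h x k) \<partial>?N \<partial>lborel)"
  by (rule nn_integral_count_space_nn_integral[symmetric]) auto
 also have "\<dots> = (\<integral>\<^sup>+x. norm (F x) \<partial>lborel)" by (simp only: n1)
 finally have h'_int: "integrable (lborel \<Otimes>\<^sub>M ?N) (\<lambda>(x, k). ?h' x k)"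
  using hm' nnF by (simp only: integrable_iff_bounded)
 have "(LBINT x. F x) = (LBINT x. \<integral>k. ?h x k \<partial>?N)"
 proof (rule Bochner_Integration.integral_cong[OF refl])
  fix x
  have "(\<integral>k. ?h x k \<partial>?N) = (\<integral>k. indicator {\<chi> i. \<lfloor>x $ i / L\<rfloor>} k *\<^sub>R F x \<partial>?N)" unfolding ind ..
  also have "\<dots> = F x" by (subst integral_scaleR_left) (auto simp: emeasure_count_space measure_count_space intro: integrable_real_indicator)
  finally show "F x = (\<integral>k. ?h x k \<partial>?N)" ..
 qed
 also have "\<dots> = (\<integral>k. \<integral>x. ?h x k \<partial>lborel \<partial>?N)" by (rule P.Fubini_integral[symmetric, OF h_int])
 also have "\<dots> = (\<integral>k. \<integral>x. ?h' x k \<partial>lborel \<partial>?N)"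
 proof (rule Bochner_Integration.integral_cong[OF refl])
  fix k
  show "(LBINT x. ?h x k) = (LBINT x. ?h' x k)"
   using lborel_integral_shift[of "\<lambda>x. ?h x k" "L *\<^sub>R rvec k"] by simp
 qed
 also have "\<dots> = (LBINT x. \<integral>k. ?h' x k \<partial>?N)" by (rule P.Fubini_integral[OF h'_int])
 also have "\<dots> = (LBINT x. indicator (box_L L) x *\<^sub>R (\<integral>k. F (x + L *\<^sub>R rvec k) \<partial>?N))"
  by (simp only: integral_scaleR_right)
 finally show ?thesis .
qed

subsection \<open>Fourier series on the torus\<close>

abbreviation box_int :: "real \<Rightarrow> (real^'n \<Rightarrow> 'b) \<Rightarrow> 'b :: {banach, second_countable_topology}" where
 "box_int L u \<equiv> (LBINT x. indicator (box_L L) x *\<^sub>R u x)"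

definition tchar :: "real \<Rightarrow> int^'n \<Rightarrow> real^'n \<Rightarrow> complex" where
 "tchar L k x = cis (2 * pi / L * (rvec k \<bullet> x))"

abbreviation fchar :: "real^'n \<Rightarrow> real^'n \<Rightarrow> complex" where
 "fchar \<xi> x \<equiv> cis (- (2 * pi * (\<xi> \<bullet> x)))"

definition FT :: "(real^'n \<Rightarrow> real) \<Rightarrow> real^'n \<Rightarrow> complex" where
 "FT f \<xi> = (LBINT x. f x *\<^sub>R fchar \<xi> x)"

lemma norm_tchar [simp]: "norm (tchar L k x) = 1" by (simp add: tchar_def)

lemma tchar_add: "tchar L k (x + y) = tchar L k x * tchar L k y"
 by (simp add: tchar_def cis_mult inner_right_distrib distrib_left)

lemma tchar_plus: "tchar L (k + l) x = tchar L k x * tchar L l x"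
proof -
 have "rvec (k + l) = rvec k + rvec l" by (simp add: vec_eq_iff)
 thus ?thesis by (simp add: tchar_def cis_mult inner_left_distrib distrib_left)
qed

lemma tchar_minus: "tchar L (- k) x = cnj (tchar L k x)"
proof -
 have "rvec (- k) = - rvec k" by (simp add: vec_eq_iff)
 thus ?thesis by (simp add: tchar_def cis_cnj)
qed

lemma tchar_minus_arg: "tchar L k (- x) = cnj (tchar L k x)" by (simp add: tchar_def cis_cnj)

lemma tchar_0 [simp]: "tchar L 0 x = 1" "tchar L k 0 = 1"
proof -
 have "rvec 0 = (0 :: real^'n)" by (simp add: vec_eq_iff)
 thus "tchar L 0 x = 1" by (simp add: tchar_def flip: zero_vec_def)
qed (simp add: tchar_def)

lemma tchar_lattice:
 assumes "L > 0" shows "tchar L k (L *\<^sub>R rvec l) = 1"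
proof -
 have "rvec k \<bullet> rvec l = of_int (\<Sum>i\<in>UNIV. k $ i * l $ i)" by (simp add: inner_vec_def)
 hence "2 * pi / L * (rvec k \<bullet> (L *\<^sub>R rvec l)) = 2 * pi * of_int (\<Sum>i\<in>UNIV. k $ i * l $ i)"
  using assms by (simp only: inner_scaleR_right) simp
 thus ?thesis unfolding tchar_def by (metis cis_multiple_2pi Ints_of_int)
qed

lemma tchar_periodic: "L > 0 \<Longrightarrow> tchar L k (x + L *\<^sub>R rvec l) = tchar L k x"
 by (simp add: tchar_add tchar_lattice)

lemma tchar_continuous [continuous_intros]: "continuous_on A (tchar L k)"
 unfolding tchar_def by (intro continuous_intros)

lemma tchar_measurable [measurable]: "tchar L k \<in> borel_measurable borel"
 by (intro borel_measurable_continuous_onI tchar_continuous)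

lemma FT_tchar: "FT f (rvec k /\<^sub>R L) = (LBINT x. f x *\<^sub>R tchar L (- k) x)"
proof -
 have "rvec (- k) = - rvec k" by (simp add: vec_eq_iff)
 hence "cis (- (2 * pi * ((rvec k /\<^sub>R L) \<bullet> x))) = tchar L (- k) x" for x
  by (simp add: tchar_def divide_inverse mult_ac)
 thus ?thesis by (simp add: FT_def)
qed

lemma box_L_finite: "L > 0 \<Longrightarrow> emeasure lborel (box_L L :: (real^'n) set) = ennreal (L ^ CARD('n))"
 and box_L_bounded: "box_L L \<subseteq> cbox (0 :: real^'n) (\<chi> i. L)"
proof -
 show sub: "box_L L \<subseteq> cbox (0 :: real^'n) (\<chi> i. L)" by (auto simp: box_L_def mem_box_cart less_imp_le)
 assume L: "L > 0"
 have prod: "(\<Prod>b\<in>(Basis :: (real^'n) set). ((\<chi> i. L) - 0) \<bullet> b) = L ^ CARD('n)"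
 proof -
  have B: "(Basis :: (real^'n) set) = range (\<lambda>i. axis i 1)" by (auto simp: Basis_vec_def)
  have "inj (\<lambda>i::'n. axis i (1::real))" by (auto simp: inj_on_def axis_eq_axis)
  thus ?thesis unfolding B by (simp add: prod.reindex inner_axis)
 qed
 have nn: "(0::real^'n) \<bullet> b \<le> (\<chi> i. L) \<bullet> b" if "b \<in> Basis" for b
  using that L by (auto simp: Basis_vec_def inner_axis)
 have "emeasure lborel (box_L L :: (real^'n) set) \<le> emeasure lborel (cbox (0 :: real^'n) (\<chi> i. L))"
  using sub by (intro emeasure_mono) auto
 also have "\<dots> = ennreal (L ^ CARD('n))" using nn prod by (subst emeasure_lborel_cbox) auto
 finally have le: "emeasure lborel (box_L L :: (real^'n) set) \<le> ennreal (L ^ CARD('n))" .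
 have "emeasure lborel (box (0 :: real^'n) (\<chi> i. L)) \<le> emeasure lborel (box_L L :: (real^'n) set)"
  by (intro emeasure_mono) (auto simp: box_L_def mem_box_cart less_imp_le)
 also have "emeasure lborel (box (0 :: real^'n) (\<chi> i. L)) = ennreal (L ^ CARD('n))"
  using nn prod by (subst emeasure_lborel_box) auto
 finally show "emeasure lborel (box_L L :: (real^'n) set) = ennreal (L ^ CARD('n))" using le by (rule antisym[rotated])
qed

lemma box_integrable:
 fixes u :: "real^'n \<Rightarrow> 'b :: {banach, second_countable_topology}"
 assumes "L > 0" "continuous_on UNIV u"
 shows "integrable lborel (\<lambda>x. indicator (box_L L) x *\<^sub>R u x)"
proof -
 have "bounded (u ` cbox 0 (\<chi> i. L))"
  by (intro compact_imp_bounded compact_continuous_image continuous_on_subset[OF assms(2)]) auto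
 then obtain B where B: "\<And>x. x \<in> cbox 0 (\<chi> i. L) \<Longrightarrow> norm (u x) \<le> B" by (auto simp: bounded_iff)
 have "integrable lborel (\<lambda>x. indicator (box_L L :: (real^'n) set) x *\<^sub>R B)"
  using box_L_finite[OF assms(1), where 'n = 'n] by (intro integrable_scaleR_left integrable_real_indicator) auto
 thus ?thesis
 proof (rule Bochner_Integration.integrable_bound)
  show "AE x in lborel. norm (indicator (box_L L) x *\<^sub>R u x) \<le> norm (indicator (box_L L) x *\<^sub>R B)"
   using B box_L_bounded[of L] by (intro AE_I2) (auto simp: indicator_def intro: order_trans[OF _ abs_ge_self])
 qed (use borel_measurable_continuous_onI[OF assms(2)] in measurable)
qed

text \<open>A periodic \<open>u\<close> factors through the compact torus in \<open>\<complex>\<^sup>n\<close>, where polynomials are dense and pull back to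
 trigonometric polynomials; so \<open>u\<close> is orthogonal to itself.\<close>

lemma fourier_uniqueness:
 fixes u :: "real^'n \<Rightarrow> real"
 assumes L: "L > 0" and cont: "continuous_on UNIV u" and per: "\<And>x k. u (x + L *\<^sub>R rvec k) = u x"
  and zero: "\<And>k. box_int L (\<lambda>x. of_real (u x) * tchar L k x) = 0"
 shows "u x = 0"
proof -
 let ?Q = "cbox 0 (\<chi> i. L) :: (real^'n) set"
 define e :: "real^'n \<Rightarrow> complex^'n" where "e x = (\<chi> i. cis (2 * pi / L * x $ i))" for x
 have e_cont: "continuous_on A e" for A unfolding e_def by (intro continuous_intros)
 have e_tchar: "e x $ i = tchar L (axis i 1) x" "cnj (e x $ i) = tchar L (- axis i 1) x" for x i
 proof -
  have "rvec (axis i 1) = (axis i 1 :: real^'n)" by (simp add: vec_eq_iff axis_def)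
  thus "e x $ i = tchar L (axis i 1) x" by (simp add: tchar_def e_def inner_axis')
  thus "cnj (e x $ i) = tchar L (- axis i 1) x" by (simp add: tchar_minus)
 qed
 \<comment> \<open>A continuous map from a compact to a Hausdorff space is a quotient map onto its
   image, so a function constant on its fibres descends to a continuous one.\<close>
 have quot: "quotient_map (top_of_set ?Q) (top_of_set (e ` ?Q)) e"
  by (intro continuous_imp_quotient_map) (auto simp: e_cont compact_space_def compactin_subtopology Hausdorff_space_subtopology)
 have fac: "u x = u y" if "e x = e y" for x y
 proof -
  have "\<exists>k::int. x $ i = y $ i + L * of_int k" for i
  proof -
   have "cis (2 * pi / L * x $ i) = cis (2 * pi / L * y $ i)" using that by (simp add: e_def vec_eq_iff)
   then obtain k :: int where "2 * pi / L * x $ i = 2 * pi / L * y $ i + 2 * pi * of_int k"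
    using sin_cos_eq_iff[of "2 * pi / L * x $ i" "2 * pi / L * y $ i"] by (auto simp: complex_eq_iff)
   hence "2 * pi / L * x $ i = 2 * pi / L * (y $ i + L * of_int k)" using L by (simp add: distrib_left)
   thus ?thesis using L by (intro exI[of _ k]) simp
  qed
  then obtain k where "\<And>i. x $ i = y $ i + L * of_int (k i)" by metis
  hence "x = y + L *\<^sub>R rvec (\<chi> i. k i)" by (simp add: vec_eq_iff)
  thus ?thesis by (simp only: per)
 qed
 have "continuous_map (top_of_set ?Q) euclidean u" using continuous_on_subset[OF cont] by simp
 then obtain U where "continuous_map (top_of_set (e ` ?Q)) euclidean U" "\<And>x. x \<in> topspace (top_of_set ?Q) \<Longrightarrow> U (e x) = u x"
  by (rule quotient_map_lift_exists[OF quot]) (use fac in blast)+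
 hence U: "continuous_on (e ` ?Q) U" "\<And>x. x \<in> ?Q \<Longrightarrow> U (e x) = u x" by simp_all
 \<comment> \<open>The continuous functions whose Fourier coefficients all vanish. Multiplication by
   Re (c e_i) shifts frequencies by one unit in either direction, so the class is stable under
   multiplication by polynomials in e.\<close>
 define Z where "Z g \<longleftrightarrow> continuous_on UNIV g \<and> (\<forall>k. box_int L (\<lambda>x. of_real (g x) * tchar L k x) = 0)" for g :: "real^'n \<Rightarrow> real"
 have lin: "Z (\<lambda>x. g x * Re (c * e x $ i))" if g: "Z g" for g c i
 proof -
  let ?I = "\<lambda>k x. indicator (box_L L) x *\<^sub>R (of_real (g x) * tchar L k x)"
  have i: "integrable lborel (?I k)" for k using g by (intro box_integrable L continuous_intros) (simp add: Z_def)
  have "indicator (box_L L) x *\<^sub>R (of_real (g x * Re (c * e x $ i)) * tchar L k x) = c / 2 * ?I (axis i 1 + k) x + cnj c / 2 * ?I (- axis i 1 + k) x" for k x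
  proof -
   have "of_real (Re (c * e x $ i)) = c / 2 * tchar L (axis i 1) x + cnj c / 2 * tchar L (- axis i 1) x"
    unfolding e_tchar[symmetric] by (simp add: complex_eq_iff diff_divide_distrib add_divide_distrib)
   thus ?thesis unfolding tchar_plus of_real_mult by (simp add: scaleR_conv_of_real algebra_simps)
  qed
  hence "box_int L (\<lambda>x. of_real (g x * Re (c * e x $ i)) * tchar L k x)
    = c / 2 * integral\<^sup>L lborel (?I (axis i 1 + k)) + cnj c / 2 * integral\<^sup>L lborel (?I (- axis i 1 + k))" for k
   by (simp only: Bochner_Integration.integral_add[OF integrable_mult_right integrable_mult_right, OF i i] integral_mult_right_zero)
  moreover have "continuous_on UNIV (\<lambda>x. g x * Re (c * e x $ i))"
   using g unfolding Z_def e_def by (intro continuous_intros) auto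
  ultimately show ?thesis using g by (simp add: Z_def)
 qed
 have Z_add: "Z (\<lambda>x. f x + g x)" if "Z f" "Z g" for f g
 proof -
  have i: "integrable lborel (\<lambda>x. indicator (box_L L) x *\<^sub>R (complex_of_real (h x) * tchar L k x))" if "Z h" for h k
   using that by (intro box_integrable L continuous_intros) (simp add: Z_def)
  have "box_int L (\<lambda>x. of_real (f x + g x) * tchar L k x) = 0" for k
   using Bochner_Integration.integral_add[OF i[OF that(1), of k] i[OF that(2), of k]] that
   by (simp add: Z_def distrib_right scaleR_add_right)
  thus ?thesis using that by (auto simp: Z_def intro!: continuous_intros)
 qed
 have poly: "Z (\<lambda>x. g x * p (e x))" if "real_polynomial_function p" "Z g" for p g
  using that
 proof (induction arbitrary: g)
  case (linear p)
  define c where "c i = Complex (p (axis i 1)) (- p (axis i \<i>))" for i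
  interpret p: bounded_linear p by (rule linear.hyps)
  have "p (e x) = (\<Sum>i\<in>UNIV. Re (c i * e x $ i))" for x
  proof -
   have "e x = (\<Sum>i\<in>UNIV. Re (e x $ i) *\<^sub>R axis i 1 + Im (e x $ i) *\<^sub>R axis i \<i>)"
    by (simp add: vec_eq_iff axis_def complex_eq_iff if_distrib sum.delta cong: if_cong)
   hence "p (e x) = p (\<Sum>i\<in>UNIV. Re (e x $ i) *\<^sub>R axis i 1 + Im (e x $ i) *\<^sub>R axis i \<i>)" by (rule arg_cong)
   thus ?thesis by (simp add: p.sum p.add p.scaleR c_def mult.commute)
  qed
  hence eq: "(\<lambda>x. g x * p (e x)) = (\<lambda>x. \<Sum>i\<in>UNIV. g x * Re (c i * e x $ i))" by (simp add: sum_distrib_left)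
  have "Z (\<lambda>x. \<Sum>i\<in>A. g x * Re (c i * e x $ i))" for A
  proof (induction A rule: infinite_finite_induct)
   case (insert i A) thus ?case using Z_add[OF lin[OF linear.prems, of "c i" i] insert.IH] by simp
  qed (simp_all add: Z_def)
  thus ?case unfolding eq .
 next
  case (const c)
  have "box_int L (\<lambda>x. of_real (g x * c) * tchar L k x)
   = of_real c * box_int L (\<lambda>x. of_real (g x) * tchar L k x)" for k
   unfolding integral_mult_right_zero[symmetric] by (simp add: mult_ac)
  thus ?case using const by (auto simp: Z_def intro!: continuous_intros)
 next
  case (add p q) thus ?case using Z_add[OF add.IH(1) add.IH(2)] by (simp add: distrib_left)
 next
  case (mult p q) thus ?case using mult.IH(2)[OF mult.IH(1)] by (simp add: mult.assoc)
 qed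
 have box_sub: "box_L L \<subseteq> ?Q" by (rule box_L_bounded)
 define J where "J = box_int L (\<lambda>x. u x * u x)"
 define K where "K = box_int L (\<lambda>x. \<bar>u x\<bar>)"
 have K: "K \<ge> 0" by (simp add: K_def)
 \<comment> \<open>u times a polynomial p in e integrates to 0, so the integral of u^2 equals that
   of u (u - p) and is at most \<epsilon> times that of |u|.\<close>
 have J_le: "J \<le> \<epsilon> * K" if \<epsilon>: "\<epsilon> > 0" for \<epsilon>
 proof -
  obtain p where p: "real_polynomial_function p" "\<And>z. z \<in> e ` ?Q \<Longrightarrow> \<bar>U z - p z\<bar> < \<epsilon>"
   using Stone_Weierstrass_real_polynomial_function[OF compact_continuous_image[OF e_cont compact_cbox] U(1) \<epsilon>] by blast
  have Zp: "Z (\<lambda>x. u x * p (e x))" by (rule poly[OF p(1)]) (simp add: Z_def cont zero)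
  have "of_real (box_int L (\<lambda>x. u x * p (e x))) = (LBINT x. complex_of_real (indicator (box_L L) x *\<^sub>R (u x * p (e x))))"
   by (rule integral_complex_of_real[symmetric])
  also have "\<dots> = box_int L (\<lambda>x. of_real (u x * p (e x)) * tchar L 0 x)"
   by (rule Bochner_Integration.integral_cong) (auto simp: scaleR_conv_of_real)
  also have "\<dots> = 0" using Zp[unfolded Z_def] by blast
  finally have 0: "box_int L (\<lambda>x. u x * p (e x)) = 0" by simp
  have i: "integrable lborel (\<lambda>x. indicator (box_L L) x *\<^sub>R (u x * u x))" "integrable lborel (\<lambda>x. indicator (box_L L) x *\<^sub>R (u x * p (e x)))"
   "integrable lborel (\<lambda>x. indicator (box_L L) x *\<^sub>R \<bar>u x\<bar>)"
   by (intro box_integrable L continuous_intros cont Zp[unfolded Z_def, THEN conjunct1])+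
  have "J = (LBINT x. indicator (box_L L) x *\<^sub>R (u x * u x) - indicator (box_L L) x *\<^sub>R (u x * p (e x)))"
   unfolding Bochner_Integration.integral_diff[OF i(1,2)] 0 J_def by simp
  also have "\<dots> \<le> (LBINT x. \<epsilon> * (indicator (box_L L) x *\<^sub>R \<bar>u x\<bar>))"
  proof (intro integral_mono Bochner_Integration.integrable_diff integrable_mult_right i)
   fix x
   have "u x * u x - u x * p (e x) \<le> \<epsilon> * \<bar>u x\<bar>" if "x \<in> box_L L"
   proof -
    have "\<bar>u x - p (e x)\<bar> \<le> \<epsilon>" using p(2)[of "e x"] U(2)[of x] that box_sub by fastforce
    hence "\<bar>u x\<bar> * \<bar>u x - p (e x)\<bar> \<le> \<bar>u x\<bar> * \<epsilon>" by (intro mult_left_mono) auto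
    thus ?thesis by (simp add: abs_mult[symmetric] right_diff_distrib mult.commute abs_le_iff)
   qed
   thus "indicator (box_L L) x *\<^sub>R (u x * u x) - indicator (box_L L) x *\<^sub>R (u x * p (e x)) \<le> \<epsilon> * (indicator (box_L L) x *\<^sub>R \<bar>u x\<bar>)"
    by (simp add: indicator_def)
  qed
  finally show ?thesis by (simp add: K_def)
 qed
 have J: "J \<le> 0"
 proof (rule ccontr)
  assume "\<not> J \<le> 0"
  hence "J > 0" by simp
  hence "J \<le> J / (2 * (K + 1)) * K" using K by (intro J_le) auto
  also have "\<dots> < J" using \<open>J > 0\<close> K by (simp add: field_simps add_nonneg_pos)
  finally show False by simp
 qed
 \<comment> \<open>The vanishing criterion concerns closed boxes and J the half-open one; the open
   box lies inside both and has the same integral as its closure.\<close>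
 let ?B = "box 0 (\<chi> i. L) :: (real^'n) set"
 have ne: "?B \<noteq> {}" using L by (simp add: interval_ne_empty_cart)
 have sub: "?B \<subseteq> box_L L" by (auto simp: box_L_def mem_box_cart less_imp_le)
 have uu: "integrable lborel (\<lambda>x. indicator (box_L L) x *\<^sub>R (u x * u x))" by (intro box_integrable L continuous_intros cont)
 have B_int: "integrable lborel (\<lambda>x. indicator ?B x *\<^sub>R (u x * u x))"
 proof (rule Bochner_Integration.integrable_bound[OF uu])
  have [measurable]: "u \<in> borel_measurable borel" using cont by (rule borel_measurable_continuous_onI)
  show "(\<lambda>x. indicator ?B x *\<^sub>R (u x * u x)) \<in> borel_measurable lborel" by measurable
 qed (use sub in \<open>auto simp: indicator_def\<close>)
 have "integral ?Q (\<lambda>x. u x * u x) = integral ?B (\<lambda>x. u x * u x)" by (rule integral_open_interval[symmetric])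
 also have "\<dots> = (LBINT x. indicator ?B x *\<^sub>R (u x * u x))"
  using set_borel_integral_eq_integral(2)[of ?B "\<lambda>x. u x * u x"] B_int by (simp add: set_integrable_def set_lebesgue_integral_def)
 also have "\<dots> \<le> J" unfolding J_def by (rule integral_mono[OF B_int uu]) (use sub in \<open>auto simp: indicator_def\<close>)
 finally have "integral ?Q (\<lambda>x. u x * u x) \<le> 0" using J by simp
 moreover have c: "continuous_on ?Q (\<lambda>x. u x * u x)" by (intro continuous_intros continuous_on_subset[OF cont]) auto
 moreover have "integral ?Q (\<lambda>x. u x * u x) \<ge> 0" by (rule integral_nonneg[OF integrable_continuous[OF c]]) simp
 ultimately have z: "\<forall>x\<in>?Q. u x * u x = 0" using integral_cbox_eq_0_iff[OF c ne] by auto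
 define y where "y = x - L *\<^sub>R rvec (\<chi> i. \<lfloor>x $ i / L\<rfloor>)"
 have "y \<in> box_L L" unfolding y_def using box_L_unique[OF L] by blast
 moreover have "u y = u x" using per[of y "\<chi> i. \<lfloor>x $ i / L\<rfloor>"] by (simp add: y_def)
 ultimately show ?thesis using z box_sub by auto
qed

lemma infsum_continuous:
 fixes w :: "'k \<Rightarrow> real^'n \<Rightarrow> complex"
 assumes c: "(\<lambda>k. norm (c k)) summable_on UNIV" and w: "\<And>k. continuous_on UNIV (w k)" "\<And>k x. norm (w k x) \<le> 1"
 shows "continuous_on UNIV (\<lambda>x. \<Sum>\<^sub>\<infinity>k. c k * w k x)"
proof (rule continuous_at_imp_continuous_on, rule ballI)
 fix x
 show "isCont (\<lambda>x. \<Sum>\<^sub>\<infinity>k. c k * w k x) x"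
  unfolding continuous_at_sequentially o_def
 proof (intro allI impI infsum_dominated_convergence[OF _ _ c])
  fix X k assume X: "X \<longlonglongrightarrow> x"
  have "isCont (w k) x" using w by (simp add: continuous_on_eq_continuous_at)
  thus "(\<lambda>n. c k * w k (X n)) \<longlonglongrightarrow> c k * w k x"
   by (intro tendsto_intros isCont_tendsto_compose[OF _ X])
 next
  fix X :: "nat \<Rightarrow> real^'n" and n k
  show "norm (c k * w k (X n)) \<le> norm (c k)" using w(2)[of k "X n"] by (simp add: norm_mult mult_left_le)
 qed
qed

lemma box_infsum_integral:
 fixes w :: "int^'n \<Rightarrow> real^'n \<Rightarrow> complex"
 assumes L: "L > 0" and c: "(\<lambda>k. norm (c k)) summable_on UNIV"
  and w: "\<And>k. continuous_on UNIV (w k)" "\<And>k x. norm (w k x) \<le> 1" and v: "continuous_on UNIV v"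
 shows "box_int L (\<lambda>x. v x * (\<Sum>\<^sub>\<infinity>k. c k * w k x))
   = (\<Sum>\<^sub>\<infinity>k. c k * box_int L (\<lambda>x. v x * w k x))"
proof -
 let ?N = "count_space (UNIV :: (int^'n) set)"
 interpret N: sigma_finite_measure ?N by (rule sigma_finite_measure_count_space_countable) simp
 interpret P: pair_sigma_finite "lborel :: (real^'n) measure" ?N by standard
 define g where "g x = indicator (box_L L) x *\<^sub>R v x" for x
 have g: "integrable lborel g" unfolding g_def by (rule box_integrable[OF L v])
 have [measurable]: "g \<in> borel_measurable borel" using g by (simp add: borel_measurable_integrable)
 have [measurable]: "w k \<in> borel_measurable borel" for k using w by (simp add: borel_measurable_continuous_onI)
 let ?h = "\<lambda>x k. g x * (c k * w k x)"
 have hm: "(\<lambda>(x, k). ?h x k) \<in> borel_measurable (lborel \<Otimes>\<^sub>M ?N)"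
 proof -
  have "(\<lambda>z. ?h (fst z) (snd z)) \<in> borel_measurable (lborel \<Otimes>\<^sub>M ?N)"
   by (rule measurable_compose_countable[where f = "\<lambda>k z. ?h (fst z) k" and g = snd]) measurable
  thus ?thesis by (simp add: split_beta')
 qed
 have nc: "(\<integral>\<^sup>+k. norm (c k) \<partial>?N) < \<infinity>"
  using count_space_infsum(1)[OF c] by (simp add: integrable_iff_bounded)
 have ng: "(\<integral>\<^sup>+x. norm (g x) \<partial>lborel) < \<infinity>" using g by (simp add: integrable_iff_bounded)
 have "(\<integral>\<^sup>+z. norm (case z of (x, k) \<Rightarrow> ?h x k) \<partial>(lborel \<Otimes>\<^sub>M ?N)) = (\<integral>\<^sup>+x. \<integral>\<^sup>+k. norm (?h x k) \<partial>?N \<partial>lborel)"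
  using hm by (subst N.nn_integral_fst[symmetric]) auto
 also have "\<dots> \<le> (\<integral>\<^sup>+x. \<integral>\<^sup>+k. ennreal (norm (g x)) * ennreal (norm (c k)) \<partial>?N \<partial>lborel)"
 proof (intro nn_integral_mono)
  fix x k
  have "norm (g x) * (norm (c k) * norm (w k x)) \<le> norm (g x) * (norm (c k) * 1)"
   using w(2) by (intro mult_left_mono) auto
  thus "ennreal (norm (?h x k)) \<le> ennreal (norm (g x)) * ennreal (norm (c k))"
   by (simp add: norm_mult ennreal_mult[symmetric] ennreal_leI)
 qed
 also have "\<dots> = (\<integral>\<^sup>+x. norm (g x) \<partial>lborel) * (\<integral>\<^sup>+k. norm (c k) \<partial>?N)"
  by (simp add: nn_integral_cmult nn_integral_multc)
 also have "\<dots> < \<infinity>" using nc ng by (simp add: ennreal_mult_less_top)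
 finally have h_int: "integrable (lborel \<Otimes>\<^sub>M ?N) (\<lambda>(x, k). ?h x k)"
  using hm by (simp only: integrable_iff_bounded)
 have cs: "(\<integral>k. ?h x k \<partial>?N) = g x * (\<Sum>\<^sub>\<infinity>k. c k * w k x)" for x
 proof -
  have "(\<lambda>k. norm (c k * w k x)) summable_on UNIV"
   by (rule summable_on_comparison_test[OF c]) (use w(2) in \<open>auto simp: norm_mult mult_left_le\<close>)
  from count_space_infsum(2)[OF this] show ?thesis by simp
 qed
 have I: "(LBINT x. ?h x k) = c k * (LBINT x. g x * w k x)" for k
 proof -
  have "(LBINT x. ?h x k) = (LBINT x. c k * (g x * w k x))" by (simp add: mult_ac)
  thus ?thesis by simp
 qed
 have Ib: "norm (LBINT x. g x * w k x) \<le> (LBINT x. norm (g x))" for k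
 proof -
  have gi: "integrable lborel (\<lambda>x. g x * w k x)"
  proof (rule Bochner_Integration.integrable_bound[OF integrable_norm[OF g]])
   show "AE x in lborel. norm (g x * w k x) \<le> norm (norm (g x))"
    using w(2) by (intro AE_I2) (simp add: norm_mult mult_left_le)
  qed measurable
  have "(LBINT x. norm (g x * w k x)) \<le> (LBINT x. norm (g x))"
  proof (rule integral_mono[OF integrable_norm[OF gi] integrable_norm[OF g]])
   show "norm (g x * w k x) \<le> norm (g x)" for x using w(2)[of k x] by (simp add: norm_mult mult_left_le)
  qed
  thus ?thesis by (rule order_trans[OF integral_norm_bound])
 qed
 have "box_int L (\<lambda>x. v x * (\<Sum>\<^sub>\<infinity>k. c k * w k x)) = (LBINT x. \<integral>k. ?h x k \<partial>?N)"
  by (rule Bochner_Integration.integral_cong[OF refl]) (simp only: cs, simp add: g_def)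
 also have "\<dots> = (\<integral>k. \<integral>x. ?h x k \<partial>lborel \<partial>?N)" by (rule P.Fubini_integral[symmetric, OF h_int])
 also have "\<dots> = (\<integral>k. c k * (LBINT x. g x * w k x) \<partial>?N)" by (simp only: I)
 also have "\<dots> = (\<Sum>\<^sub>\<infinity>k. c k * (LBINT x. g x * w k x))"
 proof (rule count_space_infsum(2))
  have "(\<lambda>k. norm (c k) * (LBINT x. norm (g x))) summable_on UNIV" by (rule summable_on_cmult_left[OF c])
  thus "(\<lambda>k. norm (c k * (LBINT x. g x * w k x))) summable_on UNIV"
   by (rule summable_on_comparison_test) (use Ib in \<open>auto simp: norm_mult mult_left_mono\<close>)
 qed
 finally show ?thesis by (simp add: g_def)
qed

text \<open>A shift by half a period in a coordinate where m does not vanish changes the sign of the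
  character, while the box integral of a periodic function is invariant under shifts; so the
  integral equals its own negative.\<close>

lemma box_char_integral:
 assumes L: "L > 0"
 shows "box_int L (\<lambda>x. tchar L (m :: int^'n) x) = (if m = 0 then of_real (L ^ CARD('n)) else 0)"
proof (cases "m = 0")
 case True
 have "(LBINT x. indicator (box_L L :: (real^'n) set) x *\<^sub>R (1::complex)) = measure lborel (box_L L :: (real^'n) set) *\<^sub>R 1"
  using box_L_finite[OF L, where 'n = 'n] by (subst integral_scaleR_left) (auto intro: integrable_real_indicator)
 also have "measure lborel (box_L L :: (real^'n) set) = L ^ CARD('n)"
  using box_L_finite[OF L, where 'n = 'n] L by (simp add: measure_def)
 finally show ?thesis using True by (simp add: scaleR_conv_of_real)
next
 case False
 then obtain i where i: "m $ i \<noteq> 0" by (auto simp: vec_eq_iff)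
 define s :: "real^'n" where "s = axis i (L / (2 * of_int (m $ i)))"
 have s: "tchar L m s = -1"
 proof -
  have e1: "rvec m \<bullet> s = L / 2" using i by (simp add: s_def inner_axis)
  have e2: "2 * pi / L * (L / 2) = pi" using L by simp
  show ?thesis by (simp only: tchar_def e1 e2 cis_pi)
 qed
 let ?I = "\<integral>x. indicator (box_L L) x *\<^sub>R tchar L m x \<partial>lborel"
 let ?F = "\<lambda>x. indicator (box_L L) (x + s) *\<^sub>R tchar L m (x + s)"
 have base: "integrable lborel (\<lambda>x. indicator (box_L L) x *\<^sub>R tchar L m x)"
  by (rule box_integrable[OF L tchar_continuous])
 have F: "integrable lborel ?F"
 proof -
  have "integrable (distr lborel borel ((+) s)) (\<lambda>x. indicator (box_L L) x *\<^sub>R tchar L m x)"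
   using base by (simp add: lborel_distr_plus)
  hence "integrable lborel (\<lambda>x. indicator (box_L L) (s + x) *\<^sub>R tchar L m (s + x))"
   by (subst (asm) integrable_distr_eq) auto
  thus ?thesis by (simp add: add.commute)
 qed
 have "?I = (LBINT x. ?F x)" by (rule lborel_integral_shift[symmetric]) measurable
 also have "\<dots> = box_int L (\<lambda>x. \<integral>k. ?F (x + L *\<^sub>R rvec k) \<partial>count_space UNIV)"
  by (rule unfold_integral[OF F L])
 also have "\<dots> = (LBINT x. tchar L m s * (indicator (box_L L) x *\<^sub>R tchar L m x))"
 proof (rule Bochner_Integration.integral_cong[OF refl])
  fix x
  \<comment> \<open>The only lattice vector that brings x + s back into the box.\<close>
  define k0 :: "int^'n" where "k0 = - (\<chi> i. \<lfloor>(x + s) $ i / L\<rfloor>)"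
  have "x + L *\<^sub>R rvec k + s \<in> box_L L \<longleftrightarrow> k = k0" for k
  proof -
   have "rvec (- k) = - rvec k" by (simp add: vec_eq_iff)
   hence "x + L *\<^sub>R rvec k + s = (x + s) - L *\<^sub>R rvec (- k)" by simp
   hence "x + L *\<^sub>R rvec k + s \<in> box_L L \<longleftrightarrow> - k = (\<chi> i. \<lfloor>(x + s) $ i / L\<rfloor>)"
    using box_L_unique[OF L, of "x + s" "- k"] by metis
   thus ?thesis unfolding k0_def by (metis minus_minus)
  qed
  hence ind: "indicator (box_L L) (x + L *\<^sub>R rvec k + s) = (indicator {k0} k :: real)" for k
   by (auto simp: indicator_def)
  have "tchar L m (x + L *\<^sub>R rvec k + s) = tchar L m (x + s)" for k
   using tchar_periodic[OF L, of m "x + s" k] by (simp add: algebra_simps)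
  hence "(\<integral>k. ?F (x + L *\<^sub>R rvec k) \<partial>count_space UNIV) = (\<integral>k. indicator {k0} k *\<^sub>R tchar L m (x + s) \<partial>count_space UNIV)"
   by (simp only: ind)
  also have "\<dots> = tchar L m (x + s)"
   by (subst integral_scaleR_left) (auto simp: emeasure_count_space measure_count_space intro: integrable_real_indicator)
  finally show "indicator (box_L L) x *\<^sub>R (\<integral>k. ?F (x + L *\<^sub>R rvec k) \<partial>count_space UNIV) = tchar L m s * (indicator (box_L L) x *\<^sub>R tchar L m x)"
   by (simp add: tchar_add mult.commute)
 qed
 also have "\<dots> = - ?I" by (simp add: s)
 finally show ?thesis using False by simp
qed

lemma periodize_periodic: "periodize f L (x + L *\<^sub>R rvec (l :: int^'n)) = periodize f L x"
proof -
 have bij: "bij_betw (\<lambda>k. l + k) UNIV (UNIV :: (int^'n) set)" by (rule bij_betwI[where g = "\<lambda>k. k - l"]) auto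
 have "rvec (l + k) = rvec l + rvec k" for k by (simp add: vec_eq_iff)
 hence "periodize f L (x + L *\<^sub>R rvec l) = (\<Sum>\<^sub>\<infinity>k. f (x + L *\<^sub>R rvec (l + k)))"
  unfolding periodize_def by (simp add: algebra_simps)
 also have "\<dots> = periodize f L x" unfolding periodize_def by (rule infsum_reindex_bij_betw[OF bij])
 finally show ?thesis .
qed

text \<open>The character is periodic, so it can be pulled inside the lattice sum, and
  \<open>unfold_integral\<close> turns the box integral into one over the whole space.\<close>

lemma periodize_coefficient:
 fixes f :: "real^'n \<Rightarrow> real"
 assumes f: "tame f" and L: "L > 0"
 shows "box_int L (\<lambda>x. of_real (periodize f L (x - y)) * tchar L (- k) x)
   = tchar L (- k) y * FT f (rvec k /\<^sub>R L)"
proof -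
 let ?F = "\<lambda>x. f (x - y) *\<^sub>R tchar L (- k) x"
 have f_int: "integrable lborel f" by (rule tame_integrable[OF f])
 have fm [measurable]: "f \<in> borel_measurable borel" using f_int by (simp add: borel_measurable_integrable)
 have base: "integrable lborel (\<lambda>x. f x *\<^sub>R tchar L (- k) (x + y))"
 proof (rule Bochner_Integration.integrable_bound[OF f_int])
  show "AE x in lborel. norm (f x *\<^sub>R tchar L (- k) (x + y)) \<le> norm (f x)" by simp
 qed measurable
 have F: "integrable lborel ?F"
 proof -
  have "integrable (distr lborel borel ((+) (- y))) (\<lambda>x. f x *\<^sub>R tchar L (- k) (x + y))"
   using base by (simp add: lborel_distr_plus)
  thus ?thesis by (subst (asm) integrable_distr_eq) auto
 qed
 have "box_int L (\<lambda>x. of_real (periodize f L (x - y)) * tchar L (- k) x)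
   = box_int L (\<lambda>x. \<integral>j. ?F (x + L *\<^sub>R rvec j) \<partial>count_space UNIV)"
 proof (rule Bochner_Integration.integral_cong[OF refl])
  fix x
  have s: "(\<lambda>j. norm (f (x - y + L *\<^sub>R rvec j))) summable_on UNIV"
   using tame_lattice_summable[OF f L, of "x - y"] by simp
  have "(\<integral>j. ?F (x + L *\<^sub>R rvec j) \<partial>count_space UNIV) = (\<integral>j. f (x - y + L *\<^sub>R rvec j) *\<^sub>R tchar L (- k) x \<partial>count_space UNIV)"
   by (simp add: tchar_periodic[OF L] algebra_simps)
  also have "\<dots> = (\<integral>j. f (x - y + L *\<^sub>R rvec j) \<partial>count_space UNIV) *\<^sub>R tchar L (- k) x"
   by (rule integral_scaleR_left) (rule count_space_infsum(1)[OF s])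
  also have "(\<integral>j. f (x - y + L *\<^sub>R rvec j) \<partial>count_space UNIV) = periodize f L (x - y)"
   unfolding periodize_def by (rule count_space_infsum(2)[OF s])
  finally show "indicator (box_L L) x *\<^sub>R (of_real (periodize f L (x - y)) * tchar L (- k) x)
    = indicator (box_L L) x *\<^sub>R (\<integral>j. ?F (x + L *\<^sub>R rvec j) \<partial>count_space UNIV)"
   by (simp add: scaleR_conv_of_real)
 qed
 also have "\<dots> = (LBINT x. ?F x)" by (rule unfold_integral[OF F L, symmetric])
 also have "\<dots> = (LBINT x. ?F (x + y))" by (rule lborel_integral_shift[symmetric]) measurable
 also have "\<dots> = (LBINT x. tchar L (- k) y * (f x *\<^sub>R tchar L (- k) x))"
  by (rule Bochner_Integration.integral_cong) (auto simp: tchar_add scaleR_conv_of_real mult_ac)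
 also have "\<dots> = tchar L (- k) y * FT f (rvec k /\<^sub>R L)" by (simp only: integral_mult_right_zero FT_tchar)
 finally show ?thesis .
qed

text \<open>Both sides are continuous and periodic with equal Fourier coefficients. As
  \<open>fourier_uniqueness\<close> is about real functions, the series is first shown to be real:
  its coefficients at k and -k are conjugate.\<close>

theorem poisson_summation:
 fixes f :: "real^'n \<Rightarrow> real"
 assumes f: "tame f" and L: "L > 0" and s: "(\<lambda>k. norm (FT f (rvec k /\<^sub>R L))) summable_on UNIV"
 shows "of_real (periodize f L x) = (\<Sum>\<^sub>\<infinity>k. FT f (rvec k /\<^sub>R L) * tchar L k x) / of_real (L ^ CARD('n))"
proof -
 define c where "c k = FT f (rvec k /\<^sub>R L) / of_real (L ^ CARD('n))" for k
 define g where "g x = (\<Sum>\<^sub>\<infinity>k. c k * tchar L k x)" for x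
 have c: "(\<lambda>k. norm (c k)) summable_on UNIV"
  using summable_on_cmult_left[OF s, of "1 / norm (of_real (L ^ CARD('n)) :: complex)"] by (simp add: c_def norm_divide)
 have bij: "bij_betw uminus UNIV (UNIV :: (int^'n) set)" by (rule bij_betwI[where g = uminus]) auto
 have cnj_c: "cnj (c k) = c (- k)" for k
 proof -
  have "cnj (FT f (rvec k /\<^sub>R L)) = (LBINT x. cnj (f x *\<^sub>R tchar L (- k) x))"
   unfolding FT_tchar by (rule Bochner_Integration.integral_cnj[symmetric])
  also have "\<dots> = FT f (rvec (- k) /\<^sub>R L)" unfolding FT_tchar by (simp add: tchar_minus)
  finally have "cnj (FT f (rvec k /\<^sub>R L)) = FT f (rvec (- k) /\<^sub>R L)" .
  thus ?thesis by (simp add: c_def)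
 qed
 have "cnj (g y) = g y" for y
 proof -
  have "cnj (g y) = (\<Sum>\<^sub>\<infinity>k. c (- k) * tchar L (- k) y)"
   unfolding g_def infsum_cnj[symmetric] by (simp add: cnj_c tchar_minus)
  also have "\<dots> = g y" unfolding g_def by (rule infsum_reindex_bij_betw[OF bij])
  finally show ?thesis .
 qed
 hence g_real: "of_real (Re (g y)) = g y" for y by (metis Reals_cnj_iff of_real_Re)
 have g_cont: "continuous_on UNIV g" unfolding g_def by (rule infsum_continuous[OF c]) (auto intro: tchar_continuous)
 define u where "u x = periodize f L x - Re (g x)" for x
 have "u x = 0"
 proof (rule fourier_uniqueness[OF L])
  show "continuous_on UNIV u" unfolding u_def
   by (intro continuous_intros periodize_continuous[OF f L] g_cont)
  have "g (x + L *\<^sub>R rvec k) = g x" for x k by (simp add: g_def tchar_periodic[OF L])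
  thus "u (x + L *\<^sub>R rvec k) = u x" for x k by (simp add: u_def periodize_periodic)
  fix k :: "int^'n"
  have i1: "integrable lborel (\<lambda>x. indicator (box_L L) x *\<^sub>R (of_real (periodize f L x) * tchar L k x))"
   and i2: "integrable lborel (\<lambda>x. indicator (box_L L) x *\<^sub>R (tchar L k x * g x))"
   by (intro box_integrable[OF L] continuous_intros periodize_continuous[OF f L] g_cont)+
  have p: "box_int L (\<lambda>x. of_real (periodize f L x) * tchar L k x) = FT f (rvec (- k) /\<^sub>R L)"
   using periodize_coefficient[OF f L, of 0 "- k"] by simp
  have "box_int L (\<lambda>x. tchar L k x * g x)
    = (\<Sum>\<^sub>\<infinity>j. c j * box_int L (\<lambda>x. tchar L k x * tchar L j x))"
   unfolding g_def by (rule box_infsum_integral[OF L c]) (auto intro: tchar_continuous)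
  also have "\<dots> = (\<Sum>\<^sub>\<infinity>j. c j * (if k + j = 0 then of_real (L ^ CARD('n)) else 0))"
   by (simp only: tchar_plus[symmetric] box_char_integral[OF L])
  also have "\<dots> = (\<Sum>\<^sub>\<infinity>j\<in>{- k}. c j * (if k + j = 0 then of_real (L ^ CARD('n)) else 0))"
   by (rule infsum_cong_neutral) (auto simp: add_eq_0_iff)
  also have "\<dots> = FT f (rvec (- k) /\<^sub>R L)" using L by (simp add: c_def)
  finally have q: "box_int L (\<lambda>x. tchar L k x * g x) = FT f (rvec (- k) /\<^sub>R L)" .
  have "indicator (box_L L) x *\<^sub>R (of_real (u x) * tchar L k x) = indicator (box_L L) x *\<^sub>R (of_real (periodize f L x) * tchar L k x)
    - indicator (box_L L) x *\<^sub>R (tchar L k x * g x)" for x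
   by (simp add: u_def g_real algebra_simps)
  hence "box_int L (\<lambda>x. of_real (u x) * tchar L k x)
   = (LBINT x. indicator (box_L L) x *\<^sub>R (of_real (periodize f L x) * tchar L k x) - indicator (box_L L) x *\<^sub>R (tchar L k x * g x))"
   by (simp only:)
  also have "\<dots> = 0" unfolding Bochner_Integration.integral_diff[OF i1 i2] p q by simp
  finally show "box_int L (\<lambda>x. of_real (u x) * tchar L k x) = 0" .
 qed
 hence "of_real (periodize f L x) = g x" using g_real[of x] by (simp add: u_def)
 also have "g x = (\<Sum>\<^sub>\<infinity>k. FT f (rvec k /\<^sub>R L) * tchar L k x) / of_real (L ^ CARD('n))"
  unfolding g_def c_def divide_inverse by (subst infsum_cmult_left'[symmetric]) (simp add: mult_ac)
 finally show ?thesis .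
qed

subsection \<open>Decay of the Fourier transform\<close>

text \<open>The power 2 d is the one that compares with \<open>maj\<close>; being radial, it passes
  through convolutions by the triangle inequality.\<close>

definition decays :: "(real^'n \<Rightarrow> real) \<Rightarrow> bool" where
 "decays f \<longleftrightarrow> continuous_on UNIV f \<and> (\<exists>C. \<forall>x. (1 + norm x) ^ (2 * CARD('n)) * \<bar>f x\<bar> \<le> C)"

lemma decays_maj:
 fixes f :: "real^'n \<Rightarrow> real"
 assumes "(1 + norm x) ^ (2 * CARD('n)) * \<bar>f x\<bar> \<le> C"
 shows "\<bar>f x\<bar> \<le> C * maj x"
proof -
 have "\<bar>f x\<bar> * 1 \<le> \<bar>f x\<bar> * ((1 + norm x) ^ (2 * CARD('n)) * maj x)"
  by (intro mult_left_mono maj_le_norm) auto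
 also have "\<dots> = ((1 + norm x) ^ (2 * CARD('n)) * \<bar>f x\<bar>) * maj x" by (simp add: mult_ac)
 also have "\<dots> \<le> C * maj x" by (rule mult_right_mono[OF assms]) (simp add: less_imp_le maj_pos)
 finally show ?thesis by simp
qed

lemma decays_tame: "decays f \<Longrightarrow> tame f" unfolding decays_def tame_def using decays_maj by blast

lemma iter_pderiv_append: "iter_pderiv js (iter_pderiv is f) = iter_pderiv (js @ is) f" by (induction js) auto

lemma schwartz_iter_pderiv: "schwartz f \<Longrightarrow> schwartz (iter_pderiv is f)"
 unfolding schwartz_def iter_pderiv_append by blast

lemma schwartz_decays: "schwartz f \<Longrightarrow> decays f"
proof -
 assume s: "schwartz f"
 have "f differentiable (at x)" for x using s[unfolded schwartz_def, THEN conjunct1, rule_format, of "[]" x] by simp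
 hence "continuous_on UNIV f" by (intro continuous_at_imp_continuous_on ballI differentiable_imp_continuous_within) auto
 moreover have "\<exists>C. \<forall>x. (1 + norm x) ^ k * \<bar>f x\<bar> \<le> C" for k
  using s unfolding schwartz_def by (metis iter_pderiv.simps(1))
 ultimately show ?thesis by (simp add: decays_def)
qed

lemma integrable_FT:
 assumes "integrable lborel f"
 shows "integrable lborel (\<lambda>x. f x *\<^sub>R fchar \<xi> x)"
proof (rule Bochner_Integration.integrable_bound[OF assms])
 have "f \<in> borel_measurable borel" using assms by (simp add: borel_measurable_integrable)
 moreover have "(\<lambda>x. fchar \<xi> x) \<in> borel_measurable borel"
  by (intro borel_measurable_continuous_onI continuous_intros)
 ultimately show "(\<lambda>x. f x *\<^sub>R fchar \<xi> x) \<in> borel_measurable lborel" by simp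
qed auto

lemma norm_FT_le: "integrable lborel f \<Longrightarrow> norm (FT f \<xi>) \<le> (LBINT x. \<bar>f x\<bar>)"
 unfolding FT_def using integral_norm_bound[of lborel "\<lambda>x. f x *\<^sub>R fchar \<xi> x"] by simp

text \<open>The transform of a difference quotient is explicit because a shift of f becomes a phase;
  by domination it also converges to the transform of the derivative. This takes the place of
  integration by parts.\<close>

lemma FT_pderiv:
 fixes f :: "real^'n \<Rightarrow> real"
 assumes s: "schwartz f"
 shows "FT (iter_pderiv [i] f) \<xi> = (2 * pi * \<xi> $ i) * \<i> * FT f \<xi>"
proof -
 let ?e = "axis i (1::real) :: real^'n"
 define p where "p = iter_pderiv [i] f"
 have f_int: "integrable lborel f" by (intro tame_integrable decays_tame schwartz_decays s)
 have p_dec: "decays p" unfolding p_def by (intro schwartz_decays schwartz_iter_pderiv s)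
 then obtain C where C: "\<And>x. (1 + norm x) ^ (2 * CARD('n)) * \<bar>p x\<bar> \<le> C" by (auto simp: decays_def)
 have diff: "f differentiable (at x)" for x using s[unfolded schwartz_def, THEN conjunct1, rule_format, of "[]" x] by simp
 have deriv: "((\<lambda>t. f (x + t *\<^sub>R ?e)) has_real_derivative p (x + t *\<^sub>R ?e)) (at t)" for x t
 proof -
  have "(f has_derivative frechet_derivative f (at (x + t *\<^sub>R ?e))) (at (x + t *\<^sub>R ?e))"
   using diff frechet_derivative_works by blast
  moreover have "((\<lambda>t. x + t *\<^sub>R ?e) has_derivative (\<lambda>h. h *\<^sub>R ?e)) (at t)"
   by (auto intro!: derivative_eq_intros)
  ultimately have "((\<lambda>t. f (x + t *\<^sub>R ?e)) has_derivative (\<lambda>h. frechet_derivative f (at (x + t *\<^sub>R ?e)) (h *\<^sub>R ?e))) (at t)"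
   by (rule has_derivative_compose[rotated])
  moreover have "frechet_derivative f (at (x + t *\<^sub>R ?e)) (h *\<^sub>R ?e) = p (x + t *\<^sub>R ?e) * h" for h
   using linear_frechet_derivative[OF diff] by (simp add: linear_cmul p_def)
  ultimately show ?thesis by (simp add: has_field_derivative_def)
 qed
 define h where "h n = 1 / real (Suc n)" for n
 have h: "0 < h n" "h n \<le> 1" for n by (auto simp: h_def)
 have h0: "h \<longlonglongrightarrow> 0" unfolding h_def using LIMSEQ_inverse_real_of_nat by (simp add: inverse_eq_divide)
 have hat0: "filterlim h (at 0) sequentially" unfolding filterlim_at using h0 by (auto simp: h_def)
 define q where "q n x = (f (x + h n *\<^sub>R ?e) - f x) / h n" for n x
 have q_lim: "(\<lambda>n. q n x) \<longlonglongrightarrow> p x" for x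
 proof -
  have "((\<lambda>t. (f (x + t *\<^sub>R ?e) - f x) / t) \<longlongrightarrow> p x) (at 0)"
   using deriv[of x 0] by (simp add: DERIV_def)
  from filterlim_compose[OF this hat0] show ?thesis by (simp add: q_def)
 qed
 \<comment> \<open>The mean value theorem evaluates p within distance 1 of x, and such a move
   changes 1 + |x| by a factor of at most 2.\<close>
 have q_bound: "\<bar>q n x\<bar> \<le> 2 ^ (2 * CARD('n)) * C * maj x" for n x
 proof -
  have "\<exists>t. 0 < t \<and> t < h n \<and> f (x + h n *\<^sub>R ?e) - f (x + 0 *\<^sub>R ?e) = (h n - 0) * p (x + t *\<^sub>R ?e)"
   using h deriv by (intro MVT2) auto
  then obtain t where t: "0 < t" "t < h n" "q n x = p (x + t *\<^sub>R ?e)" using h[of n] by (auto simp: q_def)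
  let ?y = "x + t *\<^sub>R ?e"
  have "norm x \<le> norm ?y + norm (t *\<^sub>R ?e)" using norm_triangle_ineq4[of ?y "t *\<^sub>R ?e"] by simp
  moreover have "norm (t *\<^sub>R ?e) \<le> 1" using t h(2)[of n] by simp
  ultimately have "norm x \<le> norm ?y + 1" by (rule order_trans[OF _ add_left_mono])
  also have "norm ?y + 1 \<le> 1 + 2 * norm ?y" by simp
  finally have "1 + norm x \<le> 2 * (1 + norm ?y)" by simp
  hence "(1 + norm x) ^ (2 * CARD('n)) \<le> (2 * (1 + norm ?y)) ^ (2 * CARD('n))" by (intro power_mono) auto
  hence "(1 + norm x) ^ (2 * CARD('n)) * \<bar>p ?y\<bar> \<le> (2 * (1 + norm ?y)) ^ (2 * CARD('n)) * \<bar>p ?y\<bar>"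
   by (rule mult_right_mono) simp
  also have "\<dots> = 2 ^ (2 * CARD('n)) * ((1 + norm ?y) ^ (2 * CARD('n)) * \<bar>p ?y\<bar>)" by (simp only: power_mult_distrib mult.assoc)
  also have "\<dots> \<le> 2 ^ (2 * CARD('n)) * C" by (rule mult_left_mono[OF C]) simp
  finally show ?thesis unfolding t(3)[symmetric] by (rule decays_maj)
 qed
 have fm [measurable]: "f \<in> borel_measurable borel" using f_int by (simp add: borel_measurable_integrable)
 have pm [measurable]: "p \<in> borel_measurable borel" using p_dec by (simp add: decays_def borel_measurable_continuous_onI)
 have em [measurable]: "(\<lambda>x. fchar \<xi> x) \<in> borel_measurable borel"
  by (intro borel_measurable_continuous_onI continuous_intros)
 have qm [measurable]: "q n \<in> borel_measurable borel" for n unfolding q_def by measurable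
 have lim1: "(\<lambda>n. \<integral>x. q n x *\<^sub>R fchar \<xi> x \<partial>lborel) \<longlonglongrightarrow> FT p \<xi>"
  unfolding FT_def
 proof (rule integral_dominated_convergence[where w = "\<lambda>x. 2 ^ (2 * CARD('n)) * C * maj x"])
  show "AE x in lborel. (\<lambda>n. q n x *\<^sub>R fchar \<xi> x) \<longlonglongrightarrow> p x *\<^sub>R fchar \<xi> x"
   by (intro AE_I2 tendsto_intros q_lim)
  show "AE x in lborel. norm (q n x *\<^sub>R fchar \<xi> x) \<le> 2 ^ (2 * CARD('n)) * C * maj x" for n
   using q_bound by (intro AE_I2) simp
  show "integrable lborel (\<lambda>x. 2 ^ (2 * CARD('n)) * C * maj (x :: real^'n))"
   by (intro integrable_mult_right maj_integrable)
 qed measurable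
 have val: "(LBINT x. q n x *\<^sub>R fchar \<xi> x) = (cis (2 * pi * \<xi> $ i * h n) - 1) / h n * FT f \<xi>" for n
 proof -
  let ?g = "\<lambda>x. f x *\<^sub>R fchar \<xi> x"
  have g: "integrable lborel ?g" by (rule integrable_FT[OF f_int])
  have gs: "integrable lborel (\<lambda>x. ?g (x + h n *\<^sub>R ?e))"
  proof -
   have "integrable (distr lborel borel ((+) (h n *\<^sub>R ?e))) ?g" using g by (simp add: lborel_distr_plus)
   thus ?thesis by (subst (asm) integrable_distr_eq) (auto simp: add.commute)
  qed
  have "q n x *\<^sub>R fchar \<xi> x = (cis (2 * pi * \<xi> $ i * h n) / h n) * ?g (x + h n *\<^sub>R ?e) - (1 / h n) * ?g x" for x
  proof -
   have "fchar \<xi> x = cis (2 * pi * \<xi> $ i * h n) * cis (- (2 * pi * (\<xi> \<bullet> (x + h n *\<^sub>R ?e))))"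
    by (simp add: cis_mult inner_add_right inner_axis algebra_simps)
   thus ?thesis using h(1)[of n]
    by (simp add: q_def scaleR_conv_of_real diff_divide_distrib algebra_simps)
  qed
  hence "(LBINT x. q n x *\<^sub>R fchar \<xi> x)
    = (LBINT x. (cis (2 * pi * \<xi> $ i * h n) / h n) * ?g (x + h n *\<^sub>R ?e) - (1 / h n) * ?g x)" by (simp only:)
  also have "\<dots> = (cis (2 * pi * \<xi> $ i * h n) / h n) * (LBINT x. ?g (x + h n *\<^sub>R ?e)) - (1 / h n) * (LBINT x. ?g x)"
   using g gs by (subst Bochner_Integration.integral_diff) (auto simp only: integral_mult_right_zero intro!: integrable_mult_right)
  also have "(LBINT x. ?g (x + h n *\<^sub>R ?e)) = FT f \<xi>"
   unfolding FT_def by (rule lborel_integral_shift) measurable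
  finally show ?thesis by (simp add: FT_def algebra_simps diff_divide_distrib)
 qed
 define w :: complex where "w = \<i> * of_real (2 * pi * \<xi> $ i)"
 have "((\<lambda>z. exp (z * w)) has_field_derivative w) (at 0)" by (auto intro!: derivative_eq_intros)
 hence "((\<lambda>z. (exp (z * w) - 1) / z) \<longlongrightarrow> w) (at 0)" by (simp add: DERIV_def)
 moreover have "filterlim (\<lambda>n. complex_of_real (h n)) (at 0) sequentially"
 proof (rule filterlim_atI)
  show "(\<lambda>n. complex_of_real (h n)) \<longlonglongrightarrow> 0" using tendsto_of_real[OF h0, where 'a = complex] by simp
  show "\<forall>\<^sub>F n in sequentially. complex_of_real (h n) \<noteq> 0"
  proof (rule always_eventually, rule allI)
   fix n show "complex_of_real (h n) \<noteq> 0" using h(1)[of n] by simp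
  qed
 qed
 ultimately have "(\<lambda>n. (exp (of_real (h n) * w) - 1) / of_real (h n)) \<longlonglongrightarrow> w" by (rule filterlim_compose)
 moreover have "exp (of_real (h n) * w) = cis (2 * pi * \<xi> $ i * h n)" for n
  by (simp add: w_def cis_conv_exp mult_ac)
 ultimately have lim2: "(\<lambda>n. (cis (2 * pi * \<xi> $ i * h n) - 1) / h n * FT f \<xi>) \<longlonglongrightarrow> w * FT f \<xi>"
  by (intro tendsto_intros) simp
 show ?thesis using LIMSEQ_unique[OF lim1[unfolded val] lim2] by (simp add: p_def w_def mult_ac)
qed

lemma FT_pderiv_power:
 assumes s: "schwartz f"
 shows "FT (iter_pderiv (replicate m i) f) \<xi> = ((2 * pi * \<xi> $ i) * \<i>) ^ m * FT f \<xi>"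
proof (induction m)
 case (Suc m)
 have "FT (iter_pderiv (replicate (Suc m) i) f) \<xi> = FT (iter_pderiv [i] (iter_pderiv (replicate m i) f)) \<xi>"
  by (simp add: iter_pderiv_append)
 also have "\<dots> = (2 * pi * \<xi> $ i) * \<i> * FT (iter_pderiv (replicate m i) f) \<xi>"
  by (rule FT_pderiv) (rule schwartz_iter_pderiv[OF s])
 finally show ?case by (simp add: Suc.IH mult.assoc)
qed simp

text \<open>It suffices to differentiate in the direction of the largest coordinate of \<xi>, whose
  modulus is at least |\<xi>| / d.\<close>

lemma FT_decay:
 fixes f :: "real^'n \<Rightarrow> real"
 assumes s: "schwartz f"
 obtains C where "\<And>\<xi>. norm \<xi> ^ m * norm (FT f \<xi>) \<le> C"
proof
 let ?d = "real CARD('n)"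
 define I where "I i = (LBINT x. \<bar>iter_pderiv (replicate m i) f x\<bar>)" for i
 have I0: "I i \<ge> 0" for i unfolding I_def by simp
 fix \<xi> :: "real^'n"
 obtain i where i: "\<And>j. \<bar>\<xi> $ j\<bar> \<le> \<bar>\<xi> $ i\<bar>"
  using Max_in[of "range (\<lambda>j. \<bar>\<xi> $ j\<bar>)"] Max_ge[of "range (\<lambda>j. \<bar>\<xi> $ j\<bar>)"]
  by (metis (no_types, lifting) finite_class.finite_UNIV finite_imageI image_iff image_is_empty rangeI UNIV_not_empty)
 have "norm \<xi> \<le> (\<Sum>j\<in>UNIV. \<bar>\<xi> $ j\<bar>)" by (rule norm_le_l1_cart)
 also have "\<dots> \<le> (\<Sum>j\<in>(UNIV::'n set). \<bar>\<xi> $ i\<bar>)" by (intro sum_mono i)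
 also have "\<dots> = ?d * \<bar>\<xi> $ i\<bar>" by simp
 also have "\<dots> \<le> ?d * (2 * pi * \<bar>\<xi> $ i\<bar>)"
  using pi_ge_two by (intro mult_left_mono) (simp_all add: mult_le_cancel_right1)
 finally have "norm \<xi> ^ m * norm (FT f \<xi>) \<le> (?d * (2 * pi * \<bar>\<xi> $ i\<bar>)) ^ m * norm (FT f \<xi>)"
  by (intro mult_right_mono power_mono) auto
 also have "\<dots> = ?d ^ m * norm (FT (iter_pderiv (replicate m i) f) \<xi>)"
  unfolding FT_pderiv_power[OF s] by (simp add: norm_mult norm_power power_mult_distrib abs_mult)
 also have "\<dots> \<le> ?d ^ m * I i"
  unfolding I_def by (intro mult_left_mono norm_FT_le tame_integrable decays_tame schwartz_decays schwartz_iter_pderiv s) simp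
 also have "\<dots> \<le> ?d ^ m * (\<Sum>i\<in>UNIV. I i)" by (intro mult_left_mono member_le_sum) (auto simp: I0)
 finally show "norm \<xi> ^ m * norm (FT f \<xi>) \<le> ?d ^ m * (\<Sum>i\<in>UNIV. I i)" .
qed

section \<open>Bounds for the Fourier transform of the density\<close>

locale schwartz_density =
 fixes \<phi> :: "real^'n \<Rightarrow> real"
 assumes schw: "schwartz \<phi>" and nonneg: "\<And>x. \<phi> x \<ge> 0" and total: "(LBINT x. \<phi> x) = 1"
begin

lemma phi_decays: "decays \<phi>" by (rule schwartz_decays[OF schw])
lemma phi_tame: "tame \<phi>" by (rule decays_tame[OF phi_decays])
lemma phi_integrable: "integrable lborel \<phi>" by (rule tame_integrable[OF phi_tame])
lemma phi_cont: "continuous_on UNIV \<phi>" using phi_tame by (simp add: tame_def)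

lemma phi_ball: "\<exists>x0 r \<epsilon>. r > 0 \<and> \<epsilon> > 0 \<and> (\<forall>x\<in>ball x0 r. \<phi> x \<ge> \<epsilon>)"
proof -
 have "\<exists>x0. \<phi> x0 > 0"
 proof (rule ccontr)
  assume "\<nexists>x0. \<phi> x0 > 0"
  hence "\<phi> = (\<lambda>_. 0)" using nonneg by (auto simp: fun_eq_iff not_less intro: antisym)
  thus False using total by simp
 qed
 then obtain x0 where x0: "\<phi> x0 > 0" by blast
 have "isCont \<phi> x0" using phi_cont by (simp add: continuous_on_eq_continuous_at)
 then obtain r where r: "r > 0" "\<And>x. dist x x0 < r \<Longrightarrow> dist (\<phi> x) (\<phi> x0) < \<phi> x0 / 2"
  using x0 unfolding continuous_at_eps_delta by (metis half_gt_zero)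
 have "\<phi> x \<ge> \<phi> x0 / 2" if "x \<in> ball x0 r" for x
  using r(2)[of x] that by (auto simp: dist_commute dist_real_def abs_if split: if_splits)
 thus ?thesis using r x0 by (intro exI[of _ x0] exI[of _ r] exI[of _ "\<phi> x0 / 2"]) auto
qed

lemma FT_0: "FT \<phi> 0 = 1"
proof -
 have "FT \<phi> 0 = (LBINT x. complex_of_real (\<phi> x))" by (simp add: FT_def scaleR_conv_of_real)
 thus ?thesis by (simp add: total)
qed

lemma FT_le_1: "norm (FT \<phi> \<xi>) \<le> 1"
 using norm_FT_le[OF phi_integrable, of \<xi>] by (simp add: nonneg total)

text \<open>1 - cos y = 2 sin^2 (y / 2), and sin t \<ge> t / 2 on [0,1] since cos \<ge> 1 / 2 up to
  pi / 3.\<close>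

lemma one_minus_cos_ge:
 assumes "\<bar>y :: real\<bar> \<le> 1" shows "y\<^sup>2 / 8 \<le> 1 - cos y"
proof -
 have s: "sin t \<ge> t / 2" if t: "0 \<le> t" "t \<le> 1" for t :: real
 proof (cases "t = 0")
  case False
  hence "\<exists>z. 0 < z \<and> z < t \<and> sin t - sin 0 = (t - 0) * cos z" using t by (intro MVT2) (auto intro: DERIV_sin)
  then obtain z where z: "0 < z" "z < t" "sin t = t * cos z" by auto
  have "cos (pi / 3) \<le> cos z" using z t pi_gt3 by (intro cos_monotone_0_pi_le) auto
  thus ?thesis using z t by (simp add: cos_60 mult_left_mono[of "1/2" "cos z" t, simplified])
 qed simp
 define t where "t = \<bar>y\<bar> / 2"
 have "(t / 2)\<^sup>2 \<le> (sin t)\<^sup>2" using s[of t] assms by (intro power_mono) (auto simp: t_def)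
 moreover have "cos y = 1 - 2 * (sin t)\<^sup>2"
 proof -
  have "cos y = cos (2 * t)" by (simp add: t_def abs_if)
  also have "\<dots> = 1 - 2 * (sin t)\<^sup>2" by (simp add: cos_double_sin)
  finally show ?thesis .
 qed
 moreover have "(t / 2)\<^sup>2 = y\<^sup>2 / 16" by (simp add: t_def power2_eq_square abs_mult_self_eq)
 ultimately show ?thesis by simp
qed

text \<open>1 - |FT| is the mean of 1 - cos A for a phase A. On a ball where \<phi> \<ge>
  \<epsilon>, the phases at x and x + s differ by 2 pi times the inner product of \<xi> and s, so
  they cannot both be close to multiples of 2 pi. This bounds the mean from below by a multiple of
  |\<xi>|^2, uniformly for |\<xi>| \<le> R.\<close>

lemma FT_local:
 assumes R: "R > 0"
 obtains \<kappa> where "\<kappa> > 0" "\<And>\<xi>. norm \<xi> \<le> R \<Longrightarrow> norm (FT \<phi> \<xi>) \<le> 1 - \<kappa> * (norm \<xi>)\<^sup>2"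
proof -
 obtain x0 r \<epsilon> where r: "r > 0" "\<epsilon> > 0" "\<And>x. x \<in> ball x0 r \<Longrightarrow> \<phi> x \<ge> \<epsilon>" using phi_ball by blast
 \<comment> \<open>\<sigma> \<le> r / 2 keeps the shifted half ball inside the ball of radius r; 2
   pi \<sigma> R \<le> 1 puts the phase difference in the range of
   \<open>one_minus_cos_ge\<close>.\<close>
 define \<sigma> where "\<sigma> = min (r / 2) (1 / (2 * pi * R))"
 have \<sigma>: "\<sigma> > 0" "\<sigma> \<le> r / 2" "2 * pi * \<sigma> * R \<le> 1"
 proof -
  show "\<sigma> > 0" "\<sigma> \<le> r / 2" using r R by (auto simp: \<sigma>_def)
  have "\<sigma> \<le> 1 / (2 * pi * R)" by (simp add: \<sigma>_def)
  thus "2 * pi * \<sigma> * R \<le> 1" using R by (simp add: field_simps)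
 qed
 let ?B = "ball x0 (r / 2)"
 define b where "b = measure lborel ?B"
 have b: "b > 0" unfolding b_def using r content_ball_pos[of "r / 2" x0] by simp
 define \<kappa> where "\<kappa> = \<epsilon> / 4 * b * ((2 * pi * \<sigma>)\<^sup>2 / 8)"
 show ?thesis
 proof (rule that[of \<kappa>])
  show "\<kappa> > 0" using r b \<sigma> by (simp add: \<kappa>_def)
  fix \<xi> :: "real^'n" assume xi: "norm \<xi> \<le> R"
  show "norm (FT \<phi> \<xi>) \<le> 1 - \<kappa> * (norm \<xi>)\<^sup>2"
  proof (cases "\<xi> = 0")
   case False
   define s where "s = (\<sigma> / norm \<xi>) *\<^sub>R \<xi>"
   have s: "norm s = \<sigma>" "\<xi> \<bullet> s = \<sigma> * norm \<xi>"
    using False \<sigma> by (simp_all add: s_def dot_square_norm power2_eq_square)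
   \<comment> \<open>Rotation by the argument of FT makes its modulus the integral of \<phi> cos
     A.\<close>
   obtain \<alpha> where \<alpha>: "FT \<phi> \<xi> = norm (FT \<phi> \<xi>) * cis \<alpha>"
    using rcis_cmod_Arg[of "FT \<phi> \<xi>"] by (metis rcis_def)
   define A where "A x = 2 * pi * (\<xi> \<bullet> x) + \<alpha>" for x
   define G where "G x = 1 - cos (A x)" for x
   have G: "0 \<le> G x" "G x \<le> 2" for x by (auto simp: G_def)
   have [measurable]: "G \<in> borel_measurable borel"
    unfolding G_def A_def by (intro borel_measurable_continuous_onI continuous_intros)
   have phim [measurable]: "\<phi> \<in> borel_measurable borel" using phi_cont by (rule borel_measurable_continuous_onI)
   have "norm (FT \<phi> \<xi>) = Re (cis (- \<alpha>) * FT \<phi> \<xi>)"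
   proof -
    have "cis (- \<alpha>) * (complex_of_real r * cis \<alpha>) = of_real r" for r by (simp add: cis_mult mult.left_commute)
    from this[of "norm (FT \<phi> \<xi>)"] have "cis (- \<alpha>) * FT \<phi> \<xi> = of_real (norm (FT \<phi> \<xi>))"
     unfolding \<alpha>[symmetric] .
    thus ?thesis by simp
   qed
   also have "cis (- \<alpha>) * FT \<phi> \<xi> = (LBINT x. cis (- \<alpha>) * (\<phi> x *\<^sub>R fchar \<xi> x))"
    by (simp only: FT_def integral_mult_right_zero)
   also have "Re \<dots> = (LBINT x. Re (cis (- \<alpha>) * (\<phi> x *\<^sub>R fchar \<xi> x)))"
    by (rule integral_Re[symmetric]) (intro integrable_mult_right integrable_FT phi_integrable)
   also have "\<dots> = (LBINT x. \<phi> x - \<phi> x * G x)"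
   proof (rule Bochner_Integration.integral_cong[OF refl])
    fix x
    have "cis (- \<alpha>) * (\<phi> x *\<^sub>R fchar \<xi> x) = \<phi> x *\<^sub>R cis (- A x)"
     by (simp add: cis_mult A_def add.commute)
    hence "Re (cis (- \<alpha>) * (\<phi> x *\<^sub>R fchar \<xi> x)) = Re (\<phi> x *\<^sub>R cis (- A x))" by (simp only:)
    thus "Re (cis (- \<alpha>) * (\<phi> x *\<^sub>R fchar \<xi> x)) = \<phi> x - \<phi> x * G x"
     by (simp only: G_def) (simp add: right_diff_distrib)
   qed
   also have "\<dots> = 1 - (LBINT x. \<phi> x * G x)"
   proof -
    have "integrable lborel (\<lambda>x. \<phi> x * G x)"
    proof (rule Bochner_Integration.integrable_bound[OF integrable_mult_left[OF phi_integrable, of 2]])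
     show "AE x in lborel. norm (\<phi> x * G x) \<le> norm (\<phi> x * 2)"
      using G nonneg by (intro AE_I2) (simp add: abs_mult mult_left_mono)
    qed measurable
    thus ?thesis by (simp add: phi_integrable total)
   qed
   finally have eq: "norm (FT \<phi> \<xi>) = 1 - (LBINT x. \<phi> x * G x)" .
   have Bint: "integrable lborel (indicator ?B :: _ \<Rightarrow> real)"
    by (rule integrable_real_indicator) (use emeasure_bounded_finite[of ?B] in auto)
   have phiG: "integrable lborel (\<lambda>x. \<phi> x * G x)"
   proof (rule Bochner_Integration.integrable_bound[OF integrable_mult_left[OF phi_integrable, of 2]])
    show "AE x in lborel. norm (\<phi> x * G x) \<le> norm (\<phi> x * 2)"
     using G nonneg by (intro AE_I2) (simp add: abs_mult mult_left_mono)
   qed measurable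
   have BG: "integrable lborel (\<lambda>x. indicator ?B x * G (x + c))" for c
   proof (rule Bochner_Integration.integrable_bound[OF integrable_mult_left[OF Bint, of 2]])
    show "AE x in lborel. norm (indicator ?B x * G (x + c)) \<le> norm (indicator ?B x * (2::real))"
     using G by (intro AE_I2) (simp add: abs_mult mult_left_mono)
    have "continuous_on UNIV (\<lambda>x. G (x + c))" unfolding G_def A_def by (intro continuous_intros)
    hence "(\<lambda>x. G (x + c)) \<in> borel_measurable borel" by (rule borel_measurable_continuous_onI)
    thus "(\<lambda>x. indicator ?B x * G (x + c)) \<in> borel_measurable lborel"
     by (intro borel_measurable_times borel_measurable_indicator) auto
   qed
   have BG0: "integrable lborel (\<lambda>x. indicator ?B x * G x)" using BG[of 0] by simp
   have BGs: "integrable lborel (\<lambda>x. indicator ?B (x - s) * G x)"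
   proof -
    have "integrable (distr lborel borel ((+) (- s))) (\<lambda>x. indicator ?B x * G (x + s))"
     using BG[of s] by (simp add: lborel_distr_plus)
    moreover have "(\<lambda>x. indicat_real ?B x * G (x + s)) \<in> borel_measurable borel"
     using BG[of s] borel_measurable_integrable by force
    ultimately show ?thesis by (subst (asm) integrable_distr_eq) auto
   qed
   have "\<epsilon> / 4 * b * (1 - cos (2 * pi * (\<xi> \<bullet> s))) = (LBINT x. \<epsilon> / 4 * (indicator ?B x * (1 - cos (2 * pi * (\<xi> \<bullet> s)))))"
    using Bint by (simp add: b_def)
   also have "\<dots> \<le> (LBINT x. \<epsilon> / 2 * (indicator ?B x * G x) + \<epsilon> / 2 * (indicator ?B x * G (x + s)))"
   proof (rule integral_mono)
    show "integrable lborel (\<lambda>x. \<epsilon> / 4 * (indicator ?B x * (1 - cos (2 * pi * (\<xi> \<bullet> s)))))"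
     by (intro integrable_mult_right integrable_mult_left Bint)
    show "integrable lborel (\<lambda>x. \<epsilon> / 2 * (indicator ?B x * G x) + \<epsilon> / 2 * (indicator ?B x * G (x + s)))"
     by (intro Bochner_Integration.integrable_add integrable_mult_right BG BG0)
    fix x
    \<comment> \<open>\<open>1 - cos (a - b) \<le> 2 (1 - cos a) + 2 (1 - cos b)\<close>, the triangle inequality for chords\<close>
    have tri: "1 - cos (u - v) \<le> 2 * (1 - cos u) + 2 * (1 - cos v)" for u v :: real
    proof -
     have "0 \<le> (2 - cos u - cos v)\<^sup>2 + (sin u + sin v)\<^sup>2" by simp
     also have "\<dots> = 4 - 4 * cos u - 4 * cos v + 2 * (cos u * cos v + sin u * sin v) + ((sin u)\<^sup>2 + (cos u)\<^sup>2) + ((sin v)\<^sup>2 + (cos v)\<^sup>2)"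
      by (simp only: power2_eq_square) (simp only: algebra_simps)
     also have "\<dots> = 6 - 4 * cos u - 4 * cos v + 2 * cos (u - v)" by (simp add: cos_diff)
     finally have "0 \<le> 6 - 4 * cos u - 4 * cos v + 2 * cos (u - v)" .
     thus ?thesis by (simp add: field_simps)
    qed
    have "A (x + s) - A x = 2 * pi * (\<xi> \<bullet> s)" by (simp add: A_def inner_add_right algebra_simps)
    hence "1 - cos (2 * pi * (\<xi> \<bullet> s)) \<le> 2 * G (x + s) + 2 * G x"
     using tri[of "A (x + s)" "A x"] by (simp add: G_def)
    hence "\<epsilon> / 4 * (1 - cos (2 * pi * (\<xi> \<bullet> s))) \<le> \<epsilon> / 4 * (2 * G (x + s) + 2 * G x)"
     using r by (intro mult_left_mono) auto
    thus "\<epsilon> / 4 * (indicator ?B x * (1 - cos (2 * pi * (\<xi> \<bullet> s)))) \<le> \<epsilon> / 2 * (indicator ?B x * G x) + \<epsilon> / 2 * (indicator ?B x * G (x + s))"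
     by (auto simp: indicator_def algebra_simps)
   qed
   also have "\<dots> = \<epsilon> / 2 * (LBINT x. indicator ?B x * G x) + \<epsilon> / 2 * (LBINT x. indicator ?B x * G (x + s))"
    using BG[of s] BG0 by simp
   also have "(LBINT x. indicator ?B x * G (x + s)) = (LBINT x. indicator ?B (x - s) * G x)"
    using lborel_integral_shift[of "\<lambda>x. indicator ?B (x - s) * G x" s] borel_measurable_integrable[OF BGs] by simp
   also have "\<epsilon> / 2 * (LBINT x. indicator ?B x * G x) + \<epsilon> / 2 * (LBINT x. indicator ?B (x - s) * G x)
     = (LBINT x. \<epsilon> / 2 * (indicator ?B x * G x) + \<epsilon> / 2 * (indicator ?B (x - s) * G x))"
    using BG0 BGs by simp
   also have "\<dots> \<le> (LBINT x. \<phi> x * G x)"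
   proof (rule integral_mono[OF _ phiG])
    show "integrable lborel (\<lambda>x. \<epsilon> / 2 * (indicator ?B x * G x) + \<epsilon> / 2 * (indicator ?B (x - s) * G x))"
     by (intro Bochner_Integration.integrable_add integrable_mult_right BG0 BGs)
    fix x
    \<comment> \<open>The half ball and its shift may overlap, hence the weight \<epsilon> / 2 for
      each; both lie where \<phi> \<ge> \<epsilon>.\<close>
    have "\<epsilon> / 2 * indicator ?B x + \<epsilon> / 2 * indicator ?B (x - s) \<le> \<phi> x"
    proof (cases "x \<in> ball x0 r")
     case True
     have "\<epsilon> / 2 * indicator ?B x + \<epsilon> / 2 * indicator ?B (x - s) \<le> \<epsilon> / 2 * 1 + \<epsilon> / 2 * 1"
      using r(2) by (intro add_mono mult_left_mono) (auto simp: indicator_def)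
     also have "\<dots> \<le> \<phi> x" using r(3)[OF True] by simp
     finally show ?thesis .
    next
     case False
     have "x \<notin> ?B" using False r by auto
     moreover have "x - s \<notin> ?B"
     proof
      assume "x - s \<in> ?B"
      hence "dist x0 (x - s) < r / 2" by simp
      moreover have "dist (x - s) x = \<sigma>" using s by (simp add: dist_norm)
      ultimately have "dist x0 x < r" using dist_triangle[of x0 x "x - s"] \<sigma> by linarith
      thus False using False by simp
     qed
     ultimately show ?thesis using nonneg[of x] by simp
    qed
    hence "(\<epsilon> / 2 * indicator ?B x + \<epsilon> / 2 * indicator ?B (x - s)) * G x \<le> \<phi> x * G x"
     using G by (intro mult_right_mono) auto
    thus "\<epsilon> / 2 * (indicator ?B x * G x) + \<epsilon> / 2 * (indicator ?B (x - s) * G x) \<le> \<phi> x * G x"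
     by (simp add: algebra_simps)
   qed
   finally have low: "\<epsilon> / 4 * b * (1 - cos (2 * pi * (\<xi> \<bullet> s))) \<le> (LBINT x. \<phi> x * G x)" .
   have "\<bar>2 * pi * (\<xi> \<bullet> s)\<bar> \<le> 1"
   proof -
    have "2 * pi * \<sigma> * norm \<xi> \<le> 2 * pi * \<sigma> * R" using xi \<sigma> by (intro mult_left_mono) auto
    hence "2 * pi * \<sigma> * norm \<xi> \<le> 1" using \<sigma>(3) by (rule order_trans)
    moreover have "\<bar>2 * pi * (\<xi> \<bullet> s)\<bar> = 2 * pi * \<sigma> * norm \<xi>" using \<sigma>(1) by (simp add: s abs_mult)
    ultimately show ?thesis by simp
   qed
   hence "(2 * pi * (\<xi> \<bullet> s))\<^sup>2 / 8 \<le> 1 - cos (2 * pi * (\<xi> \<bullet> s))" by (rule one_minus_cos_ge)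
   hence "\<epsilon> / 4 * b * ((2 * pi * (\<xi> \<bullet> s))\<^sup>2 / 8) \<le> \<epsilon> / 4 * b * (1 - cos (2 * pi * (\<xi> \<bullet> s)))"
    using r b by (intro mult_left_mono) auto
   moreover have "\<epsilon> / 4 * b * ((2 * pi * (\<xi> \<bullet> s))\<^sup>2 / 8) = \<kappa> * (norm \<xi>)\<^sup>2"
    by (simp add: \<kappa>_def s power_mult_distrib)
   ultimately show ?thesis using eq low by linarith
  qed (simp add: FT_0)
 qed
qed

text \<open>Inside radius R the quadratic bound beats (1 + c |\<xi>|^2)^d through 1 + y \<le> exp y;
  outside, Schwartz decay of order 2 d + 2 does. The bound is attained at \<xi> = 0, which is what
  makes its l-th powers useful.\<close>

theorem FT_product_bound:
 obtains c where "c > 0" "\<And>\<xi>. norm (FT \<phi> \<xi>) \<le> (\<Prod>i\<in>UNIV. 1 / (1 + c * (\<xi> $ i)\<^sup>2))"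
proof -
 let ?d = "CARD('n)"
 obtain C where C: "\<And>\<xi>. norm \<xi> ^ (2 * ?d + 2) * norm (FT \<phi> \<xi>) \<le> C" using FT_decay[OF schw] by blast
 \<comment> \<open>R \<ge> C lets the two spare powers of |\<xi>| absorb the decay constant; R \<ge>
   2 together with c \<le> 1 / 2 gives 1 + c |\<xi>|^2 \<le> |\<xi>|^2 outside.\<close>
 define R where "R = 2 + \<bar>C\<bar>"
 have R: "R \<ge> 2" "R \<ge> C" by (auto simp: R_def)
 obtain \<kappa> where \<kappa>: "\<kappa> > 0" "\<And>\<xi>. norm \<xi> \<le> R \<Longrightarrow> norm (FT \<phi> \<xi>) \<le> 1 - \<kappa> * (norm \<xi>)\<^sup>2"
  using FT_local[of R] R by auto
 define c where "c = min (1 / 2) (\<kappa> / real ?d)"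
 have c: "c > 0" "c \<le> 1 / 2" "real ?d * c \<le> \<kappa>"
 proof -
  show "c > 0" using \<kappa> by (simp add: c_def)
  show "c \<le> 1 / 2" unfolding c_def by (rule min.cobounded1)
  have "c \<le> \<kappa> / real ?d" by (simp add: c_def)
  thus "real ?d * c \<le> \<kappa>" by (simp add: field_simps)
 qed
 have rad: "norm (FT \<phi> \<xi>) * (1 + c * (norm \<xi>)\<^sup>2) ^ ?d \<le> 1" for \<xi>
 proof (cases "norm \<xi> \<le> R")
  case True
  let ?y = "c * (norm \<xi>)\<^sup>2"
  have y: "?y \<ge> 0" using c by simp
  have "norm (FT \<phi> \<xi>) * (1 + ?y) ^ ?d \<le> exp (- (real ?d * ?y)) * exp (real ?d * ?y)"
  proof (rule mult_mono)
   have "norm (FT \<phi> \<xi>) \<le> 1 - \<kappa> * (norm \<xi>)\<^sup>2" by (rule \<kappa>(2)[OF True])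
   also have "\<dots> \<le> 1 - (real ?d * c) * (norm \<xi>)\<^sup>2" using c(3) by (simp add: mult_right_mono)
   also have "\<dots> \<le> exp (- (real ?d * ?y))" using exp_ge_add_one_self[of "- (real ?d * ?y)"] by (simp add: mult.assoc)
   finally show "norm (FT \<phi> \<xi>) \<le> exp (- (real ?d * ?y))" .
   have "(1 + ?y) ^ ?d \<le> exp ?y ^ ?d" using y exp_ge_add_one_self[of ?y] by (intro power_mono) auto
   thus "(1 + ?y) ^ ?d \<le> exp (real ?d * ?y)" by (simp add: exp_of_nat_mult)
  qed (use y in auto)
  thus ?thesis by (simp add: exp_minus)
 next
  case False
  hence n: "norm \<xi> > R" by simp
  have "1 + c * (norm \<xi>)\<^sup>2 \<le> (norm \<xi>)\<^sup>2"
  proof -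
   have "2\<^sup>2 \<le> (norm \<xi>)\<^sup>2" using n R by (intro power_mono) auto
   moreover have "c * (norm \<xi>)\<^sup>2 \<le> 1 / 2 * (norm \<xi>)\<^sup>2" using c by (intro mult_right_mono) auto
   ultimately show ?thesis by simp
  qed
  hence "(1 + c * (norm \<xi>)\<^sup>2) ^ ?d \<le> ((norm \<xi>)\<^sup>2) ^ ?d" using c by (intro power_mono) auto
  hence "norm (FT \<phi> \<xi>) * (1 + c * (norm \<xi>)\<^sup>2) ^ ?d \<le> norm (FT \<phi> \<xi>) * norm \<xi> ^ (2 * ?d)"
   by (intro mult_left_mono) (auto simp: power_mult)
  also have "\<dots> \<le> 1"
  proof -
   have "(norm (FT \<phi> \<xi>) * norm \<xi> ^ (2 * ?d)) * (norm \<xi>)\<^sup>2 \<le> C" using C[of \<xi>] by (simp only: power_add mult_ac)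
   also have "C \<le> norm \<xi>" using n R by linarith
   also have "\<dots> \<le> 1 * (norm \<xi>)\<^sup>2" using n R by (simp add: power2_eq_square mult_le_cancel_right1)
   finally show ?thesis using n R by (simp only: mult_le_cancel_right) (auto split: if_splits)
  qed
  finally show ?thesis .
 qed
 show ?thesis
 proof (rule that[OF c(1)])
  fix \<xi> :: "real^'n"
  have pos: "(\<Prod>i\<in>UNIV. 1 + c * (\<xi> $ i)\<^sup>2) > 0" using c by (intro prod_pos) (simp add: add_pos_nonneg)
  have "(\<Prod>i\<in>UNIV. 1 + c * (\<xi> $ i)\<^sup>2) \<le> (\<Prod>i\<in>(UNIV::'n set). 1 + c * (norm \<xi>)\<^sup>2)"
  proof (rule prod_mono, rule conjI)
   fix i
   have "(\<xi> $ i)\<^sup>2 \<le> (norm \<xi>)\<^sup>2" using component_le_norm_cart[of \<xi> i] by (intro abs_le_square_iff[THEN iffD1]) auto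
   thus "1 + c * (\<xi> $ i)\<^sup>2 \<le> 1 + c * (norm \<xi>)\<^sup>2" using c by (simp add: mult_left_mono)
  qed (use c in simp)
  hence "norm (FT \<phi> \<xi>) * (\<Prod>i\<in>UNIV. 1 + c * (\<xi> $ i)\<^sup>2) \<le> norm (FT \<phi> \<xi>) * (1 + c * (norm \<xi>)\<^sup>2) ^ ?d"
   by (intro mult_left_mono) auto
  hence "norm (FT \<phi> \<xi>) * (\<Prod>i\<in>UNIV. 1 + c * (\<xi> $ i)\<^sup>2) \<le> 1" using rad[of \<xi>] by linarith
  thus "norm (FT \<phi> \<xi>) \<le> (\<Prod>i\<in>UNIV. 1 / (1 + c * (\<xi> $ i)\<^sup>2))"
   using pos by (simp add: prod_dividef pos_le_divide_eq)
 qed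
qed

end

lemma lattice_bound_sum:
 fixes b :: real
 assumes b: "b > 0"
 shows "(\<lambda>k::int^'n. \<Prod>i\<in>UNIV. 1 / (1 + b * (real_of_int (k $ i))\<^sup>2)) summable_on UNIV"
  and "(\<Sum>\<^sub>\<infinity>k::int^'n. \<Prod>i\<in>UNIV. 1 / (1 + b * (real_of_int (k $ i))\<^sup>2)) \<le> (1 + pi / sqrt b) ^ CARD('n)"
proof -
 have u0: "1 / (1 + b * (real_of_int k)\<^sup>2) \<ge> 0" for k using b by (simp add: add_nonneg_nonneg)
 note s = int_inverse_square[OF b]
 show "(\<lambda>k::int^'n. \<Prod>i\<in>UNIV. 1 / (1 + b * (real_of_int (k $ i))\<^sup>2)) summable_on UNIV"
  by (rule lattice_prod_summable(1)[OF s(1) u0])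
 show "(\<Sum>\<^sub>\<infinity>k::int^'n. \<Prod>i\<in>UNIV. 1 / (1 + b * (real_of_int (k $ i))\<^sup>2)) \<le> (1 + pi / sqrt b) ^ CARD('n)"
  unfolding lattice_prod_summable(2)[OF s(1) u0] by (intro power_mono s(2) infsum_nonneg u0)
qed

section \<open>Traces of the convolution powers on the torus\<close>

context schwartz_density begin

definition decay_const :: real where
 "decay_const = (SOME c. c > 0 \<and> (\<forall>\<xi>. norm (FT \<phi> \<xi>) \<le> (\<Prod>i\<in>UNIV. 1 / (1 + c * (\<xi> $ i)\<^sup>2))))"

lemma decay_const: "decay_const > 0" "norm (FT \<phi> \<xi>) \<le> (\<Prod>i\<in>UNIV. 1 / (1 + decay_const * (\<xi> $ i)\<^sup>2))"
proof -
 have "\<exists>c. c > 0 \<and> (\<forall>\<xi>. norm (FT \<phi> \<xi>) \<le> (\<Prod>i\<in>UNIV. 1 / (1 + c * (\<xi> $ i)\<^sup>2)))"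
  using FT_product_bound by metis
 from someI_ex[OF this] show "decay_const > 0" "norm (FT \<phi> \<xi>) \<le> (\<Prod>i\<in>UNIV. 1 / (1 + decay_const * (\<xi> $ i)\<^sup>2))"
  by (auto simp: decay_const_def)
qed

text \<open>Bernoulli's inequality (1 + y)^l \<ge> 1 + l y in each coordinate: taking the l-th power
  multiplies the constant by l.\<close>

lemma FT_power_bound:
 "norm (FT \<phi> \<xi> ^ l) \<le> (\<Prod>i\<in>UNIV. 1 / (1 + decay_const * real l * (\<xi> $ i)\<^sup>2))"
proof -
 have "norm (FT \<phi> \<xi> ^ l) \<le> (\<Prod>i\<in>UNIV. 1 / (1 + decay_const * (\<xi> $ i)\<^sup>2)) ^ l"
  unfolding norm_power by (intro power_mono decay_const) simp
 also have "\<dots> = (\<Prod>i\<in>UNIV. (1 / (1 + decay_const * (\<xi> $ i)\<^sup>2)) ^ l)" by (simp add: prod_power_distrib)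
 also have "\<dots> \<le> (\<Prod>i\<in>UNIV. 1 / (1 + decay_const * real l * (\<xi> $ i)\<^sup>2))"
 proof (rule prod_mono, rule conjI)
  fix i
  let ?y = "decay_const * (\<xi> $ i)\<^sup>2"
  have y: "?y \<ge> 0" using decay_const(1) by simp
  show "0 \<le> (1 / (1 + ?y)) ^ l" using y by simp
  have "1 + real l * ?y \<le> (1 + ?y) ^ l" using y by (intro Bernoulli_inequality) simp
  hence "1 / (1 + ?y) ^ l \<le> 1 / (1 + real l * ?y)" using y by (intro divide_left_mono mult_pos_pos) (auto intro: add_pos_nonneg)
  thus "(1 / (1 + ?y)) ^ l \<le> 1 / (1 + decay_const * real l * (\<xi> $ i)\<^sup>2)" by (simp add: power_divide mult_ac)
 qed
 finally show ?thesis .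
qed

lemma FT_lattice_bound:
 assumes "L > 0"
 shows "norm (FT \<phi> (rvec k /\<^sub>R L) ^ l) \<le> (\<Prod>i\<in>UNIV. 1 / (1 + decay_const * real l / L\<^sup>2 * (real_of_int (k $ i))\<^sup>2))"
 using FT_power_bound[of "rvec k /\<^sub>R L" l] by (simp add: power_mult_distrib power_inverse divide_inverse mult_ac)

lemma FT_lattice_summable:
 assumes "L > 0" "l > 0"
 shows "(\<lambda>k. norm (FT \<phi> (rvec k /\<^sub>R L) ^ l)) summable_on UNIV"
proof (rule summable_on_comparison_test[OF lattice_bound_sum(1)])
 show "decay_const * real l / L\<^sup>2 > 0" using assms decay_const(1) by simp
qed (use FT_lattice_bound[OF assms(1)] in auto)

text \<open>The l-th convolution power of the periodised density, given by its Fourier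
  series.\<close>

definition fser :: "real \<Rightarrow> nat \<Rightarrow> real^'n \<Rightarrow> complex" where
 "fser L l x = (\<Sum>\<^sub>\<infinity>k. FT \<phi> (rvec k /\<^sub>R L) ^ l * tchar L k x) / of_real (L ^ CARD('n))"

lemma fser_cont: "L > 0 \<Longrightarrow> l > 0 \<Longrightarrow> continuous_on UNIV (fser L l)"
 unfolding fser_def
 by (intro continuous_intros infsum_continuous FT_lattice_summable) (auto intro: tchar_continuous)

lemma fser_1: "L > 0 \<Longrightarrow> of_real (periodize \<phi> L x) = fser L 1 x"
 unfolding fser_def using poisson_summation[OF phi_tame, of L x] FT_lattice_summable[of L 1] by simp

lemma fser_conv:
 assumes L: "L > 0" and l: "l > 0"
 shows "box_int L (\<lambda>x. of_real (periodize \<phi> L (x - y)) * fser L l (z - x)) = fser L (Suc l) (z - y)"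
proof -
 let ?a = "\<lambda>k. FT \<phi> (rvec k /\<^sub>R L) ^ l"
 let ?D = "of_real (L ^ CARD('n)) :: complex"
 have tc: "tchar L k (z - x) = tchar L k z * tchar L (- k) x" for k x
  using tchar_add[of L k z "- x"] by (simp add: tchar_minus_arg tchar_minus)
 define c where "c k = ?a k * tchar L k z" for k
 have c: "(\<lambda>k. norm (c k)) summable_on UNIV" using FT_lattice_summable[OF L l] by (simp add: c_def norm_mult)
 have "box_int L (\<lambda>x. of_real (periodize \<phi> L (x - y)) * fser L l (z - x))
   = (LBINT x. (indicator (box_L L) x *\<^sub>R (of_real (periodize \<phi> L (x - y)) * (\<Sum>\<^sub>\<infinity>k. c k * tchar L (- k) x))) / ?D)"
 proof (rule Bochner_Integration.integral_cong[OF refl])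
  fix x
  have "fser L l (z - x) = (\<Sum>\<^sub>\<infinity>k. c k * tchar L (- k) x) / ?D"
   unfolding fser_def c_def tc by (simp only: mult.assoc)
  thus "indicator (box_L L) x *\<^sub>R (of_real (periodize \<phi> L (x - y)) * fser L l (z - x))
   = (indicator (box_L L) x *\<^sub>R (of_real (periodize \<phi> L (x - y)) * (\<Sum>\<^sub>\<infinity>k. c k * tchar L (- k) x))) / ?D"
   by (simp only: scaleR_conv_of_real times_divide_eq_right)
 qed
 also have "\<dots> = box_int L (\<lambda>x. of_real (periodize \<phi> L (x - y)) * (\<Sum>\<^sub>\<infinity>k. c k * tchar L (- k) x)) / ?D"
  by (rule integral_divide_zero)
 also have "box_int L (\<lambda>x. of_real (periodize \<phi> L (x - y)) * (\<Sum>\<^sub>\<infinity>k. c k * tchar L (- k) x))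
  = (\<Sum>\<^sub>\<infinity>k. c k * box_int L (\<lambda>x. of_real (periodize \<phi> L (x - y)) * tchar L (- k) x))"
 proof (rule box_infsum_integral[OF L c])
  have "continuous_on UNIV (\<lambda>x. periodize \<phi> L (x - y))"
   by (rule continuous_on_compose2[OF periodize_continuous[OF phi_tame L]]) (auto intro!: continuous_intros)
  thus "continuous_on UNIV (\<lambda>x. complex_of_real (periodize \<phi> L (x - y)))" by (intro continuous_intros)
 qed (auto intro: tchar_continuous)
 also have "\<dots> = (\<Sum>\<^sub>\<infinity>k. FT \<phi> (rvec k /\<^sub>R L) ^ Suc l * tchar L k (z - y))"
  unfolding periodize_coefficient[OF phi_tame L] c_def tc by (simp add: mult_ac)
 finally show ?thesis by (simp add: fser_def)
qed

abbreviation "torus L \<equiv> restrict_space lborel (box_L L :: (real^'n) set)"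
abbreviation "pkernel L \<equiv> (\<lambda>y z :: real^'n. ennreal (periodize \<phi> L (z - y)))"

lemma kernel_on_torus:
 assumes L: "L > 0" shows "kernel_on (torus L) (pkernel L)"
proof -
 have sf: "sigma_finite_measure (torus L)"
  by (rule sigma_finite_measure_restrict_space) (auto simp: sigma_finite_lborel)
 have per: "periodize \<phi> L \<in> borel_measurable borel"
  by (intro borel_measurable_continuous_onI periodize_continuous phi_tame L)
 have idM: "(\<lambda>x. x) \<in> measurable (torus L) borel" by (intro measurable_restrict_space1) simp
 have "(\<lambda>p. snd p - fst p) \<in> borel_measurable (torus L \<Otimes>\<^sub>M torus L)"
  by (intro borel_measurable_diff measurable_compose[OF measurable_snd idM] measurable_compose[OF measurable_fst idM])
 hence "(\<lambda>p. ennreal (periodize \<phi> L (snd p - fst p))) \<in> borel_measurable (torus L \<Otimes>\<^sub>M torus L)"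
  by (intro measurable_compose[OF _ measurable_ennreal] measurable_compose[OF _ per])
 thus ?thesis using sf by (auto simp: kernel_on_def kernel_on_axioms_def case_prod_beta)
qed

text \<open>Realness and nonnegativity travel with the induction because every step passes from an
  ennreal integral to a complex one and back.\<close>

lemma kernel_pow_eq:
 assumes L: "L > 0"
 shows "kernel_on.kernel_pow (torus L) (pkernel L) m y z = ennreal (Re (fser L (Suc m) (z - y)))
  \<and> Im (fser L (Suc m) (z - y)) = 0 \<and> Re (fser L (Suc m) (z - y)) \<ge> 0"
proof (induction m arbitrary: y)
 interpret kernel_on "torus L" "pkernel L" by (rule kernel_on_torus[OF L])
 case 0
 have "fser L (Suc 0) (z - y) = of_real (periodize \<phi> L (z - y))" using fser_1[OF L] by simp
 thus ?case by (simp add: periodize_nonneg nonneg)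
next
 interpret kernel_on "torus L" "pkernel L" by (rule kernel_on_torus[OF L])
 case (Suc m)
 define P where "P x = periodize \<phi> L (x - y) * Re (fser L (Suc m) (z - x))" for x
 have P0: "P x \<ge> 0" for x unfolding P_def using Suc.IH[of x] by (intro mult_nonneg_nonneg periodize_nonneg nonneg) auto
 have per_cont: "continuous_on UNIV (\<lambda>x. periodize \<phi> L (x - y))"
  by (rule continuous_on_compose2[OF periodize_continuous[OF phi_tame L]]) (auto intro!: continuous_intros)
 have f_cont: "continuous_on UNIV (\<lambda>x. fser L (Suc m) (z - x))"
  by (rule continuous_on_compose2[OF fser_cont[OF L]]) (auto intro!: continuous_intros)
 have P_cont: "continuous_on UNIV P" unfolding P_def by (intro continuous_intros per_cont f_cont)
 have P_int: "integrable lborel (\<lambda>x. indicator (box_L L) x *\<^sub>R P x)" by (rule box_integrable[OF L P_cont])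
 have "kernel_pow (Suc m) y z = (\<integral>\<^sup>+x. ennreal (P x) \<partial>torus L)"
  using Suc.IH by (simp add: P_def ennreal_mult[symmetric] periodize_nonneg nonneg)
 also have "\<dots> = (\<integral>\<^sup>+x. ennreal (P x) * indicator (box_L L) x \<partial>lborel)"
  by (subst nn_integral_restrict_space) auto
 also have "\<dots> = (\<integral>\<^sup>+x. ennreal (indicator (box_L L) x *\<^sub>R P x) \<partial>lborel)"
  by (intro nn_integral_cong) (auto simp: indicator_def)
 also have "\<dots> = ennreal (box_int L (\<lambda>x. P x))"
  by (rule nn_integral_eq_integral[OF P_int]) (use P0 in auto)
 finally have k: "kernel_pow (Suc m) y z = ennreal (box_int L (\<lambda>x. P x))" .
 have "complex_of_real (box_int L (\<lambda>x. P x)) = (LBINT x. complex_of_real (indicator (box_L L) x *\<^sub>R P x))"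
  by (rule integral_complex_of_real[symmetric])
 also have "\<dots> = box_int L (\<lambda>x. of_real (periodize \<phi> L (x - y)) * fser L (Suc m) (z - x))"
 proof (rule Bochner_Integration.integral_cong[OF refl])
  fix x
  have "complex_of_real (Re (fser L (Suc m) (z - x))) = fser L (Suc m) (z - x)"
   using Suc.IH[of x] by (simp add: complex_eq_iff)
  thus "complex_of_real (indicator (box_L L) x *\<^sub>R P x) = indicator (box_L L) x *\<^sub>R (of_real (periodize \<phi> L (x - y)) * fser L (Suc m) (z - x))"
   by (simp add: P_def scaleR_conv_of_real)
 qed
 also have "\<dots> = fser L (Suc (Suc m)) (z - y)" by (rule fser_conv[OF L]) simp
 finally have e: "fser L (Suc (Suc m)) (z - y) = complex_of_real (box_int L (\<lambda>x. P x))" ..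
 have "box_int L (\<lambda>x. P x) \<ge> 0" using P0 by (intro integral_nonneg_AE) auto
 thus ?case unfolding e k by simp
qed

text \<open>The trace 1 + v of the overview. The value at l = 0 is a placeholder, chosen so that the
  weight is nonnegative and the excess is 0.\<close>

definition cweight :: "real \<Rightarrow> nat \<Rightarrow> real" where
 "cweight L l = (if l = 0 then 1 else Re (\<Sum>\<^sub>\<infinity>k. FT \<phi> (rvec k /\<^sub>R L) ^ l))"

lemma fser_at_0: "L > 0 \<Longrightarrow> Re (fser L (Suc m) 0) = cweight L (Suc m) / L ^ CARD('n)"
 unfolding fser_def cweight_def by (simp flip: of_real_power)

lemma kernel_trace_eq:
 assumes L: "L > 0"
 shows "kernel_on.kernel_trace (torus L) (pkernel L) m = ennreal (cweight L (Suc m))"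
proof -
 interpret kernel_on "torus L" "pkernel L" by (rule kernel_on_torus[OF L])
 have "kernel_trace m = (\<integral>\<^sup>+y. ennreal (cweight L (Suc m) / L ^ CARD('n)) \<partial>torus L)"
  unfolding kernel_trace_def using kernel_pow_eq[OF L, of m] by (simp add: fser_at_0[OF L])
 also have "\<dots> = ennreal (cweight L (Suc m) / L ^ CARD('n)) * ennreal (L ^ CARD('n))"
  using box_L_finite[OF L, where 'n = 'n] by (simp add: emeasure_restrict_space space_restrict_space)
 also have "\<dots> = ennreal (cweight L (Suc m))" using L by (subst ennreal_mult''[symmetric]) auto
 finally show ?thesis .
qed

lemma cweight_nonneg: "L > 0 \<Longrightarrow> cweight L l \<ge> 0"
proof (cases l)
 case (Suc m)
 assume L: "L > 0"
 have "Re (fser L (Suc m) (0 - 0)) \<ge> 0" using kernel_pow_eq[OF L, of m 0 0] by blast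
 thus ?thesis using fser_at_0[OF L, of m] L Suc zero_less_power[OF L, of "CARD('n)"] by (simp add: zero_le_divide_iff)
qed (simp add: cweight_def)

text \<open>The term k = 0 is exactly 1. The others are dominated by the product majorant, whose
  full lattice sum is bounded explicitly and whose own term at 0 is again 1, so the subtraction of 1
  is without loss.\<close>

lemma cweight_bound:
 assumes L: "L > 0" and l: "l > 0"
 shows "\<bar>cweight L l - 1\<bar> \<le> (1 + pi / sqrt decay_const * (L / sqrt (real l))) ^ CARD('n) - 1"
proof -
 define b where "b = decay_const * real l / L\<^sup>2"
 have b: "b > 0" using decay_const(1) L l by (simp add: b_def)
 let ?u = "\<lambda>k::int^'n. \<Prod>i\<in>UNIV. 1 / (1 + b * (real_of_int (k $ i))\<^sup>2)"
 let ?F = "\<lambda>k. FT \<phi> (rvec k /\<^sub>R L) ^ l"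
 have F0: "?F 0 = 1"
 proof -
  have "rvec 0 = (0 :: real^'n)" by (simp add: vec_eq_iff)
  hence "FT \<phi> (rvec 0 /\<^sub>R L) = 1" using FT_0 by (simp only:) simp
  thus ?thesis by (simp only: power_one)
 qed
 have s: "(\<lambda>k. norm (?F k)) summable_on UNIV" by (rule FT_lattice_summable[OF L l])
 have sF: "?F summable_on UNIV" by (rule abs_summable_summable[OF s])
 have u: "?u summable_on UNIV" "infsum ?u UNIV \<le> (1 + pi / sqrt b) ^ CARD('n)" by (rule lattice_bound_sum[OF b])+
 have split: "infsum g UNIV = g 0 + infsum g (UNIV - {0})" if "g summable_on UNIV" for g :: "int^'n \<Rightarrow> 'b :: banach"
 proof -
  have "infsum g ({0} \<union> (UNIV - {0})) = infsum g {0} + infsum g (UNIV - {0})"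
   by (rule infsum_Un_disjoint) (auto intro: summable_on_subset_banach[OF that])
  thus ?thesis by (simp add: Un_commute)
 qed
 have "\<bar>cweight L l - 1\<bar> = \<bar>Re (infsum ?F (UNIV - {0}))\<bar>"
  using l split[OF sF] F0 by (simp add: cweight_def)
 also have "\<dots> \<le> norm (infsum ?F (UNIV - {0}))" by (rule abs_Re_le_cmod)
 also have "\<dots> \<le> infsum ?u (UNIV - {0})" by (rule norm_infsum_le)
    (use FT_lattice_bound[OF L, of _ l] sF u in \<open>auto simp: b_def intro!: has_sum_infsum summable_on_subset_banach[of _ UNIV]\<close>)
 also have "\<dots> = infsum ?u UNIV - 1" using split[OF u(1)] by simp
 also have "\<dots> \<le> (1 + pi / sqrt b) ^ CARD('n) - 1" using u(2) by simp
 also have "pi / sqrt b = pi / sqrt decay_const * (L / sqrt (real l))"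
  using L by (simp add: b_def real_sqrt_divide real_sqrt_mult)
 finally show ?thesis .
qed

subsection \<open>Convolution powers\<close>

text \<open>Decay survives convolution because 1 + |x| \<le> 2 max (1 + |x - y|) (1 + |y|): the
  weight is charged to one factor while the other is integrated.\<close>

lemma conv_pow_props:
 "decays (conv_pow \<phi> j) \<and> (\<forall>x. conv_pow \<phi> j x \<ge> 0) \<and> (\<forall>\<xi>. FT (conv_pow \<phi> j) \<xi> = FT \<phi> \<xi> ^ Suc j)"
proof (induction j)
 case 0
 thus ?case by (simp add: phi_decays nonneg)
next
 case (Suc j)
 define g where "g = conv_pow \<phi> j"
 have g_dec: "decays g" and g0: "\<And>x. g x \<ge> 0" and g_FT: "\<And>\<xi>. FT g \<xi> = FT \<phi> \<xi> ^ Suc j" using Suc by (auto simp: g_def)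
 have g_int: "integrable lborel g" by (intro tame_integrable decays_tame g_dec)
 have g_cont: "continuous_on UNIV g" using g_dec by (simp add: decays_def)
 have [measurable]: "g \<in> borel_measurable borel" by (rule borel_measurable_continuous_onI[OF g_cont])
 have [measurable]: "\<phi> \<in> borel_measurable borel" by (rule borel_measurable_continuous_onI[OF phi_cont])
 let ?p = "2 * CARD('n)"
 obtain C1 where C1: "\<And>x. (1 + norm x) ^ ?p * \<bar>\<phi> x\<bar> \<le> C1" using phi_decays by (auto simp: decays_def)
 obtain C2 where C2: "\<And>x. (1 + norm x) ^ ?p * \<bar>g x\<bar> \<le> C2" using g_dec by (auto simp: decays_def)
 have phi_le: "\<bar>\<phi> x\<bar> \<le> C1" for x
  using mult_right_mono[OF one_le_power[of "1 + norm x" ?p], of "\<bar>\<phi> x\<bar>"] C1[of x] by simp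
 have conv_int: "integrable lborel (\<lambda>y. \<phi> (x - y) * g y)" for x
 proof (rule Bochner_Integration.integrable_bound[OF integrable_mult_right[OF g_int, of C1]])
  show "AE y in lborel. norm (\<phi> (x - y) * g y) \<le> norm (C1 * g y)"
   using phi_le by (intro AE_I2) (auto simp: abs_mult intro!: mult_right_mono order_trans[OF phi_le abs_ge_self])
 qed measurable
 let ?h = "\<lambda>x. \<integral>y. \<phi> (x - y) * g y \<partial>lborel"
 have h_eq: "conv_pow \<phi> (Suc j) = ?h" by (simp add: g_def)
 have shift_int: "integrable lborel (\<lambda>y. \<phi> (x - y))" for x
 proof -
  have "integrable (distr lborel borel (\<lambda>y. x + (-1) *\<^sub>R y)) \<phi>"
   using phi_integrable lborel_affine[of "-1" x] by (simp add: density_1)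
  thus ?thesis by (subst (asm) integrable_distr_eq) auto
 qed
 have shift_val: "(LBINT y. \<phi> (x - y)) = 1" for x
 proof -
  have "1 = (\<integral>y. \<phi> y \<partial>distr lborel borel (\<lambda>y. x + (-1) *\<^sub>R y))"
   using total lborel_affine[of "-1" x] by (simp add: density_1)
  also have "\<dots> = (LBINT y. \<phi> (x - y))" by (subst integral_distr) auto
  finally show ?thesis ..
 qed
 have h_cont: "continuous_on UNIV ?h"
 proof (rule continuous_at_imp_continuous_on, rule ballI)
  fix x show "isCont ?h x"
   unfolding continuous_at_sequentially o_def
  proof (intro allI impI)
   fix X assume X: "X \<longlonglongrightarrow> x"
   have c: "isCont \<phi> y" for y using phi_cont by (simp add: continuous_on_eq_continuous_at)
   show "(\<lambda>n. ?h (X n)) \<longlonglongrightarrow> ?h x"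
   proof (rule integral_dominated_convergence[where w = "\<lambda>y. C1 * \<bar>g y\<bar>"])
    show "AE y in lborel. (\<lambda>n. \<phi> (X n - y) * g y) \<longlonglongrightarrow> \<phi> (x - y) * g y"
     by (intro AE_I2 tendsto_intros isCont_tendsto_compose[OF c] X)
    show "AE y in lborel. norm (\<phi> (X n - y) * g y) \<le> C1 * \<bar>g y\<bar>" for n
     using phi_le by (intro AE_I2) (simp add: abs_mult mult_right_mono)
    show "integrable lborel (\<lambda>y. C1 * \<bar>g y\<bar>)" by (intro integrable_mult_right integrable_abs g_int)
   qed measurable
  qed
 qed
 have h_dec: "(1 + norm x) ^ ?p * \<bar>?h x\<bar> \<le> 2 ^ ?p * (C1 * (LBINT y. g y) + C2)" for x
 proof -
  have pt: "(1 + norm x) ^ ?p * (\<phi> (x - y) * g y) \<le> 2 ^ ?p * (C1 * g y + C2 * \<phi> (x - y))" for y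
  proof -
   define m where "m = max (1 + norm (x - y)) (1 + norm y)"
   have "norm x \<le> norm (x - y) + norm y" using norm_triangle_ineq[of "x - y" y] by simp
   hence "1 + norm x \<le> 2 * m" unfolding m_def by (simp add: max_def)
   hence "(1 + norm x) ^ ?p \<le> (2 * m) ^ ?p" by (intro power_mono) auto
   also have "\<dots> = 2 ^ ?p * m ^ ?p" by (simp add: power_mult_distrib)
   also have "\<dots> \<le> 2 ^ ?p * ((1 + norm (x - y)) ^ ?p + (1 + norm y) ^ ?p)"
    by (intro mult_left_mono) (auto simp: m_def max_def)
   finally have "(1 + norm x) ^ ?p * (\<phi> (x - y) * g y) \<le> 2 ^ ?p * ((1 + norm (x - y)) ^ ?p + (1 + norm y) ^ ?p) * (\<phi> (x - y) * g y)"
    using nonneg g0 by (intro mult_right_mono) auto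
   also have "\<dots> = 2 ^ ?p * (((1 + norm (x - y)) ^ ?p * \<bar>\<phi> (x - y)\<bar>) * g y + ((1 + norm y) ^ ?p * \<bar>g y\<bar>) * \<phi> (x - y))"
    using nonneg g0 by (simp add: algebra_simps)
   also have "\<dots> \<le> 2 ^ ?p * (C1 * g y + C2 * \<phi> (x - y))"
    using nonneg g0 by (intro mult_left_mono add_mono mult_right_mono C1 C2) auto
   finally show ?thesis .
  qed
  have "(1 + norm x) ^ ?p * \<bar>?h x\<bar> = (LBINT y. (1 + norm x) ^ ?p * (\<phi> (x - y) * g y))"
   using nonneg g0 by (simp add: abs_of_nonneg integral_nonneg_AE)
  also have "\<dots> \<le> (LBINT y. 2 ^ ?p * (C1 * g y + C2 * \<phi> (x - y)))"
   using pt by (intro integral_mono integrable_mult_right Bochner_Integration.integrable_add conv_int g_int shift_int) auto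
  also have "\<dots> = 2 ^ ?p * (C1 * (LBINT y. g y) + C2)" using g_int shift_int[of x] by (simp add: shift_val)
  finally show ?thesis .
 qed
 have h_FT: "FT ?h \<xi> = FT \<phi> \<xi> * FT g \<xi>" for \<xi>
 proof -
  let ?e = "\<lambda>x. fchar \<xi> x"
  have [measurable]: "?e \<in> borel_measurable borel" by (intro borel_measurable_continuous_onI continuous_intros)
  let ?k = "\<lambda>x y. (\<phi> (x - y) * g y) *\<^sub>R ?e x"
  have km: "(\<lambda>(x, y). ?k x y) \<in> borel_measurable (lborel \<Otimes>\<^sub>M lborel)" by measurable
  have phi_nn: "(\<integral>\<^sup>+x. ennreal (\<phi> (x - y)) \<partial>lborel) = 1" for y
  proof -
   have "(\<integral>\<^sup>+x. ennreal (\<phi> (x - y)) \<partial>lborel) = (\<integral>\<^sup>+x. ennreal (\<phi> x) \<partial>lborel)"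
    using lborel_nn_integral_shift[of "\<lambda>x. ennreal (\<phi> x)" "- y"] by simp
   also have "\<dots> = 1" using nn_integral_eq_integral[OF phi_integrable] nonneg total by simp
   finally show ?thesis .
  qed
  have "(\<integral>\<^sup>+z. norm (case z of (x, y) \<Rightarrow> ?k x y) \<partial>(lborel \<Otimes>\<^sub>M lborel)) = (\<integral>\<^sup>+y. \<integral>\<^sup>+x. norm (?k x y) \<partial>lborel \<partial>lborel)"
   using km by (subst lborel_pair.nn_integral_snd[symmetric]) (auto simp: split_beta')
  also have "\<dots> = (\<integral>\<^sup>+y. \<integral>\<^sup>+x. ennreal (g y) * ennreal (\<phi> (x - y)) \<partial>lborel \<partial>lborel)"
   using nonneg g0 by (intro nn_integral_cong) (simp add: abs_mult ennreal_mult[symmetric] mult.commute)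
  also have "\<dots> = (\<integral>\<^sup>+y. ennreal (g y) \<partial>lborel)" by (simp add: nn_integral_cmult phi_nn)
  also have "\<dots> < \<infinity>" using nn_integral_eq_integral[OF g_int] g0 by simp
  finally have k_int: "integrable (lborel \<Otimes>\<^sub>M lborel) (\<lambda>(x, y). ?k x y)"
   using km by (simp only: integrable_iff_bounded)
  have "FT ?h \<xi> = (LBINT x. \<integral>y. ?k x y \<partial>lborel)"
   unfolding FT_def by (intro Bochner_Integration.integral_cong refl integral_scaleR_left[symmetric] conv_int)
  also have "\<dots> = (LBINT y. \<integral>x. ?k x y \<partial>lborel)" by (rule lborel_pair.Fubini_integral[symmetric, OF k_int])
  also have "\<dots> = (LBINT y. (g y *\<^sub>R ?e y) * FT \<phi> \<xi>)"
  proof (rule Bochner_Integration.integral_cong[OF refl])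
   fix y
   have "(LBINT x. ?k x y) = (LBINT x. ?k (x + y) y)" by (rule lborel_integral_shift[symmetric]) measurable
   also have "\<dots> = (LBINT x. (g y *\<^sub>R ?e y) * (\<phi> x *\<^sub>R ?e x))"
   proof (rule Bochner_Integration.integral_cong[OF refl])
    fix x
    have "?e (x + y) = ?e y * ?e x" by (simp add: cis_mult inner_add_right algebra_simps)
    thus "?k (x + y) y = (g y *\<^sub>R ?e y) * (\<phi> x *\<^sub>R ?e x)" by (simp add: scaleR_conv_of_real mult_ac)
   qed
   also have "\<dots> = (g y *\<^sub>R ?e y) * FT \<phi> \<xi>" unfolding FT_def by (rule integral_mult_right_zero)
   finally show "(LBINT x. ?k x y) = (g y *\<^sub>R ?e y) * FT \<phi> \<xi>" .
  qed
  also have "\<dots> = FT g \<xi> * FT \<phi> \<xi>" unfolding FT_def by (rule integral_mult_left_zero)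
  finally show ?thesis by (simp add: mult.commute)
 qed
 show ?case unfolding h_eq
  using h_cont h_dec h_FT g_FT nonneg g0 by (auto simp: decays_def intro!: integral_nonneg_AE)
qed

text \<open>Poisson summation read backwards: for fixed j and large L, the trace divided by L^d
  approaches the convolution power at 0. This is how \<open>rho_c\<close> appears.\<close>

lemma conv_pow_lattice:
 assumes L: "L > 0"
 shows "periodize (conv_pow \<phi> j) L 0 = cweight L (Suc j) / L ^ CARD('n)"
proof -
 have t: "tame (conv_pow \<phi> j)" using conv_pow_props decays_tame by blast
 have FT: "FT (conv_pow \<phi> j) \<xi> = FT \<phi> \<xi> ^ Suc j" for \<xi> using conv_pow_props by blast
 have "of_real (periodize (conv_pow \<phi> j) L 0) = fser L (Suc j) 0"
  unfolding fser_def FT[symmetric] by (rule poisson_summation[OF t L]) (unfold FT, rule FT_lattice_summable[OF L], simp)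
 thus ?thesis using fser_at_0[OF L, of j] by (metis Re_complex_of_real)
qed

end

subsection \<open>The mean weight in the different regimes\<close>

lemma sum_inverse_sqrt_le: "(\<Sum>l=1..N. 1 / sqrt (real l)) \<le> 2 * sqrt (real N)"
proof (induction N)
 case (Suc n)
 define s t where "s = sqrt (real (Suc n))" and "t = sqrt (real n)"
 have st: "s > 0" "s\<^sup>2 = t\<^sup>2 + 1" by (simp_all add: s_def t_def)
 have "1 \<le> (s - t)\<^sup>2 + 1" by simp
 also have "\<dots> = (2 * (s - t)) * s" using st by (simp add: power2_eq_square algebra_simps)
 finally have "1 / s \<le> 2 * (s - t)" using st by (simp add: pos_divide_le_eq)
 thus ?case using Suc.IH by (simp add: s_def t_def)
qed simp

lemma harm_over_ln: "(\<lambda>N. harm N / ln (real N)) \<longlonglongrightarrow> (1 :: real)"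
proof -
 have ln: "filterlim (\<lambda>N. ln (real N)) at_top sequentially"
  by (rule filterlim_compose[OF ln_at_top filterlim_real_sequentially])
 have "(\<lambda>N. (harm N - ln (real N)) / ln (real N) + 1) \<longlonglongrightarrow> 0 + 1"
  by (intro tendsto_add tendsto_const real_tendsto_divide_at_top[OF euler_mascheroni_LIMSEQ ln])
 hence "(\<lambda>N. (harm N - ln (real N)) / ln (real N) + 1) \<longlonglongrightarrow> (1 :: real)" by simp
 thus ?thesis
 proof (rule Lim_transform_eventually)
  show "\<forall>\<^sub>F N in sequentially. (harm N - ln (real N)) / ln (real N) + 1 = harm N / ln (real N)"
   using eventually_gt_at_top[of 1] by eventually_elim (simp add: diff_divide_distrib)
 qed
qed

lemma sqrt_over_self: "sqrt (real N) / real N = 1 / sqrt (real N)"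
 using real_div_sqrt[of "real N"] by (cases "N = 0") (auto simp: field_simps)

text \<open>Used with s = sqrt (N / l): the bound at length l is compared with the one at length N,
  which gives \<open>v_le\<close> its form.\<close>

lemma one_plus_power_scaling:
 fixes a s :: real
 assumes a: "a \<ge> 0" and s: "s \<ge> 1"
 shows "(1 + a * s) ^ d - 1 \<le> s ^ d * ((1 + a) ^ d - 1)"
proof (induction d)
 case (Suc d)
 have "(1 + a * s) ^ Suc d - 1 = (1 + a * s) * ((1 + a * s) ^ d - 1) + a * s" by (simp add: algebra_simps)
 also have "\<dots> \<le> (s * (1 + a)) * (s ^ d * ((1 + a) ^ d - 1)) + a * s ^ Suc d"
 proof (rule add_mono)
  show "(1 + a * s) * ((1 + a * s) ^ d - 1) \<le> s * (1 + a) * (s ^ d * ((1 + a) ^ d - 1))"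
   using a s by (intro mult_mono Suc.IH) (auto simp: algebra_simps)
  show "a * s \<le> a * s ^ Suc d" using a s by (intro mult_left_mono self_le_power) auto
 qed
 also have "\<dots> = s ^ Suc d * ((1 + a) ^ Suc d - 1)" by (simp add: algebra_simps)
 finally show ?case .
qed simp

text \<open>Separates the leading power from a linear term: for x \<ge> 1 the former dominates all
  intermediate powers, for x < 1 the latter does.\<close>

lemma one_plus_power_le:
 fixes x :: real
 assumes x: "x \<ge> 0"
 shows "(1 + x) ^ d - 1 \<le> 2 ^ d * x ^ d + 2 ^ d * x"
proof (cases "x \<ge> 1")
 case True
 hence "(1 + x) ^ d \<le> (2 * x) ^ d" by (intro power_mono) auto
 moreover have "0 \<le> 2 ^ d * x" using x by simp
 ultimately show ?thesis by (simp add: power_mult_distrib)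
next
 case False
 have "(1 + x) ^ d - 1 \<le> x * (2 ^ d - 1)"
 proof (induction d)
  case (Suc d)
  have "(1 + x) ^ Suc d - 1 = (1 + x) * ((1 + x) ^ d - 1) + x" by (simp add: algebra_simps)
  also have "\<dots> \<le> 2 * (x * (2 ^ d - 1)) + x"
   using x False by (intro add_mono mult_mono Suc.IH) (auto simp: one_le_power)
  also have "\<dots> = x * (2 ^ Suc d - 1)" by (simp add: algebra_simps)
  finally show ?case .
 qed simp
 also have "\<dots> \<le> 2 ^ d * x" using x by (simp add: algebra_simps)
 finally show ?thesis using x by (simp add: add_increasing)
qed

lemma decays_norm:
 assumes "decays f" obtains C where "\<And>x. (1 + norm x) * \<bar>f x\<bar> \<le> C"
proof -
 obtain C where C: "\<And>x. (1 + norm x) ^ (2 * CARD('a)) * \<bar>f x\<bar> \<le> C" using assms by (auto simp: decays_def)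
 have "(1 + norm x) * \<bar>f x\<bar> \<le> C" for x
 proof -
  have "1 + norm x \<le> (1 + norm x) ^ (2 * CARD('a))" by (intro self_le_power) auto
  hence "(1 + norm x) * \<bar>f x\<bar> \<le> (1 + norm x) ^ (2 * CARD('a)) * \<bar>f x\<bar>" by (intro mult_right_mono) auto
  thus ?thesis using C[of x] by linarith
 qed
 thus ?thesis by (rule that)
qed

text \<open>As the period grows only the term k = 0 survives; dominated convergence handles the
  lattice sum.\<close>

lemma periodize_tendsto:
 fixes f :: "real^'n \<Rightarrow> real"
 assumes f: "decays f" and L: "filterlim L at_top sequentially"
 shows "(\<lambda>n::nat. periodize f (L n) 0) \<longlonglongrightarrow> f 0"
proof -
 \<comment> \<open>A lower bound on the period for all n makes the domination uniform.\<close>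
 define M where "M n = max 1 (L n)" for n
 have M: "M n \<ge> 1" for n by (simp add: M_def)
 have M_eq: "\<forall>\<^sub>F n in sequentially. M n = L n"
  using filterlim_at_top[THEN iffD1, OF L, rule_format, of 1] by eventually_elim (simp add: M_def)
 have M_top: "filterlim M at_top sequentially" by (rule filterlim_at_top_mono[OF L]) (simp add: M_def)
 obtain C where C: "\<And>x. (1 + norm x) * \<bar>f x\<bar> \<le> C" using decays_norm[OF f] by blast
 obtain C' where C': "\<And>x. \<bar>f x\<bar> \<le> C' * maj x" using decays_tame[OF f] by (auto simp: tame_def)
 have C'0: "C' \<ge> 0" using C'[of 0] maj_pos[of "0 :: real^'n"] by (smt (verit) zero_le_mult_iff)
 let ?u = "\<lambda>k::int^'n. \<Prod>i\<in>UNIV. 1 / (1 + 1 * (real_of_int (k $ i))\<^sup>2)"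
 have "(\<lambda>n. \<Sum>\<^sub>\<infinity>k. f (M n *\<^sub>R rvec k)) \<longlonglongrightarrow> (\<Sum>\<^sub>\<infinity>k::int^'n. if k = 0 then f 0 else 0)"
 proof (rule infsum_dominated_convergence)
  show "(\<lambda>n. f (M n *\<^sub>R rvec k)) \<longlonglongrightarrow> (if k = 0 then f 0 else 0)" for k :: "int^'n"
  proof (cases "k = 0")
   case True
   have "rvec k = (0 :: real^'n)" using True by (simp add: vec_eq_iff)
   thus ?thesis using True by (simp only:) simp
  next
   case False
   define x :: "real^'n" where "x = rvec k"
   have x: "norm x > 0" using False by (auto simp: x_def vec_eq_iff)
   have "norm (f (M n *\<^sub>R x)) \<le> C / norm x * inverse (M n)" for n
   proof -
    have Mx: "M n * norm x > 0" using M[of n] x by (intro mult_pos_pos) auto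
    have "M n * norm x * \<bar>f (M n *\<^sub>R x)\<bar> \<le> (1 + norm (M n *\<^sub>R x)) * \<bar>f (M n *\<^sub>R x)\<bar>"
     using M[of n] by (intro mult_right_mono) auto
    hence "M n * norm x * \<bar>f (M n *\<^sub>R x)\<bar> \<le> C" using C order_trans by blast
    hence "\<bar>f (M n *\<^sub>R x)\<bar> \<le> C / (M n * norm x)" using Mx by (simp add: pos_le_divide_eq mult.commute)
    also have "\<dots> = C / norm x * inverse (M n)" by (simp add: divide_inverse mult_ac)
    finally show ?thesis by simp
   qed
   moreover have "(\<lambda>n. C / norm x * inverse (M n)) \<longlonglongrightarrow> 0"
    by (intro tendsto_mult_right_zero tendsto_inverse_0_at_top M_top)
   ultimately have "(\<lambda>n. f (M n *\<^sub>R x)) \<longlonglongrightarrow> 0" by (rule Lim_null_comparison[OF always_eventually[OF allI]])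
   thus ?thesis using False by (simp add: x_def)
  qed
  show "norm (f (M n *\<^sub>R rvec k)) \<le> C' * ?u k" for n and k :: "int^'n"
  proof -
   have "maj (M n *\<^sub>R rvec k :: real^'n) \<le> ?u k" unfolding maj_def
   proof (rule prod_mono, intro conjI)
    fix i
    have "1 * (real_of_int (k $ i))\<^sup>2 \<le> (M n)\<^sup>2 * (real_of_int (k $ i))\<^sup>2"
     using M[of n] by (intro mult_right_mono) (auto simp: one_le_power)
    thus "1 / (1 + ((M n *\<^sub>R rvec k :: real^'n) $ i)\<^sup>2) \<le> 1 / (1 + 1 * (real_of_int (k $ i))\<^sup>2)"
     by (intro divide_left_mono) (auto simp: power_mult_distrib add_pos_nonneg)
   qed (auto simp: add_nonneg_nonneg)
   hence "C' * maj (M n *\<^sub>R rvec k :: real^'n) \<le> C' * ?u k" using C'0 by (intro mult_left_mono)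
   thus ?thesis using C'[of "M n *\<^sub>R rvec k"] by simp
  qed
  show "(\<lambda>k. C' * ?u k) summable_on UNIV" by (intro summable_on_cmult_right lattice_bound_sum(1)) simp
 qed
 also have "(\<Sum>\<^sub>\<infinity>k::int^'n. if k = 0 then f 0 else 0) = f 0"
  proof -
  have "(\<Sum>\<^sub>\<infinity>k::int^'n. if k = 0 then f 0 else 0) = (\<Sum>\<^sub>\<infinity>k\<in>{0::int^'n}. f 0)"
   by (rule infsum_cong_neutral) auto
  thus ?thesis by simp
 qed
 finally have "(\<lambda>n. periodize f (M n) 0) \<longlonglongrightarrow> f 0" by (simp add: periodize_def)
 thus ?thesis by (rule Lim_transform_eventually) (use M_eq in eventually_elim, simp)
qed

context schwartz_density begin

definition width :: real where "width = pi / sqrt decay_const"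

abbreviation "mean_weight \<theta> L N \<equiv> \<theta> / real N * (\<Sum>l=1..N. cweight (L N) l - 1)"

lemma width_pos: "width > 0" using decay_const(1) by (simp add: width_def)

lemma cweight_le:
 assumes "L > 0" "l > 0"
 shows "\<bar>cweight L l - 1\<bar> \<le> (1 + width * (L / sqrt (real l))) ^ CARD('n) - 1"
 unfolding width_def by (rule cweight_bound[OF assms])

lemma cycle_weights_cweight:
 assumes th: "\<theta> > 0" and tau: "0 \<le> \<tau>" "\<tau> < 1" and L: "\<And>N. L N > 0"
  and L_lim: "(\<lambda>N. L N / sqrt (real N)) \<longlonglongrightarrow> 0"
  and mean: "(\<lambda>N. mean_weight \<theta> L N) \<longlonglongrightarrow> \<tau>"
 shows "cycle_weights \<theta> \<tau> CARD('n) (\<lambda>N l. cweight (L N) l - 1)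
   (\<lambda>N. (1 + width * (L N / sqrt (real N))) ^ CARD('n) - 1)"
proof
 let ?a = "\<lambda>N. width * (L N / sqrt (real N))"
 have a: "?a N \<ge> 0" for N using L[of N] width_pos by (intro mult_nonneg_nonneg) auto
 show "\<bar>cweight (L N) l - 1\<bar> \<le> ((1 + ?a N) ^ CARD('n) - 1) * (real N / real l) ^ CARD('n)" if l: "1 \<le> l" "l \<le> N" for N l
 proof -
  define s where "s = sqrt (real N / real l)"
  have s: "s \<ge> 1" "s\<^sup>2 = real N / real l" using l by (simp_all add: s_def le_divide_eq)
  have "width * (L N / sqrt (real l)) = ?a N * s" using l by (simp add: s_def real_sqrt_divide)
  hence "\<bar>cweight (L N) l - 1\<bar> \<le> (1 + ?a N * s) ^ CARD('n) - 1" using cweight_le[OF L[of N], of l] l by simp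
  also have "\<dots> \<le> s ^ CARD('n) * ((1 + ?a N) ^ CARD('n) - 1)" by (rule one_plus_power_scaling[OF a s(1)])
  \<comment> \<open>s^d is weakened to (s^2)^d = (N / l)^d, the form required by the locale.\<close>
  also have "\<dots> \<le> (s\<^sup>2) ^ CARD('n) * ((1 + ?a N) ^ CARD('n) - 1)"
   using a[of N] s by (intro mult_right_mono power_mono self_le_power) (auto simp: one_le_power)
  finally show ?thesis by (simp only: s(2) mult.commute)
 qed
 show "0 \<le> (1 + ?a N) ^ CARD('n) - 1" for N using a[of N] by (simp add: one_le_power)
 have "(\<lambda>N. (1 + ?a N) ^ CARD('n) - 1) \<longlonglongrightarrow> (1 + width * 0) ^ CARD('n) - 1" by (intro tendsto_intros L_lim)
 thus "(\<lambda>N. (1 + ?a N) ^ CARD('n) - 1) \<longlonglongrightarrow> 0" by simp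
qed (use th tau cweight_nonneg[OF L] mean in auto)

lemma abs_mean_le:
 assumes "\<theta> > 0" "\<And>l. 1 \<le> l \<Longrightarrow> l \<le> N \<Longrightarrow> \<bar>v l\<bar> \<le> b l"
 shows "norm (\<theta> / real N * (\<Sum>l=1..N. v l)) \<le> \<theta> / real N * (\<Sum>l=1..N. b l)"
proof -
 have "\<bar>\<Sum>l=1..N. v l\<bar> \<le> (\<Sum>l=1..N. b l)" using assms(2) by (intro order_trans[OF sum_abs] sum_mono) auto
 hence "\<theta> / real N * \<bar>\<Sum>l=1..N. v l\<bar> \<le> \<theta> / real N * (\<Sum>l=1..N. b l)" using assms(1) by (intro mult_left_mono) auto
 thus ?thesis using assms(1) by (simp add: abs_mult)
qed

text \<open>For d = 1 the bound on the excess is a multiple of L / sqrt l, with average over l \<le>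
  N of order L / sqrt N.\<close>

lemma mean_dim_1:
 assumes th: "\<theta> > 0" and d: "CARD('n) = 1" and L: "\<And>N. L N > 0" and L_lim: "(\<lambda>N. L N / sqrt (real N)) \<longlonglongrightarrow> 0"
 shows "(\<lambda>N. mean_weight \<theta> L N) \<longlonglongrightarrow> 0"
proof (rule Lim_null_comparison[OF always_eventually[OF allI]])
 fix N
 have "norm (mean_weight \<theta> L N) \<le> \<theta> / real N * (\<Sum>l=1..N. width * L N * (1 / sqrt (real l)))"
  by (rule abs_mean_le[OF th]) (use cweight_le[OF L] d in auto)
 also have "\<dots> = \<theta> / real N * (width * L N * (\<Sum>l=1..N. 1 / sqrt (real l)))" by (simp only: sum_distrib_left)
 also have "\<dots> \<le> \<theta> / real N * (width * L N * (2 * sqrt (real N)))"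
  using th width_pos L[of N] by (intro mult_left_mono sum_inverse_sqrt_le) auto
 also have "\<dots> = 2 * \<theta> * width * (L N * (sqrt (real N) / real N))" by simp
 also have "\<dots> = 2 * \<theta> * width * (L N / sqrt (real N))" by (simp only: sqrt_over_self) simp
 finally show "norm (mean_weight \<theta> L N) \<le> 2 * \<theta> * width * (L N / sqrt (real N))" .
 show "(\<lambda>N. 2 * \<theta> * width * (L N / sqrt (real N))) \<longlonglongrightarrow> 0" by (intro tendsto_mult_right_zero L_lim)
qed

lemma cweight_bound_2:
 assumes d: "CARD('n) = 2" and L: "L > 0" and l: "l > 0"
 shows "\<bar>cweight L l - 1\<bar> \<le> 2 * width * L * (1 / sqrt (real l)) + width\<^sup>2 * L\<^sup>2 * (1 / real l)"
proof -
 let ?x = "width * (L / sqrt (real l))"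
 have "\<bar>cweight L l - 1\<bar> \<le> (1 + ?x)\<^sup>2 - 1" using cweight_le[OF L l] unfolding d .
 also have "\<dots> = 2 * ?x + ?x\<^sup>2" by (simp add: power2_eq_square algebra_simps)
 also have "?x\<^sup>2 = width\<^sup>2 * L\<^sup>2 * (1 / real l)" by (simp add: power_mult_distrib power_divide)
 finally show ?thesis by simp
qed

text \<open>In the plane the bound has an additional term of order L^2 / l, whose sum is
  logarithmic; \<open>L_ln\<close> makes its average vanish.\<close>

lemma mean_dim_2_hyper:
 assumes th: "\<theta> > 0" and d: "CARD('n) = 2" and L: "\<And>N. L N > 0" and L_lim: "(\<lambda>N. L N / sqrt (real N)) \<longlonglongrightarrow> 0"
  and L_ln: "(\<lambda>N. (L N)\<^sup>2 / real N * ln (real N)) \<longlonglongrightarrow> 0"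
 shows "(\<lambda>N. mean_weight \<theta> L N) \<longlonglongrightarrow> 0"
proof (rule Lim_null_comparison[OF always_eventually[OF allI]])
 fix N
 have "norm (mean_weight \<theta> L N)
   \<le> \<theta> / real N * (\<Sum>l=1..N. 2 * width * L N * (1 / sqrt (real l)) + width\<^sup>2 * (L N)\<^sup>2 * (1 / real l))"
  by (rule abs_mean_le[OF th]) (use cweight_bound_2[OF d L] in auto)
 also have "\<dots> = \<theta> / real N * (2 * width * L N * (\<Sum>l=1..N. 1 / sqrt (real l)) + width\<^sup>2 * (L N)\<^sup>2 * harm N)"
  by (simp only: sum.distrib sum_distrib_left harm_def inverse_eq_divide)
 also have "\<dots> \<le> \<theta> / real N * (2 * width * L N * (2 * sqrt (real N)) + width\<^sup>2 * (L N)\<^sup>2 * harm N)"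
  using th width_pos L[of N] by (intro mult_left_mono add_right_mono sum_inverse_sqrt_le) auto
 also have "\<dots> = 4 * \<theta> * width * (L N * (sqrt (real N) / real N)) + \<theta> * width\<^sup>2 * ((L N)\<^sup>2 / real N * harm N)"
  by (simp add: algebra_simps)
 also have "\<dots> = 4 * \<theta> * width * (L N / sqrt (real N)) + \<theta> * width\<^sup>2 * ((L N)\<^sup>2 / real N * harm N)"
  by (simp only: sqrt_over_self) simp
 finally show "norm (mean_weight \<theta> L N)
   \<le> 4 * \<theta> * width * (L N / sqrt (real N)) + \<theta> * width\<^sup>2 * ((L N)\<^sup>2 / real N * harm N)" .
 have "(\<lambda>N. ((L N)\<^sup>2 / real N * ln (real N)) * (harm N / ln (real N))) \<longlonglongrightarrow> 0 * 1"
  by (intro tendsto_mult L_ln harm_over_ln)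
 hence "(\<lambda>N. (L N)\<^sup>2 / real N * harm N) \<longlonglongrightarrow> 0 * 1"
  by (rule Lim_transform_eventually) (use eventually_gt_at_top[of 1] in eventually_elim, simp)
 hence h: "(\<lambda>N. (L N)\<^sup>2 / real N * harm N) \<longlonglongrightarrow> 0" by (simp only: mult_zero_left)
 have "(\<lambda>N. 4 * \<theta> * width * (L N / sqrt (real N)) + \<theta> * width\<^sup>2 * ((L N)\<^sup>2 / real N * harm N)) \<longlonglongrightarrow> 4 * \<theta> * width * 0 + \<theta> * width\<^sup>2 * 0"
  by (intro tendsto_add tendsto_mult_left L_lim h)
 thus "(\<lambda>N. 4 * \<theta> * width * (L N / sqrt (real N)) + \<theta> * width\<^sup>2 * ((L N)\<^sup>2 / real N * harm N)) \<longlonglongrightarrow> 0" by simp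
qed

lemma conv_pow_nonneg: "conv_pow \<phi> j x \<ge> 0" using conv_pow_props by blast

text \<open>Divided by L^d, the excess at length j + 1 tends to \<open>conv_pow \<phi> j 0\<close>.
  It is dominated by a summable b j, of exponent 3 / 2, plus \<kappa> N / sqrt (j + 1), which is not
  summable but whose sum up to N is of order L / sqrt N. Removing the second part first makes
  dominated convergence applicable.\<close>

lemma mean_dim_3:
 assumes th: "\<theta> > 0" and d: "CARD('n) \<ge> 3" and L: "\<And>N. L N > 0" and L_lim: "(\<lambda>N. L N / sqrt (real N)) \<longlonglongrightarrow> 0"
  and L_top: "filterlim L at_top sequentially"
  and r: "r > 0" "\<And>N. N > 0 \<Longrightarrow> L N ^ CARD('n) = real N / r"
 shows "(\<lambda>N. mean_weight \<theta> L N) \<longlonglongrightarrow> rho_c \<theta> \<phi> / r" and "rho_c \<theta> \<phi> \<ge> 0"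
proof -
 let ?D = "CARD('n)"
 define W where "W N j = (cweight (L N) (Suc j) - 1) / L N ^ ?D" for N j
 define c where "c j = conv_pow \<phi> j 0" for j
 define b where "b j = 2 ^ ?D * width ^ ?D * (1 / sqrt (real (Suc j))) ^ 3" for j
 define \<kappa> where "\<kappa> N = 2 ^ ?D * width * (L N / L N ^ ?D)" for N
 have \<kappa>0: "\<kappa> N \<ge> 0" for N using L[of N] width_pos by (simp add: \<kappa>_def)
 have b_sum: "summable b"
 proof -
  have "(1 / sqrt (real (Suc j))) ^ 3 = real (Suc j) powr (- 3 / 2)" for j
   by (simp add: powr_half_sqrt[symmetric] powr_minus powr_powr divide_simps flip: powr_realpow powr_add)
  thus ?thesis unfolding b_def
   using summable_real_powr_iff[of "- 3 / 2"] summable_Suc_iff[of "\<lambda>n. real n powr (- 3 / 2)"]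
   by (simp only:) (auto intro: summable_mult)
 qed
 have b0: "b j \<ge> 0" for j using width_pos by (simp add: b_def)
 have W_le: "\<bar>W N j\<bar> \<le> b j + \<kappa> N * (1 / sqrt (real (Suc j)))" for N j
 proof -
  let ?s = "1 / sqrt (real (Suc j))"
  let ?x = "width * (L N / sqrt (real (Suc j)))"
  have x: "?x \<ge> 0" using L[of N] width_pos by (intro mult_nonneg_nonneg) auto
  have LD: "L N ^ ?D > 0" using L[of N] by simp
  have "\<bar>cweight (L N) (Suc j) - 1\<bar> \<le> 2 ^ ?D * ?x ^ ?D + 2 ^ ?D * ?x"
   using cweight_le[OF L[of N], of "Suc j"] one_plus_power_le[OF x, of ?D] by simp
  hence "\<bar>W N j\<bar> \<le> (2 ^ ?D * ?x ^ ?D + 2 ^ ?D * ?x) / L N ^ ?D"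
   unfolding W_def using LD by (simp add: abs_divide divide_right_mono)
  also have "\<dots> = 2 ^ ?D * width ^ ?D * ?s ^ ?D + \<kappa> N * ?s"
   using L[of N] by (simp add: \<kappa>_def add_divide_distrib power_mult_distrib power_divide mult_ac)
  also have "\<dots> \<le> b j + \<kappa> N * ?s"
   unfolding b_def using width_pos d by (intro add_right_mono mult_left_mono power_decreasing) auto
  finally show ?thesis .
 qed
 have \<kappa>N: "(\<lambda>N. \<kappa> N * (2 * sqrt (real N))) \<longlonglongrightarrow> 0"
 proof -
  have "(\<lambda>N. 2 ^ ?D * width * 2 * r * (L N / sqrt (real N))) \<longlonglongrightarrow> 0" by (intro tendsto_mult_right_zero L_lim)
  thus ?thesis
  proof (rule Lim_transform_eventually)
   show "\<forall>\<^sub>F N in sequentially. 2 ^ ?D * width * 2 * r * (L N / sqrt (real N)) = \<kappa> N * (2 * sqrt (real N))"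
    using eventually_gt_at_top[of 0]
   proof eventually_elim
    case (elim N)
    have "L N / L N ^ ?D * sqrt (real N) = L N * r * (sqrt (real N) / real N)" using r elim by (simp add: mult_ac)
    also have "\<dots> = L N * r / sqrt (real N)" by (simp only: sqrt_over_self) simp
    finally have e: "L N / L N ^ ?D * sqrt (real N) = L N * r / sqrt (real N)" .
    have "\<kappa> N * (2 * sqrt (real N)) = 2 ^ ?D * width * 2 * (L N / L N ^ ?D * sqrt (real N))"
     by (simp only: \<kappa>_def mult_ac)
    also have "\<dots> = 2 ^ ?D * width * 2 * r * (L N / sqrt (real N))" unfolding e by simp
    finally show ?case ..
   qed
  qed
 qed
 have \<kappa>_lim: "\<kappa> \<longlonglongrightarrow> 0"
 proof (rule Lim_null_comparison[OF _ \<kappa>N])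
  show "\<forall>\<^sub>F N in sequentially. norm (\<kappa> N) \<le> \<kappa> N * (2 * sqrt (real N))"
   using eventually_ge_at_top[of 1]
  proof eventually_elim
   case (elim N)
   hence "1 \<le> 2 * sqrt (real N)" using real_sqrt_ge_1_iff[of "real N"] by linarith
   hence "\<kappa> N * 1 \<le> \<kappa> N * (2 * sqrt (real N))" using \<kappa>0 by (intro mult_left_mono)
   thus ?case using \<kappa>0[of N] by simp
  qed
 qed
 have W_lim: "(\<lambda>N. W N j) \<longlonglongrightarrow> c j" for j
 proof -
  have "(\<lambda>N. periodize (conv_pow \<phi> j) (L N) 0 - inverse (L N ^ ?D)) \<longlonglongrightarrow> conv_pow \<phi> j 0 - 0"
  proof (intro tendsto_diff periodize_tendsto L_top)
   show "decays (conv_pow \<phi> j)" using conv_pow_props by blast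
   show "(\<lambda>N. inverse (L N ^ ?D)) \<longlonglongrightarrow> 0"
    by (intro tendsto_inverse_0_at_top filterlim_pow_at_top L_top) simp
  qed
  thus ?thesis by (simp add: W_def c_def conv_pow_lattice[OF L] diff_divide_distrib inverse_eq_divide)
 qed
 have c_le: "\<bar>c j\<bar> \<le> b j" for j
 proof (rule LIMSEQ_le)
  show "(\<lambda>N. \<bar>W N j\<bar>) \<longlonglongrightarrow> \<bar>c j\<bar>" by (intro tendsto_rabs W_lim)
  have "(\<lambda>N. b j + \<kappa> N * (1 / sqrt (real (Suc j)))) \<longlonglongrightarrow> b j + 0 * (1 / sqrt (real (Suc j)))"
   by (intro tendsto_intros \<kappa>_lim)
  thus "(\<lambda>N. b j + \<kappa> N * (1 / sqrt (real (Suc j)))) \<longlonglongrightarrow> b j" by simp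
 qed (use W_le in blast)
 have c_sum: "summable c" by (rule summable_comparison_test'[OF b_sum]) (use c_le in auto)
 \<comment> \<open>The deviation with the non-summable part cut off; it is dominated by 2 b
   j.\<close>
 define q where "q N j = max 0 (\<bar>W N j - c j\<bar> - \<kappa> N * (1 / sqrt (real (Suc j))))" for N j
 have q_le: "norm (q N j) \<le> 2 * b j" for N j
  using W_le[of N j] c_le[of j] b0[of j] abs_triangle_ineq4[of "W N j" "c j"] by (simp add: q_def)
 have b_sum_on: "(\<lambda>j. 2 * b j) summable_on UNIV"
  using b_sum b0 by (intro summable_on_cmult_right norm_summable_imp_summable_on) simp
 have q_lim: "(\<lambda>N. \<Sum>\<^sub>\<infinity>j. q N j) \<longlonglongrightarrow> 0"
 proof -
  have "(\<lambda>N. \<Sum>\<^sub>\<infinity>j. q N j) \<longlonglongrightarrow> (\<Sum>\<^sub>\<infinity>j::nat. 0)"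
  proof (rule infsum_dominated_convergence[OF _ q_le b_sum_on])
   fix j
   have "(\<lambda>N. q N j) \<longlonglongrightarrow> max 0 (\<bar>c j - c j\<bar> - 0 * (1 / sqrt (real (Suc j))))"
    unfolding q_def by (intro tendsto_intros W_lim \<kappa>_lim)
   thus "(\<lambda>N. q N j) \<longlonglongrightarrow> 0" by simp
  qed
  thus ?thesis by simp
 qed
 have diff: "(\<lambda>N. (\<Sum>j<N. W N j) - (\<Sum>j<N. c j)) \<longlonglongrightarrow> 0"
 proof (rule Lim_null_comparison[OF always_eventually[OF allI]])
  fix N
  have "norm ((\<Sum>j<N. W N j) - (\<Sum>j<N. c j)) = \<bar>\<Sum>j<N. W N j - c j\<bar>" by (simp add: sum_subtractf)
  also have "\<dots> \<le> (\<Sum>j<N. q N j + \<kappa> N * (1 / sqrt (real (Suc j))))"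
   by (intro order_trans[OF sum_abs] sum_mono) (simp add: q_def)
  also have "\<dots> = (\<Sum>j<N. q N j) + \<kappa> N * (\<Sum>l=1..N. 1 / sqrt (real l))"
   by (simp add: sum.distrib sum_distrib_left sum.atLeast1_atMost_eq)
  also have "\<dots> \<le> (\<Sum>\<^sub>\<infinity>j. q N j) + \<kappa> N * (2 * sqrt (real N))"
  proof (intro add_mono mult_left_mono sum_inverse_sqrt_le \<kappa>0)
   have "(\<Sum>j<N. q N j) = (\<Sum>\<^sub>\<infinity>j\<in>{..<N}. q N j)" by simp
   also have "\<dots> \<le> (\<Sum>\<^sub>\<infinity>j. q N j)"
   proof (rule infsum_mono_neutral)
    show "q N summable_on UNIV"
     by (rule summable_on_comparison_test[OF b_sum_on]) (use q_le[of N] in \<open>auto simp: q_def\<close>)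
   qed (auto simp: q_def)
   finally show "(\<Sum>j<N. q N j) \<le> (\<Sum>\<^sub>\<infinity>j. q N j)" .
  qed
  finally show "norm ((\<Sum>j<N. W N j) - (\<Sum>j<N. c j)) \<le> (\<Sum>\<^sub>\<infinity>j. q N j) + \<kappa> N * (2 * sqrt (real N))" .
  show "(\<lambda>N. (\<Sum>\<^sub>\<infinity>j. q N j) + \<kappa> N * (2 * sqrt (real N))) \<longlonglongrightarrow> 0"
   using tendsto_add[OF q_lim \<kappa>N] by simp
 qed
 have "(\<lambda>N. \<theta> / r * (((\<Sum>j<N. W N j) - (\<Sum>j<N. c j)) + (\<Sum>j<N. c j))) \<longlonglongrightarrow> \<theta> / r * (0 + (\<Sum>j. c j))"
  by (intro tendsto_intros diff summable_LIMSEQ c_sum)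
 moreover have "\<forall>\<^sub>F N in sequentially. \<theta> / r * (((\<Sum>j<N. W N j) - (\<Sum>j<N. c j)) + (\<Sum>j<N. c j)) = mean_weight \<theta> L N"
  using eventually_gt_at_top[of 0]
 proof eventually_elim
  case (elim N)
  have "(\<Sum>l=1..N. cweight (L N) l - 1) = (\<Sum>j<N. cweight (L N) (Suc j) - 1)"
   by (simp add: sum.atLeast1_atMost_eq)
  hence "(\<Sum>j<N. W N j) = (\<Sum>l=1..N. cweight (L N) l - 1) * (r / real N)"
   using r elim by (simp add: W_def sum_divide_distrib[symmetric] sum_distrib_right)
  thus ?case using r elim by simp
 qed
 ultimately have "(\<lambda>N. mean_weight \<theta> L N) \<longlonglongrightarrow> \<theta> / r * (0 + (\<Sum>j. c j))"
  by (rule Lim_transform_eventually)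
 thus "(\<lambda>N. mean_weight \<theta> L N) \<longlonglongrightarrow> rho_c \<theta> \<phi> / r" by (simp add: rho_c_def c_def)
 have "(\<Sum>j. c j) \<ge> 0" by (rule suminf_nonneg[OF c_sum]) (simp add: c_def conv_pow_nonneg)
 thus "rho_c \<theta> \<phi> \<ge> 0" using th by (simp add: rho_c_def c_def)
qed

end

subsection \<open>The local central limit theorem\<close>

context schwartz_density begin

text \<open>The second moment of the inner product of \<xi> and X; as an integral its sign and
  scaling are immediate, and \<open>qform_cov\<close> links it to the covariance matrix.\<close>

definition qform :: "real^'n \<Rightarrow> real" where
 "qform \<xi> = (LBINT x. (\<xi> \<bullet> x)\<^sup>2 * \<phi> x)"

abbreviation "gauss x \<equiv> exp (- (2 * pi\<^sup>2 * qform x))"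

lemma moment_integrable: "integrable lborel (\<lambda>x. norm x ^ k * \<phi> x)"
proof -
 obtain C where "\<And>x. (1 + norm x) ^ (2 * CARD('n) + k) * \<bar>iter_pderiv [] \<phi> x\<bar> \<le> C"
  using schw unfolding schwartz_def by blast
 hence C: "(1 + norm x) ^ (2 * CARD('n) + k) * \<phi> x \<le> C" for x using nonneg by simp
 have "decays (\<lambda>x. norm x ^ k * \<phi> x)" unfolding decays_def
 proof (intro conjI exI allI)
  show "continuous_on UNIV (\<lambda>x. norm x ^ k * \<phi> x)" by (intro continuous_intros phi_cont)
  fix x
  have "(1 + norm x) ^ (2 * CARD('n)) * \<bar>norm x ^ k * \<phi> x\<bar> = (1 + norm x) ^ (2 * CARD('n)) * (norm x ^ k * \<phi> x)"
   using nonneg by (simp add: abs_mult)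
  also have "\<dots> \<le> (1 + norm x) ^ (2 * CARD('n)) * ((1 + norm x) ^ k * \<phi> x)"
   using nonneg by (intro mult_left_mono mult_right_mono power_mono) auto
  also have "\<dots> \<le> C" using C[of x] by (simp only: power_add mult.assoc)
  finally show "(1 + norm x) ^ (2 * CARD('n)) * \<bar>norm x ^ k * \<phi> x\<bar> \<le> C" .
 qed
 thus ?thesis by (intro tame_integrable decays_tame)
qed

lemma phi_measurable [measurable]: "\<phi> \<in> borel_measurable borel"
 by (rule borel_measurable_continuous_onI[OF phi_cont])

lemma moment_dominated:
 fixes F :: "real^'n \<Rightarrow> real"
 assumes "continuous_on UNIV F" "\<And>x. \<bar>F x\<bar> \<le> C * norm x ^ k"
 shows "integrable lborel (\<lambda>x. F x * \<phi> x)"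
proof (rule Bochner_Integration.integrable_bound[OF integrable_mult_right[OF moment_integrable, of C k]])
 have [measurable]: "F \<in> borel_measurable borel" using assms(1) by (rule borel_measurable_continuous_onI)
 show "(\<lambda>x. F x * \<phi> x) \<in> borel_measurable lborel" by simp
 show "AE x in lborel. norm (F x * \<phi> x) \<le> norm (C * (norm x ^ k * \<phi> x))"
 proof (rule AE_I2)
  fix x
  have "\<bar>F x\<bar> * \<phi> x \<le> C * norm x ^ k * \<phi> x" by (intro mult_right_mono assms(2) nonneg)
  also have "\<dots> \<le> \<bar>C * (norm x ^ k * \<phi> x)\<bar>" by simp
  finally show "norm (F x * \<phi> x) \<le> norm (C * (norm x ^ k * \<phi> x))" using nonneg[of x] by (simp add: abs_mult)
 qed
qed

lemma qform_integrable: "integrable lborel (\<lambda>x. (\<xi> \<bullet> x)\<^sup>2 * \<phi> x)"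
proof (rule moment_dominated[where C = "(norm \<xi>)\<^sup>2" and k = 2])
 fix x :: "real^'n"
 have "\<bar>\<xi> \<bullet> x\<bar>\<^sup>2 \<le> (norm \<xi> * norm x)\<^sup>2" by (intro power_mono Cauchy_Schwarz_ineq2) simp
 thus "\<bar>(\<xi> \<bullet> x)\<^sup>2\<bar> \<le> (norm \<xi>)\<^sup>2 * norm x ^ 2" by (simp add: power_mult_distrib)
qed (intro continuous_intros)

lemma qform_nonneg: "qform \<xi> \<ge> 0" unfolding qform_def by (intro integral_nonneg_AE) (simp add: nonneg)

lemma qform_scaleR: "qform (r *\<^sub>R \<xi>) = r\<^sup>2 * qform \<xi>"
 unfolding qform_def by (simp add: power_mult_distrib mult.assoc)

lemma qform_cov:
 assumes "mean_vec \<phi> = 0"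
 shows "qform \<xi> = (\<Sum>i\<in>UNIV. \<Sum>j\<in>UNIV. \<xi> $ i * \<xi> $ j * cov_mat \<phi> $ i $ j)"
proof -
 have int: "integrable lborel (\<lambda>x. x $ i * x $ j * \<phi> x)" for i j
 proof (rule moment_dominated[where C = 1 and k = 2])
  fix x :: "real^'n"
  have "\<bar>x $ i * x $ j\<bar> \<le> norm x * norm x"
   unfolding abs_mult by (intro mult_mono component_le_norm_cart) auto
  thus "\<bar>x $ i * x $ j\<bar> \<le> 1 * norm x ^ 2" by (simp add: power2_eq_square)
 qed (intro continuous_intros)
 have "(\<xi> \<bullet> x)\<^sup>2 * \<phi> x = (\<Sum>i\<in>UNIV. \<Sum>j\<in>UNIV. \<xi> $ i * \<xi> $ j * (x $ i * x $ j * \<phi> x))" for x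
 proof -
  have "(\<xi> \<bullet> x)\<^sup>2 * \<phi> x = (\<Sum>i\<in>UNIV. \<xi> $ i * x $ i) * (\<Sum>j\<in>UNIV. \<xi> $ j * x $ j) * \<phi> x"
   by (simp add: inner_vec_def power2_eq_square)
  also have "\<dots> = (\<Sum>i\<in>UNIV. \<Sum>j\<in>UNIV. \<xi> $ i * \<xi> $ j * (x $ i * x $ j * \<phi> x))"
   unfolding sum_product unfolding sum_distrib_right by (intro sum.cong refl) (simp add: mult_ac)
  finally show ?thesis .
 qed
 hence "qform \<xi> = (LBINT x. (\<Sum>i\<in>UNIV. \<Sum>j\<in>UNIV. \<xi> $ i * \<xi> $ j * (x $ i * x $ j * \<phi> x)))"
  unfolding qform_def by (simp only:)
 also have "\<dots> = (\<Sum>i\<in>UNIV. \<Sum>j\<in>UNIV. \<xi> $ i * \<xi> $ j * (LBINT x. x $ i * x $ j * \<phi> x))"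
  using int by (simp add: Bochner_Integration.integral_sum Bochner_Integration.integrable_sum)
 finally show ?thesis by (simp add: cov_mat_def assms)
qed

text \<open>The third-order remainder of the exponential is integrated against \<phi>; the linear
  term disappears because the mean is 0.\<close>

lemma FT_taylor:
 assumes mean: "mean_vec \<phi> = 0"
 obtains M where "M \<ge> 0" "\<And>\<xi>. norm (FT \<phi> \<xi> - of_real (1 - 2 * pi\<^sup>2 * qform \<xi>)) \<le> M * norm \<xi> ^ 3"
proof
 define I3 where "I3 = (LBINT x. norm x ^ 3 * \<phi> x)"
 have I3: "I3 \<ge> 0" unfolding I3_def by (intro integral_nonneg_AE) (simp add: nonneg)
 thus "(2 * pi) ^ 3 / 6 * I3 \<ge> 0" by simp
 fix \<xi> :: "real^'n"
 define y where "y x = - (2 * pi * (\<xi> \<bullet> x))" for x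
 define P where "P x = complex_of_real (\<phi> x) * (1 + \<i> * of_real (y x) - of_real ((y x)\<^sup>2 / 2))" for x
 have i1: "integrable lborel (\<lambda>x. y x * \<phi> x)"
 proof (rule moment_dominated[where C = "2 * pi * norm \<xi>" and k = 1])
  show "continuous_on UNIV y" unfolding y_def by (intro continuous_intros)
  show "\<bar>y x\<bar> \<le> 2 * pi * norm \<xi> * norm x ^ 1" for x
   using Cauchy_Schwarz_ineq2[of \<xi> x] by (simp add: y_def abs_mult mult.assoc)
 qed
 have y1: "(LBINT x. y x * \<phi> x) = 0"
 proof -
  have v: "integrable lborel (\<lambda>x. \<phi> x *\<^sub>R x)"
  proof (rule Bochner_Integration.integrable_bound[OF moment_integrable[of 1]])
   show "AE x in lborel. norm (\<phi> x *\<^sub>R x) \<le> norm (norm x ^ 1 * \<phi> x)" by (simp add: abs_mult mult.commute)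
  qed measurable
  have "(LBINT x. y x * \<phi> x) = (LBINT x. (- (2 * pi) *\<^sub>R \<xi>) \<bullet> (\<phi> x *\<^sub>R x))"
   by (intro Bochner_Integration.integral_cong refl) (simp add: y_def)
  also have "\<dots> = (- (2 * pi) *\<^sub>R \<xi>) \<bullet> mean_vec \<phi>" unfolding mean_vec_def by (rule integral_inner_right) (rule v)
  finally show ?thesis by (simp add: mean)
 qed
 have i2: "integrable lborel (\<lambda>x. (y x)\<^sup>2 / 2 * \<phi> x)" and y2: "(LBINT x. (y x)\<^sup>2 / 2 * \<phi> x) = 2 * pi\<^sup>2 * qform \<xi>"
 proof -
  have e: "(y x)\<^sup>2 / 2 * \<phi> x = 2 * pi\<^sup>2 * ((\<xi> \<bullet> x)\<^sup>2 * \<phi> x)" for x by (simp add: y_def power_mult_distrib)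
  show "integrable lborel (\<lambda>x. (y x)\<^sup>2 / 2 * \<phi> x)" unfolding e by (intro integrable_mult_right qform_integrable)
  show "(LBINT x. (y x)\<^sup>2 / 2 * \<phi> x) = 2 * pi\<^sup>2 * qform \<xi>" unfolding e qform_def by (rule integral_mult_right_zero)
 qed
 have P_eq: "P x = complex_of_real (\<phi> x) + \<i> * complex_of_real (y x * \<phi> x) - complex_of_real ((y x)\<^sup>2 / 2 * \<phi> x)" for x
  by (simp add: P_def algebra_simps)
 have c: "integrable lborel (\<lambda>x. complex_of_real (\<phi> x))" "integrable lborel (\<lambda>x. \<i> * complex_of_real (y x * \<phi> x))"
  "integrable lborel (\<lambda>x. complex_of_real ((y x)\<^sup>2 / 2 * \<phi> x))"
  by (intro integrable_of_real integrable_mult_right phi_integrable i1 i2)+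
 have P_int: "integrable lborel P" unfolding P_eq by (intro Bochner_Integration.integrable_add Bochner_Integration.integrable_diff c)
 have "(LBINT x. P x) = (LBINT x. complex_of_real (\<phi> x) + \<i> * complex_of_real (y x * \<phi> x)) - (LBINT x. complex_of_real ((y x)\<^sup>2 / 2 * \<phi> x))"
  unfolding P_eq by (rule Bochner_Integration.integral_diff[OF Bochner_Integration.integrable_add[OF c(1,2)] c(3)])
 also have "(LBINT x. complex_of_real (\<phi> x) + \<i> * complex_of_real (y x * \<phi> x))
   = (LBINT x. complex_of_real (\<phi> x)) + (LBINT x. \<i> * complex_of_real (y x * \<phi> x))"
  by (rule Bochner_Integration.integral_add[OF c(1,2)])
 also have "\<dots> - (LBINT x. complex_of_real ((y x)\<^sup>2 / 2 * \<phi> x)) = of_real (1 - 2 * pi\<^sup>2 * qform \<xi>)"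
  by (simp only: integral_mult_right_zero integral_complex_of_real total y1 y2) simp
 finally have P_val: "(LBINT x. P x) = of_real (1 - 2 * pi\<^sup>2 * qform \<xi>)" .
 have F_int: "integrable lborel (\<lambda>x. \<phi> x *\<^sub>R cis (y x))" unfolding y_def by (rule integrable_FT[OF phi_integrable])
 have "norm (FT \<phi> \<xi> - of_real (1 - 2 * pi\<^sup>2 * qform \<xi>)) = norm (LBINT x. \<phi> x *\<^sub>R cis (y x) - P x)"
  using Bochner_Integration.integral_diff[OF F_int P_int] by (simp add: FT_def P_val y_def)
 also have "\<dots> \<le> (LBINT x. (2 * pi) ^ 3 / 6 * norm \<xi> ^ 3 * (norm x ^ 3 * \<phi> x))"
 proof (rule order_trans[OF integral_norm_bound integral_mono])
  show "integrable lborel (\<lambda>x. norm (\<phi> x *\<^sub>R cis (y x) - P x))" by (intro integrable_norm Bochner_Integration.integrable_diff F_int P_int)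
  show "integrable lborel (\<lambda>x. (2 * pi) ^ 3 / 6 * norm \<xi> ^ 3 * (norm x ^ 3 * \<phi> x))"
   by (intro integrable_mult_right moment_integrable)
  fix x
  have tay: "norm (cis (y x) - (1 + \<i> * of_real (y x) - of_real ((y x)\<^sup>2 / 2))) \<le> \<bar>y x\<bar> ^ 3 / 6"
   using iexp_approx1[of "y x" 2]
   by (simp add: cis_conv_exp numeral_2_eq_2 fact_numeral power_mult_distrib numeral_3_eq_3 algebra_simps)
  have yx: "\<bar>y x\<bar> \<le> 2 * pi * norm \<xi> * norm x"
   using Cauchy_Schwarz_ineq2[of \<xi> x] by (simp add: y_def abs_mult mult.assoc)
  have "\<phi> x *\<^sub>R cis (y x) - P x = \<phi> x *\<^sub>R (cis (y x) - (1 + \<i> * of_real (y x) - of_real ((y x)\<^sup>2 / 2)))"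
   by (simp add: P_def scaleR_conv_of_real right_diff_distrib)
  hence "norm (\<phi> x *\<^sub>R cis (y x) - P x) = \<phi> x * norm (cis (y x) - (1 + \<i> * of_real (y x) - of_real ((y x)\<^sup>2 / 2)))"
   using nonneg[of x] by (simp only: norm_scaleR abs_of_nonneg)
  also have "\<dots> \<le> \<phi> x * ((2 * pi * norm \<xi> * norm x) ^ 3 / 6)"
  proof (intro mult_left_mono nonneg order_trans[OF tay] divide_right_mono)
   show "\<bar>y x\<bar> ^ 3 \<le> (2 * pi * norm \<xi> * norm x) ^ 3" by (rule power_mono[OF yx abs_ge_zero])
  qed simp
  also have "\<dots> = (2 * pi) ^ 3 / 6 * norm \<xi> ^ 3 * (norm x ^ 3 * \<phi> x)" by (simp add: power_mult_distrib)
  finally show "norm (\<phi> x *\<^sub>R cis (y x) - P x) \<le> (2 * pi) ^ 3 / 6 * norm \<xi> ^ 3 * (norm x ^ 3 * \<phi> x)" .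
 qed
 also have "\<dots> = (2 * pi) ^ 3 / 6 * norm \<xi> ^ 3 * I3" unfolding I3_def by (rule integral_mult_right_zero)
 also have "\<dots> = (2 * pi) ^ 3 / 6 * I3 * norm \<xi> ^ 3" by simp
 finally show "norm (FT \<phi> \<xi> - of_real (1 - 2 * pi\<^sup>2 * qform \<xi>)) \<le> (2 * pi) ^ 3 / 6 * I3 * norm \<xi> ^ 3" .
qed

text \<open>The central limit theorem with moving arguments. z^l is compared with w^l for w = exp (-
  Y / l) through |z^l - w^l| \<le> l |z - w|, valid in the unit disc; by \<open>FT_taylor\<close>
  the difference z - w is of order l^(-3/2).\<close>

lemma FT_power_limit:
 assumes mean: "mean_vec \<phi> = 0" and \<xi>: "\<xi> \<longlonglongrightarrow> x" and l: "filterlim l at_top sequentially" "\<And>n::nat. l n > (0::nat)"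
 shows "(\<lambda>n. FT \<phi> (\<xi> n /\<^sub>R sqrt (real (l n))) ^ l n) \<longlonglongrightarrow> of_real (gauss x)"
proof -
 obtain M where M: "M \<ge> 0" "\<And>\<xi>. norm (FT \<phi> \<xi> - of_real (1 - 2 * pi\<^sup>2 * qform \<xi>)) \<le> M * norm \<xi> ^ 3"
  using FT_taylor[OF mean] by blast
 define Y where "Y n = 2 * pi\<^sup>2 * qform (\<xi> n)" for n
 have Y0: "Y n \<ge> 0" for n using qform_nonneg by (simp add: Y_def)
 have Y_lim: "Y \<longlonglongrightarrow> 2 * pi\<^sup>2 * qform x"
  unfolding Y_def qform_cov[OF mean] by (intro tendsto_intros \<xi>)
 define s where "s n = sqrt (real (l n))" for n
 have s: "s n > 0" "(s n)\<^sup>2 = real (l n)" for n using l(2)[of n] by (auto simp: s_def)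
 have s_lim: "filterlim s at_top sequentially"
  unfolding s_def by (intro filterlim_compose[OF sqrt_at_top] filterlim_compose[OF filterlim_real_sequentially] l(1))
 let ?z = "\<lambda>n. FT \<phi> (\<xi> n /\<^sub>R s n)"
 let ?w = "\<lambda>n. complex_of_real (exp (- (Y n / real (l n))))"
 have bound: "norm (?z n ^ l n - of_real (exp (- Y n))) \<le> M * norm (\<xi> n) ^ 3 * inverse (s n) + (Y n)\<^sup>2 * (inverse (s n))\<^sup>2" for n
 proof -
  let ?y = "Y n / real (l n)"
  have y: "?y \<ge> 0" using Y0 l(2)[of n] by simp
  have y_eq: "2 * pi\<^sup>2 * qform (\<xi> n /\<^sub>R s n) = ?y"
   by (simp only: qform_scaleR Y_def power_inverse s(2)) (simp add: divide_inverse)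
  have e1: "1 - ?y \<le> exp (- ?y)" using exp_ge_add_one_self[of "- ?y"] by simp
  have e2: "exp (- ?y) \<le> 1 - ?y + ?y\<^sup>2"
  proof -
   have "exp (- ?y) * (1 + ?y) \<le> exp (- ?y) * exp ?y" using exp_ge_add_one_self by (intro mult_left_mono) auto
   also have "\<dots> = 1" by (simp flip: exp_add)
   also have "1 \<le> (1 - ?y + ?y\<^sup>2) * (1 + ?y)"
   proof -
    have "(1 - t + t\<^sup>2) * (1 + t) = 1 + t ^ 3" for t :: real by (simp add: power2_eq_square power3_eq_cube algebra_simps)
    thus ?thesis using y by simp
   qed
   finally show ?thesis using y by (simp only: mult_le_cancel_right)
  qed
  have "norm (?w n - of_real (1 - ?y)) = \<bar>exp (- ?y) - (1 - ?y)\<bar>" by (simp only: norm_of_real flip: of_real_diff)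
  also have "\<dots> \<le> ?y\<^sup>2" using e1 e2 by simp
  finally have wy: "norm (?w n - of_real (1 - ?y)) \<le> ?y\<^sup>2" .
  have zy: "norm (?z n - of_real (1 - ?y)) \<le> M * (norm (\<xi> n) / s n) ^ 3"
   using M(2)[of "\<xi> n /\<^sub>R s n"] s(1)[of n] by (simp only: y_eq) (simp add: divide_inverse mult.commute)
  have "?w n ^ l n = of_real (exp (- Y n))" using l(2)[of n] by (simp flip: of_real_power exp_of_nat_mult)
  hence "norm (?z n ^ l n - of_real (exp (- Y n))) = norm (?z n ^ l n - ?w n ^ l n)" by simp
  also have "\<dots> \<le> real (l n) * norm (?z n - ?w n)" using y by (intro norm_power_diff FT_le_1) simp
  also have "\<dots> \<le> real (l n) * (M * (norm (\<xi> n) / s n) ^ 3 + ?y\<^sup>2)"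
  proof (intro mult_left_mono)
   have "norm (?z n - ?w n) \<le> norm (?z n - of_real (1 - ?y)) + norm (?w n - of_real (1 - ?y))"
    using norm_triangle_ineq4[of "?z n - of_real (1 - ?y)" "?w n - of_real (1 - ?y)"] by simp
   thus "norm (?z n - ?w n) \<le> M * (norm (\<xi> n) / s n) ^ 3 + ?y\<^sup>2" using zy wy by linarith
  qed simp
  also have "\<dots> = M * norm (\<xi> n) ^ 3 * inverse (s n) + (Y n)\<^sup>2 * (inverse (s n))\<^sup>2"
   using s(1)[of n] unfolding s(2)[symmetric] by (simp add: field_simps power2_eq_square power3_eq_cube)
  finally show ?thesis .
 qed
 have "(\<lambda>n. ?z n ^ l n - of_real (exp (- Y n))) \<longlonglongrightarrow> 0"
 proof (rule Lim_null_comparison[OF always_eventually[OF allI]])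
  show "norm (?z n ^ l n - of_real (exp (- Y n))) \<le> M * norm (\<xi> n) ^ 3 * inverse (s n) + (Y n)\<^sup>2 * (inverse (s n))\<^sup>2" for n by (rule bound)
  have "(\<lambda>n. inverse (s n)) \<longlonglongrightarrow> 0" by (rule tendsto_inverse_0_at_top[OF s_lim])
  hence "(\<lambda>n. M * norm (\<xi> n) ^ 3 * inverse (s n) + (Y n)\<^sup>2 * (inverse (s n))\<^sup>2)
    \<longlonglongrightarrow> M * norm x ^ 3 * 0 + (2 * pi\<^sup>2 * qform x)\<^sup>2 * 0\<^sup>2"
   by (intro tendsto_intros \<xi> Y_lim)
  thus "(\<lambda>n. M * norm (\<xi> n) ^ 3 * inverse (s n) + (Y n)\<^sup>2 * (inverse (s n))\<^sup>2) \<longlonglongrightarrow> 0" by simp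
 qed
 moreover have "(\<lambda>n. complex_of_real (exp (- Y n))) \<longlonglongrightarrow> of_real (gauss x)"
  by (intro tendsto_of_real tendsto_exp tendsto_minus Y_lim)
 ultimately have "(\<lambda>n. (?z n ^ l n - of_real (exp (- Y n))) + complex_of_real (exp (- Y n))) \<longlonglongrightarrow> 0 + of_real (gauss x)"
  by (rule tendsto_add)
 thus ?thesis by (simp add: s_def)
qed

lemma FT_continuous: "continuous_on UNIV (FT \<phi>)"
proof (rule continuous_at_imp_continuous_on, rule ballI)
 fix \<xi>
 show "isCont (FT \<phi>) \<xi>" unfolding continuous_at_sequentially o_def
 proof (intro allI impI)
  fix X assume X: "X \<longlonglongrightarrow> \<xi>"
  show "(\<lambda>n. FT \<phi> (X n)) \<longlonglongrightarrow> FT \<phi> \<xi>" unfolding FT_def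
  proof (rule integral_dominated_convergence[OF _ _ phi_integrable])
   show "AE x in lborel. (\<lambda>n. \<phi> x *\<^sub>R cis (- (2 * pi * (X n \<bullet> x)))) \<longlonglongrightarrow> \<phi> x *\<^sub>R fchar \<xi> x"
    unfolding cis_conv_exp by (intro AE_I2 tendsto_intros X)
   show "AE x in lborel. norm (\<phi> x *\<^sub>R cis (- (2 * pi * (X n \<bullet> x)))) \<le> \<phi> x" for n
    by (intro AE_I2) (simp add: nonneg)
  qed (use integrable_FT[OF phi_integrable] borel_measurable_integrable in blast)+
 qed
qed

text \<open>The lattice sum over \<open>k \<noteq> 0\<close> is a Riemann sum of mesh \<open>sqrt l / L\<close> for the integral of the Gaussian.\<close>

theorem cweight_local_limit:
 assumes mean: "mean_vec \<phi> = 0" and l: "filterlim l at_top sequentially" "\<And>n::nat. l n > (0::nat)"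
  and L: "\<And>n. L n > 0" and small: "(\<lambda>n. sqrt (real (l n)) / L n) \<longlonglongrightarrow> 0"
 shows "(\<lambda>n. (sqrt (real (l n)) / L n) ^ CARD('n) * (cweight (L n) (l n) - 1))
   \<longlonglongrightarrow> (LBINT x. gauss x)"
proof -
 let ?D = "CARD('n)"
 define \<delta> where "\<delta> n = sqrt (real (l n)) / L n" for n
 have \<delta>: "\<delta> n > 0" for n using l(2)[of n] L[of n] by (simp add: \<delta>_def)
 have \<delta>_lim: "\<delta> \<longlonglongrightarrow> 0" using small by (simp add: \<delta>_def[abs_def])
 \<comment> \<open>x rounded down to the lattice of mesh \<delta>. The function F n below is
   constant on the cells, so its integral is exactly \<delta>^d times the lattice sum.\<close>
 define g :: "nat \<Rightarrow> real^'n \<Rightarrow> real^'n" where "g n x = \<delta> n *\<^sub>R rvec (\<chi> i. \<lfloor>x $ i / \<delta> n\<rfloor>)" for n x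
 have g_near: "\<bar>g n x $ i - x $ i\<bar> \<le> \<delta> n" for n x i
 proof -
  let ?t = "x $ i / \<delta> n"
  have "\<delta> n * \<bar>real_of_int \<lfloor>?t\<rfloor> - ?t\<bar> \<le> \<delta> n * 1" using \<delta>[of n] by (intro mult_left_mono) linarith+
  moreover have "g n x $ i - x $ i = \<delta> n * (real_of_int \<lfloor>?t\<rfloor> - ?t)" using \<delta>[of n] by (simp add: g_def right_diff_distrib)
  ultimately show ?thesis using \<delta>[of n] by (simp add: abs_mult)
 qed
 \<comment> \<open>Set to 0 for \<delta> > 1, where rounding would move x too far for the majorant;
   this affects only finitely many n.\<close>
 define F where "F n x = (if \<delta> n \<le> 1 then FT \<phi> (g n x /\<^sub>R sqrt (real (l n))) ^ l n else 0)" for n x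
 have g_meas: "g n \<in> borel_measurable borel" for n
 proof -
  have "g n = (\<lambda>x. \<Sum>i\<in>UNIV. (\<delta> n * real_of_int \<lfloor>x $ i / \<delta> n\<rfloor>) *\<^sub>R axis i 1)"
   by (auto simp: g_def fun_eq_iff vec_eq_iff axis_def if_distrib sum.delta cong: if_cong)
  moreover have "(\<lambda>x::real^'n. \<Sum>i\<in>UNIV. (\<delta> n * real_of_int \<lfloor>x $ i / \<delta> n\<rfloor>) *\<^sub>R axis i (1::real)) \<in> borel_measurable borel"
   by measurable
  ultimately show ?thesis by (simp only:)
 qed
 have FT_meas: "FT \<phi> \<in> borel_measurable borel" by (rule borel_measurable_continuous_onI[OF FT_continuous])
 have F_meas: "F n \<in> borel_measurable borel" for n
  unfolding F_def using g_meas[of n] by (intro measurable_If borel_measurable_power measurable_compose[OF _ FT_meas]) auto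
 \<comment> \<open>Rounding moves a coordinate t to some u at distance at most 1, so 1 + t^2 \<le> 3
   + 2 u^2 \<le> K (1 + c u^2) with c = \<open>decay_const\<close>.\<close>
 define K where "K = 3 + 2 / decay_const"
 have K: "K \<ge> 0" "K * decay_const = 3 * decay_const + 2" using decay_const(1) by (simp_all add: K_def distrib_right)
 have F_le: "norm (F n x) \<le> K ^ ?D * maj x" for n x
 proof (cases "\<delta> n \<le> 1")
  case True
  have "norm (F n x) \<le> (\<Prod>i\<in>UNIV. 1 / (1 + decay_const * real (l n) * ((g n x /\<^sub>R sqrt (real (l n))) $ i)\<^sup>2))"
   using FT_power_bound[of "g n x /\<^sub>R sqrt (real (l n))" "l n"] True by (simp add: F_def)
  also have "\<dots> = (\<Prod>i\<in>UNIV. 1 / (1 + decay_const * (g n x $ i)\<^sup>2))"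
  proof (rule prod.cong[OF refl])
   fix i
   have "real (l n) * (inverse (real (l n)) * t) = t" for t using l(2)[of n] by simp
   thus "1 / (1 + decay_const * real (l n) * ((g n x /\<^sub>R sqrt (real (l n))) $ i)\<^sup>2) = 1 / (1 + decay_const * (g n x $ i)\<^sup>2)"
    by (simp add: power_mult_distrib power_inverse mult.assoc)
  qed
  also have "\<dots> \<le> (\<Prod>i\<in>UNIV. K * (1 / (1 + (x $ i)\<^sup>2)))"
  proof (rule prod_mono, rule conjI)
   fix i
   let ?u = "g n x $ i" and ?t = "x $ i"
   have p: "1 + decay_const * ?u\<^sup>2 > 0" "1 + ?t\<^sup>2 > 0" using decay_const(1) by (auto intro: add_pos_nonneg)
   show "0 \<le> 1 / (1 + decay_const * ?u\<^sup>2)" using p by simp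
   have "\<bar>?u - ?t\<bar> \<le> 1" using g_near[of n x i] True by linarith
   hence "(?u - ?t)\<^sup>2 \<le> 1" by (simp add: abs_square_le_1)
   moreover have "2 * ?u\<^sup>2 + 2 * (?u - ?t)\<^sup>2 - ?t\<^sup>2 = (2 * ?u - ?t)\<^sup>2" by (simp add: power2_eq_square algebra_simps)
   ultimately have "?t\<^sup>2 \<le> 2 * ?u\<^sup>2 + 2" using zero_le_power2[of "2 * ?u - ?t"] by linarith
   hence "1 + ?t\<^sup>2 \<le> 3 + 2 * ?u\<^sup>2" by simp
   also have "\<dots> \<le> 3 + 2 / decay_const + (3 * decay_const + 2) * ?u\<^sup>2"
    using decay_const(1) by (intro add_mono mult_right_mono) auto
   also have "\<dots> = K * (1 + decay_const * ?u\<^sup>2)"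
    using K(2) by (simp add: K_def[symmetric] distrib_left mult.assoc[symmetric])
   finally show "1 / (1 + decay_const * ?u\<^sup>2) \<le> K * (1 / (1 + ?t\<^sup>2))"
    using p by (simp add: divide_le_eq le_divide_eq)
  qed
  also have "\<dots> = K ^ ?D * maj x" by (simp only: maj_def prod.distrib prod_constant)
  finally show ?thesis .
 qed (use K maj_pos[of x] in \<open>simp add: F_def less_imp_le\<close>)
 have maj_int: "integrable lborel (\<lambda>x::real^'n. K ^ ?D * maj x)" by (intro integrable_mult_right maj_integrable)
 have F_int: "integrable lborel (F n)" for n
  by (rule Bochner_Integration.integrable_bound[OF maj_int]) (use F_meas F_le order_trans[OF F_le abs_ge_self] in auto)
 have F_lim: "(\<lambda>n. F n x) \<longlonglongrightarrow> of_real (gauss x)" for x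
 proof -
  have "(\<lambda>n. g n x) \<longlonglongrightarrow> x"
  proof (rule vec_tendstoI)
   fix i
   have "(\<lambda>n. g n x $ i - x $ i) \<longlonglongrightarrow> 0" by (rule Lim_null_comparison[OF _ \<delta>_lim]) (simp add: g_near)
   thus "(\<lambda>n. g n x $ i) \<longlonglongrightarrow> x $ i" by (rule LIM_zero_cancel)
  qed
  from FT_power_limit[OF mean this l] show ?thesis
  proof (rule Lim_transform_eventually)
   show "\<forall>\<^sub>F n in sequentially. FT \<phi> (g n x /\<^sub>R sqrt (real (l n))) ^ l n = F n x"
    using order_tendstoD(2)[OF \<delta>_lim, of 1] by (auto elim!: eventually_mono simp: F_def)
  qed
 qed
 have int_lim: "(\<lambda>n. \<integral>x. F n x \<partial>lborel) \<longlonglongrightarrow> (LBINT x. complex_of_real (gauss x))"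
 proof (rule integral_dominated_convergence[OF _ _ maj_int])
  have "(\<lambda>x. complex_of_real (gauss x)) \<in> borel_measurable borel"
   by (rule borel_measurable_LIMSEQ_metric[OF F_meas F_lim])
  thus "(\<lambda>x. complex_of_real (gauss x)) \<in> borel_measurable lborel" by simp
 qed (use F_meas F_lim F_le in auto)
 have val: "(LBINT x. F n x) = of_real (\<delta> n ^ ?D) * (\<Sum>\<^sub>\<infinity>k::int^'n. FT \<phi> (rvec k /\<^sub>R L n) ^ l n)" if d1: "\<delta> n \<le> 1" for n
 proof -
  let ?S = "\<Sum>\<^sub>\<infinity>k::int^'n. FT \<phi> (rvec k /\<^sub>R L n) ^ l n"
  have "(LBINT x. F n x) = (LBINT x. indicator (box_L (\<delta> n)) x *\<^sub>R (\<integral>k. F n (x + \<delta> n *\<^sub>R rvec k) \<partial>count_space UNIV))"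
   by (rule unfold_integral[OF F_int \<delta>])
  also have "\<dots> = (LBINT x. indicator (box_L (\<delta> n)) (x :: real^'n) *\<^sub>R ?S)"
  proof (rule Bochner_Integration.integral_cong[OF refl])
   fix x :: "real^'n"
   show "indicator (box_L (\<delta> n)) x *\<^sub>R (\<integral>k. F n (x + \<delta> n *\<^sub>R rvec k) \<partial>count_space UNIV) = indicator (box_L (\<delta> n)) x *\<^sub>R ?S"
   proof (cases "x \<in> box_L (\<delta> n)")
    case True
    have "F n (x + \<delta> n *\<^sub>R rvec k) = FT \<phi> (rvec k /\<^sub>R L n) ^ l n" for k :: "int^'n"
    proof -
     have "(x + \<delta> n *\<^sub>R rvec k) - \<delta> n *\<^sub>R rvec k \<in> box_L (\<delta> n)" using True by simp
     hence "k = (\<chi> i. \<lfloor>(x + \<delta> n *\<^sub>R rvec k) $ i / \<delta> n\<rfloor>)" by (rule box_L_unique[OF \<delta>, THEN iffD1])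
     hence "g n (x + \<delta> n *\<^sub>R rvec k) = \<delta> n *\<^sub>R rvec k" unfolding g_def by (metis (no_types))
     moreover have "(\<delta> n *\<^sub>R rvec k) /\<^sub>R sqrt (real (l n)) = (rvec k /\<^sub>R L n :: real^'n)"
      using l(2)[of n] by (simp add: \<delta>_def divide_inverse)
     ultimately show ?thesis using d1 by (simp only: F_def if_True)
    qed
    thus ?thesis using count_space_infsum(2)[OF FT_lattice_summable[OF L l(2)]] by simp
   qed simp
  qed
  also have "\<dots> = measure lborel (box_L (\<delta> n) :: (real^'n) set) *\<^sub>R ?S"
   using box_L_finite[OF \<delta>[of n], where 'n = 'n] by (subst integral_scaleR_left) (auto intro: integrable_real_indicator)
  also have "measure lborel (box_L (\<delta> n) :: (real^'n) set) = \<delta> n ^ ?D"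
   using box_L_finite[OF \<delta>[of n], where 'n = 'n] \<delta>[of n] by (simp add: measure_def)
  finally show ?thesis by (simp add: scaleR_conv_of_real)
 qed
 \<comment> \<open>The 1 subtracted from the trace contributes \<delta>^d, which vanishes in the
   limit.\<close>
 have "(\<lambda>n. Re (LBINT x. F n x) - \<delta> n ^ ?D) \<longlonglongrightarrow> Re (LBINT x. complex_of_real (gauss x)) - 0 ^ ?D"
  by (intro tendsto_diff tendsto_Re int_lim tendsto_power \<delta>_lim)
 hence "(\<lambda>n. Re (LBINT x. F n x) - \<delta> n ^ ?D) \<longlonglongrightarrow> (LBINT x. gauss x)"
  unfolding integral_complex_of_real by (simp add: power_0_left)
 thus ?thesis
 proof (rule Lim_transform_eventually)
  show "\<forall>\<^sub>F n in sequentially. Re (LBINT x. F n x) - \<delta> n ^ ?D = (sqrt (real (l n)) / L n) ^ ?D * (cweight (L n) (l n) - 1)"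
   using order_tendstoD(2)[OF \<delta>_lim, of 1, OF zero_less_one]
  proof eventually_elim
   case (elim n)
   have "Re (LBINT x. F n x) = \<delta> n ^ ?D * cweight (L n) (l n)"
    using val[of n] elim l(2)[of n] by (simp add: cweight_def)
   thus ?case by (simp add: \<delta>_def[symmetric] right_diff_distrib)
  qed
 qed
qed

end

subsection \<open>The critical planar regime\<close>

lemma nn_integral_plane:
 fixes f :: "real^'n \<Rightarrow> ennreal"
 assumes ij: "i \<noteq> j" "UNIV = {i, j :: 'n}" and f [measurable]: "f \<in> borel_measurable borel"
 shows "(\<integral>\<^sup>+x. f x \<partial>lborel) = (\<integral>\<^sup>+t. \<integral>\<^sup>+s. f (s *\<^sub>R axis i 1 + t *\<^sub>R axis j 1) \<partial>lborel \<partial>lborel)"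
proof -
 let ?e = "\<lambda>k. axis k (1::real) :: real^'n"
 interpret product_sigma_finite "\<lambda>_ :: real^'n. lborel :: real measure" by standard
 have ne: "?e i \<noteq> ?e j" using ij(1) by (auto simp: axis_eq_axis)
 have B: "Basis = {?e i, ?e j}" using ij(2) by (auto simp: Basis_vec_def)
 let ?s = "\<lambda>x::real^'n \<Rightarrow> real. \<Sum>b\<in>{?e i, ?e j}. x b *\<^sub>R b"
 have [measurable]: "?s \<in> measurable (\<Pi>\<^sub>M b\<in>{?e i, ?e j}. lborel) borel" by measurable
 have "(lborel :: (real^'n) measure) = distr (\<Pi>\<^sub>M b\<in>{?e i, ?e j}. lborel) borel ?s"
  unfolding lborel_eq_real lborel_def[where 'a = "real^'n"] B ..
 hence "(\<integral>\<^sup>+x. f x \<partial>lborel) = (\<integral>\<^sup>+x. f x \<partial>distr (\<Pi>\<^sub>M b\<in>{?e i, ?e j}. lborel) borel ?s)"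
  by (rule arg_cong)
 also have "\<dots> = (\<integral>\<^sup>+x. f (?s x) \<partial>(\<Pi>\<^sub>M b\<in>{?e i, ?e j}. lborel))"
  by (rule nn_integral_distr) measurable
 also have "\<dots> = (\<integral>\<^sup>+x. \<integral>\<^sup>+y. f (?s (x(?e i := y))) \<partial>lborel \<partial>(\<Pi>\<^sub>M b\<in>{?e j}. lborel))"
  by (rule product_nn_integral_insert) (use ne in auto)
 also have "\<dots> = (\<integral>\<^sup>+x. (\<lambda>t. \<integral>\<^sup>+s. f (s *\<^sub>R ?e i + t *\<^sub>R ?e j) \<partial>lborel) (x (?e j)) \<partial>(\<Pi>\<^sub>M b\<in>{?e j}. lborel))"
  using ne by simp
 also have "\<dots> = (\<integral>\<^sup>+t. \<integral>\<^sup>+s. f (s *\<^sub>R ?e i + t *\<^sub>R ?e j) \<partial>lborel \<partial>lborel)"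
  by (rule product_nn_integral_singleton) measurable
 finally show ?thesis .
qed

lemma nn_integral_gaussian:
 fixes p m :: real
 assumes p: "p > 0"
 shows "(\<integral>\<^sup>+s. ennreal (exp (- (p * (s + m)\<^sup>2))) \<partial>lborel) = ennreal (sqrt (pi / p))"
proof -
 define \<sigma> where "\<sigma> = sqrt (1 / (2 * p))"
 have \<sigma>: "\<sigma> > 0" "\<sigma>\<^sup>2 = 1 / (2 * p)" using p by (simp_all add: \<sigma>_def)
 have eq: "exp (- (p * (s + m)\<^sup>2)) = sqrt (pi / p) * normal_density (- m) \<sigma> s" for s
  using p by (simp add: normal_density_def \<sigma>(2))
 interpret prob_space "density lborel (\<lambda>x. ennreal (normal_density (- m) \<sigma> x))"
  by (rule prob_space_normal_density[OF \<sigma>(1)])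
 have "(\<integral>\<^sup>+s. ennreal (normal_density (- m) \<sigma> s) \<partial>lborel) = 1"
  using emeasure_space_1 by (simp add: emeasure_density)
 thus ?thesis unfolding eq using p by (simp add: ennreal_mult nn_integral_cmult)
qed

lemma det_two:
 fixes A :: "real^'n^'n"
 assumes ij: "i \<noteq> j" "UNIV = {i, j :: 'n}"
 shows "det A = A $ i $ i * A $ j $ j - A $ i $ j * A $ j $ i"
proof -
 have f: "finite {j}" "i \<notin> {j}" using ij(1) by auto
 show ?thesis
  unfolding det_def ij(2)
  unfolding sum_over_permutations_insert[OF f]
  unfolding permutes_sing
  using ij(1) by (simp add: sign_swap_id sign_id swap_id_eq)
qed

context schwartz_density begin

text \<open>Nondegeneracy is read off from the Fourier side: exp (- 2 pi^2 qform \<xi>) is a limit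
  of moduli of powers of FT, all of them below one product that is less than 1 when \<xi> \<noteq>
  0.\<close>

lemma qform_pos:
 assumes mean: "mean_vec \<phi> = 0" and \<xi>: "\<xi> \<noteq> 0"
 shows "qform \<xi> > 0"
proof -
 obtain k where k: "\<xi> $ k \<noteq> 0" using \<xi> by (auto simp: vec_eq_iff)
 let ?P = "\<lambda>c. \<Prod>i\<in>UNIV. 1 / (1 + c * (\<xi> $ i)\<^sup>2)"
 have "(\<lambda>n. FT \<phi> (\<xi> /\<^sub>R sqrt (real (Suc n))) ^ Suc n) \<longlonglongrightarrow> of_real (exp (- (2 * pi\<^sup>2 * qform \<xi>)))"
  by (rule FT_power_limit[OF mean tendsto_const filterlim_Suc]) simp
 hence "(\<lambda>n. norm (FT \<phi> (\<xi> /\<^sub>R sqrt (real (Suc n))) ^ Suc n)) \<longlonglongrightarrow> exp (- (2 * pi\<^sup>2 * qform \<xi>))"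
  by (drule_tac tendsto_norm) simp
 moreover have "norm (FT \<phi> (\<xi> /\<^sub>R sqrt (real (Suc n))) ^ Suc n) \<le> ?P decay_const" for n
 proof -
  have "decay_const * real (Suc n) * (inverse (sqrt (real (Suc n))) * t)\<^sup>2 = decay_const * t\<^sup>2" for t
   by (simp add: power_mult_distrib power_inverse)
  thus ?thesis using FT_power_bound[of "\<xi> /\<^sub>R sqrt (real (Suc n))" "Suc n"] by (simp only: vector_scaleR_component real_scaleR_def)
 qed
 ultimately have "exp (- (2 * pi\<^sup>2 * qform \<xi>)) \<le> ?P decay_const" by (blast intro: LIMSEQ_le_const2)
 also have "?P decay_const = 1 / (1 + decay_const * (\<xi> $ k)\<^sup>2) * (\<Prod>i\<in>UNIV - {k}. 1 / (1 + decay_const * (\<xi> $ i)\<^sup>2))"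
  by (rule prod.remove) auto
 also have "\<dots> \<le> 1 / (1 + decay_const * (\<xi> $ k)\<^sup>2) * 1"
  using decay_const(1) by (intro mult_left_mono prod_le_1) (auto simp: add_nonneg_nonneg divide_le_eq add_pos_nonneg)
 also have "\<dots> < 1" using decay_const(1) k by (simp add: divide_less_eq add_pos_pos)
 finally have "exp (- (2 * pi\<^sup>2 * qform \<xi>)) < 1" .
 thus ?thesis by (simp add: zero_less_mult_iff)
qed

text \<open>Completing the square in the first coordinate reduces to two one-dimensional Gaussian
  integrals. The form takes the value a D at the vector (- b, a), which gives D > 0.\<close>

lemma gaussian_plane:
 assumes mean: "mean_vec \<phi> = 0" and d: "CARD('n) = 2"
 shows "det (cov_mat \<phi>) > 0" and "(LBINT x. gauss x) = 1 / (2 * pi * sqrt (det (cov_mat \<phi>)))"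
proof -
 obtain i j :: 'n where ij: "i \<noteq> j" "UNIV = {i, j}" using d by (auto simp: card_2_iff)
 let ?S = "cov_mat \<phi>"
 define a b c where "a = ?S $ i $ i" and "b = ?S $ i $ j" and "c = ?S $ j $ j"
 have b': "?S $ j $ i = b" by (simp add: b_def cov_mat_def mult.commute)
 have Q: "qform (s *\<^sub>R axis i 1 + t *\<^sub>R axis j 1) = a * s\<^sup>2 + 2 * b * s * t + c * t\<^sup>2" for s t
  unfolding qform_cov[OF mean] ij(2) using ij(1)
  by (simp add: axis_def b' a_def[symmetric] b_def[symmetric] c_def[symmetric] power2_eq_square algebra_simps)
 have ne: "s *\<^sub>R axis i 1 + t *\<^sub>R axis j 1 \<noteq> (0 :: real^'n)" if "s \<noteq> 0 \<or> t \<noteq> 0" for s t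
 proof
  assume z: "s *\<^sub>R axis i 1 + t *\<^sub>R axis j 1 = (0 :: real^'n)"
  have "(s *\<^sub>R axis i 1 + t *\<^sub>R axis j 1 :: real^'n) $ i = s" "(s *\<^sub>R axis i 1 + t *\<^sub>R axis j 1 :: real^'n) $ j = t"
   using ij(1) by (auto simp: axis_def)
  thus False using that unfolding z by simp
 qed
 have a: "a > 0" using qform_pos[OF mean ne[of 1 0]] Q[of 1 0] by simp
 define D where "D = det ?S"
 have D: "D = a * c - b * b" unfolding D_def det_two[OF ij] by (simp add: b' a_def b_def c_def)
 have "a * D = a * b\<^sup>2 + 2 * b * (- b) * a + c * a\<^sup>2" by (simp add: D power2_eq_square algebra_simps)
 also have "\<dots> > 0" using qform_pos[OF mean ne[of "- b" a]] Q[of "- b" a] a by simp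
 finally have D0: "D > 0" using a by (simp add: zero_less_mult_iff)
 thus "det (cov_mat \<phi>) > 0" by (simp add: D_def)
 define p q where "p = 2 * pi\<^sup>2 * a" and "q = 2 * pi\<^sup>2 * (D / a)"
 have pq: "p > 0" "q > 0" using a D0 by (simp_all add: p_def q_def)
 have split: "2 * pi\<^sup>2 * qform (s *\<^sub>R axis i 1 + t *\<^sub>R axis j 1) = q * (t + 0)\<^sup>2 + p * (s + b / a * t)\<^sup>2" for s t
  using a by (simp add: Q p_def q_def D field_simps power2_eq_square)
 have cont: "continuous_on UNIV (\<lambda>x. gauss x)" unfolding qform_cov[OF mean] by (intro continuous_intros)
 hence meas: "(\<lambda>x. gauss x) \<in> borel_measurable borel" by (rule borel_measurable_continuous_onI)
 have "(\<integral>\<^sup>+x. ennreal (gauss x) \<partial>lborel)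
   = (\<integral>\<^sup>+t. \<integral>\<^sup>+s. ennreal (exp (- (2 * pi\<^sup>2 * qform (s *\<^sub>R axis i 1 + t *\<^sub>R axis j 1)))) \<partial>lborel \<partial>lborel)"
  by (rule nn_integral_plane[OF ij]) (use meas in simp)
 also have "\<dots> = (\<integral>\<^sup>+t. \<integral>\<^sup>+s. ennreal (exp (- (q * (t + 0)\<^sup>2))) * ennreal (exp (- (p * (s + b / a * t)\<^sup>2))) \<partial>lborel \<partial>lborel)"
  unfolding split by (simp add: ennreal_mult[symmetric] flip: exp_add)
 also have "\<dots> = (\<integral>\<^sup>+t. ennreal (exp (- (q * (t + 0)\<^sup>2))) * ennreal (sqrt (pi / p)) \<partial>lborel)"
  by (subst nn_integral_cmult) (simp_all only: nn_integral_gaussian[OF pq(1)], simp)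
 also have "\<dots> = (\<integral>\<^sup>+t. ennreal (exp (- (q * (t + 0)\<^sup>2))) \<partial>lborel) * ennreal (sqrt (pi / p))"
  by (rule nn_integral_multc) simp
 also have "\<dots> = ennreal (sqrt (pi / q) * sqrt (pi / p))"
  unfolding nn_integral_gaussian[OF pq(2)] using pq by (simp add: ennreal_mult)
 also have "sqrt (pi / q) * sqrt (pi / p) = 1 / (2 * pi * sqrt D)"
 proof -
  have "pi / q * (pi / p) = (1 / (2 * pi))\<^sup>2 * (1 / D)"
   using a D0 by (simp add: p_def q_def field_simps power2_eq_square)
  hence "sqrt (pi / q) * sqrt (pi / p) = sqrt ((1 / (2 * pi))\<^sup>2 * (1 / D))" by (simp only: flip: real_sqrt_mult)
  thus ?thesis by (simp add: real_sqrt_mult real_sqrt_divide)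
 qed
 finally have "(\<integral>\<^sup>+x. ennreal (gauss x) \<partial>lborel) = ennreal (1 / (2 * pi * sqrt D))" .
 thus "(LBINT x. gauss x) = 1 / (2 * pi * sqrt (det (cov_mat \<phi>)))"
  using meas D0 by (subst integral_eq_nn_integral) (simp_all add: D_def)
qed

text \<open>If uniformity failed for K = n + 1 and \<eta> = 1 / (n + 1) with every n, the
  counterexamples would form a sequence to which \<open>cweight_local_limit\<close> applies.\<close>

lemma cweight_local_uniform:
 assumes mean: "mean_vec \<phi> = 0" and d: "CARD('n) = 2" and \<epsilon>: "\<epsilon> > 0"
 obtains K :: nat and \<eta> :: real where "\<eta> > 0"
  "\<And>L l. L > 0 \<Longrightarrow> K \<le> l \<Longrightarrow> real l \<le> \<eta> * L\<^sup>2 \<Longrightarrow> \<bar>real l / L\<^sup>2 * (cweight L l - 1) - 1 / (2 * pi * sqrt (det (cov_mat \<phi>)))\<bar> \<le> \<epsilon>"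
proof -
 let ?G = "1 / (2 * pi * sqrt (det (cov_mat \<phi>)))"
 let ?P = "\<lambda>K \<eta>. \<forall>L l. L > 0 \<and> K \<le> l \<and> real l \<le> \<eta> * L\<^sup>2 \<longrightarrow> \<bar>real l / L\<^sup>2 * (cweight L l - 1) - ?G\<bar> \<le> \<epsilon>"
 have "\<exists>n. ?P (Suc n) (1 / real (Suc n))"
 proof (rule ccontr)
  assume "\<nexists>n. ?P (Suc n) (1 / real (Suc n))"
  hence "\<forall>n. \<exists>L l. L > 0 \<and> Suc n \<le> l \<and> real l \<le> 1 / real (Suc n) * L\<^sup>2 \<and> \<not> \<bar>real l / L\<^sup>2 * (cweight L l - 1) - ?G\<bar> \<le> \<epsilon>" by blast
  then obtain L l where Ll: "\<And>n. L n > 0" "\<And>n. Suc n \<le> l n" "\<And>n. real (l n) \<le> 1 / real (Suc n) * (L n)\<^sup>2"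
   "\<And>n. \<not> \<bar>real (l n) / (L n)\<^sup>2 * (cweight (L n) (l n) - 1) - ?G\<bar> \<le> \<epsilon>"
   by metis
  have l_top: "filterlim l at_top sequentially"
   by (rule filterlim_at_top_mono[OF filterlim_ident]) (rule always_eventually[OF allI[OF Suc_leD[OF Ll(2)]]])
  have l_pos: "l n > 0" for n using Ll(2)[of n] by simp
  have ratio: "real (l n) / (L n)\<^sup>2 \<le> inverse (real (Suc n))" for n
  proof -
   have "(L n)\<^sup>2 > 0" using Ll(1)[of n] by simp
   thus ?thesis using Ll(3)[of n] by (simp add: pos_divide_le_eq inverse_eq_divide)
  qed
  have small: "(\<lambda>n. sqrt (real (l n)) / L n) \<longlonglongrightarrow> 0"
  proof (rule Lim_null_comparison[OF always_eventually[OF allI]])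
   show "norm (sqrt (real (l n)) / L n) \<le> sqrt (inverse (real (Suc n)))" for n
    using real_sqrt_le_mono[OF ratio[of n]] Ll(1)[of n] by (simp add: real_sqrt_divide abs_mult)
   show "(\<lambda>n. sqrt (inverse (real (Suc n)))) \<longlonglongrightarrow> 0"
    using tendsto_real_sqrt[OF LIMSEQ_inverse_real_of_nat] by simp
  qed
  have "(sqrt (real (l n)) / L n) ^ CARD('n) * t = real (l n) / (L n)\<^sup>2 * t" for n t
   by (simp add: d power_divide)
  hence "(\<lambda>n. real (l n) / (L n)\<^sup>2 * (cweight (L n) (l n) - 1)) \<longlonglongrightarrow> ?G"
   using cweight_local_limit[OF mean l_top l_pos Ll(1) small] unfolding gaussian_plane(2)[OF mean d] by (simp only:)
  from tendstoD[OF this \<epsilon>] obtain n where "dist (real (l n) / (L n)\<^sup>2 * (cweight (L n) (l n) - 1)) ?G < \<epsilon>"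
   by (auto simp: eventually_sequentially)
  thus False using Ll(4)[of n] by (simp add: dist_real_def)
 qed
 then obtain n where "?P (Suc n) (1 / real (Suc n))" by blast
 thus ?thesis by (intro that[of "1 / real (Suc n)" "Suc n"]) auto
qed

text \<open>The excess at length l is close to G L^2 / l for K \<le> l \<le> \<eta> L^2, so the mean
  is about \<theta> G (ln N) / \<rho>. Outside this window crude bounds give O (K + sqrt \<rho>) for
  the sum, which is o (ln N) because \<rho> is of order ln N.\<close>

lemma mean_dim_2_critical:
 assumes th: "\<theta> > 0" and mean: "mean_vec \<phi> = 0" and d: "CARD('n) = 2"
  and rho: "\<And>N. \<rho> N > 0" and rho_lim: "(\<lambda>N. \<rho> N / ln (real N)) \<longlonglongrightarrow> \<alpha>" and \<alpha>: "\<alpha> > 0"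
  and L: "\<And>N. L N > 0" and L_eq: "\<And>N. N > 0 \<Longrightarrow> (L N)\<^sup>2 = real N / \<rho> N"
 shows "(\<lambda>N. mean_weight \<theta> L N) \<longlonglongrightarrow> alpha_c \<theta> \<phi> / \<alpha>"
proof -
 define G where "G = 1 / (2 * pi * sqrt (det (cov_mat \<phi>)))"
 have G0: "G \<ge> 0" using gaussian_plane(1)[OF mean d] by (simp add: G_def)
 define w where "w N l = real l / (L N)\<^sup>2 * (cweight (L N) l - 1)" for N l
 define B where "B = width\<^sup>2 + G"
 have B0: "B \<ge> 0" using G0 by (simp add: B_def)
 have ln_top: "filterlim (\<lambda>N. ln (real N)) at_top sequentially"
  by (rule filterlim_compose[OF ln_at_top filterlim_real_sequentially])
 have ln_pos: "\<forall>\<^sub>F N in sequentially. ln (real N) > 0" using eventually_gt_at_top[of 1] by eventually_elim simp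
 have sqrt_lim: "(\<lambda>N. sqrt (\<rho> N) / ln (real N)) \<longlonglongrightarrow> 0"
 proof -
  have "(\<lambda>N. sqrt (\<rho> N / ln (real N)) * inverse (sqrt (ln (real N)))) \<longlonglongrightarrow> sqrt \<alpha> * 0"
   by (intro tendsto_mult tendsto_real_sqrt rho_lim tendsto_inverse_0_at_top filterlim_compose[OF sqrt_at_top ln_top])
  hence "(\<lambda>N. sqrt (\<rho> N / ln (real N)) * inverse (sqrt (ln (real N)))) \<longlonglongrightarrow> 0" by simp
  thus ?thesis
  proof (rule Lim_transform_eventually)
   show "\<forall>\<^sub>F N in sequentially. sqrt (\<rho> N / ln (real N)) * inverse (sqrt (ln (real N))) = sqrt (\<rho> N) / ln (real N)"
    using ln_pos
   proof eventually_elim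
    case (elim N)
    have "sqrt (ln (real N)) * sqrt (ln (real N)) = ln (real N)" using elim by simp
    moreover have "sqrt (\<rho> N / ln (real N)) * inverse (sqrt (ln (real N))) = sqrt (\<rho> N) * inverse (sqrt (ln (real N)) * sqrt (ln (real N)))"
     unfolding real_sqrt_divide by (simp only: divide_inverse inverse_mult_distrib mult.assoc)
    ultimately show ?case by (simp only: divide_inverse)
   qed
  qed
 qed
 have w_le: "\<bar>w N l - G\<bar> \<le> B + 2 * width * sqrt (real l) / L N" if l: "l > 0" for N l
 proof -
  have "\<bar>w N l\<bar> = real l / (L N)\<^sup>2 * \<bar>cweight (L N) l - 1\<bar>" by (simp add: w_def abs_mult)
  also have "\<dots> \<le> real l / (L N)\<^sup>2 * (2 * width * L N * (1 / sqrt (real l)) + width\<^sup>2 * (L N)\<^sup>2 * (1 / real l))"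
   by (intro mult_left_mono cweight_bound_2 d L l) simp
  also have "\<dots> = 2 * width * (real l / sqrt (real l)) / L N + width\<^sup>2"
   using L[of N] l by (simp add: field_simps power2_eq_square)
  also have "real l / sqrt (real l) = sqrt (real l)" by (rule real_div_sqrt) simp
  finally show ?thesis using G0 by (simp add: B_def)
 qed
 have key: "(\<lambda>N. (\<Sum>l=1..N. (w N l - G) / real l) / ln (real N)) \<longlonglongrightarrow> 0"
 proof (rule tendstoI)
  fix e :: real assume e: "e > 0"
  obtain K :: nat and \<eta> where \<eta>: "\<eta> > 0" and unif: "\<And>L l. L > 0 \<Longrightarrow> K \<le> l \<Longrightarrow> real l \<le> \<eta> * L\<^sup>2 \<Longrightarrow> \<bar>real l / L\<^sup>2 * (cweight L l - 1) - G\<bar> \<le> e / 2"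
   using cweight_local_uniform[OF mean d, of "e / 2"] e unfolding G_def by (metis half_gt_zero)
  define C where "C = 4 * width + 2 * B / sqrt \<eta>"
  \<comment> \<open>Below K and above \<eta> L^2 only \<open>w_le\<close> is available. In the upper
    range 1 / l \<le> 1 / (sqrt \<eta> L sqrt l), and the sum of the right side is of order sqrt N /
    L = sqrt \<rho>.\<close>
  have step: "\<bar>(w N l - G) / real l\<bar> \<le> e / 2 * (1 / real l) + B * (if l < K then 1 else 0) + (2 * width + B / sqrt \<eta>) / L N * (1 / sqrt (real l))"
   if l: "l > 0" for N l
  proof -
   have p1: "0 \<le> e / 2 * (1 / real l)" using e by simp
   have p2: "0 \<le> B * (if l < K then 1 else 0)" using B0 by simp
   have p3: "0 \<le> (2 * width) / L N * (1 / sqrt (real l))" using width_pos L[of N] by simp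
   have p4: "0 \<le> (B / sqrt \<eta>) / L N * (1 / sqrt (real l))" using B0 \<eta> L[of N] by simp
   have rewr: "(2 * width + B / sqrt \<eta>) / L N * (1 / sqrt (real l)) = (2 * width) / L N * (1 / sqrt (real l)) + (B / sqrt \<eta>) / L N * (1 / sqrt (real l))"
    by (simp only: add_divide_distrib distrib_right)
   show ?thesis
   proof (cases "K \<le> l \<and> real l \<le> \<eta> * (L N)\<^sup>2")
    case True
    hence "\<bar>w N l - G\<bar> \<le> e / 2" unfolding w_def by (intro unif L) auto
    hence "\<bar>w N l - G\<bar> / real l \<le> e / 2 / real l" by (intro divide_right_mono) auto
    thus ?thesis using p2 p3 p4 unfolding rewr by simp
   next
    case False
    have "\<bar>w N l - G\<bar> / real l \<le> (B + 2 * width * sqrt (real l) / L N) / real l" using w_le[OF l] by (intro divide_right_mono) auto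
    also have "\<dots> = B * (1 / real l) + 2 * width / L N * (sqrt (real l) / real l)"
     by (simp add: add_divide_distrib)
    also have "\<dots> = B * (1 / real l) + 2 * width / L N * (1 / sqrt (real l))" by (simp only: sqrt_over_self)
    finally have up: "\<bar>w N l - G\<bar> / real l \<le> B * (1 / real l) + 2 * width / L N * (1 / sqrt (real l))" .
    have "B * (1 / real l) \<le> B * (if l < K then 1 else 0) + (B / sqrt \<eta>) / L N * (1 / sqrt (real l))"
    proof (cases "l < K")
     case True
     have "B * (1 / real l) \<le> B * 1" using l B0 by (intro mult_left_mono) auto
     thus ?thesis using True p4 by simp
    next
     case F2: False
     hence "\<eta> * (L N)\<^sup>2 \<le> real l" using False by auto
     hence "sqrt (\<eta> * (L N)\<^sup>2) \<le> sqrt (real l)" by simp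
     hence "sqrt \<eta> * L N \<le> sqrt (real l)" using L[of N] by (simp add: real_sqrt_mult)
     hence "1 / sqrt (real l) \<le> 1 / (sqrt \<eta> * L N)" using \<eta> L[of N] l by (intro divide_left_mono) auto
     hence "B * (1 / sqrt (real l) * (1 / sqrt (real l))) \<le> B * (1 / (sqrt \<eta> * L N) * (1 / sqrt (real l)))"
      using B0 by (intro mult_left_mono mult_right_mono) auto
     also have "\<dots> = (B / sqrt \<eta>) / L N * (1 / sqrt (real l))" by simp
     finally show ?thesis using F2 by simp
    qed
    thus ?thesis using up p1 unfolding rewr by simp
   qed
  qed
  define R where "R N = e / 2 * (harm N / ln (real N)) + B * real K * inverse (ln (real N)) + C * (sqrt (\<rho> N) / ln (real N))" for N
  have R_lim: "R \<longlonglongrightarrow> e / 2 * 1 + B * real K * 0 + C * 0" unfolding R_def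
   by (intro tendsto_add tendsto_mult tendsto_const harm_over_ln sqrt_lim tendsto_inverse_0_at_top ln_top)
  have "\<forall>\<^sub>F N in sequentially. R N < e" using order_tendstoD(2)[OF R_lim, of e] e by simp
  thus "\<forall>\<^sub>F N in sequentially. dist ((\<Sum>l=1..N. (w N l - G) / real l) / ln (real N)) 0 < e"
   using ln_pos eventually_gt_at_top[of 0]
  proof eventually_elim
   case (elim N)
   have "\<bar>\<Sum>l=1..N. (w N l - G) / real l\<bar> \<le> (\<Sum>l=1..N. e / 2 * (1 / real l) + B * (if l < K then 1 else 0) + (2 * width + B / sqrt \<eta>) / L N * (1 / sqrt (real l)))"
    by (intro order_trans[OF sum_abs] sum_mono step) auto
   also have "\<dots> = e / 2 * harm N + B * (\<Sum>l=1..N. if l < K then 1 else 0) + (2 * width + B / sqrt \<eta>) / L N * (\<Sum>l=1..N. 1 / sqrt (real l))"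
    by (simp only: sum.distrib sum_distrib_left harm_def inverse_eq_divide)
   also have "\<dots> \<le> e / 2 * harm N + B * real K + (2 * width + B / sqrt \<eta>) / L N * (2 * sqrt (real N))"
   proof (intro add_mono mult_left_mono sum_inverse_sqrt_le B0 order_refl)
    have "(\<Sum>l=1..N. if l < K then 1 else (0::real)) = real (card {l \<in> {1..N}. l < K})" by (simp add: sum.If_cases Int_def)
    also have "\<dots> \<le> real (card {..<K})" by (intro of_nat_mono card_mono) auto
    finally show "(\<Sum>l=1..N. if l < K then 1 else (0::real)) \<le> real K" by simp
    show "0 \<le> (2 * width + B / sqrt \<eta>) / L N" using width_pos B0 \<eta> L[of N] by simp
   qed (use e in auto)
   also have "(2 * width + B / sqrt \<eta>) / L N * (2 * sqrt (real N)) = C * sqrt (\<rho> N)"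
   proof -
    have "sqrt ((L N)\<^sup>2) = sqrt (real N / \<rho> N)" using L_eq elim by simp
    hence "L N * sqrt (\<rho> N) = sqrt (real N)" using L[of N] rho[of N] by (simp add: real_sqrt_divide)
    hence "sqrt (real N) / L N = sqrt (\<rho> N)" using L[of N] by (simp add: field_simps)
    hence "(2 * width + B / sqrt \<eta>) * 2 * (sqrt (real N) / L N) = C * sqrt (\<rho> N)" by (simp add: C_def algebra_simps)
    moreover have "(2 * width + B / sqrt \<eta>) / L N * (2 * sqrt (real N)) = (2 * width + B / sqrt \<eta>) * 2 * (sqrt (real N) / L N)"
     by (simp only: divide_inverse mult_ac)
    ultimately show ?thesis by (simp only:)
   qed
   finally have "\<bar>\<Sum>l=1..N. (w N l - G) / real l\<bar> \<le> e / 2 * harm N + B * real K + C * sqrt (\<rho> N)" .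
   moreover have "0 \<le> ln (real N)" using elim by linarith
   ultimately have "\<bar>\<Sum>l=1..N. (w N l - G) / real l\<bar> / ln (real N) \<le> (e / 2 * harm N + B * real K + C * sqrt (\<rho> N)) / ln (real N)"
    by (rule divide_right_mono)
   also have "\<dots> = R N" by (simp only: R_def add_divide_distrib divide_inverse distrib_right mult.assoc)
   also have "\<dots> < e" using elim by simp
   finally show ?case using elim by (simp add: dist_real_def)
  qed
 qed
 have "(\<lambda>N. \<theta> * inverse (\<rho> N / ln (real N)) * ((\<Sum>l=1..N. (w N l - G) / real l) / ln (real N) + G * (harm N / ln (real N))))
   \<longlonglongrightarrow> \<theta> * inverse \<alpha> * (0 + G * 1)"
  using \<alpha> by (intro tendsto_mult tendsto_add tendsto_const tendsto_inverse rho_lim key harm_over_ln) simp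
 moreover have "\<theta> * inverse \<alpha> * (0 + G * 1) = alpha_c \<theta> \<phi> / \<alpha>" 
  by (simp only: alpha_c_def G_def divide_inverse mult_1_left mult_1_right add_0_left mult_ac)
 ultimately have lim: "(\<lambda>N. \<theta> * inverse (\<rho> N / ln (real N)) * ((\<Sum>l=1..N. (w N l - G) / real l) / ln (real N) + G * (harm N / ln (real N))))
   \<longlonglongrightarrow> alpha_c \<theta> \<phi> / \<alpha>" by (simp only:)
 thus ?thesis
 proof (rule Lim_transform_eventually)
  show "\<forall>\<^sub>F N in sequentially. \<theta> * inverse (\<rho> N / ln (real N)) * ((\<Sum>l=1..N. (w N l - G) / real l) / ln (real N) + G * (harm N / ln (real N)))
   = mean_weight \<theta> L N"
   using ln_pos eventually_gt_at_top[of 0]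
  proof eventually_elim
   case (elim N)
   have "(\<Sum>l=1..N. (w N l - G) / real l) + G * harm N = (\<Sum>l=1..N. w N l / real l)"
    unfolding harm_def sum_distrib_left sum.distrib[symmetric]
    by (intro sum.cong refl) (simp add: diff_divide_distrib inverse_eq_divide)
   also have "\<dots> = (\<Sum>l=1..N. (\<rho> N / real N) * (cweight (L N) l - 1))"
    using L_eq[of N] elim rho[of N] by (intro sum.cong) (auto simp: w_def)
   also have "\<dots> = \<rho> N / real N * (\<Sum>l=1..N. cweight (L N) l - 1)" by (simp only: sum_distrib_left)
   finally have s: "(\<Sum>l=1..N. (w N l - G) / real l) + G * harm N = \<rho> N / real N * (\<Sum>l=1..N. cweight (L N) l - 1)" .
   have "\<theta> * inverse (\<rho> N / ln (real N)) * ((\<Sum>l=1..N. (w N l - G) / real l) / ln (real N) + G * (harm N / ln (real N)))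
    = \<theta> * inverse (\<rho> N) * ((\<Sum>l=1..N. (w N l - G) / real l) + G * harm N)"
   proof -
    have "\<theta> * inverse (r / t) * (s / t + G * (u / t)) = \<theta> * inverse r * (s + G * u)" if "t > 0" for r s t u :: real
    proof -
     have "s / t + G * (u / t) = (s + G * u) / t" by (simp add: add_divide_distrib)
     thus ?thesis using that by (simp add: inverse_eq_divide)
    qed
    thus ?thesis using elim by blast
   qed
   also have "\<dots> = mean_weight \<theta> L N" unfolding s using rho[of N] by simp
   finally show ?case .
  qed
 qed
qed

end

section \<open>Conclusion for all regimes\<close>

lemma lim_exp_0: "lim_exp \<theta> \<tau> g 0 = (\<integral>w. g (lim_X \<tau> (fst w) (snd w)) \<partial>YU_measure \<theta>)"
 by (simp add: lim_exp_def lim_X_from_0)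

lemma continuous_on_product_sequentially:
 fixes g :: "(nat \<Rightarrow> real) \<Rightarrow> real"
 assumes g: "continuous_on UNIV g" and X: "\<And>i. (\<lambda>N::nat. X N i) \<longlonglongrightarrow> x i"
 shows "(\<lambda>N. g (X N)) \<longlonglongrightarrow> g x"
proof -
 have "limitin (product_topology (\<lambda>_. euclidean) UNIV) X x sequentially"
  unfolding limitin_componentwise using X by simp
 hence "X \<longlonglongrightarrow> x" unfolding euclidean_product_topology by simp
 moreover have "isCont g x" using g by (simp add: continuous_on_eq_continuous_at)
 ultimately show ?thesis by (rule isCont_tendsto_compose[rotated])
qed

lemma box_side_power:
 assumes "N > 0" "\<rho> > 0"
 shows "((real N / \<rho>) powr (1 / real CARD('n::finite))) ^ CARD('n) = real N / \<rho>"
 using assms by (subst powr_power) auto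

text \<open>Common to all regimes: the density enters through L / sqrt N \<rightarrow> 0 and the
  limit of the mean weight. The chain starts with all N points left, so x = 1 and the limit process
  starts at partial sum 0.\<close>

theorem (in schwartz_density) cycle_lengths_limit:
 fixes g :: "(nat \<Rightarrow> real) \<Rightarrow> real"
 assumes th: "\<theta> > 0" and tau: "0 \<le> \<tau>" "\<tau> < 1" and L: "\<And>N. L N > 0"
  and L_lim: "(\<lambda>N. L N / sqrt (real N)) \<longlonglongrightarrow> 0"
  and mean: "(\<lambda>N. mean_weight \<theta> L N) \<longlonglongrightarrow> \<tau>"
  and g: "bounded (range g)" "continuous_on UNIV g" and dep: "\<And>x y. (\<And>i. i < k \<Longrightarrow> x i = y i) \<Longrightarrow> g x = g y"
 shows "(\<lambda>N. \<integral>z. g (\<lambda>j. real (cyc_len (snd z) N j) / real N) \<partial>spm_measure \<phi> \<theta> (L N) N)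
   \<longlonglongrightarrow> (\<integral>w. g (lim_X \<tau> (fst w) (snd w)) \<partial>YU_measure \<theta>)"
proof -
 interpret W: cycle_weights \<theta> \<tau> "CARD('n)" "\<lambda>N l. cweight (L N) l - 1" "\<lambda>N. (1 + width * (L N / sqrt (real N))) ^ CARD('n) - 1"
  by (rule cycle_weights_cweight[OF th tau L L_lim mean])
 have a: "W.a N = (\<lambda>l. \<theta> * cweight (L N) l)" for N by (simp add: W.a_def fun_eq_iff)
 have one: "(\<lambda>N. real N / real N) \<longlonglongrightarrow> 1"
  by (rule tendsto_eventually) (use eventually_gt_at_top[of 0] in eventually_elim, simp)
 have h_pos: "\<forall>\<^sub>F N in sequentially. W.h N N > 0"
  by (rule W.first_cycle_tail(2)[where m = "\<lambda>N. N", OF order_refl one tau(2) zero_less_one])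
 obtain B where B: "\<And>x. \<bar>g x\<bar> \<le> B" using g(1) by (auto simp: bounded_iff)
 have "(\<lambda>N. cyc_exp (W.a N) k (\<lambda>s. g (\<lambda>j. real (s j) / real N)) N) \<longlonglongrightarrow> lim_exp \<theta> \<tau> g (1 - 1)"
  by (rule W.cyc_exp_limit[where G = "\<lambda>N. g" and m = "\<lambda>N. N", OF B B dep continuous_on_product_sequentially[OF g(2)] g(2) order_refl one tau(2)])
 hence "(\<lambda>N. cyc_exp (W.a N) k (\<lambda>s. g (\<lambda>j. real (s j) / real N)) N) \<longlonglongrightarrow> (\<integral>w. g (lim_X \<tau> (fst w) (snd w)) \<partial>YU_measure \<theta>)"
  by (simp add: lim_exp_0)
 thus ?thesis
 proof (rule Lim_transform_eventually)
  show "\<forall>\<^sub>F N in sequentially. cyc_exp (W.a N) k (\<lambda>s. g (\<lambda>j. real (s j) / real N)) N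
    = (\<integral>z. g (\<lambda>j. real (cyc_len (snd z) N j) / real N) \<partial>spm_measure \<phi> \<theta> (L N) N)"
   using h_pos
  proof eventually_elim
   case (elim N)
   have pos: "hh (\<lambda>l. \<theta> * cweight (L N) l) N > 0" using elim by (simp add: W.h_def a)
   have "periodize \<phi> (L N) \<in> borel_measurable borel"
    by (intro borel_measurable_continuous_onI periodize_continuous phi_tame L)
   from spm_expectation[OF th this periodize_nonneg[OF nonneg] kernel_trace_eq[OF L] cweight_nonneg[OF L] pos,
     where G = "\<lambda>s. g (\<lambda>j. real (s j) / real N)" and k = k]
   show ?case unfolding a using dep by (metis (mono_tags, lifting))
  qed
 qed
qed

theorem mainTheorem15:
  fixes \<phi> :: "real^'n \<Rightarrow> real" and \<theta> \<tau> :: real and \<rho> :: "nat \<Rightarrow> real"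
  assumes theta_pos: "\<theta> > 0"
    and schw: "schwartz \<phi>"
    and dens_nonneg: "\<forall>x. \<phi> x \<ge> 0"
    and dens_int: "(\<integral>\<^sup>+x. ennreal (\<phi> x) \<partial>lborel) = 1"
    and mean0: "mean_vec \<phi> = 0"
    and rho_pos: "\<forall>N. \<rho> N > 0"
    and regime:
      "(CARD('n) = 1 \<and> filterlim (\<lambda>N. \<rho> N / sqrt (real N)) at_top sequentially
          \<and> (\<forall>N\<ge>1. \<rho> N \<le> real N) \<and> \<tau> = 0)
     \<or> (\<exists>\<alpha>. CARD('n) = 2 \<and> ((\<lambda>N. \<rho> N / ln (real N)) \<longlonglongrightarrow> \<alpha>)
          \<and> alpha_c \<theta> \<phi> < \<alpha> \<and> \<tau> = alpha_c \<theta> \<phi> / \<alpha>)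
     \<or> (CARD('n) = 2 \<and> filterlim (\<lambda>N. \<rho> N / ln (real N)) at_top sequentially
          \<and> (\<forall>N\<ge>1. \<rho> N \<le> real N) \<and> \<tau> = 0)
     \<or> (\<exists>r. CARD('n) \<ge> 3 \<and> (\<forall>N. \<rho> N = r) \<and> r > rho_c \<theta> \<phi> \<and> \<tau> = rho_c \<theta> \<phi> / r)"
  shows
    "\<forall>(k::nat) (g::(nat \<Rightarrow> real) \<Rightarrow> real).
       bounded (range g) \<and> continuous_on UNIV g \<and> (\<forall>x y. (\<forall>i<k. x i = y i) \<longrightarrow> g x = g y)
       \<longrightarrow>
       ((\<lambda>N. \<integral>z. g (\<lambda>j. real (cyc_len (snd z) N j) / real N)
               \<partial>spm_measure \<phi> \<theta> ((real N / \<rho> N) powr (1 / real CARD('n))) N)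
         \<longlonglongrightarrow> (\<integral>w. g (lim_X \<tau> (fst w) (snd w)) \<partial>YU_measure \<theta>))"
proof -
 have phi_int: "integrable lborel \<phi>" by (intro tame_integrable decays_tame schwartz_decays schw)
 have "(LBINT x. \<phi> x) = 1"
  using borel_measurable_integrable[OF phi_int] dens_nonneg dens_int by (subst integral_eq_nn_integral) auto
 then interpret schwartz_density \<phi> using schw dens_nonneg by unfold_locales auto
 \<comment> \<open>The formula for the side gives 0 at N = 0; the value 1 keeps L positive for every
   N and leaves limits unchanged.\<close>
 define L where "L N = (if N = 0 then 1 else (real N / \<rho> N) powr (1 / real CARD('n)))" for N
 have rho: "\<rho> N > 0" for N using rho_pos by blast
 have L: "L N > 0" for N using rho[of N] by (simp add: L_def)
 have L_pow: "L N ^ CARD('n) = real N / \<rho> N" if "N > 0" for N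
  using box_side_power[OF that rho[of N], where 'n = 'n] that by (simp add: L_def)
 have ln_top: "filterlim (\<lambda>N. ln (real N)) at_top sequentially"
  by (rule filterlim_compose[OF ln_at_top filterlim_real_sequentially])
 \<comment> \<open>In the plane L / sqrt N is 1 / sqrt \<rho>, so it is enough that \<rho> tends to
   infinity.\<close>
 have planar: "(\<lambda>N. L N / sqrt (real N)) \<longlonglongrightarrow> 0" if d: "CARD('n) = 2" and top: "filterlim \<rho> at_top sequentially"
 proof (rule Lim_transform_eventually)
  show "(\<lambda>N. inverse (sqrt (\<rho> N))) \<longlonglongrightarrow> 0"
   by (intro tendsto_inverse_0_at_top filterlim_compose[OF sqrt_at_top top])
  show "\<forall>\<^sub>F N in sequentially. inverse (sqrt (\<rho> N)) = L N / sqrt (real N)"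
   using eventually_gt_at_top[of 0]
  proof eventually_elim
   case (elim N)
   have "sqrt ((L N)\<^sup>2) = sqrt (real N / \<rho> N)" using L_pow[OF elim] d by simp
   hence "L N = sqrt (real N) / sqrt (\<rho> N)" using L[of N] by (simp add: real_sqrt_divide)
   thus ?case using elim by (simp add: divide_inverse)
  qed
 qed
 have "0 \<le> \<tau> \<and> \<tau> < 1 \<and> (\<lambda>N. L N / sqrt (real N)) \<longlonglongrightarrow> 0
  \<and> (\<lambda>N. mean_weight \<theta> L N) \<longlonglongrightarrow> \<tau>"
  using regime
 proof (elim disjE exE conjE)
  assume d: "CARD('n) = 1" and top: "filterlim (\<lambda>N. \<rho> N / sqrt (real N)) at_top sequentially" and tau: "\<tau> = 0"
  have lim: "(\<lambda>N. L N / sqrt (real N)) \<longlonglongrightarrow> 0"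
  proof (rule Lim_transform_eventually[OF tendsto_inverse_0_at_top[OF top]])
   show "\<forall>\<^sub>F N in sequentially. inverse (\<rho> N / sqrt (real N)) = L N / sqrt (real N)"
    using eventually_gt_at_top[of 0]
   proof eventually_elim
    case (elim N)
    have "L N / sqrt (real N) = (real N / sqrt (real N)) / \<rho> N" using L_pow[OF elim] d by simp
    also have "real N / sqrt (real N) = sqrt (real N)" by (rule real_div_sqrt) simp
    finally show ?case by simp
   qed
  qed
  thus ?thesis using tau mean_dim_1[OF theta_pos d L lim] by simp
 next
  fix \<alpha> assume d: "CARD('n) = 2" and lim: "(\<lambda>N. \<rho> N / ln (real N)) \<longlonglongrightarrow> \<alpha>"
   and \<alpha>: "alpha_c \<theta> \<phi> < \<alpha>" and tau: "\<tau> = alpha_c \<theta> \<phi> / \<alpha>"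
  have ac: "alpha_c \<theta> \<phi> \<ge> 0" using theta_pos gaussian_plane(1)[OF mean0 d] by (simp add: alpha_c_def)
  have "filterlim (\<lambda>N. \<rho> N / ln (real N) * ln (real N)) at_top sequentially"
   by (rule filterlim_tendsto_pos_mult_at_top[OF lim _ ln_top]) (use ac \<alpha> in linarith)
  hence "filterlim \<rho> at_top sequentially"
  proof (rule filterlim_mono_eventually)
   show "\<forall>\<^sub>F N in sequentially. \<rho> N / ln (real N) * ln (real N) = \<rho> N"
    using eventually_gt_at_top[of 1] by eventually_elim simp
  qed simp_all
  moreover have "(L N)\<^sup>2 = real N / \<rho> N" if "N > 0" for N using L_pow[OF that] d by simp
  ultimately show ?thesis
   using tau ac \<alpha> planar[OF d] mean_dim_2_critical[OF theta_pos mean0 d rho lim _ L] by simp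
 next
  assume d: "CARD('n) = 2" and top: "filterlim (\<lambda>N. \<rho> N / ln (real N)) at_top sequentially" and tau: "\<tau> = 0"
  have "filterlim (\<lambda>N. \<rho> N / ln (real N) * ln (real N)) at_top sequentially"
   by (rule filterlim_at_top_mult_at_top[OF top ln_top])
  hence "filterlim \<rho> at_top sequentially"
  proof (rule filterlim_mono_eventually)
   show "\<forall>\<^sub>F N in sequentially. \<rho> N / ln (real N) * ln (real N) = \<rho> N"
    using eventually_gt_at_top[of 1] by eventually_elim simp
  qed simp_all
  note lim = planar[OF d this]
  have "(\<lambda>N. (L N)\<^sup>2 / real N * ln (real N)) \<longlonglongrightarrow> 0"
  proof (rule Lim_transform_eventually[OF tendsto_inverse_0_at_top[OF top]])
   show "\<forall>\<^sub>F N in sequentially. inverse (\<rho> N / ln (real N)) = (L N)\<^sup>2 / real N * ln (real N)"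
    using eventually_gt_at_top[of 0]
   proof eventually_elim
    case (elim N)
    have "(L N)\<^sup>2 = real N / \<rho> N" using L_pow[OF elim] d by simp
    thus ?case using elim by (simp only:) simp
   qed
  qed
  thus ?thesis using tau lim mean_dim_2_hyper[OF theta_pos d L lim] by simp
 next
  fix r assume d: "CARD('n) \<ge> 3" and r: "\<forall>N. \<rho> N = r" "r > rho_c \<theta> \<phi>" and tau: "\<tau> = rho_c \<theta> \<phi> / r"
  have r0: "r > 0" using r(1) rho[of 0] by simp
  let ?p = "1 / real CARD('n)"
  have top: "filterlim L at_top sequentially"
  proof (rule filterlim_mono_eventually)
   show "filterlim (\<lambda>N. (real N / r) powr ?p) at_top sequentially" using r0 by real_asymp
  qed (use eventually_gt_at_top[of 0] r in \<open>auto simp: L_def elim!: eventually_mono\<close>)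
  have lim: "(\<lambda>N. L N / sqrt (real N)) \<longlonglongrightarrow> 0"
  proof (rule Lim_transform_eventually)
   \<comment> \<open>At fixed density L / sqrt N is of order N^(1/d - 1/2), and d \<ge> 3 makes the
     exponent negative.\<close>
   have p: "?p - 1 / 2 < 0" using d by (simp add: divide_simps)
   have "(\<lambda>N. inverse r powr ?p * real N powr (?p - 1 / 2)) \<longlonglongrightarrow> inverse r powr ?p * 0"
    by (intro tendsto_mult tendsto_const tendsto_neg_powr[OF p] filterlim_real_sequentially)
   thus "(\<lambda>N. inverse r powr ?p * real N powr (?p - 1 / 2)) \<longlonglongrightarrow> 0" by simp
   show "\<forall>\<^sub>F N in sequentially. inverse r powr ?p * real N powr (?p - 1 / 2) = L N / sqrt (real N)"
    using eventually_gt_at_top[of 0]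
   proof eventually_elim
    case (elim N)
    have "L N = inverse r powr ?p * real N powr ?p" using elim r0 r(1) by (simp add: L_def divide_inverse powr_mult mult.commute)
    thus ?case using elim by (simp add: powr_diff powr_half_sqrt)
   qed
  qed
  have "L N ^ CARD('n) = real N / r" if "N > 0" for N using L_pow[OF that] r(1) by simp
  note m = mean_dim_3[OF theta_pos d L lim top r0 this]
  thus ?thesis using tau r r0 lim by simp
 qed
 hence tau: "0 \<le> \<tau>" "\<tau> < 1" and lim: "(\<lambda>N. L N / sqrt (real N)) \<longlonglongrightarrow> 0"
  and mean: "(\<lambda>N. mean_weight \<theta> L N) \<longlonglongrightarrow> \<tau>" by auto
 show ?thesis
 proof (intro allI impI, elim conjE)
  fix k :: nat and g :: "(nat \<Rightarrow> real) \<Rightarrow> real"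
  assume g: "bounded (range g)" "continuous_on UNIV g" and dep: "\<forall>x y. (\<forall>i<k. x i = y i) \<longrightarrow> g x = g y"
  have "(\<lambda>N. \<integral>z. g (\<lambda>j. real (cyc_len (snd z) N j) / real N) \<partial>spm_measure \<phi> \<theta> (L N) N)
    \<longlonglongrightarrow> (\<integral>w. g (lim_X \<tau> (fst w) (snd w)) \<partial>YU_measure \<theta>)"
   by (rule cycle_lengths_limit[OF theta_pos tau L lim mean g]) (use dep in blast)
  thus "(\<lambda>N. \<integral>z. g (\<lambda>j. real (cyc_len (snd z) N j) / real N)
        \<partial>spm_measure \<phi> \<theta> ((real N / \<rho> N) powr (1 / real CARD('n))) N)
     \<longlonglongrightarrow> (\<integral>w. g (lim_X \<tau> (fst w) (snd w)) \<partial>YU_measure \<theta>)"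
   by (rule Lim_transform_eventually) (use eventually_gt_at_top[of 0] in eventually_elim, simp add: L_def)
 qed
qed

end
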